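(* Let $(G,\mathcal P)\in\mathcal{ATEH}$ and suppose that $G$ is not virtually abelian, not virtually free, and not virtually Fuchsian. Then $G$ splits (nontrivially) over a finite or virtually cyclic subgroup.
   Context: Conventions. A relatively hyperbolic group is a pair $(G,\mathcal P)$ with $G$ a finitely generated group and $\mathcal P$ a finite (possibly empty) set of infinite finitely generated subgroups of $G$ (the peripheral subgroups) such that $G$ is hyperbolic relative to $\mathcal P$ (equivalently, the cusped Cayley graph, obtained by gluing combinatorial horoballs on all cosets of the $P\in\mathcal P$ in a Cayley graph, is Gromov hyperbolic). A subgroup of $G$ is elementary if it is finite, 2-ended, or contained in a conjugate of some $P\in\mathcal P$. A group is virtually X if it has a finite index subgroup that is X; finite groups count as virtually free and virtually cyclic. Splittings. A splitting of a group $H$ is a realization of $H$ as the fundamental group of a finite graph of groups; it is trivial if $H$ is one of the vertex groups, and it is over a class $\mathcal E$ of subgroups if all edge groups lie in $\mathcal E$. Hierarchies. A hierarchy $\mathcal H$ of $G$ is a rooted tree, edges oriented away from the root, each vertex labeled by a pair $(H,\Delta_H)$ with $H\le G$ and $\Delta_H$ a splitting of $H$, such that: the root is labeled $(G,\Delta_G)$; if $\Delta_H$ is nontrivial, the outgoing edges at $(H,\Delta_H)$ correspond bijectively to the vertex groups $H'$ of $\Delta_H$, the edge for $H'$ ending at a vertex labeled $(H',\Delta_{H'})$; if $\Delta_H$ is trivial, the vertex has no descendants and is called terminal. $\mathcal H$ is finite if there are no vertices at sufficiently large distance from the root. $\mathcal H$ is over $\mathcal E$ if all its splittings are over $\mathcal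 E$. If $(G,\mathcal P)$ is relatively hyperbolic and $\mathcal H$ is over elementary subgroups, each group $H$ labeling a vertex has an induced peripheral structure $\mathcal O_H$: at the root $\mathcal O_G=\mathcal P$; at a child $H'$ of $H$, $\mathcal O_{H'}$ consists (up to $H'$-conjugacy) of the infinite, not 2-ended subgroups of the form $hOh^{-1}\cap H'$ with $h\in H$, $O\in\mathcal O_H$. $\mathcal H$ is relative to $\mathcal P$ if for every vertex $(H,\Delta_H)$ each $O\in\mathcal O_H$ fixes a point of the Bass–Serre tree of $\Delta_H$. Class $\mathcal{ATEH}$. $G\in\mathcal{ATEH}$ (or $(G,\mathcal P)\in\mathcal{ATEH}$) if (1) $G$ is hyperbolic relative to $\mathcal P$ with each $P\in\mathcal P$ virtually abelian; (2) $G$ has a finite hierarchy $\mathcal H$ over elementary subgroups which is relative to $\mathcal P$; (3) every terminal vertex of $\mathcal H$ is labeled by $(H,\Delta_H)$ with $H$ virtually free, virtually abelian, or virtually Fuchsian. *)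

theory Defs
  imports
    "HOL-Algebra.Algebra"
    "HOL-Analysis.Analysis"
    "HOL-Library.Extended_Nat"
    "Graph_Theory.Arc_Walk"
    "Graph_Theory.Bidirected_Digraph"
begin

section \<open>Classes of groups\<close>

definition finitely_generated :: "'a monoid \<Rightarrow> bool" where
  "finitely_generated G \<longleftrightarrow> (\<exists>S. finite S \<and> S \<subseteq> carrier G \<and> generate G S = carrier G)"

definition virtually :: "('a monoid \<Rightarrow> bool) \<Rightarrow> 'a monoid \<Rightarrow> bool" where
  "virtually \<Phi> G \<longleftrightarrow>
    (\<exists>K. subgroup K G \<and> finite (rcosets\<^bsub>G\<^esub> K) \<and> \<Phi> (G\<lparr>carrier := K\<rparr>))"

text \<open>A group is free on \<open>B\<close> if every element is the value of exactly one reduced word in the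
  letters \<open>B\<close> and their formal inverses; the letter \<open>(b, False)\<close> stands for the inverse of \<open>b\<close>.\<close>

fun letter_val :: "'a monoid \<Rightarrow> 'a \<times> bool \<Rightarrow> 'a" where
  "letter_val G (x, b) = (if b then x else inv\<^bsub>G\<^esub> x)"

definition word_val :: "'a monoid \<Rightarrow> ('a \<times> bool) list \<Rightarrow> 'a" where
  "word_val G w = foldr (\<lambda>l y. letter_val G l \<otimes>\<^bsub>G\<^esub> y) w \<one>\<^bsub>G\<^esub>"

definition reduced_words :: "'a set \<Rightarrow> ('a \<times> bool) list set" where
  "reduced_words B =
    {w \<in> lists (B \<times> UNIV). successively (\<lambda>(x, b) (y, c). \<not> (x = y \<and> b \<noteq> c)) w}"

definition free_group :: "'a monoid \<Rightarrow> bool" where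
  "free_group G \<longleftrightarrow> group G \<and>
    (\<exists>B \<subseteq> carrier G. bij_betw (word_val G) (reduced_words B) (carrier G))"

definition SL2R :: "(real^2^2) monoid" where
  "SL2R = \<lparr>carrier = {A. det A = 1}, monoid.mult = (**), one = mat 1\<rparr>"

definition PSL2R :: "(real^2^2) set monoid" where
  "PSL2R = SL2R Mod {mat 1, - mat 1}"

text \<open>Elements of \<open>PSL2R\<close> are two-element sets of matrices. Since the projection from \<open>SL2R\<close>
  is a two-fold covering, a subgroup \<open>D\<close> of \<open>PSL2R\<close> is discrete iff its preimage \<open>\<Union>D\<close> is.\<close>

definition fuchsian_group :: "'a monoid \<Rightarrow> bool" where
  "fuchsian_group G \<longleftrightarrow>
    group G \<and> (\<exists>D. subgroup D PSL2R \<and> discrete (\<Union>D) \<and> G \<cong> PSL2R\<lparr>carrier := D\<rparr>)"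


section \<open>Graphs as symmetric relations, ends, Gromov hyperbolicity\<close>

definition cayley :: "'a monoid \<Rightarrow> 'a set \<Rightarrow> ('a \<times> 'a) set" where
  "cayley G S = {(g, h). g \<in> carrier G \<and> h \<in> carrier G \<and>
     (\<exists>s \<in> S. h = g \<otimes>\<^bsub>G\<^esub> s \<or> g = h \<otimes>\<^bsub>G\<^esub> s)}"

definition infinite_components :: "'v set \<Rightarrow> ('v \<times> 'v) set \<Rightarrow> 'v set \<Rightarrow> 'v set set" where
  "infinite_components V E K =
    {C. infinite C \<and> (\<exists>x \<in> V - K. C = (E \<inter> (V - K) \<times> (V - K))\<^sup>* `` {x})}"

text \<open>Only used for connected locally finite graphs, where the sets of infinite components
  are finite.\<close>

definition num_ends :: "'v set \<Rightarrow> ('v \<times> 'v) set \<Rightarrow> enat" where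
  "num_ends V E =
    (SUP K \<in> {K. finite K \<and> K \<subseteq> V}. enat (card (infinite_components V E K)))"

text \<open>The number of ends does not depend on the finite generating set.\<close>

definition two_ended :: "'a monoid \<Rightarrow> bool" where
  "two_ended G \<longleftrightarrow> (\<exists>S. finite S \<and> S \<subseteq> carrier G \<and> generate G S = carrier G \<and>
     num_ends (carrier G) (cayley G S) = 2)"

definition graph_dist :: "('v \<times> 'v) set \<Rightarrow> 'v \<Rightarrow> 'v \<Rightarrow> real" where
  "graph_dist E x y = real (LEAST n. (x, y) \<in> E ^^ n)"

definition gromov_product :: "('v \<Rightarrow> 'v \<Rightarrow> real) \<Rightarrow> 'v \<Rightarrow> 'v \<Rightarrow> 'v \<Rightarrow> real" where
  "gromov_product d w x y = (d x w + d y w - d x y) / 2"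

definition gromov_hyperbolic :: "'v set \<Rightarrow> ('v \<Rightarrow> 'v \<Rightarrow> real) \<Rightarrow> bool" where
  "gromov_hyperbolic V d \<longleftrightarrow> (\<exists>\<delta>. \<forall>w \<in> V. \<forall>x \<in> V. \<forall>y \<in> V. \<forall>z \<in> V.
     gromov_product d w x z \<ge> min (gromov_product d w x y) (gromov_product d w y z) - \<delta>)"


section \<open>Relatively hyperbolic groups\<close>

text \<open>The cusped Cayley graph of Groves and Manning. \<open>Horo Q g k\<close> with \<open>k \<ge> 1\<close> is the vertex at
  depth \<open>k\<close> below \<open>g\<close> in the combinatorial horoball glued onto the coset \<open>gQ\<close>. At depth \<open>k\<close>,
  two distinct vertices below the same coset \<open>gQ\<close> are joined iff their distance in the Cayley
  graph of \<open>Q\<close> with respect to \<open>S \<inter> Q\<close>, translated to \<open>gQ\<close>, is at most \<open>2 ^ k\<close>.\<close>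

datatype 'a cusp_vertex = Base 'a | Horo "'a set" 'a nat

definition cusped_verts :: "'a monoid \<Rightarrow> 'a set set \<Rightarrow> 'a cusp_vertex set" where
  "cusped_verts G \<P> = Base ` carrier G \<union>
     {Horo Q g k | Q g k. Q \<in> \<P> \<and> g \<in> carrier G \<and> 1 \<le> k}"

inductive_set cusped_edges ::
    "'a monoid \<Rightarrow> 'a set set \<Rightarrow> 'a set \<Rightarrow> ('a cusp_vertex \<times> 'a cusp_vertex) set"
  for G :: "'a monoid" and \<P> :: "'a set set" and S :: "'a set" where
  cayley: "(g, h) \<in> cayley G S \<Longrightarrow> (Base g, Base h) \<in> cusped_edges G \<P> S"
| down0: "Q \<in> \<P> \<Longrightarrow> g \<in> carrier G \<Longrightarrow> (Base g, Horo Q g 1) \<in> cusped_edges G \<P> S"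
| up0: "Q \<in> \<P> \<Longrightarrow> g \<in> carrier G \<Longrightarrow> (Horo Q g 1, Base g) \<in> cusped_edges G \<P> S"
| down: "Q \<in> \<P> \<Longrightarrow> g \<in> carrier G \<Longrightarrow> 1 \<le> k \<Longrightarrow>
    (Horo Q g k, Horo Q g (k + 1)) \<in> cusped_edges G \<P> S"
| up: "Q \<in> \<P> \<Longrightarrow> g \<in> carrier G \<Longrightarrow> 1 \<le> k \<Longrightarrow>
    (Horo Q g (k + 1), Horo Q g k) \<in> cusped_edges G \<P> S"
| horizontal: "Q \<in> \<P> \<Longrightarrow> g \<in> carrier G \<Longrightarrow> 1 \<le> k \<Longrightarrow> g \<noteq> h \<Longrightarrow>
    (g, h) \<in> cayley G (S \<inter> Q) ^^ n \<Longrightarrow> n \<le> 2 ^ k \<Longrightarrow>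
    (Horo Q g k, Horo Q h k) \<in> cusped_edges G \<P> S"

text \<open>As in the construction of Groves and Manning, the generating set contains a generating set
  of each peripheral subgroup; hyperbolicity does not depend on its choice.\<close>

definition relatively_hyperbolic :: "'a monoid \<Rightarrow> 'a set set \<Rightarrow> bool" where
  "relatively_hyperbolic G \<P> \<longleftrightarrow>
    group G \<and> finitely_generated G \<and> finite \<P> \<and>
    (\<forall>Q \<in> \<P>. subgroup Q G \<and> infinite Q \<and> finitely_generated (G\<lparr>carrier := Q\<rparr>)) \<and>
    (\<exists>S. finite S \<and> S \<subseteq> carrier G \<and> generate G S = carrier G \<and>
      (\<forall>Q \<in> \<P>. generate G (S \<inter> Q) = Q) \<and>
      gromov_hyperbolic (cusped_verts G \<P>) (graph_dist (cusped_edges G \<P> S)))"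

definition conj_set :: "'a monoid \<Rightarrow> 'a \<Rightarrow> 'a set \<Rightarrow> 'a set" where
  "conj_set G g K = (\<lambda>x. g \<otimes>\<^bsub>G\<^esub> x \<otimes>\<^bsub>G\<^esub> inv\<^bsub>G\<^esub> g) ` K"

definition elementary :: "'a monoid \<Rightarrow> 'a set set \<Rightarrow> 'a set \<Rightarrow> bool" where
  "elementary G \<P> K \<longleftrightarrow> subgroup K G \<and>
    (finite K \<or> two_ended (G\<lparr>carrier := K\<rparr>) \<or>
     (\<exists>Q \<in> \<P>. \<exists>g \<in> carrier G. K \<subseteq> conj_set G g Q))"


section \<open>Graphs of groups\<close>

text \<open>Graphs in the sense of Serre: every geometric edge is a pair of arcs interchanged by the
  fixed-point-free involution \<open>bar\<close>. \<open>emb e\<close> embeds the group of \<open>e\<close> into that of the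
  terminal vertex of \<open>e\<close>.\<close>

record ('v, 'e, 'a, 'b) gog =
  base :: "('v, 'e) pre_digraph"
  bar :: "'e \<Rightarrow> 'e"
  vgroup :: "'v \<Rightarrow> 'a monoid"
  egroup :: "'e \<Rightarrow> 'b monoid"
  emb :: "'e \<Rightarrow> 'b \<Rightarrow> 'a"

locale graph_of_groups = bidirected_digraph "base \<Gamma>" "bar \<Gamma>"
  for \<Gamma> :: "('v, 'e, 'a, 'b) gog" +
  assumes nonempty: "verts (base \<Gamma>) \<noteq> {}"
    and connected: "\<And>u v. u \<in> verts (base \<Gamma>) \<Longrightarrow> v \<in> verts (base \<Gamma>) \<Longrightarrow> \<exists>p. awalk u p v"
    and group_vgroup: "\<And>v. v \<in> verts (base \<Gamma>) \<Longrightarrow> group (vgroup \<Gamma> v)"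
    and group_egroup: "\<And>e. e \<in> arcs (base \<Gamma>) \<Longrightarrow> group (egroup \<Gamma> e)"
    and egroup_bar: "\<And>e. e \<in> arcs (base \<Gamma>) \<Longrightarrow> egroup \<Gamma> (bar \<Gamma> e) = egroup \<Gamma> e"
    and emb_mon: "\<And>e. e \<in> arcs (base \<Gamma>) \<Longrightarrow>
      emb \<Gamma> e \<in> mon (egroup \<Gamma> e) (vgroup \<Gamma> (head (base \<Gamma>) e))"

text \<open>\<open>T\<close> is the arc set of a maximal subtree iff any two vertices are joined by exactly one
  path without backtracking in \<open>T\<close>.\<close>

definition maximal_tree :: "('v, 'e, 'a, 'b) gog \<Rightarrow> 'e set \<Rightarrow> bool" where
  "maximal_tree \<Gamma> T \<longleftrightarrow> T \<subseteq> arcs (base \<Gamma>) \<and> bar \<Gamma> ` T \<subseteq> T \<and>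
    (\<forall>u \<in> verts (base \<Gamma>). \<forall>v \<in> verts (base \<Gamma>).
      \<exists>!p. pre_digraph.awalk (base \<Gamma>) u p v \<and> set p \<subseteq> T \<and>
        successively (\<lambda>e f. f \<noteq> bar \<Gamma> e) p)"

text \<open>The fundamental group with respect to a maximal tree \<open>T\<close>, presented by the vertex groups
  and a generator for every arc: words modulo the congruence generated by Serre's relations.\<close>

datatype ('v, 'e, 'a) gog_letter = VL 'v 'a | EL 'e

definition gog_letters :: "('v, 'e, 'a, 'b) gog \<Rightarrow> ('v, 'e, 'a) gog_letter set" where
  "gog_letters \<Gamma> = {VL v g | v g. v \<in> verts (base \<Gamma>) \<and> g \<in> carrier (vgroup \<Gamma> v)} \<union>
     EL ` arcs (base \<Gamma>)"

inductive pi1_eq :: "('v, 'e, 'a, 'b) gog \<Rightarrow> 'e set \<Rightarrow>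
    ('v, 'e, 'a) gog_letter list \<Rightarrow> ('v, 'e, 'a) gog_letter list \<Rightarrow> bool"
  for \<Gamma> :: "('v, 'e, 'a, 'b) gog" and T :: "'e set" where
  refl: "w \<in> lists (gog_letters \<Gamma>) \<Longrightarrow> pi1_eq \<Gamma> T w w"
| sym: "pi1_eq \<Gamma> T u w \<Longrightarrow> pi1_eq \<Gamma> T w u"
| trans: "pi1_eq \<Gamma> T u w \<Longrightarrow> pi1_eq \<Gamma> T w x \<Longrightarrow> pi1_eq \<Gamma> T u x"
| append: "pi1_eq \<Gamma> T u u' \<Longrightarrow> pi1_eq \<Gamma> T w w' \<Longrightarrow> pi1_eq \<Gamma> T (u @ w) (u' @ w')"
| vertex_mult: "v \<in> verts (base \<Gamma>) \<Longrightarrow> g \<in> carrier (vgroup \<Gamma> v) \<Longrightarrow> h \<in> carrier (vgroup \<Gamma> v) \<Longrightarrow>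
    pi1_eq \<Gamma> T [VL v g, VL v h] [VL v (g \<otimes>\<^bsub>vgroup \<Gamma> v\<^esub> h)]"
| vertex_one: "v \<in> verts (base \<Gamma>) \<Longrightarrow> pi1_eq \<Gamma> T [VL v \<one>\<^bsub>vgroup \<Gamma> v\<^esub>] []"
| arc_inv: "e \<in> arcs (base \<Gamma>) \<Longrightarrow> pi1_eq \<Gamma> T [EL e, EL (bar \<Gamma> e)] []"
| arc_conj: "e \<in> arcs (base \<Gamma>) \<Longrightarrow> a \<in> carrier (egroup \<Gamma> e) \<Longrightarrow>
    pi1_eq \<Gamma> T [EL e, VL (head (base \<Gamma>) e) (emb \<Gamma> e a), EL (bar \<Gamma> e)]
      [VL (tail (base \<Gamma>) e) (emb \<Gamma> (bar \<Gamma> e) a)]"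
| tree_arc: "e \<in> T \<Longrightarrow> e \<in> arcs (base \<Gamma>) \<Longrightarrow> pi1_eq \<Gamma> T [EL e] []"

definition pi1_class :: "('v, 'e, 'a, 'b) gog \<Rightarrow> 'e set \<Rightarrow>
    ('v, 'e, 'a) gog_letter list \<Rightarrow> ('v, 'e, 'a) gog_letter list set" where
  "pi1_class \<Gamma> T w = {u. pi1_eq \<Gamma> T w u}"

definition pi1 :: "('v, 'e, 'a, 'b) gog \<Rightarrow> 'e set \<Rightarrow> ('v, 'e, 'a) gog_letter list set monoid" where
  "pi1 \<Gamma> T = \<lparr>carrier = pi1_class \<Gamma> T ` lists (gog_letters \<Gamma>),
     monoid.mult = (\<lambda>A B. \<Union>a \<in> A. \<Union>b \<in> B. pi1_class \<Gamma> T (a @ b)),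
     one = pi1_class \<Gamma> T []\<rparr>"


section \<open>Splittings\<close>

text \<open>A splitting of \<open>H \<le> G\<close> is a finite graph of groups with an isomorphism from its fundamental
  group to \<open>H\<close>. Its graph is finite and its vertex and edge groups embed in \<open>H\<close>, so indexing it
  by natural numbers and taking these groups on the type of elements of \<open>G\<close> is no loss of generality.\<close>

record 'a splitting =
  gr :: "(nat, nat, 'a, 'a) gog"
  mtree :: "nat set"
  realization :: "(nat, nat, 'a) gog_letter list set \<Rightarrow> 'a"

definition splitting_of :: "'a monoid \<Rightarrow> 'a set \<Rightarrow> 'a splitting \<Rightarrow> bool" where
  "splitting_of G H \<Delta> \<longleftrightarrow> graph_of_groups (gr \<Delta>) \<and> fin_digraph (base (gr \<Delta>)) \<and>
    maximal_tree (gr \<Delta>) (mtree \<Delta>) \<and>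
    realization \<Delta> \<in> iso (pi1 (gr \<Delta>) (mtree \<Delta>)) (G\<lparr>carrier := H\<rparr>)"

definition word_in :: "'a splitting \<Rightarrow> (nat, nat, 'a) gog_letter list \<Rightarrow> 'a" where
  "word_in \<Delta> w = realization \<Delta> (pi1_class (gr \<Delta>) (mtree \<Delta>) w)"

definition vertex_subgroup :: "'a splitting \<Rightarrow> nat \<Rightarrow> 'a set" where
  "vertex_subgroup \<Delta> v = (\<lambda>g. word_in \<Delta> [VL v g]) ` carrier (vgroup (gr \<Delta>) v)"

text \<open>The image of an edge group in the vertex group of the tail of \<open>e\<close>. The image in the vertex
  group of the head is \<open>edge_subgroup \<Delta> (bar (gr \<Delta>) e)\<close>, a conjugate by \<open>word_in \<Delta> [EL e]\<close>.\<close>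

definition edge_subgroup :: "'a splitting \<Rightarrow> nat \<Rightarrow> 'a set" where
  "edge_subgroup \<Delta> e = (\<lambda>a. word_in \<Delta> [VL (tail (base (gr \<Delta>)) e) (emb (gr \<Delta>) (bar (gr \<Delta>) e) a)])
     ` carrier (egroup (gr \<Delta>) e)"

definition trivial_splitting :: "'a set \<Rightarrow> 'a splitting \<Rightarrow> bool" where
  "trivial_splitting H \<Delta> \<longleftrightarrow> (\<exists>v \<in> verts (base (gr \<Delta>)). vertex_subgroup \<Delta> v = H)"

definition splitting_over :: "('a set \<Rightarrow> bool) \<Rightarrow> 'a splitting \<Rightarrow> bool" where
  "splitting_over \<E> \<Delta> \<longleftrightarrow> (\<forall>e \<in> arcs (base (gr \<Delta>)). \<E> (edge_subgroup \<Delta> e))"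

text \<open>\<open>G\<close> splits nontrivially over the subgroup \<open>C\<close>, as an amalgam or an HNN extension: it has a
  nontrivial splitting with a single geometric edge, whose edge group is \<open>C\<close>.\<close>

definition splits_over :: "'a monoid \<Rightarrow> 'a set \<Rightarrow> bool" where
  "splits_over G C \<longleftrightarrow> (\<exists>\<Delta> e. splitting_of G (carrier G) \<Delta> \<and>
     \<not> trivial_splitting (carrier G) \<Delta> \<and>
     arcs (base (gr \<Delta>)) = {e, bar (gr \<Delta>) e} \<and> edge_subgroup \<Delta> e = C)"

definition bass_serre_tree ::
    "'a monoid \<Rightarrow> 'a set \<Rightarrow> 'a splitting \<Rightarrow> (nat \<times> 'a set, nat \<times> 'a set) pre_digraph" where
  "bass_serre_tree G H \<Delta> = \<lparr>
     verts = {(v, g <#\<^bsub>G\<^esub> vertex_subgroup \<Delta> v) | v g. v \<in> verts (base (gr \<Delta>)) \<and> g \<in> H},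
     arcs = {(e, g <#\<^bsub>G\<^esub> edge_subgroup \<Delta> e) | e g. e \<in> arcs (base (gr \<Delta>)) \<and> g \<in> H},
     tail = (\<lambda>(e, C). (tail (base (gr \<Delta>)) e,
       C <#>\<^bsub>G\<^esub> vertex_subgroup \<Delta> (tail (base (gr \<Delta>)) e))),
     head = (\<lambda>(e, C). (head (base (gr \<Delta>)) e,
       (C #>\<^bsub>G\<^esub> word_in \<Delta> [EL e]) <#>\<^bsub>G\<^esub> vertex_subgroup \<Delta> (head (base (gr \<Delta>)) e)))\<rparr>"

text \<open>\<open>H\<close> acts on the tree by left translation of cosets, without inversions. Hence a point in
  the interior of an edge is fixed iff both orientations of the edge are.\<close>

definition fixes_point :: "'a monoid \<Rightarrow> 'a set \<Rightarrow> 'a splitting \<Rightarrow> 'a set \<Rightarrow> bool" where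
  "fixes_point G H \<Delta> K \<longleftrightarrow>
    (\<exists>(x, C) \<in> verts (bass_serre_tree G H \<Delta>). \<forall>k \<in> K. k <#\<^bsub>G\<^esub> C = C) \<or>
    (\<exists>(x, C) \<in> arcs (bass_serre_tree G H \<Delta>). \<forall>k \<in> K. k <#\<^bsub>G\<^esub> C = C)"


section \<open>Hierarchies\<close>

text \<open>The vertices of the rooted tree are addressed by lists of vertices of the underlying graphs,
  most recent first: the root is \<open>[]\<close>, and \<open>v # p\<close> is the child of \<open>p\<close> belonging to the
  vertex \<open>v\<close> of the splitting at \<open>p\<close>.\<close>

record 'a hierarchy =
  nodes :: "nat list set"
  grp :: "nat list \<Rightarrow> 'a set"
  spl :: "nat list \<Rightarrow> 'a splitting"

definition terminal :: "'a hierarchy \<Rightarrow> nat list \<Rightarrow> bool" where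
  "terminal \<H> p \<longleftrightarrow> p \<in> nodes \<H> \<and> trivial_splitting (grp \<H> p) (spl \<H> p)"

definition is_hierarchy :: "'a monoid \<Rightarrow> 'a hierarchy \<Rightarrow> bool" where
  "is_hierarchy G \<H> \<longleftrightarrow>
    [] \<in> nodes \<H> \<and> grp \<H> [] = carrier G \<and>
    (\<forall>p \<in> nodes \<H>. subgroup (grp \<H> p) G \<and> splitting_of G (grp \<H> p) (spl \<H> p)) \<and>
    (\<forall>p v. v # p \<in> nodes \<H> \<longleftrightarrow>
      p \<in> nodes \<H> \<and> \<not> terminal \<H> p \<and> v \<in> verts (base (gr (spl \<H> p)))) \<and>
    (\<forall>p v. v # p \<in> nodes \<H> \<longrightarrow> grp \<H> (v # p) = vertex_subgroup (spl \<H> p) v)"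

definition finite_hierarchy :: "'a hierarchy \<Rightarrow> bool" where
  "finite_hierarchy \<H> \<longleftrightarrow> (\<exists>n. \<forall>p \<in> nodes \<H>. length p \<le> n)"

definition hierarchy_over :: "('a set \<Rightarrow> bool) \<Rightarrow> 'a hierarchy \<Rightarrow> bool" where
  "hierarchy_over \<E> \<H> \<longleftrightarrow> (\<forall>p \<in> nodes \<H>. splitting_over \<E> (spl \<H> p))"

text \<open>Below the root this is the full conjugation-invariant family rather than a set of
  representatives of its conjugacy classes; fixing a point of the Bass--Serre tree is invariant
  under conjugation, so this makes no difference.\<close>

primrec induced_peripherals ::
    "'a monoid \<Rightarrow> 'a set set \<Rightarrow> 'a hierarchy \<Rightarrow> nat list \<Rightarrow> 'a set set" where
  "induced_peripherals G \<P> \<H> [] = \<P>"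
| "induced_peripherals G \<P> \<H> (v # p) =
    {K. (\<exists>h \<in> grp \<H> p. \<exists>Q \<in> induced_peripherals G \<P> \<H> p. K = conj_set G h Q \<inter> grp \<H> (v # p)) \<and>
        infinite K \<and> \<not> two_ended (G\<lparr>carrier := K\<rparr>)}"

definition hierarchy_relative :: "'a monoid \<Rightarrow> 'a set set \<Rightarrow> 'a hierarchy \<Rightarrow> bool" where
  "hierarchy_relative G \<P> \<H> \<longleftrightarrow>
    (\<forall>p \<in> nodes \<H>. \<forall>Q \<in> induced_peripherals G \<P> \<H> p. fixes_point G (grp \<H> p) (spl \<H> p) Q)"

definition ATEH :: "'a monoid \<Rightarrow> 'a set set \<Rightarrow> bool" where
  "ATEH G \<P> \<longleftrightarrow>
    relatively_hyperbolic G \<P> \<and>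
    (\<forall>Q \<in> \<P>. virtually comm_group (G\<lparr>carrier := Q\<rparr>)) \<and>
    (\<exists>\<H>. is_hierarchy G \<H> \<and> finite_hierarchy \<H> \<and>
      hierarchy_over (elementary G \<P>) \<H> \<and> hierarchy_relative G \<P> \<H> \<and>
      (\<forall>p. terminal \<H> p \<longrightarrow>
        virtually free_group (G\<lparr>carrier := grp \<H> p\<rparr>) \<or>
        virtually comm_group (G\<lparr>carrier := grp \<H> p\<rparr>) \<or>
        virtually fuchsian_group (G\<lparr>carrier := grp \<H> p\<rparr>)))"

end

theory Submission
  imports Defs
begin

text \<open>Every splitting of the hierarchy is read off from a space with walls: the points are pairs of a
  vertex and a group element, the walls are the half-trees of the Bass--Serre tree. Call subgroups that
  are not virtually cyclic big. We show by induction, from the terminal vertices upwards, that a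
  group \<open>K\<close> of the hierarchy has a cut with virtually cyclic stabilizer in which all big intersections with
  peripheral conjugates are elliptic, or lies in the peripheral conjugate \<open>Q\<close> as soon as a big subgroup of \<open>K\<close> does.
  If an orbit of walls with virtually cyclic stabilizer has no global fixed point, it is such a cut. Otherwise the vertex
  groups of the tree obtained by collapsing these walls are again vertex groups of the splitting. A cut of one of
  them extends to the whole group, because the big wall stabilizers are elliptic in it; if there is none,
  malnormality of the peripheral subgroups forces all of these vertex groups, hence the group itself, into one
  peripheral conjugate. At the root only a cut is possible, and a cut with stabilizer \<open>C\<close> is
  turned into a splitting over \<open>C\<close> by the structure theorem for groups acting on trees.\<close>


section \<open>Finite index and virtually cyclic subgroups\<close>

text \<open>The induction has to quantify over actions on trees of unknown vertex type. A cut
  replaces a tree by one subset of \<open>H \<times> UNIV\<close>, a fixed type, at the price of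
  collapsing all but one orbit of edges. The obstacle is gluing. A tree of a vertex group extends to
  the whole group only if the adjacent edge groups fix vertices of it, and a cut promises this for
  big subgroups of peripheral conjugates, not for virtually cyclic ones. So walls with virtually
  cyclic stabilizer are treated first: fixed points of their single orbits are combined, one orbit
  after another, into fixed points for the vertex groups of the collapsed tree. The alternative to a
  cut is a condition that all three kinds of terminal groups satisfy. Virtually abelian subgroups of
  virtually free or virtually Fuchsian groups are virtually cyclic, so it is empty there; in the
  virtually abelian case it follows from malnormality, which comes from the cusped graph: distinct
  horoballs are close only in a bounded region. Elementary edge groups may be two-ended; such a
  group is virtually cyclic since its elements shift one half of the Cayley graph by a finite number
  of points.\<close>

definition fin_index :: "'a monoid => 'a set => 'a set => bool" where
 "fin_index G L K\<longleftrightarrow>subgroup L G\<and>subgroup K G\<and>L\<subseteq>K \<and>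
  (\<exists>F. finite F\<and>F\<subseteq>K\<and>(\<forall>k\<in>K. \<exists>l\<in>L. \<exists>f\<in>F. k = l \<otimes>\<^bsub>G\<^esub> f))"

text \<open>Finite groups are included, with \<open>z\<close> the unit. Powers and representatives
  inside \<open>G\<close> avoid groups with a changed carrier; \<open>vcyc_iff\<close> gives back
  the official notion.\<close>

definition vcyc :: "'a monoid => 'a set => bool" where
 "vcyc G K\<longleftrightarrow>(\<exists>z\<in>K. \<exists>F. finite F\<and>F\<subseteq>K \<and>
   (\<forall>k\<in>K. \<exists>n::int. \<exists>f\<in>F. k = z [^]\<^bsub>G\<^esub> n \<otimes>\<^bsub>G\<^esub> f))"

definition vab :: "'a monoid => 'a set => bool" where
 "vab G K\<longleftrightarrow>(\<exists>L. fin_index G L K\<and>(\<forall>x\<in>L. \<forall>y\<in>L. x \<otimes>\<^bsub>G\<^esub> y = y \<otimes>\<^bsub>G\<^esub> x))"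

context
 fixes G :: "'a monoid" (structure)
 assumes grp: "group G"
begin

interpretation group G by (rule grp)

lemma inv_cancel: "x\<in>carrier G ==> y\<in>carrier G ==> inv x\<otimes>(x\<otimes>y) = y"
 "x\<in>carrier G ==> y\<in>carrier G ==> x\<otimes>(inv x\<otimes>y) = y"
 by (simp_all add: m_assoc[symmetric])

text \<open>\<open>rcosets\<close> names no representatives and lives in the group with carrier
  \<open>K\<close>. Choosing one element from each coset gives the set \<open>F\<close> of
  \<open>fin_index\<close>; conversely every coset is that of a member of \<open>F\<close>.\<close>

lemma virtually_iff:
 assumes K: "subgroup K G"
 shows "virtually \<Phi> (G\<lparr>carrier := K\<rparr>)\<longleftrightarrow>(\<exists>L. fin_index G L K\<and>\<Phi> (G\<lparr>carrier := L\<rparr>))"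
proof -
 have sub: "subgroup L (G\<lparr>carrier := K\<rparr>)\<longleftrightarrow>subgroup L G\<and>L\<subseteq>K" for L
  using incl_subgroup[OF K] subgroup_incl[OF _ K] subgroup.subset[of L "G\<lparr>carrier := K\<rparr>"] by auto
 have "finite (rcosets\<^bsub>G\<lparr>carrier := K\<rparr>\<^esub> L) \<longleftrightarrow>
   (\<exists>F. finite F\<and>F\<subseteq>K\<and>(\<forall>k\<in>K. \<exists>l\<in>L. \<exists>f\<in>F. k = l\<otimes>f))"
  if L: "subgroup L G" "L\<subseteq>K" for L
 proof
  assume fin: "finite (rcosets\<^bsub>G\<lparr>carrier := K\<rparr>\<^esub> L)"
  define r where "r C = (SOME f. f\<in>K\<and>C = L #> f)" for C
  have eq: "rcosets\<^bsub>G\<lparr>carrier := K\<rparr>\<^esub> L = (\<lambda>k. L #> k) ` K"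
   by (auto simp: RCOSETS_def r_coset_def)
  have r: "r (L #> k)\<in>K\<and>L #> k = L #> r (L #> k)" if "k\<in>K" for k
   unfolding r_def by (rule someI) (use that in auto)
  have "k\<in>L #> r (L #> k)" if "k\<in>K" for k
  proof -
   have "k\<in>carrier G" using that K subgroup.subset by blast
   hence "k\<in>L #> k" using L by (simp add: rcos_self)
   thus ?thesis using r[OF that] by simp
  qed
  hence "\<forall>k\<in>K. \<exists>l\<in>L. \<exists>f\<in>r ` (rcosets\<^bsub>G\<lparr>carrier := K\<rparr>\<^esub> L). k = l\<otimes>f"
   unfolding eq by (fastforce simp: r_coset_def)
  moreover have "r ` (rcosets\<^bsub>G\<lparr>carrier := K\<rparr>\<^esub> L)\<subseteq>K" unfolding eq using r by auto
  ultimately show "\<exists>F. finite F\<and>F\<subseteq>K\<and>(\<forall>k\<in>K. \<exists>l\<in>L. \<exists>f\<in>F. k = l\<otimes>f)"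
   using fin by blast
 next
  assume "\<exists>F. finite F\<and>F\<subseteq>K\<and>(\<forall>k\<in>K. \<exists>l\<in>L. \<exists>f\<in>F. k = l\<otimes>f)"
  then obtain F where F: "finite F" "F\<subseteq>K" "\<forall>k\<in>K. \<exists>l\<in>L. \<exists>f\<in>F. k = l\<otimes>f" by blast
  have "rcosets\<^bsub>G\<lparr>carrier := K\<rparr>\<^esub> L\<subseteq>(\<lambda>f. L #> f) ` F"
  proof
   fix C assume "C\<in>rcosets\<^bsub>G\<lparr>carrier := K\<rparr>\<^esub> L"
   then obtain k where k: "k\<in>K" "C = L #> k" by (auto simp: RCOSETS_def r_coset_def)
   then obtain l f where lf: "l\<in>L" "f\<in>F" "k = l\<otimes>f" using F by blast
   have "f\<in>carrier G" using lf F(2) K subgroup.subset by blast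
   hence "L #> k = L #> f" using lf L
    by (metis coset_join3 coset_mult_assoc subgroup.mem_carrier subgroup.subset coset_join2)
   thus "C\<in>(\<lambda>f. L #> f) ` F" using k lf by auto
  qed
  thus "finite (rcosets\<^bsub>G\<lparr>carrier := K\<rparr>\<^esub> L)" using F(1) finite_subset by blast
 qed
 moreover have "(G\<lparr>carrier := K\<rparr>)\<lparr>carrier := L\<rparr> = G\<lparr>carrier := L\<rparr>" for L by simp
 ultimately show ?thesis unfolding virtually_def fin_index_def sub using K by auto
qed

lemma fin_index_refl: "subgroup K G ==> fin_index G K K"
 unfolding fin_index_def
 by (intro conjI exI[of _ "{\<one>}"]) (auto simp: subgroup.one_closed subgroup.mem_carrier)

text \<open>A coset of \<open>L\<close> that meets \<open>D\<close> is represented by an element of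
  \<open>D\<close>, and two elements of \<open>D\<close> in the same coset differ by an element of
  \<open>D \<inter> L\<close>.\<close>

lemma fin_index_Int:
 assumes LK: "fin_index G L K" and D: "subgroup D G" "D\<subseteq>K"
 shows "fin_index G (D\<inter>L) D"
proof -
 obtain F where F: "finite F" "F\<subseteq>K" "\<forall>k\<in>K. \<exists>l\<in>L. \<exists>f\<in>F. k = l\<otimes>f" and L: "subgroup L G" and K: "subgroup K G"
  using LK unfolding fin_index_def by blast
 define P where "P f d\<longleftrightarrow>d\<in>D\<and>(\<exists>l\<in>L. d = l\<otimes>f)" for f d
 \<comment> \<open>Cosets that miss \<open>D\<close> get the harmless value \<open>\<one>\<close>,
   which keeps \<open>r f\<close> in \<open>D\<close> for every \<open>f\<close>.\<close>
 define r where "r f = (if Ex (P f) then SOME d. P f d else \<one>)" for f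
 have P: "P f (r f)" if "P f d" for f d
  unfolding r_def using that by (metis someI)
 have rD: "r f\<in>D" for f
 proof (cases "Ex (P f)")
  case True thus ?thesis using P[of f] unfolding P_def by blast
 next
  case False thus ?thesis using subgroup.one_closed[OF D(1)] unfolding r_def by auto
 qed
 have "\<exists>l\<in>D\<inter>L. \<exists>f\<in>r ` F. k = l\<otimes>f" if k: "k\<in>D" for k
 proof -
  obtain l f where lf: "l\<in>L" "f\<in>F" "k = l\<otimes>f" using F k D by blast
  hence "P f k" unfolding P_def using k by blast
  from P[OF this] obtain l' where l': "l'\<in>L" "r f = l'\<otimes>f" "r f\<in>D" unfolding P_def by blast
  have KG: "f\<in>carrier G" "l\<in>carrier G" "l'\<in>carrier G" "k\<in>carrier G" "r f\<in>carrier G"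
  proof -
   show l1: "l\<in>carrier G" and l2: "l'\<in>carrier G" using lf l' L subgroup.mem_carrier by fast+
   show "k\<in>carrier G" "r f\<in>carrier G" using k D l' subgroup.mem_carrier by fast+
   show "f\<in>carrier G" using F(2) lf K subgroup.mem_carrier by fast
  qed
  have "k\<otimes>inv (r f) = l\<otimes>inv l'" using lf(3) l'(2) KG
   by (simp add: inv_mult_group m_assoc[symmetric])
     (metis inv_closed m_assoc r_inv r_one)
  moreover have "k\<otimes>inv (r f)\<in>D" using k l'(3) D by (simp add: subgroup.m_closed subgroup.m_inv_closed)
  moreover have "l\<otimes>inv l'\<in>L" using lf l' L by (simp add: subgroup.m_closed subgroup.m_inv_closed)
  ultimately have "k\<otimes>inv (r f)\<in>D\<inter>L" by simp
  moreover have "k = (k\<otimes>inv (r f))\<otimes>r f" using KG by (simp add: m_assoc)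
  ultimately show ?thesis using lf(2) by blast
 qed
 moreover have "subgroup (D\<inter>L) G" using D L subgroups_Inter_pair by blast
 ultimately show ?thesis unfolding fin_index_def
  using F(1) rD D(1) by (intro conjI exI[of _ "r ` F"]) auto
qed

lemma fin_index_trans:
 assumes "fin_index G L M" "fin_index G M K"
 shows "fin_index G L K"
proof -
 obtain F where F: "finite F" "F\<subseteq>M" "\<forall>k\<in>M. \<exists>l\<in>L. \<exists>f\<in>F. k = l\<otimes>f"
  using assms(1) unfolding fin_index_def by blast
 obtain E where E: "finite E" "E\<subseteq>K" "\<forall>k\<in>K. \<exists>l\<in>M. \<exists>f\<in>E. k = l\<otimes>f"
  using assms(2) unfolding fin_index_def by blast
 have s: "subgroup L G" "subgroup M G" "subgroup K G" "L\<subseteq>M" "M\<subseteq>K"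
  using assms unfolding fin_index_def by auto
 define D where "D = (\<lambda>(f, e). f\<otimes>e) ` (F\<times>E)"
 have "finite D" using F E unfolding D_def by simp
 moreover have "D\<subseteq>K" using F(2) E(2) s unfolding D_def by (auto intro!: subgroup.m_closed)
 moreover have "\<exists>l\<in>L. \<exists>d\<in>D. k = l\<otimes>d" if k: "k\<in>K" for k
 proof -
  obtain m e where me: "m\<in>M" "e\<in>E" "k = m\<otimes>e" using E k by blast
  obtain l f where lf: "l\<in>L" "f\<in>F" "m = l\<otimes>f" using F me by blast
  have "l\<in>carrier G" "f\<in>carrier G" "e\<in>carrier G"
   using me lf s F(2) E(2) by (auto intro: subgroup.mem_carrier)
  hence "k = l\<otimes>(f\<otimes>e)" using me lf by (simp add: m_assoc)
  moreover have "f\<otimes>e\<in>D" unfolding D_def using lf me by force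
  ultimately show ?thesis using lf by blast
 qed
 ultimately show ?thesis unfolding fin_index_def using s by blast
qed

lemma fin_index_infinite:
 assumes "fin_index G L K" "infinite K"
 shows "infinite L"
proof
 assume L: "finite L"
 obtain F where F: "finite F" "F\<subseteq>K" "\<forall>k\<in>K. \<exists>l\<in>L. \<exists>f\<in>F. k = l\<otimes>f"
  using assms(1) unfolding fin_index_def by blast
 have "K\<subseteq>(\<lambda>(l, f). l\<otimes>f) ` (L\<times>F)" using F by force
 thus False using L F(1) assms(2) finite_subset by blast
qed

text \<open>All elements outside \<open>L\<close> lie in one coset, so \<open>\<one>\<close> and any
  one of them are representatives.\<close>

lemma fin_index_two:
 assumes L: "subgroup L G" and K: "subgroup K G" and LK: "L\<subseteq>K"
  and "\<And>x y. x\<in>K ==> y\<in>K ==> x\<notin>L ==> y\<notin>L ==> x\<otimes>inv y\<in>L"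
 shows "fin_index G L K"
proof (cases "K = L")
 case True thus ?thesis using fin_index_refl[OF L] by simp
next
 case False
 then obtain a where a: "a\<in>K" "a\<notin>L" using LK by blast
 have "\<exists>l\<in>L. \<exists>f\<in>{\<one>, a}. k = l\<otimes>f" if k: "k\<in>K" for k
 proof (cases "k\<in>L")
  case True thus ?thesis using L by (auto intro!: bexI[of _ k] simp: subgroup.mem_carrier)
 next
  case False
  have "k\<in>carrier G" "a\<in>carrier G" using k a K by (auto intro: subgroup.mem_carrier)
  hence "k = (k\<otimes>inv a)\<otimes>a" by (simp add: m_assoc)
  thus ?thesis using assms(4)[OF k a(1) False a(2)] by blast
 qed
 moreover have "{\<one>, a}\<subseteq>K" using a K by (simp add: subgroup.one_closed)
 ultimately show ?thesis unfolding fin_index_def using L K LK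
  by (intro conjI exI[of _ "{\<one>, a}"]) auto
qed

section \<open>Virtually cyclic subgroups\<close>

lemma int_pow_mem: "subgroup K G ==> z\<in>K ==> z [^] (n::int)\<in>K"
 using int_pow_consistent[of K z n] group.int_pow_closed[OF subgroup_imp_group, of K z n] by simp

lemma subgroup_range_pow: "z\<in>carrier G ==> subgroup (range (\<lambda>n::int. z [^] n)) G"
proof (rule subgroupI)
 assume z: "z\<in>carrier G"
 show "range (\<lambda>n::int. z [^] n)\<subseteq>carrier G" "range (\<lambda>n::int. z [^] n)\<noteq>{}" using z by auto
 show "inv a\<in>range (\<lambda>n::int. z [^] n)" if "a\<in>range (\<lambda>n::int. z [^] n)" for a
 proof -
  obtain n :: int where "a = z [^] n" using \<open>a\<in>_\<close> by blast
  hence "inv a = z [^] (- n)" using int_pow_neg[OF z] by simp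
  thus ?thesis by blast
 qed
 show "a\<otimes>b\<in>range (\<lambda>n::int. z [^] n)"
  if "a\<in>range (\<lambda>n::int. z [^] n)" "b\<in>range (\<lambda>n::int. z [^] n)" for a b
 proof -
  obtain m n :: int where "a = z [^] m" "b = z [^] n" using \<open>a\<in>_\<close> \<open>b\<in>_\<close> by blast
  hence "a\<otimes>b = z [^] (m + n)" using int_pow_mult[OF z] by simp
  thus ?thesis by blast
 qed
qed

lemma vcyc_fin_index:
 assumes K: "subgroup K G"
 shows "vcyc G K\<longleftrightarrow>(\<exists>z\<in>K. fin_index G (range (\<lambda>n::int. z [^] n)) K)"
proof -
 have "subgroup (range (\<lambda>n::int. z [^] n)) G" "range (\<lambda>n::int. z [^] n)\<subseteq>K" if "z\<in>K" for z
  using subgroup_range_pow[OF subgroup.mem_carrier[OF K that]] int_pow_mem[OF K that] by auto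
 hence "fin_index G (range (\<lambda>n::int. z [^] n)) K \<longleftrightarrow>
   (\<exists>F. finite F\<and>F\<subseteq>K\<and>(\<forall>k\<in>K. \<exists>l\<in>range (\<lambda>n::int. z [^] n). \<exists>f\<in>F. k = l\<otimes>f))"
  if "z\<in>K" for z unfolding fin_index_def using K that by (simp only: simp_thms)
 thus ?thesis unfolding vcyc_def by (auto cong: bex_cong)
qed

lemma vcyc_iff:
 assumes K: "subgroup K G"
 shows "virtually cyclic_group (G\<lparr>carrier := K\<rparr>)\<longleftrightarrow>vcyc G K"
proof -
 have "cyclic_group (G\<lparr>carrier := L\<rparr>)\<longleftrightarrow>(\<exists>z\<in>L. L = range (\<lambda>n::int. z [^] n))"
  if L: "subgroup L G" for L
 proof -
  have "z [^]\<^bsub>G\<lparr>carrier := L\<rparr>\<^esub> (n::int) = z [^] n" if "z\<in>L" for z n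
   using int_pow_consistent[OF L that] by simp
  thus ?thesis using group.cyclic_group[OF subgroup_imp_group[OF L]] by auto
 qed
 hence "virtually cyclic_group (G\<lparr>carrier := K\<rparr>) \<longleftrightarrow>
   (\<exists>L. fin_index G L K\<and>(\<exists>z\<in>L. L = range (\<lambda>n::int. z [^] n)))"
  unfolding virtually_iff[OF K] by (auto simp: fin_index_def)
 also have "\<dots>\<longleftrightarrow>(\<exists>z\<in>K. fin_index G (range (\<lambda>n::int. z [^] n)) K)"
 proof -
  have "z\<in>range (\<lambda>n::int. z [^] n)" if "z\<in>K" for z
   using int_pow_1[OF subgroup.mem_carrier[OF K that]] by (metis rangeI)
  moreover have "L\<subseteq>K" if "fin_index G L K" for L using that unfolding fin_index_def by simp
  ultimately show ?thesis by (metis subsetD)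
 qed
 finally show ?thesis using vcyc_fin_index[OF K] by simp
qed

lemma vcyc_finite: "subgroup K G ==> finite K ==> vcyc G K"
 unfolding vcyc_def
 by (rule bexI[of _ \<one>], rule exI[of _ K]) (auto simp: subgroup.one_closed subgroup.mem_carrier)

lemma vcyc_of_fin_index:
 assumes "fin_index G L K" "vcyc G L"
 shows "vcyc G K"
proof -
 have s: "subgroup L G" "subgroup K G" "L\<subseteq>K" using assms(1) unfolding fin_index_def by auto
 show ?thesis using assms fin_index_trans[OF _ assms(1)] s
  unfolding vcyc_fin_index[OF s(1)] vcyc_fin_index[OF s(2)] by blast
qed

text \<open>Either \<open>D\<close> contains a power of \<open>z\<close> with nonzero exponent, and
  division by this exponent leaves finitely many remainders, or two elements of \<open>D\<close>
  with the same representative are equal and \<open>D\<close> is finite.\<close>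

lemma vcyc_subgroup:
 assumes K: "subgroup K G" and v: "vcyc G K" and D: "subgroup D G" and DK: "D\<subseteq>K"
 shows "vcyc G D"
proof -
 obtain z F where z: "z\<in>K" "finite F" "F\<subseteq>K"
  "\<And>k. k\<in>K ==> \<exists>n::int. \<exists>f\<in>F. k = z [^] n\<otimes>f" using v unfolding vcyc_def by blast
 have zG: "z\<in>carrier G" and FG: "F\<subseteq>carrier G" using z K subgroup.subset by blast+
 show ?thesis
 proof (cases "\<exists>m::int. m\<noteq>0\<and>z [^] m\<in>D")
  case True
  then obtain m :: int where m: "m\<noteq>0" "z [^] m\<in>D" by blast
  \<comment> \<open>For negative \<open>m\<close> the remainder \<open>n mod m\<close> may be
    negative, hence the symmetric interval; intersecting with \<open>D\<close> makes the
    representatives elements of \<open>D\<close>.\<close>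
  define F' where "F' = D\<inter>(\<lambda>(r, f). z [^] r\<otimes>f) ` ({-\<bar>m\<bar>..\<bar>m\<bar>}\<times>F)"
  have "\<exists>n::int. \<exists>f\<in>F'. d = (z [^] m) [^] n\<otimes>f" if d: "d\<in>D" for d
  proof -
   obtain n f where nf: "f\<in>F" "d = z [^] (n::int)\<otimes>f" using z(4) d DK by blast
   define e where "e = z [^] (n mod m)\<otimes>f"
   have "z [^] n = z [^] (m * (n div m))\<otimes>z [^] (n mod m)"
    using zG by (simp add: int_pow_mult[symmetric])
   hence d_eq: "d = (z [^] m) [^] (n div m)\<otimes>e"
    using nf zG FG unfolding e_def by (auto simp: int_pow_pow m_assoc)
   have eG: "e\<in>carrier G" unfolding e_def using nf zG FG by auto
   have "e = inv ((z [^] m) [^] (n div m))\<otimes>d"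
    unfolding d_eq using eG zG by (simp add: m_assoc[symmetric])
   hence "e\<in>D" using D d m int_pow_mem[OF D m(2)]
    by (simp add: subgroup.m_closed subgroup.m_inv_closed)
   moreover have "n mod m\<in>{-\<bar>m\<bar>..\<bar>m\<bar>}"
    using abs_mod_less[OF m(1), of n] unfolding atLeastAtMost_iff by linarith
   ultimately have "e\<in>F'" unfolding F'_def e_def using nf by force
   thus ?thesis using d_eq by blast
  qed
  moreover have "finite F'" "F'\<subseteq>D" unfolding F'_def using z(2) by auto
  ultimately show ?thesis unfolding vcyc_def using m by blast
 next
  case False
  define c where "c d = (SOME f. f\<in>F\<and>(\<exists>n::int. d = z [^] n\<otimes>f))" for d
  have c: "c d\<in>F\<and>(\<exists>n::int. d = z [^] n\<otimes>c d)" if "d\<in>D" for d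
   unfolding c_def by (rule someI_ex) (use z(4) that DK in blast)
  have "inj_on c D"
  proof (rule inj_onI)
   fix d d' assume d: "d\<in>D" "d'\<in>D" "c d = c d'"
   then obtain n n' :: int and e where n: "d = z [^] n\<otimes>e" "d' = z [^] n'\<otimes>e" and e: "e = c d"
    using c by metis
   have cG: "e\<in>carrier G" using c[OF d(1)] FG e by blast
   have "d\<otimes>inv d' = z [^] n\<otimes>e\<otimes>(inv e\<otimes>inv (z [^] n'))"
    unfolding n by (simp add: inv_mult_group cG zG)
   also have "\<dots> = z [^] n\<otimes>inv (z [^] n')"
    using cG zG by (simp add: m_assoc inv_cancel)
   also have "\<dots> = z [^] (n - n')" using cG zG by (simp add: int_pow_diff)
   finally have "z [^] (n - n')\<in>D"
    using subgroup.m_closed[OF D d(1) subgroup.m_inv_closed[OF D d(2)]] by simp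
   hence "n - n' = 0" using False by blast
   thus "d = d'" unfolding n by simp
  qed
  moreover have "c ` D\<subseteq>F" using c by blast
  ultimately have "finite D" using z(2) finite_imageD finite_subset by blast
  thus ?thesis by (rule vcyc_finite[OF D])
 qed
qed

text \<open>Dividing \<open>f k\<close> by a nonzero value \<open>f z\<close> leaves a remainder no
  larger than \<open>f z\<close> in absolute value, and only finitely many elements have such a
  small value. It serves for two-ended groups, where \<open>f\<close> counts a shift, and for
  parabolic and hyperbolic subgroups of \<open>PSL2R\<close>, where it is a translation
  length.\<close>

lemma vcyc_by_length_hom:
 fixes f :: "'a => real"
 assumes K: "subgroup K G"
  and f: "\<And>x y. x\<in>K ==> y\<in>K ==> f (x\<otimes>y) = f x + f y"
  and fin: "\<And>M. finite {x\<in>K. \<bar>f x\<bar> \<le> M}"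
 shows "vcyc G K"
proof (cases "\<exists>z\<in>K. f z\<noteq>0")
 case True
 then obtain z where z: "z\<in>K" "f z\<noteq>0" by blast
 have zG: "z\<in>carrier G" using z K subgroup.mem_carrier by fast
 have f1: "f \<one> = 0" using f[of \<one> \<one>] K by (simp add: subgroup.one_closed)
 have finv: "f (inv x) = - f x" if "x\<in>K" for x
  using f[of x "inv x"] f1 that K subgroup.mem_carrier[OF K that]
  by (simp add: subgroup.m_inv_closed)
 have fn: "f (x [^] (n::nat)) = n * f x" if "x\<in>K" for x n
 proof (induction n)
  case 0 thus ?case using f1 by simp
 next
  case (Suc n)
  have "x [^] n\<in>K" using int_pow_mem[OF K that, of "int n"] by (simp add: int_pow_int)
  thus ?case using Suc f[of "x [^] n" x] that by (simp add: algebra_simps)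
 qed
 have fi: "f (z [^] (n::int)) = n * f z" for n
 proof (cases "n \<ge> 0")
  case True thus ?thesis using fn[OF z(1), of "nat n"] by (metis int_nat_eq int_pow_int of_int_of_nat_eq)
 next
  case False
  hence "z [^] n = inv (z [^] (nat (- n)))" using zG
   by (metis add.inverse_inverse int_nat_eq int_pow_int int_pow_neg linorder_le_cases neg_0_le_iff_le)
  moreover have "z [^] (nat (- n))\<in>K"
   using int_pow_mem[OF K z(1), of "int (nat (- n))"] by (simp only: int_pow_int)
  ultimately show ?thesis using finv fn[OF z(1), of "nat (- n)"] False by simp
 qed
 define F where "F = {x\<in>K. \<bar>f x\<bar> \<le> \<bar>f z\<bar>}"
 have "\<exists>n::int. \<exists>e\<in>F. k = z [^] n\<otimes>e" if k: "k\<in>K" for k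
 proof -
  define n where "n = \<lfloor>f k / f z\<rfloor>"
  define e where "e = inv (z [^] n)\<otimes>k"
  have zn: "z [^] n\<in>K" by (rule int_pow_mem[OF K z(1)])
  have e: "e\<in>K" unfolding e_def using K k zn by (simp add: subgroup.m_closed subgroup.m_inv_closed)
  have "f e = f k - n * f z"
   unfolding e_def using f[of "inv (z [^] n)" k] finv[OF zn] fi K k zn by (simp add: subgroup.m_inv_closed)
  also have "\<dots> = (f k / f z - n) * f z" using z by (simp add: field_simps)
  finally have "\<bar>f e\<bar> = \<bar>f k / f z - n\<bar> * \<bar>f z\<bar>" by (simp add: abs_mult)
  moreover have "\<bar>f k / f z - n\<bar> \<le> 1" unfolding n_def by linarith
  ultimately have "\<bar>f e\<bar> \<le> \<bar>f z\<bar>" by (metis abs_ge_zero mult_left_le_one_le)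
  hence "e\<in>F" using e unfolding F_def by simp
  moreover have "k = z [^] n\<otimes>e"
   unfolding e_def using zG subgroup.mem_carrier[OF K k] by (simp add: m_assoc[symmetric])
  ultimately show ?thesis by blast
 qed
 moreover have "finite F" "F\<subseteq>K" unfolding F_def using fin by auto
 ultimately show ?thesis unfolding vcyc_def using z by blast
next
 case False
 hence "K\<subseteq>{x\<in>K. \<bar>f x\<bar> \<le> 0}" by auto
 hence "finite K" using fin finite_subset by blast
 thus ?thesis by (rule vcyc_finite[OF K])
qed

lemma vab_iff:
 assumes "subgroup K G"
 shows "virtually comm_group (G\<lparr>carrier := K\<rparr>)\<longleftrightarrow>vab G K"
proof -
 have "comm_group (G\<lparr>carrier := L\<rparr>)\<longleftrightarrow>(\<forall>x\<in>L. \<forall>y\<in>L. x\<otimes>y = y\<otimes>x)" if "subgroup L G" for L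
  using group.group_comm_groupI[OF subgroup_imp_group[OF that]] comm_monoid.m_comm[of "G\<lparr>carrier := L\<rparr>"]
  by (auto simp: comm_group_def)
 thus ?thesis unfolding virtually_iff[OF assms] vab_def fin_index_def by blast
qed

lemma vab_subgroup: "vab G K ==> subgroup D G ==> D\<subseteq>K ==> vab G D"
 unfolding vab_def using fin_index_Int by blast

section \<open>Conjugates of subgroups\<close>

lemma conj_set_eq: "g\<in>carrier G ==> K\<subseteq>carrier G ==>
  conj_set G g K = {x\<in>carrier G. inv g\<otimes>x\<otimes>g\<in>K}"
proof -
 assume a: "g\<in>carrier G" "K\<subseteq>carrier G"
 have "x\<in>conj_set G g K" if x: "x\<in>carrier G" "inv g\<otimes>x\<otimes>g\<in>K" for x
 proof -
  have "x = g\<otimes>(inv g\<otimes>x\<otimes>g)\<otimes>inv g" using a x by (auto simp: m_assoc inv_cancel)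
  thus ?thesis unfolding conj_set_def using x by blast
 qed
 moreover have "x\<in>carrier G\<and>inv g\<otimes>x\<otimes>g\<in>K" if x: "x\<in>conj_set G g K" for x
 proof -
  obtain k where k: "k\<in>K" "k\<in>carrier G" "x = g\<otimes>k\<otimes>inv g" using x a unfolding conj_set_def by blast
  moreover from this a have "inv g\<otimes>x\<otimes>g = k" by (simp add: m_assoc inv_cancel)
  ultimately show ?thesis using a by simp
 qed
 ultimately show ?thesis by blast
qed

lemma conj_set_subgroup:
 assumes g: "g\<in>carrier G" and K: "subgroup K G"
 shows "subgroup (conj_set G g K) G"
proof (rule subgroupI)
 have KG: "K\<subseteq>carrier G" using K subgroup.subset by blast
 show "conj_set G g K\<subseteq>carrier G" using conj_set_eq[OF g KG] by blast
 show "conj_set G g K\<noteq>{}" unfolding conj_set_def using subgroup.one_closed[OF K] by blast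
 fix a assume "a\<in>conj_set G g K"
 then obtain x where x: "x\<in>K" "a = g\<otimes>x\<otimes>inv g" unfolding conj_set_def by blast
 have xG: "x\<in>carrier G" using x KG by blast
 have "inv a = g\<otimes>inv x\<otimes>inv g" using x xG g by (simp add: inv_mult_group m_assoc)
 thus "inv a\<in>conj_set G g K" unfolding conj_set_def using x K subgroup.m_inv_closed by fast
 fix b assume "b\<in>conj_set G g K"
 then obtain y where y: "y\<in>K" "b = g\<otimes>y\<otimes>inv g" unfolding conj_set_def by blast
 have yG: "y\<in>carrier G" using y KG by blast
 have "a\<otimes>b = g\<otimes>(x\<otimes>y)\<otimes>inv g" using x y xG yG g
  by (simp add: m_assoc inv_cancel)
 thus "a\<otimes>b\<in>conj_set G g K" unfolding conj_set_def using x y K subgroup.m_closed by fast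
qed

lemma conj_set_one: "K\<subseteq>carrier G ==> conj_set G \<one> K = K"
 by (subst conj_set_eq) auto

lemma conj_set_conj_set: "g\<in>carrier G ==> h\<in>carrier G ==> K\<subseteq>carrier G ==>
  conj_set G g (conj_set G h K) = conj_set G (g\<otimes>h) K"
 unfolding conj_set_def image_image
 by (rule image_cong) (auto simp: inv_mult_group m_assoc)

lemma conj_set_mono: "K\<subseteq>L ==> conj_set G g K\<subseteq>conj_set G g L"
 unfolding conj_set_def by blast

lemma conj_set_subset: "g\<in>carrier G ==> K\<subseteq>carrier G ==> conj_set G g K\<subseteq>carrier G"
 by (simp add: conj_set_eq)

lemma conj_set_inv: "g\<in>carrier G ==> K\<subseteq>carrier G ==> conj_set G (inv g) (conj_set G g K) = K"
 by (simp add: conj_set_conj_set conj_set_one)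

lemma conj_set_self: "subgroup K G ==> g\<in>K ==> conj_set G g K = K"
proof -
 assume K: "subgroup K G" and g: "g\<in>K"
 have KG: "K\<subseteq>carrier G" and gG: "g\<in>carrier G" using K g subgroup.subset by blast+
 have le: "conj_set G h K\<subseteq>K" if "h\<in>K" for h
  unfolding conj_set_def using that K by (auto intro!: subgroup.m_closed subgroup.m_inv_closed)
 have "K = conj_set G g (conj_set G (inv g) K)"
  using gG KG by (simp add: conj_set_conj_set conj_set_one)
 also have "\<dots>\<subseteq>conj_set G g K" by (rule conj_set_mono, rule le) (use K g in \<open>simp add: subgroup.m_inv_closed\<close>)
 finally show ?thesis using le[OF g] by blast
qed

lemma finite_conj_set: "g\<in>carrier G ==> K\<subseteq>carrier G ==> finite (conj_set G g K)\<longleftrightarrow>finite K"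
 using conj_set_inv[of g K] unfolding conj_set_def by (metis finite_imageI)

lemma fin_index_conj:
 assumes g: "g\<in>carrier G" and LK: "fin_index G L K"
 shows "fin_index G (conj_set G g L) (conj_set G g K)"
proof -
 obtain F where F: "finite F" "F\<subseteq>K" "\<forall>k\<in>K. \<exists>l\<in>L. \<exists>f\<in>F. k = l\<otimes>f"
  using LK unfolding fin_index_def by blast
 have s: "subgroup L G" "subgroup K G" "L\<subseteq>K" using LK unfolding fin_index_def by auto
 have "\<exists>l\<in>conj_set G g L. \<exists>f\<in>conj_set G g F. k = l\<otimes>f" if k: "k\<in>conj_set G g K" for k
 proof -
  obtain x where x: "x\<in>K" "k = g\<otimes>x\<otimes>inv g" using k unfolding conj_set_def by blast
  obtain l f where lf: "l\<in>L" "f\<in>F" "x = l\<otimes>f" using F x by blast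
  have "l\<in>carrier G" "f\<in>carrier G" using lf s F(2) by (auto intro: subgroup.mem_carrier)
  hence "k = (g\<otimes>l\<otimes>inv g)\<otimes>(g\<otimes>f\<otimes>inv g)" using x lf g by (simp add: m_assoc inv_cancel)
  thus ?thesis unfolding conj_set_def using lf by blast
 qed
 moreover have "finite (conj_set G g F)" "conj_set G g F\<subseteq>conj_set G g K"
  using F conj_set_mono unfolding conj_set_def by auto
 ultimately show ?thesis unfolding fin_index_def
  using conj_set_subgroup[OF g] s conj_set_mono by blast
qed

lemma vab_conj:
 assumes g: "g\<in>carrier G" and v: "vab G K"
 shows "vab G (conj_set G g K)"
proof -
 obtain L where L: "fin_index G L K" "\<forall>x\<in>L. \<forall>y\<in>L. x\<otimes>y = y\<otimes>x" using v unfolding vab_def by blast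
 have LG: "L\<subseteq>carrier G" using L(1) subgroup.subset unfolding fin_index_def by blast
 have "\<forall>x\<in>conj_set G g L. \<forall>y\<in>conj_set G g L. x\<otimes>y = y\<otimes>x"
 proof (intro ballI)
  fix x y assume "x\<in>conj_set G g L" "y\<in>conj_set G g L"
  then obtain a b where ab: "a\<in>L" "b\<in>L" "x = g\<otimes>a\<otimes>inv g" "y = g\<otimes>b\<otimes>inv g"
   unfolding conj_set_def by blast
  have abG: "a\<in>carrier G" "b\<in>carrier G" using ab LG by auto
  have "x\<otimes>y = g\<otimes>(a\<otimes>b)\<otimes>inv g" "y\<otimes>x = g\<otimes>(b\<otimes>a)\<otimes>inv g"
   using ab abG g by (auto simp: m_assoc inv_cancel)
  thus "x\<otimes>y = y\<otimes>x" using L(2) ab by metis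
 qed
 thus ?thesis unfolding vab_def using fin_index_conj[OF g L(1)] by blast
qed

lemma vcyc_conj:
 assumes g: "g\<in>carrier G" and K: "subgroup K G" and v: "vcyc G K"
 shows "vcyc G (conj_set G g K)"
proof -
 obtain z where z: "z\<in>K" "fin_index G (range (\<lambda>n::int. z [^] n)) K" using v vcyc_fin_index[OF K] by blast
 have zG: "z\<in>carrier G" using z K subgroup.mem_carrier by fast
 define y where "y = g\<otimes>z\<otimes>inv g"
 have y: "y\<in>conj_set G g K" unfolding y_def conj_set_def using z by blast
 have yn: "y [^] (n::nat) = g\<otimes>z [^] n\<otimes>inv g" for n
 proof (induction n)
  case 0 thus ?case using g by simp
 next
  case (Suc n) thus ?case using g zG unfolding y_def by (simp add: m_assoc inv_cancel)
 qed
 have "y [^] (n::int) = g\<otimes>z [^] n\<otimes>inv g" for n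
 proof (cases "n \<ge> 0")
  case True thus ?thesis using yn[of "nat n"] by (metis int_nat_eq int_pow_int)
 next
  case False
  then obtain m where m: "n = - int m" by (metis int_cases2 of_nat_0_le_iff)
  show ?thesis unfolding m using yn[of m] g zG unfolding y_def
   by (simp add: int_pow_neg int_pow_int inv_mult_group m_assoc)
 qed
 hence "range (\<lambda>n::int. y [^] n) = conj_set G g (range (\<lambda>n::int. z [^] n))"
  unfolding conj_set_def by auto
 thus ?thesis using vcyc_fin_index[OF conj_set_subgroup[OF g K]] y fin_index_conj[OF g z(2)] by metis
qed

end

section \<open>Two-ended groups\<close>

context
 fixes G :: "'a monoid" (structure) and S :: "'a set"
 assumes grp: "group G" and S: "finite S" "S\<subseteq>carrier G" "generate G S = carrier G"
begin

interpretation group G by (rule grp)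

text \<open>The left translate of \<open>A\<close> by \<open>g\<close>, written as a preimage so
  that membership is tested by multiplying with \<open>inv g\<close>.\<close>

definition translate :: "'a => 'a set => 'a set" where
 "translate g A = {x\<in>carrier G. inv g\<otimes>x\<in>A}"

definition cobound :: "'a set => ('a\<times>'a) set" where
 "cobound A = {(x, y)\<in>cayley G S. x\<in>A\<and>y\<notin>A}"

text \<open>These are the almost invariant subsets of the Cayley graph; an infinite one with
  infinite complement separates two ends.\<close>

definition cut_set :: "'a set => bool" where
 "cut_set A\<longleftrightarrow>A\<subseteq>carrier G\<and>finite (cobound A)"

primrec wball :: "nat => 'a set" where
 "wball 0 = {\<one>}"
| "wball (Suc n) = wball n\<union>cayley G S `` wball n"

definition almost_eq :: "'a set => 'a set => bool" where
 "almost_eq A B\<longleftrightarrow>finite (A - B)\<and>finite (B - A)"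

text \<open>The signed difference in size of two possibly infinite sets that agree up to finitely
  many elements.\<close>

definition relcard :: "'a set => 'a set => real" where
 "relcard A B = real (card (A - B)) - real (card (B - A))"

lemma cayley_carrier: "(x, y)\<in>cayley G S ==> x\<in>carrier G\<and>y\<in>carrier G"
 unfolding cayley_def by blast

lemma cayley_sym: "(x, y)\<in>cayley G S ==> (y, x)\<in>cayley G S"
 unfolding cayley_def by blast

lemma cayley_translate: "g\<in>carrier G ==> (x, y)\<in>cayley G S ==> (g\<otimes>x, g\<otimes>y)\<in>cayley G S"
proof -
 assume g: "g\<in>carrier G" and "(x, y)\<in>cayley G S"
 then obtain s where s: "x\<in>carrier G" "y\<in>carrier G" "s\<in>S" "y = x\<otimes>s \<or> x = y\<otimes>s"
  unfolding cayley_def by blast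
 have "s\<in>carrier G" using s S by blast
 hence "g\<otimes>y = g\<otimes>x\<otimes>s \<or> g\<otimes>x = g\<otimes>y\<otimes>s" using s g by (auto simp: m_assoc)
 thus ?thesis using s g unfolding cayley_def by blast
qed

lemma cayley_finite: "finite (cayley G S `` {x})"
proof -
 have "cayley G S `` {x}\<subseteq>(\<lambda>s. x\<otimes>s) ` S\<union>(\<lambda>s. x\<otimes>inv s) ` S"
 proof
  fix y assume "y\<in>cayley G S `` {x}"
  then obtain s where s: "x\<in>carrier G" "y\<in>carrier G" "s\<in>S" "y = x\<otimes>s \<or> x = y\<otimes>s"
   unfolding cayley_def by blast
  have "s\<in>carrier G" using s S by blast
  hence "y = x\<otimes>s \<or> y = x\<otimes>inv s" using s by (auto simp: m_assoc)
  thus "y\<in>(\<lambda>s. x\<otimes>s) ` S\<union>(\<lambda>s. x\<otimes>inv s) ` S" using s by blast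
 qed
 thus ?thesis using S finite_subset by blast
qed

lemma cayley_Image_finite: "finite K ==> finite (cayley G S `` K)"
 using cayley_finite by (subst Image_eq_UN) blast

text \<open>Connectedness of the Cayley graph: a set closed under its edges is closed under right
  multiplication by everything that \<open>S\<close> generates.\<close>

lemma cayley_closed:
 assumes Y: "Y\<subseteq>carrier G" "x\<in>Y" and cl: "\<And>a b. a\<in>Y ==> (a, b)\<in>cayley G S ==> b\<in>Y"
 shows "Y = carrier G"
proof -
 have "a\<otimes>g\<in>Y" if "g\<in>generate G S" "a\<in>Y" for a g
  using that
 proof (induction g arbitrary: a rule: generate.induct)
  case one thus ?case using Y by auto
 next
  case (incl h)
  hence "(a, a\<otimes>h)\<in>cayley G S" using Y S unfolding cayley_def by blast
  thus ?case using cl incl by blast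
 next
  case (inv h)
  have "h\<in>carrier G" "a\<in>carrier G" using inv Y S by auto
  hence "(a, a\<otimes>inv h)\<in>cayley G S" using inv unfolding cayley_def
   by (auto simp: m_assoc intro!: bexI[of _ h])
  thus ?case using cl inv by blast
 next
  case (eng h1 h2)
  have "h1\<in>carrier G" "h2\<in>carrier G" using eng S(3) by auto
  hence "a\<otimes>(h1\<otimes>h2) = a\<otimes>h1\<otimes>h2" using eng Y by (auto simp: m_assoc)
  thus ?case using eng by metis
 qed
 from this[of "inv x\<otimes>g" x for g] have "g\<in>Y" if "g\<in>carrier G" for g
  using that Y S(3) by (metis inv_cancel(2)[OF grp] inv_closed m_closed subsetD)
 thus ?thesis using Y by blast
qed

text \<open>Once the finite set \<open>K\<close> of end points of coboundary edges is deleted, no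
  remaining edge leaves any \<open>B i\<close>. Only finitely many components remain, so each
  infinite \<open>B i\<close> contains an infinite one, and three of these contradict the number of
  ends.\<close>

lemma no_three_cut_sets:
 assumes two: "num_ends (carrier G) (cayley G S) = 2"
  and B: "\<And>i. i < (3::nat) ==> cut_set (B i)\<and>infinite (B i)"
  and disj: "\<And>i j. i < 3 ==> j < 3 ==> i\<noteq>j ==> B i\<inter>B j = {}"
 shows False
proof -
 let ?V = "carrier G" and ?E = "cayley G S"
 define K where "K = (\<Union>i\<in>{..<3}. fst ` cobound (B i)\<union>snd ` cobound (B i))"
 have K: "finite K" "K\<subseteq>?V"
  unfolding K_def using B cayley_carrier by (auto simp: cut_set_def cobound_def)
 define R where "R = ?E\<inter>(?V - K)\<times>(?V - K)"
 define comp where "comp x = R\<^sup>* `` {x}" for x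
 have symR: "sym (R\<^sup>*)"
  by (rule sym_rtrancl) (use cayley_sym in \<open>auto simp: sym_def R_def\<close>)
 have comp_eq: "comp y = comp x" if "y\<in>comp x" for x y
 proof -
  have xy: "(x, y)\<in>R\<^sup>*" "(y, x)\<in>R\<^sup>*" using that symR unfolding comp_def by (auto dest: symD)
  show ?thesis unfolding comp_def
  proof (intro equalityI subsetI)
   show "z\<in>R\<^sup>* `` {x}" if "z\<in>R\<^sup>* `` {y}" for z using that xy(1) by (auto intro: rtrancl_trans)
   show "z\<in>R\<^sup>* `` {y}" if "z\<in>R\<^sup>* `` {x}" for z using that xy(2) by (auto intro: rtrancl_trans)
  qed
 qed
 have comp_sub: "comp x\<subseteq>?V - K" if "x\<in>?V - K" for x
 proof
  fix y assume "y\<in>comp x"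
  hence "(x, y)\<in>R\<^sup>*" unfolding comp_def by blast
  thus "y\<in>?V - K" using that by (induction) (auto simp: R_def)
 qed
 have self: "x\<in>comp x" for x unfolding comp_def by blast
 \<comment> \<open>A component that contains no neighbour of \<open>K\<close> is closed under all
   edges and hence everything; the others contain one of finitely many neighbours.\<close>
 have "comp ` (?V - K)\<subseteq>{?V}\<union>comp ` (?E `` K)"
 proof
  fix C assume "C\<in>comp ` (?V - K)"
  then obtain x where x: "x\<in>?V - K" "C = comp x" by blast
  show "C\<in>{?V}\<union>comp ` (?E `` K)"
  proof (cases "C\<inter>?E `` K = {}")
   case False
   then obtain y where y: "y\<in>C" "y\<in>?E `` K" by blast
   hence "C = comp y" using comp_eq x by simp
   thus ?thesis using y by blast
  next
   case True
   have "C = ?V"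
   proof (rule cayley_closed)
    show "C\<subseteq>?V" "x\<in>C" using x comp_sub self by auto
    fix a b assume ab: "a\<in>C" "(a, b)\<in>?E"
    have "b\<notin>K" using ab True cayley_sym by blast
    moreover have "a\<in>?V - K" using ab x comp_sub by blast
    ultimately have "(a, b)\<in>R" using ab cayley_carrier unfolding R_def by blast
    thus "b\<in>C" using ab x unfolding comp_def by (auto intro: rtrancl_into_rtrancl)
   qed
   thus ?thesis by blast
  qed
 qed
 hence fin: "finite (comp ` (?V - K))" using cayley_Image_finite[OF K(1)] finite_subset by blast
 have inB: "comp x\<subseteq>B i" if "x\<in>B i - K" "i < 3" for x i
 proof
  fix y assume "y\<in>comp x"
  hence "(x, y)\<in>R\<^sup>*" unfolding comp_def by blast
  thus "y\<in>B i"
  proof induction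
   case base thus ?case using that by blast
  next
   case (step y z)
   show ?case
   proof (rule ccontr)
    assume "z\<notin>B i"
    hence "(y, z)\<in>cobound (B i)" using step unfolding cobound_def R_def by blast
    hence "y\<in>K" unfolding K_def using that(2) by force
    thus False using step unfolding R_def by blast
   qed
  qed
 qed
 have ex: "\<exists>C\<in>infinite_components ?V ?E K. C\<subseteq>B i" if i: "i < 3" for i
 proof -
  have BV: "B i\<subseteq>?V" using B[OF i] unfolding cut_set_def by blast
  have "infinite (B i - K)" using B[OF i] K by simp
  moreover have "B i - K\<subseteq>\<Union>(comp ` (B i - K))" using self by blast
  ultimately have "infinite (\<Union>(comp ` (B i - K)))" using finite_subset by blast
  moreover have "finite (comp ` (B i - K))" using fin BV
   by (meson Diff_mono finite_subset image_mono order_refl)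
  ultimately obtain x where x: "x\<in>B i - K" "infinite (comp x)" by blast
  have "comp x\<in>infinite_components ?V ?E K"
   unfolding infinite_components_def using x BV unfolding comp_def R_def by blast
  thus ?thesis using inB[OF x(1) i] by blast
 qed
 then obtain C where C: "\<And>i. i < 3 ==> C i\<in>infinite_components ?V ?E K\<and>C i\<subseteq>B i" by metis
 have "inj_on C {..<3}"
 proof (rule inj_onI)
  fix i j :: nat assume ij: "i\<in>{..<3}" "j\<in>{..<3}" "C i = C j"
  have "infinite (C i)" using C ij unfolding infinite_components_def by blast
  hence "C i\<noteq>{}" by auto
  thus "i = j" using disj[of i j] C[of i] C[of j] ij by auto
 qed
 hence "card (C ` {..<3}) = 3" by (simp add: card_image)
 moreover have "infinite_components ?V ?E K\<subseteq>comp ` (?V - K)"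
  unfolding infinite_components_def comp_def R_def by blast
 hence "finite (infinite_components ?V ?E K)" using fin finite_subset by blast
 moreover have "C ` {..<3}\<subseteq>infinite_components ?V ?E K" using C by blast
 ultimately have "3 \<le> card (infinite_components ?V ?E K)" by (metis card_mono)
 moreover have "enat (card (infinite_components ?V ?E K)) \<le> num_ends ?V ?E"
  unfolding num_ends_def by (rule SUP_upper) (use K in blast)
 ultimately show False unfolding two by (simp add: numeral_eq_enat)
qed

text \<open>Deleting some finite set \<open>K\<close> leaves two infinite components. Edges that
  leave the first one end in \<open>K\<close>, and its complement contains the second.\<close>

lemma ex_cut_set:
 assumes two: "num_ends (carrier G) (cayley G S) = 2"
 shows "\<exists>A. cut_set A\<and>infinite A\<and>infinite (carrier G - A)"
proof -
 let ?V = "carrier G" and ?E = "cayley G S"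
 have "\<exists>K. finite K\<and>K\<subseteq>?V\<and>card (infinite_components ?V ?E K) > 1"
 proof (rule ccontr)
  assume "\<not> ?thesis"
  hence "num_ends ?V ?E \<le> enat 1"
   unfolding num_ends_def by (intro SUP_least) (simp add: not_less)
  thus False unfolding two by (simp add: numeral_eq_enat)
 qed
 then obtain K where K: "finite K" "K\<subseteq>?V" "card (infinite_components ?V ?E K) > 1" by blast
 define R where "R = ?E\<inter>(?V - K)\<times>(?V - K)"
 have symR: "sym (R\<^sup>*)"
  by (rule sym_rtrancl) (use cayley_sym in \<open>auto simp: sym_def R_def\<close>)
 have fin: "finite (infinite_components ?V ?E K)" using K(3) by (metis card.infinite not_less_zero)
 obtain C D where CD: "C\<in>infinite_components ?V ?E K" "D\<in>infinite_components ?V ?E K" "C\<noteq>D"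
  using K(3) card_le_Suc0_iff_eq[OF fin] by fastforce
 obtain x where x: "x\<in>?V - K" "C = R\<^sup>* `` {x}" and "infinite C"
  using CD unfolding infinite_components_def R_def by blast
 obtain y where y: "y\<in>?V - K" "D = R\<^sup>* `` {y}" and "infinite D"
  using CD unfolding infinite_components_def R_def by blast
 have sub: "R\<^sup>* `` {u}\<subseteq>?V - K" if "u\<in>?V - K" for u
 proof
  fix v assume "v\<in>R\<^sup>* `` {u}"
  hence "(u, v)\<in>R\<^sup>*" by blast
  thus "v\<in>?V - K" using that by induction (auto simp: R_def)
 qed
 have "D\<inter>C = {}"
 proof (rule ccontr)
  assume "D\<inter>C\<noteq>{}"
  then obtain z where z: "(x, z)\<in>R\<^sup>*" "(y, z)\<in>R\<^sup>*" using x y by blast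
  hence "(z, x)\<in>R\<^sup>*" "(z, y)\<in>R\<^sup>*" using symR by (auto dest: symD)
  hence xy: "(x, y)\<in>R\<^sup>*" "(y, x)\<in>R\<^sup>*" using z by (auto intro: rtrancl_trans)
  have "C = D" unfolding x(2) y(2) using xy by (auto intro: rtrancl_trans)
  thus False using CD by blast
 qed
 hence "D\<subseteq>?V - C" using y sub by blast
 hence "infinite (?V - C)" using \<open>infinite D\<close> finite_subset by blast
 moreover have "cobound C\<subseteq>(?E `` K)\<times>K"
 proof
  fix p assume "p\<in>cobound C"
  then obtain a b where ab: "p = (a, b)" "(a, b)\<in>?E" "a\<in>C" "b\<notin>C" unfolding cobound_def by blast
  have "b\<in>K"
  proof (rule ccontr)
   assume "b\<notin>K"
   hence "(a, b)\<in>R" using ab cayley_carrier sub[OF x(1)] x(2) unfolding R_def by blast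
   thus False using ab x(2) by (auto intro: rtrancl_into_rtrancl)
  qed
  thus "p\<in>(?E `` K)\<times>K" using ab cayley_sym by blast
 qed
 hence "finite (cobound C)" using cayley_Image_finite[OF K(1)] K(1) by (meson finite_SigmaI finite_subset)
 hence "cut_set C" unfolding cut_set_def using sub[OF x(1)] x(2) by blast
 ultimately show ?thesis using \<open>infinite C\<close> by blast
qed

section \<open>Translates, and sets that agree up to finitely many elements\<close>

lemma translate_translate: "g\<in>carrier G ==> h\<in>carrier G ==>
  translate g (translate h A) = translate (g\<otimes>h) A"
 unfolding translate_def by (auto simp: inv_mult_group m_assoc)

lemma translate_Diff: "g\<in>carrier G ==> translate g (A - B) = translate g A - translate g B"
 unfolding translate_def by auto

lemma translate_carrier: "g\<in>carrier G ==> translate g (carrier G) = carrier G"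
 unfolding translate_def by auto

lemma translate_one: "A\<subseteq>carrier G ==> translate \<one> A = A"
 unfolding translate_def by auto

lemma bij_translate:
 assumes "g\<in>carrier G" "A\<subseteq>carrier G"
 shows "bij_betw (\<lambda>x. g\<otimes>x) A (translate g A)"
proof (rule bij_betw_imageI)
 show "inj_on (\<lambda>x. g\<otimes>x) A" using assms by (auto simp: inj_on_def subset_iff)
 show "(\<lambda>x. g\<otimes>x) ` A = translate g A"
 proof (intro equalityI subsetI)
  show "x\<in>translate g A" if "x\<in>(\<lambda>x. g\<otimes>x) ` A" for x
   using that assms unfolding translate_def by (auto simp: m_assoc[symmetric] subset_iff)
  show "x\<in>(\<lambda>x. g\<otimes>x) ` A" if "x\<in>translate g A" for x
  proof -
   have "x = g\<otimes>(inv g\<otimes>x)" using that assms unfolding translate_def by (simp add: m_assoc[symmetric])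
   thus ?thesis using that unfolding translate_def by blast
  qed
 qed
qed

lemma finite_translate: "g\<in>carrier G ==> A\<subseteq>carrier G ==> finite (translate g A)\<longleftrightarrow>finite A"
 using bij_translate bij_betw_finite by metis

lemma card_translate: "g\<in>carrier G ==> A\<subseteq>carrier G ==> card (translate g A) = card A"
 using bij_translate bij_betw_same_card by metis

lemma cut_set_translate:
 assumes g: "g\<in>carrier G" and A: "cut_set A"
 shows "cut_set (translate g A)"
proof -
 have "cobound (translate g A)\<subseteq>(\<lambda>(x, y). (g\<otimes>x, g\<otimes>y)) ` cobound A"
 proof
  fix p assume "p\<in>cobound (translate g A)"
  then obtain x y where xy: "p = (x, y)" "(x, y)\<in>cayley G S" "x\<in>translate g A" "y\<notin>translate g A"
   unfolding cobound_def by blast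
  have xyG: "x\<in>carrier G" "y\<in>carrier G" using xy cayley_carrier by auto
  have "(inv g\<otimes>x, inv g\<otimes>y)\<in>cobound A"
   using xy xyG cayley_translate[OF inv_closed[OF g]] unfolding cobound_def translate_def by blast
  moreover have "p = (\<lambda>(x, y). (g\<otimes>x, g\<otimes>y)) (inv g\<otimes>x, inv g\<otimes>y)"
   using xy xyG g by (simp add: m_assoc[symmetric])
  ultimately show "p\<in>(\<lambda>(x, y). (g\<otimes>x, g\<otimes>y)) ` cobound A" by blast
 qed
 thus ?thesis using A finite_subset unfolding cut_set_def translate_def by blast
qed

lemma cut_set_Int:
 assumes "cut_set A" "cut_set B" shows "cut_set (A\<inter>B)"
proof -
 have "cobound (A\<inter>B)\<subseteq>cobound A\<union>cobound B" unfolding cobound_def by blast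
 thus ?thesis using assms unfolding cut_set_def by (meson finite_UnI finite_subset le_infI1)
qed

lemma cut_set_Compl:
 assumes "cut_set A" shows "cut_set (carrier G - A)"
proof -
 have "cobound (carrier G - A)\<subseteq>(cobound A)\<inverse>"
  unfolding cobound_def using cayley_sym cayley_carrier by blast
 thus ?thesis using assms unfolding cut_set_def by (meson Diff_subset finite_converse finite_subset)
qed

lemma almost_eq_sym: "almost_eq A B ==> almost_eq B A"
 unfolding almost_eq_def by blast

lemma almost_eq_trans:
 assumes "almost_eq A B" "almost_eq B C" shows "almost_eq A C"
proof -
 have "A - C\<subseteq>(A - B)\<union>(B - C)" "C - A\<subseteq>(C - B)\<union>(B - A)" by auto
 thus ?thesis using assms unfolding almost_eq_def by (meson finite_UnI finite_subset)
qed

lemma almost_eq_Compl: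
 assumes "almost_eq A B" shows "almost_eq (carrier G - A) (carrier G - B)"
proof -
 have "(carrier G - A) - (carrier G - B)\<subseteq>B - A" "(carrier G - B) - (carrier G - A)\<subseteq>A - B" by auto
 thus ?thesis using assms unfolding almost_eq_def by (meson finite_subset)
qed

lemma almost_eq_translate:
 assumes "g\<in>carrier G" "A\<subseteq>carrier G" "B\<subseteq>carrier G" "almost_eq A B"
 shows "almost_eq (translate g A) (translate g B)"
proof -
 have "finite (translate g (A - B))" "finite (translate g (B - A))"
  using assms finite_translate[of g "A - B"] finite_translate[of g "B - A"]
  unfolding almost_eq_def by (auto simp: subset_iff)
 thus ?thesis using assms(1) translate_Diff unfolding almost_eq_def by simp
qed

lemma relcard_eq:
 assumes "finite F" "A - B\<subseteq>F" "B - A\<subseteq>F"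
 shows "relcard A B = real (card (A\<inter>F)) - real (card (B\<inter>F))"
proof -
 have "card (A\<inter>F) = card (A - B) + card (A\<inter>B\<inter>F)" "card (B\<inter>F) = card (B - A) + card (A\<inter>B\<inter>F)"
 proof -
  have "A\<inter>F = (A - B)\<union>(A\<inter>B\<inter>F)" "B\<inter>F = (B - A)\<union>(A\<inter>B\<inter>F)" using assms by auto
  moreover have "finite (A - B)" "finite (B - A)" "finite (A\<inter>B\<inter>F)" using assms finite_subset by blast+
  ultimately show "card (A\<inter>F) = card (A - B) + card (A\<inter>B\<inter>F)"
   "card (B\<inter>F) = card (B - A) + card (A\<inter>B\<inter>F)"
   by (metis (no_types, lifting) card_Un_disjoint Diff_disjoint Int_Diff inf.assoc inf_commute
     Diff_Int_distrib2 Int_empty_left inf_left_commute Diff_cancel Int_empty_right)+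
 qed
 thus ?thesis unfolding relcard_def by simp
qed

text \<open>All three differences are computed inside one finite set \<open>F\<close>, where they
  become honest differences of cardinalities.\<close>

lemma relcard_trans:
 assumes "almost_eq A B" "almost_eq B C"
 shows "relcard A C = relcard A B + relcard B C"
proof -
 define F where "F = (A - B)\<union>(B - A)\<union>(B - C)\<union>(C - B)"
 have F: "finite F" using assms unfolding F_def almost_eq_def by blast
 have "relcard A C = real (card (A\<inter>F)) - real (card (C\<inter>F))"
  by (rule relcard_eq[OF F]) (auto simp: F_def)
 moreover have "relcard A B = real (card (A\<inter>F)) - real (card (B\<inter>F))"
  by (rule relcard_eq[OF F]) (auto simp: F_def)
 moreover have "relcard B C = real (card (B\<inter>F)) - real (card (C\<inter>F))"
  by (rule relcard_eq[OF F]) (auto simp: F_def)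
 ultimately show ?thesis by simp
qed

lemma relcard_translate:
 assumes "g\<in>carrier G" "A\<subseteq>carrier G" "B\<subseteq>carrier G"
 shows "relcard (translate g A) (translate g B) = relcard A B"
proof -
 have "card (translate g A - translate g B) = card (A - B)" "card (translate g B - translate g A) = card (B - A)"
  using assms card_translate[of g "A - B"] card_translate[of g "B - A"] translate_Diff
  by (auto simp: subset_iff)
 thus ?thesis unfolding relcard_def by simp
qed

section \<open>Word balls and translations by far elements\<close>

lemma cball_carrier: "wball n\<subseteq>carrier G"
 by (induction n) (use cayley_carrier in auto)

lemma cball_finite: "finite (wball n)"
 by (induction n) (simp_all add: cayley_Image_finite)

lemma cball_mono: "m \<le> n ==> wball m\<subseteq>wball n"
 by (rule lift_Suc_mono_le[of wball]) auto

lemma cball_covers: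
 assumes "finite F" "F\<subseteq>carrier G"
 shows "\<exists>n. F\<subseteq>wball n"
proof -
 have "(\<Union>n. wball n) = carrier G"
 proof (rule cayley_closed)
  show "(\<Union>n. wball n)\<subseteq>carrier G" using cball_carrier by blast
  show "\<one>\<in>(\<Union>n. wball n)" by (rule UN_I[of 0]) auto
  fix a b assume "a\<in>(\<Union>n. wball n)" "(a, b)\<in>cayley G S"
  then obtain n where "b\<in>wball (Suc n)" by auto
  thus "b\<in>(\<Union>n. wball n)" by blast
 qed
 hence "\<forall>x\<in>F. \<exists>n. x\<in>wball n" using assms by blast
 then obtain m where m: "\<And>x. x\<in>F ==> x\<in>wball (m x)" by metis
 have "x\<in>wball (Max (m ` F))" if "x\<in>F" for x
 proof -
  have "m x \<le> Max (m ` F)" using assms(1) that by simp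
  thus ?thesis using m[OF that] cball_mono by blast
 qed
 thus ?thesis by blast
qed

text \<open>The translate of the ball is connected and, lying off the ball, contains no end of a
  coboundary edge. So it lies on one side of \<open>A\<close>, the side of its centre
  \<open>g\<close>.\<close>

lemma far_translate_side:
 assumes g: "g\<in>carrier G"
  and ends: "fst ` cobound A\<union>snd ` cobound A\<subseteq>wball r"
  and far: "\<And>x. x\<in>wball r ==> g\<otimes>x\<notin>wball r"
  and x: "x\<in>wball r"
 shows "g\<otimes>x\<in>A\<longleftrightarrow>g\<in>A"
proof -
 have "i \<le> r ==> x\<in>wball i ==> g\<otimes>x\<in>A\<longleftrightarrow>g\<in>A" for i x
 proof (induction i arbitrary: x)
  case 0 thus ?case using g by simp
 next
  case (Suc i)
  show ?case
  proof (cases "x\<in>wball i")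
   case True thus ?thesis using Suc by simp
  next
   case False
   then obtain y where y: "y\<in>wball i" "(y, x)\<in>cayley G S" using Suc by auto
   have e: "(g\<otimes>y, g\<otimes>x)\<in>cayley G S" "(g\<otimes>x, g\<otimes>y)\<in>cayley G S"
    using cayley_translate[OF g y(2)] cayley_sym by auto
   have "x\<in>wball r" "y\<in>wball r" using Suc.prems y cball_mono[of i r] cball_mono[of "Suc i" r] by auto
   hence "g\<otimes>x\<notin>wball r" "g\<otimes>y\<notin>wball r" using far by auto
   hence "(g\<otimes>y, g\<otimes>x)\<notin>cobound A" "(g\<otimes>x, g\<otimes>y)\<notin>cobound A" using ends by force+
   hence "g\<otimes>x\<in>A\<longleftrightarrow>g\<otimes>y\<in>A" using e unfolding cobound_def by blast
   thus ?thesis using Suc.IH[of y] Suc.prems y by simp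
  qed
 qed
 thus ?thesis using x by blast
qed

text \<open>Hence only finitely many group elements fail the condition \<open>far\<close> of the
  lemmas around.\<close>

lemma finite_hit: "finite {g\<in>carrier G. \<exists>x\<in>wball m. g\<otimes>x\<in>wball n}"
proof -
 have "{g\<in>carrier G. \<exists>x\<in>wball m. g\<otimes>x\<in>wball n}\<subseteq>(\<lambda>(x, y). y\<otimes>inv x) ` (wball m\<times>wball n)"
 proof
  fix g assume "g\<in>{g\<in>carrier G. \<exists>x\<in>wball m. g\<otimes>x\<in>wball n}"
  then obtain x where x: "g\<in>carrier G" "x\<in>wball m" "g\<otimes>x\<in>wball n" by blast
  have "x\<in>carrier G" using x cball_carrier by blast
  hence "g = (\<lambda>(x, y). y\<otimes>inv x) (x, g\<otimes>x)" using x by (simp add: m_assoc)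
  thus "g\<in>(\<lambda>(x, y). y\<otimes>inv x) ` (wball m\<times>wball n)" using x by blast
 qed
 moreover have "finite ((\<lambda>(x, y). y\<otimes>inv x) ` (wball m\<times>wball n))"
  by (intro finite_imageI finite_cartesian_product cball_finite)
 ultimately show ?thesis by (rule finite_subset)
qed

lemma closed_off:
 assumes Y: "Y\<subseteq>carrier G" and b: "cobound Y = {}" and z: "z\<in>carrier G" "z\<notin>Y"
 shows "Y = {}"
proof (rule ccontr)
 assume "Y\<noteq>{}"
 then obtain y where "y\<in>Y" by blast
 hence "Y = carrier G" by (rule cayley_closed[OF Y]) (use b in \<open>auto simp: cobound_def\<close>)
 thus False using z by blast
qed

text \<open>The ball with the coboundary of \<open>A\<close> lies wholly inside or wholly outside
  \<open>translate g A\<close>, according to \<open>inv g \<in> A\<close>; the translated ball lies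
  inside or outside \<open>A\<close>, according to \<open>g \<in> A\<close>. If both are inside, the
  complement of the union has no coboundary; if both are outside, the intersection has none. Such a
  set is empty, but both are infinite.\<close>

lemma far_translate_nested:
 assumes A: "A\<subseteq>carrier G" "infinite (A\<inter>translate g A)" "infinite (carrier G - (A\<union>translate g A))"
  and g: "g\<in>carrier G"
  and ends: "fst ` cobound A\<union>snd ` cobound A\<subseteq>wball r"
  and far: "\<And>x. x\<in>wball r ==> g\<otimes>x\<notin>wball r"
 shows "g\<in>A\<longleftrightarrow>inv g\<notin>A"
proof -
 have inA: "g\<otimes>x\<in>A\<longleftrightarrow>g\<in>A" if "x\<in>wball r" for x
  by (rule far_translate_side[OF g ends far that])
 have far': "inv g\<otimes>x\<notin>wball r" if "x\<in>wball r" for x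
 proof
  assume "inv g\<otimes>x\<in>wball r"
  hence "g\<otimes>(inv g\<otimes>x)\<notin>wball r" by (rule far)
  moreover have "x\<in>carrier G" using that cball_carrier by blast
  ultimately show False using that g by (simp add: inv_cancel[OF grp])
 qed
 have inT: "inv g\<otimes>x\<in>A\<longleftrightarrow>inv g\<in>A" if "x\<in>wball r" for x
  by (rule far_translate_side[OF inv_closed[OF g] ends far' that])
 have e1: "x\<in>wball r" "y\<in>wball r" if "(x, y)\<in>cayley G S" "(x\<in>A)\<noteq>(y\<in>A)" for x y
 proof -
  have "(x, y)\<in>cobound A \<or> (y, x)\<in>cobound A" using that cayley_sym unfolding cobound_def by blast
  thus "x\<in>wball r" "y\<in>wball r" using ends by force+
 qed
 have e2: "\<exists>x'\<in>wball r. x = g\<otimes>x'" if "(x, y)\<in>cayley G S" "(x\<in>translate g A)\<noteq>(y\<in>translate g A)" for x y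
 proof -
  have xy: "x\<in>carrier G" "y\<in>carrier G" using that cayley_carrier by auto
  have "(inv g\<otimes>x, inv g\<otimes>y)\<in>cayley G S" using cayley_translate g that by simp
  hence "inv g\<otimes>x\<in>wball r" using e1 that xy unfolding translate_def by blast
  thus ?thesis using xy g by (intro bexI[of _ "inv g\<otimes>x"]) (simp_all add: inv_cancel[OF grp])
 qed
 have T: "translate g A\<subseteq>carrier G" unfolding translate_def by blast
 have tx: "x\<in>translate g A\<longleftrightarrow>inv g\<in>A" if "x\<in>wball r" for x
  using inT[OF that] that cball_carrier unfolding translate_def by blast
 show ?thesis
 proof (rule ccontr)
  assume "\<not> ?thesis"
  then consider "g\<in>A" "inv g\<in>A" | "g\<notin>A" "inv g\<notin>A" by blast
  thus False
  proof cases
   case 1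
   let ?Y = "carrier G - (A\<union>translate g A)"
   have "cobound ?Y = {}"
   proof (rule ccontr)
    assume "cobound ?Y\<noteq>{}"
    then obtain x y where xy: "(x, y)\<in>cayley G S" "x\<in>?Y" "y\<in>A\<union>translate g A"
     unfolding cobound_def using cayley_carrier by blast
    show False
    proof (cases "y\<in>A")
     case True
     hence "x\<in>wball r" using e1 xy by blast
     thus False using tx 1 xy by blast
    next
     case False
     then obtain x' where "x'\<in>wball r" "x = g\<otimes>x'" using e2 xy by blast
     thus False using inA 1 xy by blast
    qed
   qed
   moreover obtain z where "z\<in>A\<inter>translate g A" using assms(2) by (metis ex_in_conv finite.emptyI)
   ultimately have "?Y = {}" using closed_off[of ?Y z] A by blast
   thus False using assms(3) by (metis finite.emptyI)
  next
   case 2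
   let ?Y = "A\<inter>translate g A"
   have "cobound ?Y = {}"
   proof (rule ccontr)
    assume "cobound ?Y\<noteq>{}"
    then obtain x y where xy: "(x, y)\<in>cayley G S" "x\<in>?Y" "y\<notin>A \<or> y\<notin>translate g A"
     unfolding cobound_def using cayley_carrier by blast
    show False
    proof (cases "y\<in>A")
     case False
     hence "x\<in>wball r" using e1 xy by blast
     thus False using tx 2 xy by blast
    next
     case True
     then obtain x' where "x'\<in>wball r" "x = g\<otimes>x'" using e2 xy by blast
     thus False using inA 2 xy by blast
    qed
   qed
   moreover obtain z where "z\<in>carrier G - (A\<union>translate g A)" using assms(3) by (metis ex_in_conv finite.emptyI)
   ultimately have "?Y = {}" using closed_off[of ?Y z] A by blast
   thus False using assms(2) by (metis finite.emptyI)
  qed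
 qed
qed

text \<open>Here the ball lies in the translate while the translated ball misses \<open>A\<close>,
  so \<open>A - translate g A\<close> has no coboundary and is empty. The rest of the translate
  reaches from the coboundary of \<open>A\<close> to its own coboundary, more than \<open>m\<close>
  steps away, and needs a point for each step.\<close>

lemma far_translate_large:
 assumes A: "A\<subseteq>carrier G" "infinite (carrier G - (A\<union>translate g A))"
  and g: "g\<in>carrier G" "g\<notin>A" "inv g\<in>A" and fin: "finite (translate g A - A)"
  and neb: "cobound A\<noteq>{}"
  and ends: "fst ` cobound A\<union>snd ` cobound A\<subseteq>wball r"
  and far: "\<And>x. x\<in>wball r ==> g\<otimes>x\<notin>wball (r + m + 1)"
 shows "A\<subseteq>translate g A\<and>card (translate g A - A) > m"
proof -
 define F where "F = translate g A - A"
 have far1: "g\<otimes>x\<notin>wball r" if "x\<in>wball r" for x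
  using far[OF that] cball_mono[of r "r + m + 1"] by auto
 have inA: "g\<otimes>x\<notin>A" if "x\<in>wball r" for x
  using far_translate_side[OF g(1) ends far1 that] g by simp
 have far': "inv g\<otimes>x\<notin>wball r" if "x\<in>wball r" for x
 proof
  assume "inv g\<otimes>x\<in>wball r"
  hence "g\<otimes>(inv g\<otimes>x)\<notin>wball r" by (rule far1)
  moreover have "x\<in>carrier G" using that cball_carrier by blast
  ultimately show False using that g by (simp add: inv_cancel[OF grp])
 qed
 have inT: "inv g\<otimes>x\<in>A" if "x\<in>wball r" for x
  using far_translate_side[OF inv_closed[OF g(1)] ends far' that] g by simp
 have e1: "x\<in>wball r" "y\<in>wball r" if "(x, y)\<in>cayley G S" "(x\<in>A)\<noteq>(y\<in>A)" for x y
 proof -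
  have "(x, y)\<in>cobound A \<or> (y, x)\<in>cobound A" using that cayley_sym unfolding cobound_def by blast
  thus "x\<in>wball r" "y\<in>wball r" using ends by force+
 qed
 have e2: "\<exists>x'\<in>wball r. x = g\<otimes>x'" if "(x, y)\<in>cayley G S" "(x\<in>translate g A)\<noteq>(y\<in>translate g A)" for x y
 proof -
  have xy: "x\<in>carrier G" "y\<in>carrier G" using that cayley_carrier by auto
  have "(inv g\<otimes>x, inv g\<otimes>y)\<in>cayley G S" using cayley_translate g that by simp
  hence "inv g\<otimes>x\<in>wball r" using e1 that xy unfolding translate_def by blast
  thus ?thesis using xy g by (intro bexI[of _ "inv g\<otimes>x"]) (simp_all add: inv_cancel[OF grp])
 qed
 have T: "translate g A\<subseteq>carrier G" unfolding translate_def by blast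
 have tx: "x\<in>translate g A" if "x\<in>wball r" for x
  using inT[OF that] that cball_carrier unfolding translate_def by blast
 obtain z where z: "z\<in>carrier G" "z\<notin>A" "z\<notin>translate g A"
  using assms(2) by (metis Diff_iff UnCI ex_in_conv finite.emptyI)
 have "A - translate g A = {}"
 proof (rule closed_off[of _ z])
  show "cobound (A - translate g A) = {}"
  proof (rule ccontr)
   assume "cobound (A - translate g A)\<noteq>{}"
   then obtain x y where xy: "(x, y)\<in>cayley G S" "x\<in>A" "x\<notin>translate g A" "y\<notin>A \<or> y\<in>translate g A"
    unfolding cobound_def by blast
   show False
   proof (cases "y\<in>A")
    case False
    hence "x\<in>wball r" using e1 xy by blast
    thus False using tx xy by blast
   next
    case True
    then obtain x' where "x'\<in>wball r" "x = g\<otimes>x'" using e2 xy by blast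
    thus False using inA xy by blast
   qed
  qed
 qed (use A z in auto)
 moreover have "card F > m"
 proof (rule ccontr)
  assume small: "\<not> card F > m"
  obtain x0 y0 where xy0: "(x0, y0)\<in>cayley G S" "x0\<in>A" "y0\<notin>A" using neb unfolding cobound_def by blast
  hence y0: "y0\<in>F\<inter>wball r" using e1 tx unfolding F_def by blast
  \<comment> \<open>\<open>F\<close> meets the ball of radius \<open>r\<close>, so if its
    intersections with the balls grew strictly at each of these steps, it would have more than
    \<open>m\<close> points.\<close>
  have "\<exists>i\<le>m. F\<inter>wball (r + Suc i) = F\<inter>wball (r + i)"
  proof (rule ccontr)
   assume neq: "\<not> ?thesis"
   have "i \<le> Suc m ==> card (F\<inter>wball (r + i)) \<ge> Suc i" for i
   proof (induction i)
    case 0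
    have "finite (F\<inter>wball r)" using cball_finite by blast
    thus ?case using y0 by (metis Suc_leI add.right_neutral card_gt_0_iff empty_iff)
   next
    case (Suc i)
    have "F\<inter>wball (r + i)\<subset>F\<inter>wball (r + Suc i)"
     using neq Suc.prems cball_mono[of "r + i" "r + Suc i"] by auto
    hence "card (F\<inter>wball (r + i)) < card (F\<inter>wball (r + Suc i))"
     using cball_finite by (intro psubset_card_mono) blast+
    thus ?case using Suc by simp
   qed
   from this[of "Suc m"] have "Suc (Suc m) \<le> card (F\<inter>wball (r + Suc m))" by simp
   also have "\<dots> \<le> card F" using fin unfolding F_def by (intro card_mono) auto
   finally show False using small by simp
  qed
  then obtain i where i: "i \<le> m" "F\<inter>wball (r + Suc i) = F\<inter>wball (r + i)" by blast
  \<comment> \<open>An edge leaving this set would either cross the coboundary of \<open>A\<close>,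
    whose outer ends in the ball belong to the set already, or the coboundary of the translate,
    which is farther out.\<close>
  let ?Y = "A\<union>(F\<inter>wball (r + i))"
  have "cobound ?Y = {}"
  proof (rule ccontr)
   assume "cobound ?Y\<noteq>{}"
   then obtain x y where xy: "(x, y)\<in>cayley G S" "x\<in>?Y" "y\<notin>?Y" unfolding cobound_def by blast
   show False
   proof (cases "x\<in>A")
    case True
    hence "y\<in>wball r" using e1 xy by blast
    hence "y\<in>F\<inter>wball (r + i)" using tx xy cball_mono[of r "r + i"] unfolding F_def by auto
    thus False using xy by blast
   next
    case False
    hence x: "x\<in>F" "x\<in>wball (r + i)" using xy by auto
    hence yb: "y\<in>wball (r + Suc i)" using xy by auto
    hence "y\<notin>F" using i xy by blast
    hence "y\<notin>translate g A" using xy unfolding F_def by blast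
    hence "(y, x)\<in>cayley G S" "(y\<in>translate g A)\<noteq>(x\<in>translate g A)"
     using x xy cayley_sym unfolding F_def by auto
    then obtain y' where "y'\<in>wball r" "y = g\<otimes>y'" using e2 by blast
    moreover have "wball (r + Suc i)\<subseteq>wball (r + m + 1)" using i by (intro cball_mono) simp
    ultimately show False using far yb by blast
   qed
  qed
  hence "?Y = {}"
   by (intro closed_off[of _ z]) (use A z T in \<open>auto simp: F_def\<close>)
  thus False using xy0 by blast
 qed
 ultimately show ?thesis unfolding F_def by blast
qed

text \<open>The elements that change a half \<open>A\<close> of the graph by a finite set only form
  a subgroup of index at most two; the others swap the ends. On this subgroup the signed number of
  points gained by \<open>A\<close> is a homomorphism to the reals, and far elements gain or lose
  many points.\<close>

lemma two_ends_vcyc: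
 assumes two: "num_ends (carrier G) (cayley G S) = 2"
 shows "vcyc G (carrier G)"
proof -
 obtain A where A: "cut_set A" "infinite A" "infinite (carrier G - A)" using ex_cut_set[OF two] by blast
 have AG: "A\<subseteq>carrier G" using A(1) unfolding cut_set_def by blast
 have TG: "translate g A\<subseteq>carrier G" for g unfolding translate_def by blast
 \<comment> \<open>Of the four intersections of \<open>A\<close> and its complement with the
   translate and its complement, at most two are infinite. As none of these four sets is finite, the
   two infinite intersections lie diagonally.\<close>
 have dich: "almost_eq (translate g A) A \<or> almost_eq (translate g A) (carrier G - A)"
  if g: "g\<in>carrier G" for g
 proof -
  let ?T = "translate g A" and ?n = "\<lambda>Y. carrier G - Y"
  have T: "cut_set ?T" by (rule cut_set_translate[OF g A(1)])
  have infT: "infinite ?T" using finite_translate[OF g AG] A by blast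
  have infcT: "infinite (?n ?T)"
   using A(3) finite_translate[OF g, of "carrier G - A"] by (simp add: translate_Diff[OF g] translate_carrier[OF g])
  have c4: "cut_set (A\<inter>?T)" "cut_set (A\<inter>?n ?T)" "cut_set (?n A\<inter>?T)" "cut_set (?n A\<inter>?n ?T)"
   using A(1) T cut_set_Int cut_set_Compl by auto
  have three: False if "cut_set B1" "cut_set B2" "cut_set B3" "infinite B1" "infinite B2" "infinite B3"
   "B1\<inter>B2 = {}" "B1\<inter>B3 = {}" "B2\<inter>B3 = {}" for B1 B2 B3
  proof (rule no_three_cut_sets[OF two])
   define B where "B i = (if i = 0 then B1 else if i = 1 then B2 else B3)" for i :: nat
   show "cut_set (B i)\<and>infinite (B i)" for i using that unfolding B_def by simp
   show "B i\<inter>B j = {}" if "i < 3" "j < 3" "i\<noteq>j" for i j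
   proof -
    have "i = 0 \<or> i = 1 \<or> i = 2" "j = 0 \<or> j = 1 \<or> j = 2" using that by auto
    thus ?thesis using that \<open>B1\<inter>B2 = {}\<close> \<open>B1\<inter>B3 = {}\<close> \<open>B2\<inter>B3 = {}\<close> unfolding B_def by auto
   qed
  qed
  have eqs: "A = (A\<inter>?T)\<union>(A\<inter>?n ?T)" "?n A = (?n A\<inter>?T)\<union>(?n A\<inter>?n ?T)"
   "?T = (A\<inter>?T)\<union>(?n A\<inter>?T)" "?n ?T = (A\<inter>?n ?T)\<union>(?n A\<inter>?n ?T)"
   using AG TG by auto
  have d: "A - ?T = A\<inter>?n ?T" "?T - A = ?n A\<inter>?T" "?T - ?n A = A\<inter>?T" "?n A - ?T = ?n A\<inter>?n ?T"
   using AG TG by auto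
  have o: "infinite (A\<inter>?T) \<or> infinite (A\<inter>?n ?T)" "infinite (?n A\<inter>?T) \<or> infinite (?n A\<inter>?n ?T)"
   "infinite (A\<inter>?T) \<or> infinite (?n A\<inter>?T)" "infinite (A\<inter>?n ?T) \<or> infinite (?n A\<inter>?n ?T)"
   using eqs A(2,3) infT infcT by (metis finite_UnI)+
  show ?thesis
  proof (cases "finite (A\<inter>?n ?T)")
   case True
   hence i: "infinite (A\<inter>?T)" "infinite (?n A\<inter>?n ?T)" using o by auto
   have "finite (?n A\<inter>?T)"
    using three[OF c4(1) c4(4) c4(3) i] by blast
   thus ?thesis using True d unfolding almost_eq_def by simp
  next
   case False
   have "finite (A\<inter>?T)"
   proof (rule ccontr)
    assume inf: "infinite (A\<inter>?T)"
    hence "finite (?n A\<inter>?T)" "finite (?n A\<inter>?n ?T)"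
     using three[OF c4(1) c4(2) c4(3) inf False] three[OF c4(1) c4(2) c4(4) inf False] by blast+
    thus False using o by blast
   qed
   moreover from this have "infinite (?n A\<inter>?T)" using o by blast
   hence "finite (?n A\<inter>?n ?T)" using three[OF c4(2) c4(3) c4(4) False] by blast
   ultimately show ?thesis using d unfolding almost_eq_def by simp
  qed
 qed
 define G0 where "G0 = {g\<in>carrier G. almost_eq (translate g A) A}"
 have refl: "almost_eq B B" for B unfolding almost_eq_def by simp
 have inv0: "almost_eq (translate (inv g) A) B"
  if "g\<in>carrier G" "B\<subseteq>carrier G" "almost_eq (translate g B) A" for g B
 proof -
  have "almost_eq (translate (inv g) (translate g B)) (translate (inv g) A)"
   using that AG by (intro almost_eq_translate) (auto simp: translate_def)
  thus ?thesis using that by (simp add: translate_translate translate_one almost_eq_sym)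
 qed
 have comp0: "almost_eq (translate (g\<otimes>h) A) C"
  if "g\<in>carrier G" "h\<in>carrier G" "B\<subseteq>carrier G" "almost_eq (translate h A) B" "almost_eq (translate g B) C"
  for g h B C
 proof -
  have "almost_eq (translate g (translate h A)) (translate g B)"
   using that TG by (intro almost_eq_translate) auto
  thus ?thesis using that almost_eq_trans by (simp add: translate_translate)
 qed
 have G0: "subgroup G0 G"
 proof (rule subgroupI)
  show "G0\<subseteq>carrier G" unfolding G0_def by blast
  have "\<one>\<in>G0" unfolding G0_def using refl AG by (simp add: translate_one)
  thus "G0\<noteq>{}" by blast
  show "inv a\<in>G0" if "a\<in>G0" for a using that inv0[OF _ AG] unfolding G0_def by simp
  show "a\<otimes>b\<in>G0" if "a\<in>G0" "b\<in>G0" for a b using that comp0[OF _ _ AG] unfolding G0_def by simp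
 qed
 have idx: "fin_index G G0 (carrier G)"
 proof (rule fin_index_two[OF grp G0 subgroup_self])
  show "G0\<subseteq>carrier G" unfolding G0_def by blast
  fix x y assume xy: "x\<in>carrier G" "y\<in>carrier G" "x\<notin>G0" "y\<notin>G0"
  let ?B = "carrier G - A"
  have B: "?B\<subseteq>carrier G" by blast
  have ae: "almost_eq (translate x A) ?B" "almost_eq (translate y A) ?B"
   using dich xy unfolding G0_def by auto
  have flip: "almost_eq (translate z ?B) A" if "z\<in>carrier G" "almost_eq (translate z A) ?B" for z
  proof -
   have "almost_eq (carrier G - translate z A) (carrier G - ?B)" by (rule almost_eq_Compl[OF that(2)])
   moreover have "carrier G - ?B = A" using AG by blast
   ultimately show ?thesis using that(1) by (simp add: translate_Diff translate_carrier)
  qed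
  have "almost_eq (translate (inv y) A) ?B" by (rule inv0[OF xy(2) B flip[OF xy(2) ae(2)]])
  hence "almost_eq (translate (x\<otimes>inv y) A) A"
   by (rule comp0[OF xy(1) inv_closed[OF xy(2)] B _ flip[OF xy(1) ae(1)]])
  thus "x\<otimes>inv y\<in>G0" unfolding G0_def using xy by simp
 qed
 define f where "f g = relcard (translate g A) A" for g
 have f_add: "f (x\<otimes>y) = f x + f y" if "x\<in>G0" "y\<in>G0" for x y
 proof -
  have xy: "x\<in>carrier G" "y\<in>carrier G" "almost_eq (translate x A) A" "almost_eq (translate y A) A"
   using that unfolding G0_def by auto
  have "almost_eq (translate x (translate y A)) (translate x A)"
   using xy AG TG by (intro almost_eq_translate) auto
  hence "f (x\<otimes>y) = relcard (translate x (translate y A)) (translate x A) + f x"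
   unfolding f_def using xy relcard_trans by (simp add: translate_translate[symmetric])
  also have "relcard (translate x (translate y A)) (translate x A) = f y"
   unfolding f_def using xy AG TG relcard_translate by simp
  finally show ?thesis by simp
 qed
 have f_one: "f \<one> = 0" unfolding f_def relcard_def using AG by (simp add: translate_one)
 have f_inv: "f (inv x) = - f x" if "x\<in>G0" for x
 proof -
  have "inv x\<in>G0" "x\<in>carrier G" using that G0 by (auto simp: subgroup.m_inv_closed subgroup.mem_carrier)
  thus ?thesis using f_add[OF that, of "inv x"] f_one by simp
 qed
 have "finite (cobound A)" using A(1) unfolding cut_set_def by blast
 moreover have "fst ` cobound A\<union>snd ` cobound A\<subseteq>carrier G"
  using cayley_carrier unfolding cobound_def by auto
 ultimately obtain r where r: "fst ` cobound A\<union>snd ` cobound A\<subseteq>wball r"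
  using cball_covers[of "fst ` cobound A\<union>snd ` cobound A"] by auto
 have neb: "cobound A\<noteq>{}"
 proof
  assume "cobound A = {}"
  moreover obtain z where "z\<in>carrier G - A" using A(3) by (metis ex_in_conv finite.emptyI)
  ultimately have "A = {}" using closed_off[OF AG] by blast
  thus False using A(2) by simp
 qed
 have infint: "infinite (A\<inter>translate g A)" "infinite (carrier G - (A\<union>translate g A))" if "g\<in>G0" for g
 proof -
  have ae: "finite (A - translate g A)" "finite (translate g A - A)"
   using that unfolding G0_def almost_eq_def by auto
  have "A = (A\<inter>translate g A)\<union>(A - translate g A)" by blast
  thus "infinite (A\<inter>translate g A)" using A(2) ae(1) by (metis finite_UnI)
  have "carrier G - A\<subseteq>(carrier G - (A\<union>translate g A))\<union>(translate g A - A)" by blast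
  thus "infinite (carrier G - (A\<union>translate g A))" using A(3) ae(2) by (meson finite_UnI finite_subset)
 qed
 \<comment> \<open>Outside the finite set \<open>P\<close> and its inverses exactly one of
   \<open>g\<close> and \<open>inv g\<close> lies in \<open>A\<close>. The bound
   \<open>large\<close> applies to the other one, and \<open>f\<close> has the same absolute value
   on both.\<close>
 have fin: "finite {x\<in>G0. \<bar>f x\<bar> \<le> M}" for M
 proof -
  obtain m :: nat where m: "M \<le> real m" using real_arch_simple by blast
  define P where "P = {g\<in>carrier G. \<exists>x\<in>wball r. g\<otimes>x\<in>wball (r + m + 1)}"
  have P: "finite P" unfolding P_def by (rule finite_hit)
  have large: "\<bar>f g\<bar> > m" if g: "g\<in>G0" "g\<notin>A" "inv g\<in>A" "g\<notin>P" for g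
  proof -
   have gG: "g\<in>carrier G" using g unfolding G0_def by blast
   have "A\<subseteq>translate g A\<and>card (translate g A - A) > m"
    by (rule far_translate_large[OF AG infint(2)[OF g(1)] gG g(2,3) _ neb r])
     (use g gG in \<open>auto simp: G0_def almost_eq_def P_def\<close>)
   moreover from this have "A - translate g A = {}" by blast
   hence "card (A - translate g A) = 0" by (metis card.empty)
   ultimately show ?thesis unfolding f_def relcard_def by simp
  qed
  have "{x\<in>G0. \<bar>f x\<bar> \<le> M}\<subseteq>P\<union>(\<lambda>x. inv x) ` P"
  proof
   fix g assume "g\<in>{x\<in>G0. \<bar>f x\<bar> \<le> M}"
   hence g: "g\<in>G0" "\<bar>f g\<bar> \<le> m" using m by auto
   have gG: "g\<in>carrier G" using g unfolding G0_def by blast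
   have ig: "inv g\<in>G0" using g G0 subgroup.m_inv_closed by fast
   show "g\<in>P\<union>(\<lambda>x. inv x) ` P"
   proof (rule ccontr)
    assume no: "g\<notin>P\<union>(\<lambda>x. inv x) ` P"
    hence "g\<notin>P" "inv g\<notin>P" using gG by (metis UnCI, metis UnCI imageI inv_inv)
    have "g\<in>A\<longleftrightarrow>inv g\<notin>A"
     by (rule far_translate_nested[OF AG infint[OF g(1)] gG r])
      (use \<open>g\<notin>P\<close> gG cball_mono[of r "r + m + 1"] in \<open>auto simp: P_def\<close>)
    then consider "g\<notin>A" "inv g\<in>A" | "inv g\<notin>A" "inv (inv g)\<in>A" using gG by auto
    thus False
    proof cases
     case 1 thus False using large[OF g(1) 1 \<open>g\<notin>P\<close>] g(2) by simp
    next
     case 2 thus False using large[OF ig 2 \<open>inv g\<notin>P\<close>] g f_inv by simp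
    qed
   qed
  qed
  thus ?thesis using P finite_subset by blast
 qed
 have "vcyc G G0" by (rule vcyc_by_length_hom[OF grp G0 f_add fin])
 thus ?thesis by (rule vcyc_of_fin_index[OF grp idx])
qed

end

lemma two_ended_vcyc:
 assumes G: "group G" and K: "subgroup K G" and two: "two_ended (G\<lparr>carrier := K\<rparr>)"
 shows "vcyc G K"
proof -
 interpret K: group "G\<lparr>carrier := K\<rparr>" by (rule group.subgroup_imp_group[OF G K])
 obtain S where "finite S" "S\<subseteq>carrier (G\<lparr>carrier := K\<rparr>)"
  "generate (G\<lparr>carrier := K\<rparr>) S = carrier (G\<lparr>carrier := K\<rparr>)"
  "num_ends (carrier (G\<lparr>carrier := K\<rparr>)) (cayley (G\<lparr>carrier := K\<rparr>) S) = 2"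
  using two unfolding two_ended_def by blast
 hence "vcyc (G\<lparr>carrier := K\<rparr>) (carrier (G\<lparr>carrier := K\<rparr>))"
  using two_ends_vcyc[OF K.is_group] by blast
 hence "virtually cyclic_group (G\<lparr>carrier := K\<rparr>)"
  using vcyc_iff[OF K.is_group K.subgroup_self] by simp
 thus ?thesis using vcyc_iff[OF G K] by simp
qed

section \<open>Abelian subgroups of free groups\<close>

fun inv_letter :: "'a\<times>bool => 'a\<times>bool" where
 "inv_letter (x, b) = (x, \<not> b)"

definition inv_word :: "('a\<times>bool) list => ('a\<times>bool) list" where
 "inv_word w = rev (map inv_letter w)"

abbreviation reduced :: "('a\<times>bool) list => bool" where
 "reduced \<equiv> successively (\<lambda>l m. m\<noteq>inv_letter l)"

lemma reduced_words_iff: "w\<in>reduced_words B\<longleftrightarrow>w\<in>lists (B\<times>UNIV)\<and>reduced w"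
proof -
 have "(\<lambda>(x, b) (y, c). \<not> (x = y\<and>b\<noteq>c)) = (\<lambda>l m :: 'a\<times>bool. m\<noteq>inv_letter l)"
  by (auto simp: fun_eq_iff)
 thus ?thesis unfolding reduced_words_def by simp
qed

lemma inv_letter_inv_letter [simp]: "inv_letter (inv_letter l) = l"
 by (cases l) simp

lemma inv_letter_neq [simp]: "inv_letter l\<noteq>l"
 by (cases l) simp

lemma not_successivelyD: "\<not> successively P w ==> \<exists>u l m v. w = u @ [l, m] @ v\<and>\<not> P l m"
proof (induction P w rule: successively.induct)
 case (3 P x y xs)
 show ?case
 proof (cases "P x y")
  case True
  then obtain u l m v where "y # xs = u @ [l, m] @ v" "\<not> P l m" using 3 by auto
  thus ?thesis by (intro exI[of _ "x # u"]) auto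
 next
  case False thus ?thesis by (intro exI[of _ "[]"]) auto
 qed
qed auto

lemma reduced_inv_word: "reduced w ==> reduced (inv_word w)"
proof -
 assume "reduced w"
 moreover have "inv_letter a\<noteq>inv_letter (inv_letter b)" if "b\<noteq>inv_letter a" for a b :: "'a\<times>bool"
  using that by simp
 ultimately show ?thesis unfolding inv_word_def
  by (auto simp: successively_map elim!: successively_mono)
qed

context
 fixes F :: "'a monoid" (structure) and B :: "'a set"
 assumes grp: "group F" and B: "B\<subseteq>carrier F"
  and bij: "bij_betw (word_val F) (reduced_words B) (carrier F)"
begin

interpretation group F by (rule grp)

abbreviation wv :: "('a\<times>bool) list => 'a" where "wv \<equiv> word_val F"
abbreviation words :: "('a\<times>bool) list set" where "words \<equiv> lists (B\<times>UNIV)"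

definition nf :: "'a => ('a\<times>bool) list" where
 "nf g = inv_into (reduced_words B) wv g"

lemma letter_val_carrier [simp]: "l\<in>B\<times>UNIV ==> letter_val F l\<in>carrier F"
 using B by (cases l) auto

lemma wv_simps [simp]: "wv [] = \<one>" "wv (l # w) = letter_val F l\<otimes>wv w"
 unfolding word_val_def by simp_all

lemma wv_carrier [simp]: "w\<in>words ==> wv w\<in>carrier F"
 by (induction w) auto

lemma wv_append: "u\<in>words ==> w\<in>words ==> wv (u @ w) = wv u\<otimes>wv w"
 by (induction u) (auto simp: m_assoc)

lemma inv_letter_words: "l\<in>B\<times>UNIV ==> inv_letter l\<in>B\<times>UNIV"
 by (cases l) auto

lemma letter_val_inv: "l\<in>B\<times>UNIV ==> letter_val F (inv_letter l) = inv (letter_val F l)"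
 using B by (cases l) auto

lemma inv_word_words: "w\<in>words ==> inv_word w\<in>words"
 unfolding inv_word_def using inv_letter_words by (auto simp: in_lists_conv_set)

lemma wv_inv_word: "w\<in>words ==> wv (inv_word w) = inv (wv w)"
proof (induction w)
 case (Cons l w)
 hence w: "w\<in>words" "l\<in>B\<times>UNIV" by auto
 have "wv (inv_word (l # w)) = wv (inv_word w @ [inv_letter l])" unfolding inv_word_def by simp
 also have "\<dots> = inv (wv w)\<otimes>inv (letter_val F l)"
  using w inv_word_words[OF w(1)] inv_letter_words[OF w(2)] Cons.IH letter_val_inv[OF w(2)]
  by (subst wv_append) auto
 finally show ?case using w by (simp add: inv_mult_group)
qed (simp add: inv_word_def)

lemma nf: "g\<in>carrier F ==> nf g\<in>words\<and>reduced (nf g)\<and>wv (nf g) = g"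
 unfolding nf_def using bij inv_into_into[of g wv "reduced_words B"] f_inv_into_f[of g wv "reduced_words B"]
 by (auto simp: bij_betw_def reduced_words_iff)

lemma nf_wv: "w\<in>words ==> reduced w ==> nf (wv w) = w"
 unfolding nf_def using bij by (auto simp: bij_betw_def reduced_words_iff)

text \<open>Deleting a cancelling pair keeps the value and shortens the word.\<close>

lemma reduce_word:
 "w\<in>words ==> length (nf (wv w)) \<le> length w\<and>(\<not> reduced w \<longrightarrow> length (nf (wv w)) < length w)"
proof (induction "length w" arbitrary: w rule: less_induct)
 case less
 show ?case
 proof (cases "reduced w")
  case True thus ?thesis using nf_wv less by simp
 next
  case False
  then obtain u l v where w: "w = u @ [l, inv_letter l] @ v" using not_successivelyD by blast
  have uv: "u\<in>words" "v\<in>words" "l\<in>B\<times>UNIV" using less w by auto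
  have l2: "[l, inv_letter l]\<in>words" using uv inv_letter_words by simp
  have "wv [l, inv_letter l] = \<one>" using uv letter_val_inv by simp
  hence "wv w = wv (u @ v)" using uv l2 unfolding w by (simp only: wv_append append_in_lists_conv) simp
  moreover have "length (nf (wv (u @ v))) \<le> length (u @ v)" using less(1)[of "u @ v"] w uv by simp
  ultimately show ?thesis using w by simp
 qed
qed

text \<open>If \<open>w @ \<alpha>\<close> were not reduced, its normal form would be shorter than
  the reduced word \<open>\<alpha> @ w\<close> of the same value. So the two words agree letter by
  letter, and \<open>min\<close> excludes that \<open>w\<close> begins with all of
  \<open>\<alpha>\<close>.\<close>

lemma commuting_prefix:
 assumes a: "\<alpha>\<in>words" "reduced \<alpha>" "\<alpha>\<noteq>[]" and w: "w\<in>words" "reduced w" and aw: "reduced (\<alpha> @ w)"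
  and comm: "wv \<alpha>\<otimes>wv w = wv w\<otimes>wv \<alpha>"
  and min: "length w \<le> length (nf (inv (wv \<alpha>)\<otimes>wv w))"
 shows "w = take (length w) \<alpha>"
proof -
 have "nf (wv (\<alpha> @ w)) = \<alpha> @ w" using nf_wv a w aw by simp
 moreover have eq: "wv (w @ \<alpha>) = wv (\<alpha> @ w)" using a w comm by (simp add: wv_append)
 ultimately have "reduced (w @ \<alpha>)" using reduce_word[of "w @ \<alpha>"] a w by auto
 hence "w @ \<alpha> = \<alpha> @ w" using eq nf_wv a w aw by (metis append_in_lists_conv)
 moreover have "length w < length \<alpha>"
 proof (rule ccontr)
  assume "\<not> length w < length \<alpha>"
  then obtain u where u: "w = \<alpha> @ u" using \<open>w @ \<alpha> = \<alpha> @ w\<close>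
   by (metis append_eq_append_conv_if append_take_drop_id linorder_not_less)
  have "u\<in>words" using w u by simp
  hence "inv (wv \<alpha>)\<otimes>wv w = wv u" using a u by (simp add: wv_append inv_cancel[OF grp])
  hence "length w \<le> length u" using min reduce_word[OF \<open>u\<in>words\<close>] by simp
  thus False using u a by simp
 qed
 ultimately show ?thesis by (metis append_eq_append_conv_if order_less_imp_le)
qed

lemma reduced_append: "reduced (u @ v)\<longleftrightarrow>reduced u\<and>reduced v\<and>(u = [] \<or> v = [] \<or> hd v\<noteq>inv_letter (last u))"
 by (simp add: successively_append_iff)

text \<open>Take a shortest element \<open>c\<close> among the products of powers of
  \<open>a\<close> with \<open>b\<close>. Its first letter cannot cancel against the last letter of
  \<open>nf a\<close> and against that of the inverse word, as \<open>nf a\<close> is cyclically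
  reduced. So \<open>c\<close> is a prefix of one of these two words.\<close>

lemma centralizer_cyclically_reduced:
 assumes a: "a\<in>carrier F" "a\<noteq>\<one>" and cyc: "reduced (nf a @ nf a)"
  and b: "b\<in>carrier F" "a\<otimes>b = b\<otimes>a"
 shows "\<exists>n::int. \<exists>c\<in>(\<lambda>k. wv (take k (nf a))) ` {..length (nf a)} \<union>
  (\<lambda>k. wv (take k (inv_word (nf a)))) ` {..length (nf a)}. b = a [^] n\<otimes>c"
proof -
 \<comment> \<open>Minimality over all integer exponents compares \<open>c\<close> with
   \<open>inv a \<otimes> c\<close> and with \<open>a \<otimes> c\<close>, as needed for the two
   words.\<close>
 define len where "len n = length (nf (a [^] (n::int)\<otimes>b))" for n
 obtain n where n: "\<And>m. len n \<le> len m" using ex_has_least_nat[of "\<lambda>_. True" 0 len] by auto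
 define c where "c = a [^] n\<otimes>b"
 have c: "c\<in>carrier F" unfolding c_def using a b by simp
 have cab: "a\<otimes>c = c\<otimes>a"
 proof -
  have "a\<otimes>a [^] n = a [^] n\<otimes>a" using a(1) int_pow_mult[OF a(1), of 1 n] int_pow_mult[OF a(1), of n 1]
   by (simp add: add.commute)
  thus ?thesis unfolding c_def using a b by (simp add: m_assoc[symmetric]) (simp add: m_assoc)
 qed
 have bc: "b = a [^] (- n)\<otimes>c" unfolding c_def using a b
  by (simp add: int_pow_neg inv_cancel[OF grp])
 let ?\<alpha> = "nf a" and ?\<beta> = "inv_word (nf a)" and ?w = "nf c"
 have al: "?\<alpha>\<in>words" "reduced ?\<alpha>" "wv ?\<alpha> = a" using nf a by auto
 have ne: "?\<alpha>\<noteq>[]" using al a by auto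
 have be: "?\<beta>\<in>words" "reduced ?\<beta>" "wv ?\<beta> = inv a" "?\<beta>\<noteq>[]"
  using al ne inv_word_words reduced_inv_word wv_inv_word by (auto simp: inv_word_def)
 have w: "?w\<in>words" "reduced ?w" "wv ?w = c" using nf c by auto
 have p1: "inv a\<otimes>c = a [^] (n - 1)\<otimes>b" "a\<otimes>c = a [^] (n + 1)\<otimes>b"
 proof -
  have "a [^] (n - 1) = a [^] (- 1 :: int)\<otimes>a [^] n" "a [^] (n + 1) = a [^] (1 :: int)\<otimes>a [^] n"
   using int_pow_mult[OF a(1), of "- 1" n] int_pow_mult[OF a(1), of 1 n] by (simp_all add: add.commute)
  thus "inv a\<otimes>c = a [^] (n - 1)\<otimes>b" "a\<otimes>c = a [^] (n + 1)\<otimes>b"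
   unfolding c_def using a b by (simp_all add: m_assoc int_pow_neg)
 qed
 have lw: "length ?w = len n" unfolding len_def c_def by simp
 have "?w = take (length ?w) ?\<alpha> \<or> ?w = take (length ?w) ?\<beta>"
 proof (cases "reduced (?\<alpha> @ ?w)")
  case True
  have "length ?w \<le> length (nf (inv (wv ?\<alpha>)\<otimes>wv ?w))"
   using n[of "n - 1"] lw unfolding al(3) w(3) p1 len_def by simp
  thus ?thesis using commuting_prefix[OF al(1,2) ne w(1,2) True] al w cab by simp
 next
  case False
  hence wne: "?w\<noteq>[]" and hw: "hd ?w = inv_letter (last ?\<alpha>)" using al w reduced_append by auto
  have "reduced (?\<beta> @ ?w)"
  proof (rule ccontr)
   assume "\<not> reduced (?\<beta> @ ?w)"
   hence "hd ?w = inv_letter (last ?\<beta>)" using be w reduced_append by auto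
   also have "last ?\<beta> = inv_letter (hd ?\<alpha>)" unfolding inv_word_def using ne by (simp add: last_rev hd_map)
   finally have "hd ?\<alpha> = inv_letter (last ?\<alpha>)" using hw by simp
   thus False using cyc ne unfolding reduced_append by blast
  qed
  moreover have "wv ?\<beta>\<otimes>wv ?w = wv ?w\<otimes>wv ?\<beta>"
  proof -
   have "inv a\<otimes>c = inv a\<otimes>(c\<otimes>a)\<otimes>inv a" using a c by (simp add: m_assoc)
   also have "\<dots> = c\<otimes>inv a" using a c unfolding cab[symmetric] by (simp add: inv_cancel[OF grp])
   finally show ?thesis unfolding be(3) w(3) .
  qed
  moreover have "length ?w \<le> length (nf (inv (wv ?\<beta>)\<otimes>wv ?w))"
   using n[of "n + 1"] lw a p1 unfolding be(3) w(3) len_def by simp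
  ultimately show ?thesis using commuting_prefix[OF be(1,2,4) w(1,2)] by simp
 qed
 moreover have "take k v = take (min k (length v)) v" for k and v :: "('a\<times>bool) list"
  by (simp add: min_def)
 moreover have "length ?\<beta> = length ?\<alpha>" unfolding inv_word_def by simp
 ultimately have "\<exists>k\<le>length ?\<alpha>. ?w = take k ?\<alpha> \<or> ?w = take k ?\<beta>"
  by (metis min.cobounded2)
 hence "c\<in>(\<lambda>k. wv (take k ?\<alpha>)) ` {..length ?\<alpha>}\<union>(\<lambda>k. wv (take k ?\<beta>)) ` {..length ?\<alpha>}"
  using w(3) by force
 thus ?thesis using bc by blast
qed

text \<open>Among the conjugates of a nontrivial element of \<open>E\<close> a shortest one is
  cyclically reduced, since otherwise conjugation by its first letter shortens it. The conjugate of
  \<open>E\<close> lies in its centralizer, which is covered by finitely many cosets of its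
  powers.\<close>

lemma free_abelian_vcyc_aux:
 assumes E: "subgroup E F" and comm: "\<And>x y. x\<in>E ==> y\<in>E ==> x\<otimes>y = y\<otimes>x"
 shows "vcyc F E"
proof (cases "E = {\<one>}")
 case True thus ?thesis using vcyc_finite[OF grp E] by simp
next
 case False
 then obtain a0 where a0: "a0\<in>E" "a0\<noteq>\<one>" using E subgroup.one_closed by blast
 have a0F: "a0\<in>carrier F" using a0 E subgroup.mem_carrier by fast
 obtain g where g: "g\<in>carrier F" and
  min: "\<And>h. h\<in>carrier F ==> length (nf (g\<otimes>a0\<otimes>inv g)) \<le> length (nf (h\<otimes>a0\<otimes>inv h))"
  using ex_has_least_nat[of "\<lambda>h. h\<in>carrier F" \<one> "\<lambda>h. length (nf (h\<otimes>a0\<otimes>inv h))"] by auto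
 define a where "a = g\<otimes>a0\<otimes>inv g"
 have a: "a\<in>carrier F" "a\<in>conj_set F g E" unfolding a_def conj_set_def using g a0 a0F by auto
 have "a\<noteq>\<one>"
 proof
  assume "a = \<one>"
  hence "inv g\<otimes>a\<otimes>g = \<one>" using g by simp
  thus False unfolding a_def using g a0 a0F by (simp add: m_assoc inv_cancel[OF grp])
 qed
 have al: "nf a\<in>words" "reduced (nf a)" "wv (nf a) = a" using nf a by auto
 have cyc: "reduced (nf a @ nf a)"
 proof (rule ccontr)
  assume "\<not> reduced (nf a @ nf a)"
  hence ne: "nf a\<noteq>[]" and hl: "hd (nf a) = inv_letter (last (nf a))" using al reduced_append by auto
  define l where "l = hd (nf a)"
  obtain v where v: "nf a = l # v" unfolding l_def using ne by (metis list.collapse)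
  have "v\<noteq>[]" using hl v by (metis inv_letter_neq last.simps list.sel(1))
  then obtain u where u: "v = u @ [inv_letter l]"
   using hl v by (metis append_butlast_last_id inv_letter_inv_letter last.simps list.sel(1))
  have w: "l\<in>B\<times>UNIV" "u\<in>words" using al(1) v u by auto
  let ?x = "letter_val F l"
  have x: "?x\<in>carrier F" using w by simp
  have uF: "wv u\<in>carrier F" using w by simp
  have "a = ?x\<otimes>(wv u\<otimes>inv ?x)" using al(3) v u w inv_letter_words[OF w(1)]
   by (simp add: wv_append letter_val_inv)
  hence "wv u = inv ?x\<otimes>a\<otimes>?x" using x uF by (simp add: m_assoc inv_cancel[OF grp])
  also have "\<dots> = (inv ?x\<otimes>g)\<otimes>a0\<otimes>inv (inv ?x\<otimes>g)"
   unfolding a_def using x g a0F by (simp add: m_assoc inv_mult_group)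
  finally have "length (nf a) \<le> length (nf (wv u))" using min[of "inv ?x\<otimes>g"] x g unfolding a_def by simp
  thus False using reduce_word[OF w(2)] v u by simp
 qed
 let ?E = "conj_set F g E"
 have E': "subgroup ?E F" by (rule conj_set_subgroup[OF grp g E])
 have EF: "E\<subseteq>carrier F" using E subgroup.subset by blast
 define C where "C = (\<lambda>k. wv (take k (nf a))) ` {..length (nf a)} \<union>
  (\<lambda>k. wv (take k (inv_word (nf a)))) ` {..length (nf a)}"
 have CF: "C\<subseteq>carrier F" unfolding C_def using al inv_word_words[OF al(1)]
  by (auto intro!: wv_carrier simp: in_lists_conv_set dest: in_set_takeD)
 have "\<exists>n::int. \<exists>c\<in>C\<inter>?E. b = a [^] n\<otimes>c" if b: "b\<in>?E" for b
 proof -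
  have bF: "b\<in>carrier F" using b E' subgroup.mem_carrier by fast
  obtain b0 where b0: "b0\<in>E" "b = g\<otimes>b0\<otimes>inv g" using b unfolding conj_set_def by blast
  have "b0\<in>carrier F" using b0 EF by blast
  hence "a\<otimes>b = g\<otimes>(a0\<otimes>b0)\<otimes>inv g" "b\<otimes>a = g\<otimes>(b0\<otimes>a0)\<otimes>inv g"
   unfolding a_def b0(2) using g a0F by (simp_all add: m_assoc inv_cancel[OF grp])
  hence "a\<otimes>b = b\<otimes>a" using comm[OF a0(1) b0(1)] by simp
  from centralizer_cyclically_reduced[OF a(1) \<open>a\<noteq>\<one>\<close> cyc bF this]
  obtain n :: int and c where c: "c\<in>C" "b = a [^] n\<otimes>c" unfolding C_def by blast
  have "c = inv (a [^] n)\<otimes>b" using c CF a by (auto simp: inv_cancel[OF grp])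
  hence "c\<in>?E" using E' b int_pow_mem[OF grp E' a(2)]
   by (simp add: subgroup.m_closed subgroup.m_inv_closed)
  thus ?thesis using c by blast
 qed
 moreover have "finite (C\<inter>?E)" unfolding C_def by blast
 ultimately have "vcyc F ?E" unfolding vcyc_def using a by (meson Int_lower2)
 hence "vcyc F (conj_set F (inv g) ?E)" by (rule vcyc_conj[OF grp inv_closed[OF g] E'])
 thus ?thesis using conj_set_inv[OF grp g EF] by simp
qed

end

lemma vcyc_carrier_update:
 assumes "group G" "subgroup L G" "subgroup E G" "E\<subseteq>L"
 shows "vcyc (G\<lparr>carrier := L\<rparr>) E\<longleftrightarrow>vcyc G E"
proof -
 have "group (G\<lparr>carrier := L\<rparr>)" "subgroup E (G\<lparr>carrier := L\<rparr>)"
  using assms group.subgroup_imp_group group.subgroup_incl by blast+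
 from vcyc_iff[OF this] vcyc_iff[OF assms(1,3)] show ?thesis by simp
qed

lemma free_abelian_vcyc:
 assumes G: "group G" and L: "subgroup L G" "free_group (G\<lparr>carrier := L\<rparr>)"
  and E: "subgroup E G" "E\<subseteq>L" "\<And>x y. x\<in>E ==> y\<in>E ==> x \<otimes>\<^bsub>G\<^esub> y = y \<otimes>\<^bsub>G\<^esub> x"
 shows "vcyc G E"
proof -
 have "subgroup E (G\<lparr>carrier := L\<rparr>)" using G L E group.subgroup_incl by blast
 moreover obtain B where "B\<subseteq>carrier (G\<lparr>carrier := L\<rparr>)"
  "bij_betw (word_val (G\<lparr>carrier := L\<rparr>)) (reduced_words B) (carrier (G\<lparr>carrier := L\<rparr>))"
  and "group (G\<lparr>carrier := L\<rparr>)" using L(2) unfolding free_group_def by blast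
 ultimately have "vcyc (G\<lparr>carrier := L\<rparr>) E" using free_abelian_vcyc_aux[of "G\<lparr>carrier := L\<rparr>" B E] E(3) by simp
 thus ?thesis using vcyc_carrier_update[OF G L(1) E(1,2)] by simp
qed

section \<open>Abelian subgroups of Fuchsian groups\<close>

lemma mat2_eq_iff: "(M :: real^2^2) = N \<longleftrightarrow>
  M$1$1 = N$1$1\<and>M$1$2 = N$1$2\<and>M$2$1 = N$2$1\<and>M$2$2 = N$2$2"
 by (auto simp: vec_eq_iff forall_2)

lemma mat2_mult [simp]: "((M :: real^2^2) ** N) $ i $ j = M$i$1 * N$1$j + M$i$2 * N$2$j"
 by (simp add: matrix_matrix_mult_def sum_2)

lemma mat2_one [simp]: "(mat 1 :: real^2^2)$1$1 = 1" "(mat 1 :: real^2^2)$1$2 = 0"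
  "(mat 1 :: real^2^2)$2$1 = 0" "(mat 1 :: real^2^2)$2$2 = 1"
 by (simp_all add: mat_def)

lemma mat2_norm_le: "norm (M :: real^2^2) \<le> \<bar>M$1$1\<bar> + \<bar>M$1$2\<bar> + \<bar>M$2$1\<bar> + \<bar>M$2$2\<bar>"
proof -
 have "norm M \<le> norm (M$1) + norm (M$2)" using norm_le_l1_cart[of "\<chi> i. norm (M$i)"]
  by (simp add: norm_vec_def L2_set_def sum_2)
 also have "norm (M$1) \<le> \<bar>M$1$1\<bar> + \<bar>M$1$2\<bar>" using norm_le_l1_cart[of "M$1"] by (simp add: sum_2)
 also have "norm (M$2) \<le> \<bar>M$2$1\<bar> + \<bar>M$2$2\<bar>" using norm_le_l1_cart[of "M$2"] by (simp add: sum_2)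
 finally show ?thesis by simp
qed

lemma mat2_entry_le: "\<bar>(M :: real^2^2)$i$j\<bar> \<le> norm M"
 using component_le_norm_cart[of "M$i" j] Finite_Cartesian_Product.norm_nth_le[of M i] by linarith

lemma mat2_scale [simp]: "(M :: real^2^2) ** (s *\<^sub>R (N :: real^2^2)) = s *\<^sub>R (M ** N)"
  "(s *\<^sub>R (M :: real^2^2)) ** (N :: real^2^2) = s *\<^sub>R (M ** N)"
 unfolding mat2_eq_iff by (auto simp: algebra_simps)

lemma mat2_cancel:
 assumes "det (M :: real^2^2) = 1" "M ** N = M ** P" shows "N = P"
proof -
 obtain K where "K ** M = mat 1" using assms(1) invertible_det_nz[of M] unfolding invertible_def by auto
 thus ?thesis using assms(2) by (metis matrix_mul_assoc matrix_mul_lid)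
qed

lemma mat2_cayley_hamilton:
 assumes "det (A :: real^2^2) = 1"
 shows "A ** A = (A$1$1 + A$2$2) *\<^sub>R A - mat 1"
 using assms unfolding det_2 mat2_eq_iff by (simp add: algebra_simps)

text \<open>Commuting means that the off-diagonal entries and the difference of the diagonal entries
  of \<open>M\<close> are proportional to those of \<open>A\<close>; the factor is read off where
  \<open>A\<close> does not vanish.\<close>

lemma mat2_commuting:
 fixes A M :: "real^2^2"
 assumes "A ** M = M ** A" and "\<not> (A$1$2 = 0\<and>A$2$1 = 0\<and>A$1$1 = A$2$2)"
 shows "\<exists>u v. M = u *\<^sub>R mat 1 + v *\<^sub>R A"
proof -
 let ?b = "A$1$2" and ?c = "A$2$1" and ?e = "A$1$1 - A$2$2"
 let ?q = "M$1$2" and ?r = "M$2$1" and ?f = "M$1$1 - M$2$2"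
 have eqs: "?b * ?r = ?q * ?c" "?e * ?q = ?f * ?b" "?e * ?r = ?f * ?c"
 proof -
  have "A$1$1 * M$1$1 + A$1$2 * M$2$1 = M$1$1 * A$1$1 + M$1$2 * A$2$1"
   "A$1$1 * M$1$2 + A$1$2 * M$2$2 = M$1$1 * A$1$2 + M$1$2 * A$2$2"
   "A$2$1 * M$1$1 + A$2$2 * M$2$1 = M$2$1 * A$1$1 + M$2$2 * A$2$1"
   using assms(1) unfolding mat2_eq_iff mat2_mult by blast+
  thus "?b * ?r = ?q * ?c" "?e * ?q = ?f * ?b" "?e * ?r = ?f * ?c"
   unfolding left_diff_distrib by (simp_all add: mult.commute)
 qed
 obtain v where v: "?q = v * ?b" "?r = v * ?c" "?f = v * ?e"
 proof (cases "?b = 0")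
  case False
  have "?q = (?q / ?b) * ?b" "?r = (?q / ?b) * ?c" "?f = (?q / ?b) * ?e"
   using False eqs by (simp_all add: field_simps)
  thus ?thesis using that by blast
 next
  case b: True
  show ?thesis
  proof (cases "?c = 0")
   case False
   have "?q = (?r / ?c) * ?b" "?r = (?r / ?c) * ?c" "?f = (?r / ?c) * ?e"
    using False b eqs by (simp_all add: field_simps)
   thus ?thesis using that by blast
  next
   case c: True
   hence e: "?e\<noteq>0" using assms(2) b by auto
   have "?q = (?f / ?e) * ?b" "?r = (?f / ?e) * ?c" "?f = (?f / ?e) * ?e"
    using e b c eqs by (simp_all add: field_simps)
   thus ?thesis using that by blast
  qed
 qed
 have "M = (M$1$1 - v * A$1$1) *\<^sub>R mat 1 + v *\<^sub>R A"
  using v unfolding mat2_eq_iff by (simp add: algebra_simps)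
 thus ?thesis by blast
qed

section \<open>Abelian groups of matrices up to sign, discrete at the identity\<close>

context
 fixes G :: "'a monoid" (structure) and E :: "'a set" and m :: "'a => real^2^2" and e0 :: real
 assumes grp: "group G" and E: "subgroup E G" and comm: "\<And>x y. x\<in>E ==> y\<in>E ==> x\<otimes>y = y\<otimes>x"
  and det1: "\<And>x. x\<in>E ==> det (m x) = 1"
  and mult: "\<And>x y. x\<in>E ==> y\<in>E ==> m (x\<otimes>y) = m x ** m y \<or> m (x\<otimes>y) = - (m x ** m y)"
  and inj: "\<And>x y. x\<in>E ==> y\<in>E ==> m x = m y \<or> m x = - m y ==> x = y"
  and e0: "e0 > 0" "\<And>x. x\<in>E ==> x\<noteq>\<one> ==> norm (m x - mat 1) \<ge> e0\<and>norm (- m x - mat 1) \<ge> e0"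
begin

interpretation group G by (rule grp)

text \<open>Infinitely many lifts in a ball accumulate, so the lifts of two distinct elements
  \<open>x\<close> and \<open>y\<close> are as close as desired. The lift of
  \<open>inv x \<otimes> y\<close> is then close to plus or minus the identity, against
  discreteness.\<close>

lemma bounded_part_finite: "finite {x\<in>E. norm (m x) \<le> R}"
proof (rule ccontr)
 let ?T = "{x\<in>E. norm (m x) \<le> R}"
 assume inf: "infinite ?T"
 have "inj_on m ?T" using inj by (auto simp: inj_on_def)
 hence "infinite (m ` ?T)" using inf finite_imageD by blast
 moreover have "m ` ?T\<subseteq>cball 0 R" by auto
 ultimately obtain L where L: "L islimpt (m ` ?T)"
  using Heine_Borel_imp_Bolzano_Weierstrass[of "cball 0 R" "m ` ?T"] compact_cball by blast
 \<comment> \<open>The entries of \<open>D\<close> below are at most \<open>2 * e\<close>, those of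
   \<open>?W\<close> at most \<open>4 * \<bar>R\<bar> * e\<close>, and four of them give the norm
   bound \<open>16 * \<bar>R\<bar> * e\<close>, which is less than \<open>e0\<close>.\<close>
 define e where "e = e0 / (16 * (\<bar>R\<bar> + 1))"
 have e: "e > 0" unfolding e_def using e0 by simp
 obtain x where x: "x\<in>?T" "m x\<noteq>L" "dist (m x) L < e" using L e unfolding islimpt_approachable by blast
 \<comment> \<open>Being strictly closer to \<open>L\<close> makes \<open>m y\<close> different from
   \<open>m x\<close>.\<close>
 obtain y where y: "y\<in>?T" "m y\<noteq>L" "dist (m y) L < dist (m x) L" using L x unfolding islimpt_approachable
  by (metis (no_types, lifting) imageE zero_less_dist_iff)
 have "x\<noteq>y" using y by auto
 have xyE: "x\<in>E" "y\<in>E" and xyG: "x\<in>carrier G" "y\<in>carrier G" using x y subgroup.mem_carrier[OF E] by auto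
 define z where "z = inv x\<otimes>y"
 have z: "z\<in>E" unfolding z_def using xyE E by (simp add: subgroup.m_closed subgroup.m_inv_closed)
 have "z\<noteq>\<one>"
 proof
  assume "z = \<one>"
  hence "x\<otimes>z = x" using xyG by simp
  thus False using \<open>x\<noteq>y\<close> xyG unfolding z_def by (simp add: inv_cancel[OF grp])
 qed
 have xz: "x\<otimes>z = y" unfolding z_def using xyG by (simp add: inv_cancel[OF grp])
 obtain s :: real where s: "s = 1 \<or> s = - 1" "m x ** (s *\<^sub>R m z) = m y"
 proof -
  from mult[OF xyE(1) z] xz consider "m y = m x ** m z" | "m y = - (m x ** m z)" by auto
  thus ?thesis
  proof cases
   case 1 thus ?thesis using that[of 1] by simp
  next
   case 2
   have "m x ** ((-1) *\<^sub>R m z) = m y" unfolding 2 mat2_eq_iff by simp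
   thus ?thesis using that[of "-1"] by blast
  qed
 qed
 define Z where "Z = s *\<^sub>R m z"
 define D where "D = m y - m x"
 have nD: "\<bar>D$i$j\<bar> \<le> 2 * e" for i j
 proof -
  have "norm D \<le> dist (m y) L + dist (m x) L" unfolding D_def by (metis dist_norm dist_triangle2)
  thus ?thesis using mat2_entry_le[of D i j] x(3) y(3) by linarith
 qed
 have nx: "\<bar>(m x)$i$j\<bar> \<le> R" for i j using mat2_entry_le[of "m x" i j] x(1) by simp
 have dx: "(m x)$1$1 * (m x)$2$2 - (m x)$1$2 * (m x)$2$1 = 1" using det1[OF xyE(1)] by (simp add: det_2)
 have XD: "m x ** (Z - mat 1) = D"
 proof -
  have "m x ** (Z - mat 1) = m x ** Z - m x" unfolding mat2_eq_iff by (simp add: algebra_simps)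
  thus ?thesis using s(2) unfolding D_def Z_def by simp
 qed
 let ?W = "Z - mat 1"
 \<comment> \<open>Cramer's rule for \<open>XD\<close>, with determinant 1.\<close>
 have cramer: "?W$1$j = (m x)$2$2 * D$1$j - (m x)$1$2 * D$2$j"
  "?W$2$j = (m x)$1$1 * D$2$j - (m x)$2$1 * D$1$j" for j
 proof -
  have d: "D$1$j = (m x)$1$1 * ?W$1$j + (m x)$1$2 * ?W$2$j" "D$2$j = (m x)$2$1 * ?W$1$j + (m x)$2$2 * ?W$2$j"
   using XD by auto
  have "(m x)$2$2 * D$1$j - (m x)$1$2 * D$2$j = ((m x)$1$1 * (m x)$2$2 - (m x)$1$2 * (m x)$2$1) * ?W$1$j"
   "(m x)$1$1 * D$2$j - (m x)$2$1 * D$1$j = ((m x)$1$1 * (m x)$2$2 - (m x)$1$2 * (m x)$2$1) * ?W$2$j"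
   unfolding d by (simp_all add: algebra_simps)
  thus "?W$1$j = (m x)$2$2 * D$1$j - (m x)$1$2 * D$2$j" "?W$2$j = (m x)$1$1 * D$2$j - (m x)$2$1 * D$1$j"
   unfolding dx by simp_all
 qed
 have prod_le: "\<bar>(m x)$i$k * D$k'$j\<bar> \<le> \<bar>R\<bar> * (2 * e)" for i k k' j
  unfolding abs_mult using nx[of i k] nD[of k' j] by (intro mult_mono) auto
 have "\<bar>?W$i$j\<bar> \<le> 2 * (\<bar>R\<bar> * (2 * e))" for i j
 proof -
  have "i = 1 \<or> i = 2" using exhaust_2 by blast
  thus ?thesis
  proof
   assume "i = 1"
   show ?thesis unfolding \<open>i = 1\<close> using cramer(1)[of j] prod_le[of 2 2 1 j] prod_le[of 1 2 2 j] by linarith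
  next
   assume "i = 2"
   show ?thesis unfolding \<open>i = 2\<close> using cramer(2)[of j] prod_le[of 1 1 2 j] prod_le[of 2 1 1 j] by linarith
  qed
 qed
 from this[of 1 1] this[of 1 2] this[of 2 1] this[of 2 2]
 have "norm ?W \<le> 16 * \<bar>R\<bar> * e" using mat2_norm_le[of ?W] by linarith
 also have "\<dots> < e0"
 proof -
  have "16 * \<bar>R\<bar> * e = e0 * (\<bar>R\<bar> / (\<bar>R\<bar> + 1))" unfolding e_def by (simp add: field_simps)
  also have "\<dots> < e0 * 1" by (rule mult_strict_left_mono) (use e0 in auto)
  finally show ?thesis by simp
 qed
 finally have "norm (s *\<^sub>R m z - mat 1) < e0" unfolding Z_def .
 thus False using e0(2)[OF z \<open>z\<noteq>\<one>\<close>] s(1) by auto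
qed

text \<open>Fix a nontrivial \<open>a\<close> with lift \<open>A\<close>. The lifts of elements of
  \<open>E\<close> commute with \<open>A\<close> up to sign, and those that commute form a subgroup
  \<open>E1\<close> of index at most two. There a lift is a combination \<open>u + v A\<close> with
  determinant \<open>u^2 + t u v + v^2 = 1\<close>, where \<open>t\<close> is the trace of
  \<open>A\<close>. The sign of \<open>t^2 - 4\<close> decides whether this conic is an ellipse, a
  pair of lines or a hyperbola.\<close>

lemma psl2_abelian_vcyc: "vcyc G E"
proof (cases "E = {\<one>}")
 case True thus ?thesis using vcyc_finite[OF grp E] by simp
next
 case False
 have m_one: "m \<one> = mat 1 \<or> m \<one> = - mat 1"
 proof -
  have 1: "\<one>\<in>E" using E subgroup.one_closed by blast
  from mult[OF 1 1] have "m \<one> ** m \<one> = m \<one> ** mat 1 \<or> m \<one> ** m \<one> = m \<one> ** (- mat 1)"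
   by (auto simp: mat2_eq_iff)
  thus ?thesis using mat2_cancel[OF det1[OF 1]] by blast
 qed
 obtain a where a: "a\<in>E" "a\<noteq>\<one>" using False E subgroup.one_closed by blast
 define A where "A = m a"
 have dA: "A$1$1 * A$2$2 - A$1$2 * A$2$1 = 1" using det1[OF a(1)] unfolding A_def by (simp add: det_2)
 have nonscalar: "\<not> (A$1$2 = 0\<and>A$2$1 = 0\<and>A$1$1 = A$2$2)"
 proof
  assume s: "A$1$2 = 0\<and>A$2$1 = 0\<and>A$1$1 = A$2$2"
  hence "(A$1$1)\<^sup>2 = 1" using dA by (simp add: power2_eq_square)
  hence "A$1$1 = 1 \<or> A$1$1 = - 1" by (simp add: power2_eq_1_iff)
  hence "A = mat 1 \<or> A = - mat 1" using s unfolding mat2_eq_iff by auto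
  hence "m a = m \<one> \<or> m a = - m \<one>" using m_one unfolding A_def by auto
  hence "a = \<one>" using inj[OF a(1)] E subgroup.one_closed by blast
  thus False using a by simp
 qed
 define E1 where "E1 = {x\<in>E. A ** m x = m x ** A}"
 have neg_mult: "A ** (- M) = - (A ** M)" "(- M) ** A = - (M ** A)" for M :: "real^2^2"
  unfolding mat2_eq_iff by simp_all
 have anti: "A ** m x = m x ** A \<or> A ** m x = - (m x ** A)" if "x\<in>E" for x
  using mult[OF a(1) that] mult[OF that a(1)] comm[OF a(1) that] unfolding A_def
  by (metis minus_minus)
 \<comment> \<open>Treats commuting (\<open>c = 1\<close>) and anticommuting
   (\<open>c = - 1\<close>) lifts at once; \<open>s\<close> is the sign by which the lifts of
   \<open>x\<close> and \<open>inv x\<close> fail to be inverse.\<close>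
 have minv: "A ** m (inv x) = c *\<^sub>R (m (inv x) ** A)" if x: "x\<in>E" "A ** m x = c *\<^sub>R (m x ** A)" "c * c = 1" for x c
 proof -
  have ix: "inv x\<in>E" using x E subgroup.m_inv_closed by fast
  have xG: "x\<in>carrier G" using x E subgroup.mem_carrier by fast
  obtain s :: real where s: "s * s = 1" "m x ** m (inv x) = s *\<^sub>R mat 1" "m (inv x) ** m x = s *\<^sub>R mat 1"
  proof -
   define M N where "M = m x" and "N = m (inv x)"
   have "M ** N = mat 1 \<or> M ** N = - mat 1"
    using mult[OF x(1) ix] m_one xG unfolding M_def N_def by simp (metis minus_minus)
   then obtain s :: real where s: "s * s = 1" "M ** N = s *\<^sub>R mat 1"
   proof
    assume "M ** N = mat 1" thus ?thesis using that[of 1] by simp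
   next
    assume "M ** N = - mat 1" thus ?thesis using that[of "- 1"] by simp
   qed
   have "M ** (s *\<^sub>R N) = mat 1" using s by simp
   hence "(s *\<^sub>R N) ** M = mat 1" using matrix_left_right_inverse by blast
   hence "s *\<^sub>R (N ** M) = mat 1" by simp
   hence "(s * s) *\<^sub>R (N ** M) = s *\<^sub>R mat 1" by (metis scaleR_scaleR)
   hence "N ** M = s *\<^sub>R mat 1" using s by simp
   thus ?thesis using that s unfolding M_def N_def by blast
  qed
  let ?M = "m x" and ?N = "m (inv x)"
  have "?N ** (A ** ?M) ** ?N = ?N ** (c *\<^sub>R (?M ** A)) ** ?N" using x(2) by simp
  hence "(?N ** A) ** (?M ** ?N) = c *\<^sub>R ((?N ** ?M) ** (A ** ?N))"
   by (simp add: matrix_mul_assoc)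
  hence "s *\<^sub>R (?N ** A) = (c * s) *\<^sub>R (A ** ?N)" unfolding s(2,3) by simp
  hence "(c * s) *\<^sub>R (s *\<^sub>R (?N ** A)) = (c * s) *\<^sub>R ((c * s) *\<^sub>R (A ** ?N))" by simp
  moreover have "(c * s) * s = c" using s(1) by (simp add: mult.assoc)
  moreover have "(c * s) * (c * s) = (c * c) * (s * s)" by (simp only: ac_simps)
  hence "(c * s) * (c * s) = 1" using s(1) x(3) by simp
  ultimately show ?thesis by (simp only: scaleR_scaleR scaleR_one)
 qed
 have E1: "subgroup E1 G"
 proof (rule subgroupI)
  show "E1\<subseteq>carrier G" unfolding E1_def using subgroup.subset[OF E] by blast
  have "\<one>\<in>E1" unfolding E1_def using m_one E subgroup.one_closed by (auto simp: neg_mult)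
  thus "E1\<noteq>{}" by blast
  show "inv x\<in>E1" if "x\<in>E1" for x
   using minv[of x 1] that subgroup.m_inv_closed[OF E] unfolding E1_def by simp
  show "x\<otimes>y\<in>E1" if "x\<in>E1" "y\<in>E1" for x y
  proof -
   have "A ** (m x ** m y) = (m x ** m y) ** A" using that unfolding E1_def
    by simp (metis matrix_mul_assoc)
   thus ?thesis using mult[of x y] that subgroup.m_closed[OF E] unfolding E1_def by (auto simp: neg_mult)
  qed
 qed
 have idx: "fin_index G E1 E"
 proof (rule fin_index_two[OF grp E1 E])
  show "E1\<subseteq>E" unfolding E1_def by blast
  fix x y assume xy: "x\<in>E" "y\<in>E" "x\<notin>E1" "y\<notin>E1"
  have ax: "A ** m x = - (m x ** A)" "A ** m y = - (m y ** A)" using anti xy unfolding E1_def by auto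
  have iy: "inv y\<in>E" using xy E subgroup.m_inv_closed by fast
  have ay: "A ** m (inv y) = - (m (inv y) ** A)" using minv[of y "- 1"] ax xy by simp
  have "A ** (m x ** m (inv y)) = - (m x ** A) ** m (inv y)" using ax(1) by (simp add: matrix_mul_assoc)
  also have "\<dots> = - (m x ** (A ** m (inv y)))" by (simp add: mat2_eq_iff algebra_simps)
  also have "\<dots> = m x ** m (inv y) ** A" unfolding ay by (simp add: mat2_eq_iff algebra_simps)
  finally show "x\<otimes>inv y\<in>E1"
   using mult[OF xy(1) iy] xy iy subgroup.m_closed[OF E] unfolding E1_def by (auto simp: neg_mult)
 qed
 define t where "t = A$1$1 + A$2$2"
 have "\<forall>x\<in>E1. \<exists>u v. m x = u *\<^sub>R mat 1 + v *\<^sub>R A"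
  using mat2_commuting[OF _ nonscalar] unfolding E1_def by blast
 then obtain u v where uv: "\<And>x. x\<in>E1 ==> m x = u x *\<^sub>R mat 1 + v x *\<^sub>R A" by metis
 have uniq: "p = p'\<and>q = q'" if "p *\<^sub>R mat 1 + q *\<^sub>R A = p' *\<^sub>R mat 1 + q' *\<^sub>R A" for p q p' q'
 proof -
  have "p + q * A$1$1 = p' + q' * A$1$1" "q * A$1$2 = q' * A$1$2" "q * A$2$1 = q' * A$2$1"
   "p + q * A$2$2 = p' + q' * A$2$2" using that unfolding mat2_eq_iff by auto
  hence "(q - q') * A$1$2 = 0" "(q - q') * A$2$1 = 0" "(q - q') * (A$1$1 - A$2$2) = 0" "p - p' = - (q - q') * A$1$1"
   by (auto simp: algebra_simps)
  thus ?thesis using nonscalar by auto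
 qed
 have uv_det: "(u x)\<^sup>2 + t * u x * v x + (v x)\<^sup>2 = 1" if "x\<in>E1" for x
 proof -
  have "det (m x) = 1" using det1 that unfolding E1_def by blast
  hence "(u x + v x * A$1$1) * (u x + v x * A$2$2) - (v x * A$1$2) * (v x * A$2$1) = 1"
   unfolding uv[OF that] by (simp add: det_2)
  moreover have "(u x + v x * A$1$1) * (u x + v x * A$2$2) - (v x * A$1$2) * (v x * A$2$1) =
    (u x)\<^sup>2 + t * u x * v x + (v x)\<^sup>2 * (A$1$1 * A$2$2 - A$1$2 * A$2$1)"
   unfolding t_def by (simp add: algebra_simps power2_eq_square)
  ultimately show ?thesis unfolding dA by simp
 qed
 have uv_mult: "\<exists>s. (s = 1 \<or> s = - 1)\<and>u (x\<otimes>y) = s * (u x * u y - v x * v y) \<and>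
   v (x\<otimes>y) = s * (u x * v y + v x * u y + t * v x * v y)" if xy: "x\<in>E1" "y\<in>E1" for x y
 proof -
  have xyE: "x\<in>E" "y\<in>E" using xy unfolding E1_def by auto
  have e: "m x ** m y = (u x * u y - v x * v y) *\<^sub>R mat 1 + (u x * v y + v x * u y + t * v x * v y) *\<^sub>R A"
  proof -
   have "m x ** m y = (u x * u y) *\<^sub>R mat 1 + (u x * v y + v x * u y) *\<^sub>R A + (v x * v y) *\<^sub>R (A ** A)"
    unfolding uv[OF xy(1)] uv[OF xy(2)] mat2_eq_iff by (simp add: algebra_simps)
   also have "A ** A = t *\<^sub>R A - mat 1"
    using mat2_cayley_hamilton[of A] det1[OF a(1)] unfolding t_def A_def by simp
   finally show ?thesis by (simp add: mat2_eq_iff algebra_simps)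
  qed
  obtain s :: real where s: "s = 1 \<or> s = - 1" "m (x\<otimes>y) = s *\<^sub>R (m x ** m y)"
   using mult[OF xyE] by (metis scaleR_minus1_left scaleR_one)
  have "x\<otimes>y\<in>E1" using xy E1 subgroup.m_closed by fast
  hence "u (x\<otimes>y) *\<^sub>R mat 1 + v (x\<otimes>y) *\<^sub>R A = (s * (u x * u y - v x * v y)) *\<^sub>R mat 1 +
    (s * (u x * v y + v x * u y + t * v x * v y)) *\<^sub>R A"
   using uv[of "x\<otimes>y"] s(2) unfolding e by (simp add: scaleR_add_right)
  thus ?thesis using uniq s(1) by blast
 qed
 have uv_fin: "finite {x\<in>E1. \<bar>u x\<bar> \<le> R\<and>\<bar>v x\<bar> \<le> R}" for R
 proof (rule finite_subset[OF _ bounded_part_finite])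
  show "{x\<in>E1. \<bar>u x\<bar> \<le> R\<and>\<bar>v x\<bar> \<le> R} \<subseteq>
    {x\<in>E. norm (m x) \<le> R * norm (mat 1 :: real^2^2) + R * norm A}"
  proof safe
   fix x assume x: "x\<in>E1" "\<bar>u x\<bar> \<le> R" "\<bar>v x\<bar> \<le> R"
   thus "x\<in>E" unfolding E1_def by blast
   have "norm (m x) \<le> \<bar>u x\<bar> * norm (mat 1 :: real^2^2) + \<bar>v x\<bar> * norm A"
    unfolding uv[OF x(1)] by (rule order_trans[OF norm_triangle_ineq]) simp
   also have "\<dots> \<le> R * norm (mat 1 :: real^2^2) + R * norm A"
    using x by (intro add_mono mult_right_mono) auto
   finally show "norm (m x) \<le> R * norm (mat 1 :: real^2^2) + R * norm A" .
  qed
 qed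
 consider "t\<^sup>2 < 4" | "t = 2 \<or> t = - 2" | "t\<^sup>2 > 4"
 proof -
  have "t\<^sup>2 = 4 ==> t = 2 \<or> t = - 2" using power2_eq_iff[of t 2] by simp
  thus ?thesis using that by linarith
 qed
 hence "vcyc G E1"
 proof cases
  case 1
  \<comment> \<open>Completing the square turns the determinant into a square plus \<open>k\<close>
    times a square, so \<open>u\<close> and \<open>v\<close> are bounded and \<open>E1\<close> is
    finite.\<close>
  define k where "k = 1 - t\<^sup>2 / 4"
  have k: "k > 0" unfolding k_def using 1 by simp
  have "\<bar>u x\<bar> \<le> 1 / k + 1\<and>\<bar>v x\<bar> \<le> 1 / k + 1" if x: "x\<in>E1" for x
  proof -
   have "(u x + t / 2 * v x)\<^sup>2 + k * (v x)\<^sup>2 = 1" "(v x + t / 2 * u x)\<^sup>2 + k * (u x)\<^sup>2 = 1"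
    using uv_det[OF x] unfolding k_def by (simp_all add: power2_eq_square field_simps)
   hence "k * (v x)\<^sup>2 \<le> 1" "k * (u x)\<^sup>2 \<le> 1"
    using zero_le_power2[of "u x + t / 2 * v x"] zero_le_power2[of "v x + t / 2 * u x"] by linarith+
   hence "(v x)\<^sup>2 \<le> 1 / k" "(u x)\<^sup>2 \<le> 1 / k" using k by (simp_all add: field_simps)
   moreover have "\<bar>w\<bar> \<le> w\<^sup>2 + 1" for w :: real
   proof -
    have "0 \<le> (\<bar>w\<bar> - 1 / 2)\<^sup>2" by simp
    thus ?thesis by (simp add: power2_eq_square algebra_simps)
   qed
   ultimately show ?thesis by (meson add_right_mono order_trans)
  qed
  hence "E1\<subseteq>{x\<in>E1. \<bar>u x\<bar> \<le> 1 / k + 1\<and>\<bar>v x\<bar> \<le> 1 / k + 1}" by blast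
  hence "finite E1" using uv_fin finite_subset by blast
  thus ?thesis by (rule vcyc_finite[OF grp E1])
 next
  case 2
  define \<epsilon> where "\<epsilon> = t / 2"
  have eps: "\<epsilon> = 1 \<or> \<epsilon> = - 1" "t = 2 * \<epsilon>" unfolding \<epsilon>_def using 2 by auto
  \<comment> \<open>The double eigenvalue of the lift; its square is the determinant.\<close>
  define c where "c x = u x + \<epsilon> * v x" for x
  have c: "c x = 1 \<or> c x = - 1" if "x\<in>E1" for x
  proof -
   have "(c x)\<^sup>2 = 1" unfolding c_def using uv_det[OF that] eps by (auto simp: power2_eq_square algebra_simps)
   thus ?thesis by (simp add: power2_eq_1_iff)
  qed
  \<comment> \<open>Passing to the other lift changes the signs of both factors, so the product
    depends on \<open>x\<close> alone. It is the translation length of a parabolic element.\<close>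
  define f where "f x = v x * c x" for x
  show ?thesis
  proof (rule vcyc_by_length_hom[OF grp E1, of f])
   fix x y assume xy: "x\<in>E1" "y\<in>E1"
   obtain s where s: "s = 1 \<or> s = - 1" "u (x\<otimes>y) = s * (u x * u y - v x * v y)"
    "v (x\<otimes>y) = s * (u x * v y + v x * u y + t * v x * v y)" using uv_mult[OF xy] by blast
   have ee: "\<epsilon> * \<epsilon> = 1" "s * s = 1" using eps(1) s(1) by auto
   have cc: "c x * c x = 1" "c y * c y = 1" using c[OF xy(1)] c[OF xy(2)] by auto
   have v_eq: "v (x\<otimes>y) = s * (c x * v y + c y * v x)" unfolding s(3) c_def eps(2) by (simp add: algebra_simps)
   have c_eq: "c (x\<otimes>y) = s * (c x * c y)"
   proof -
    have "c (x\<otimes>y) = s * (u x * u y - v x * v y + \<epsilon> * (u x * v y + v x * u y + 2 * \<epsilon> * v x * v y))"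
     unfolding c_def s(2,3) eps(2) by (simp add: algebra_simps)
    also have "\<dots> = s * (u x * u y + (2 * (\<epsilon> * \<epsilon>) - 1) * (v x * v y) + \<epsilon> * (u x * v y + v x * u y))"
     by (simp add: algebra_simps)
    also have "\<dots> = s * (u x * u y + (\<epsilon> * \<epsilon>) * (v x * v y) + \<epsilon> * (u x * v y + v x * u y))"
     unfolding ee by simp
    also have "\<dots> = s * (c x * c y)" unfolding c_def by (simp add: algebra_simps)
    finally show ?thesis .
   qed
   have "f (x\<otimes>y) = (s * s) * ((c x * c x) * (v y * c y) + (c y * c y) * (v x * c x))"
    unfolding f_def v_eq c_eq by (simp add: algebra_simps)
   thus "f (x\<otimes>y) = f x + f y" unfolding ee cc f_def by simp
  next
   fix M
   have "{x\<in>E1. \<bar>f x\<bar> \<le> M}\<subseteq>{x\<in>E1. \<bar>u x\<bar> \<le> M + 1\<and>\<bar>v x\<bar> \<le> M + 1}"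
   proof safe
    fix x assume x: "x\<in>E1" "\<bar>f x\<bar> \<le> M"
    have v: "\<bar>v x\<bar> \<le> M" using x c[OF x(1)] unfolding f_def by auto
    thus "\<bar>v x\<bar> \<le> M + 1" by simp
    have "\<bar>u x\<bar> \<le> \<bar>c x\<bar> + \<bar>v x\<bar>" unfolding c_def using eps(1) by auto
    thus "\<bar>u x\<bar> \<le> M + 1" using v c[OF x(1)] by auto
   qed
   thus "finite {x\<in>E1. \<bar>f x\<bar> \<le> M}" using uv_fin finite_subset by blast
  qed
 next
  case 3
  define r where "r = sqrt (t\<^sup>2 - 4)"
  have r: "r > 0" "r * r = t\<^sup>2 - 4" unfolding r_def using 3 by auto
  \<comment> \<open>The eigenvalues of \<open>A\<close>; \<open>c\<close> and \<open>d\<close> below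
    are the corresponding eigenvalues of the lift \<open>u + v A\<close>, with product 1.\<close>
  define \<mu> \<nu> where "\<mu> = (t + r) / 2" and "\<nu> = (t - r) / 2"
  have mn: "\<mu> + \<nu> = t" "\<mu> * \<nu> = 1" "\<mu> - \<nu> = r"
   unfolding \<mu>_def \<nu>_def using r by (auto simp: field_simps power2_eq_square)
  have mu2: "\<mu> * \<mu> = t * \<mu> - 1" using mn(2) unfolding mn(1)[symmetric] by (simp add: algebra_simps)
  define c where "c x = u x + v x * \<mu>" for x
  define d where "d x = u x + v x * \<nu>" for x
  have cd: "c x * d x = 1" if "x\<in>E1" for x
  proof -
   have "c x * d x = (u x)\<^sup>2 + (\<mu> + \<nu>) * u x * v x + (v x)\<^sup>2 * (\<mu> * \<nu>)"
    unfolding c_def d_def by (simp add: algebra_simps power2_eq_square)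
   thus ?thesis using uv_det[OF that] unfolding mn by simp
  qed
  hence c0: "c x\<noteq>0" if "x\<in>E1" for x using that by fastforce
  define f where "f x = ln \<bar>c x\<bar>" for x
  show ?thesis
  proof (rule vcyc_by_length_hom[OF grp E1, of f])
   fix x y assume xy: "x\<in>E1" "y\<in>E1"
   obtain s where s: "s = 1 \<or> s = - 1" "u (x\<otimes>y) = s * (u x * u y - v x * v y)"
    "v (x\<otimes>y) = s * (u x * v y + v x * u y + t * v x * v y)" using uv_mult[OF xy] by blast
   have "c x * c y = u x * u y + (u x * v y + v x * u y) * \<mu> + v x * v y * (\<mu> * \<mu>)"
    unfolding c_def by (simp add: algebra_simps)
   moreover have "c (x\<otimes>y) = s * (u x * u y + (u x * v y + v x * u y) * \<mu> + v x * v y * (t * \<mu> - 1))"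
    unfolding c_def s(2,3) by (simp add: algebra_simps)
   ultimately have "c (x\<otimes>y) = s * (c x * c y)" unfolding mu2 by simp
   hence "\<bar>c (x\<otimes>y)\<bar> = \<bar>c x\<bar> * \<bar>c y\<bar>" using s(1) by (auto simp: abs_mult)
   thus "f (x\<otimes>y) = f x + f y" unfolding f_def using c0 xy by (simp add: ln_mult)
  next
   fix M
   \<comment> \<open>Both \<open>c\<close> and \<open>d\<close> are at most \<open>exp M\<close> in
     absolute value. Solving for \<open>v\<close> divides their difference by \<open>r\<close>, and
     solving for \<open>u\<close> multiplies \<open>v\<close> by \<open>\<mu>\<close>; one bound
     serves both.\<close>
   define R where "R = exp M + (2 * exp M / r) * (1 + \<bar>\<mu>\<bar>)"
   have "{x\<in>E1. \<bar>f x\<bar> \<le> M}\<subseteq>{x\<in>E1. \<bar>u x\<bar> \<le> R\<and>\<bar>v x\<bar> \<le> R}"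
   proof safe
    fix x assume x: "x\<in>E1" "\<bar>f x\<bar> \<le> M"
    have "\<bar>c x\<bar> = exp (f x)" unfolding f_def using c0[OF x(1)] by simp
    hence c: "\<bar>c x\<bar> \<le> exp M" using x(2) by simp
    have "\<bar>d x\<bar> = 1 / \<bar>c x\<bar>" using cd[OF x(1)] c0[OF x(1)] by (simp add: field_simps abs_mult[symmetric])
    also have "\<dots> = exp (- f x)" using \<open>\<bar>c x\<bar> = exp (f x)\<close> by (simp add: exp_minus inverse_eq_divide)
    finally have d: "\<bar>d x\<bar> \<le> exp M" using x(2) by simp
    have "v x * r = c x - d x" unfolding c_def d_def mn(3)[symmetric] by (simp add: algebra_simps)
    hence "v x = (c x - d x) / r" using r(1) by (simp add: field_simps)
    hence "\<bar>v x\<bar> = \<bar>c x - d x\<bar> / r" using r(1) by simp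
    also have "\<dots> \<le> 2 * exp M / r" using c d r(1) by (intro divide_right_mono) auto
    finally have v: "\<bar>v x\<bar> \<le> 2 * exp M / r" .
    have pos: "0 \<le> 2 * exp M / r" using r(1) by simp
    have "2 * exp M / r \<le> (2 * exp M / r) * (1 + \<bar>\<mu>\<bar>)" using pos
     by (metis abs_ge_zero le_add_same_cancel1 mult.right_neutral mult_left_mono)
    thus "\<bar>v x\<bar> \<le> R" unfolding R_def using v exp_gt_zero[of M] by linarith
    have "\<bar>u x\<bar> \<le> \<bar>c x\<bar> + \<bar>v x\<bar> * \<bar>\<mu>\<bar>"
    proof -
     have "u x = c x - v x * \<mu>" unfolding c_def by simp
     thus ?thesis by (metis abs_mult abs_triangle_ineq4)
    qed
    also have "\<dots> \<le> exp M + (2 * exp M / r) * (1 + \<bar>\<mu>\<bar>)"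
     using c v pos by (intro add_mono mult_mono) auto
    finally show "\<bar>u x\<bar> \<le> R" unfolding R_def .
   qed
   thus "finite {x\<in>E1. \<bar>f x\<bar> \<le> M}" using uv_fin finite_subset by blast
  qed
 qed
 thus ?thesis by (rule vcyc_of_fin_index[OF grp idx])
qed

end

lemma PSL2R_carrier_elt:
 assumes "C\<in>carrier PSL2R"
 shows "\<exists>M. det M = 1\<and>C = {M, - M}"
proof -
 obtain M where "det M = 1" "C = {mat 1, - mat 1} #>\<^bsub>SL2R\<^esub> M"
  using assms unfolding PSL2R_def FactGroup_def RCOSETS_def SL2R_def by auto
 moreover have "{mat 1, - mat 1} #>\<^bsub>SL2R\<^esub> M = {M, - M}"
  unfolding r_coset_def SL2R_def by (auto simp: mat2_eq_iff)
 ultimately show ?thesis by blast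
qed

lemma PSL2R_mult: "{M, - M} \<otimes>\<^bsub>PSL2R\<^esub> {N, - N} = {M ** N, - (M ** N)}"
proof -
 have "(- M) ** N = - (M ** N)" "M ** (- N) = - (M ** N)" "(- M) ** (- N) = M ** N"
  by (simp_all add: mat2_eq_iff)
 thus ?thesis unfolding PSL2R_def FactGroup_def set_mult_def SL2R_def by auto
qed

text \<open>One matrix from each pair \<open>{M, - M}\<close> makes the isomorphism multiplicative
  up to sign. Discreteness of the preimage in \<open>SL2R\<close> isolates the identity matrix,
  which gives the uniform distance \<open>e\<close>.\<close>

lemma fuchsian_abelian_vcyc:
 assumes G: "group G" and L: "subgroup L G" "fuchsian_group (G\<lparr>carrier := L\<rparr>)"
  and E: "subgroup E G" "E\<subseteq>L" "\<And>x y. x\<in>E ==> y\<in>E ==> x \<otimes>\<^bsub>G\<^esub> y = y \<otimes>\<^bsub>G\<^esub> x"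
 shows "vcyc G E"
proof -
 obtain D \<phi> where D: "subgroup D PSL2R" "discrete (\<Union>D)" and \<phi>: "\<phi>\<in>iso (G\<lparr>carrier := L\<rparr>) (PSL2R\<lparr>carrier := D\<rparr>)"
  using L(2) unfolding fuchsian_group_def is_iso_def by blast
 have \<phi>D: "\<phi> x\<in>D" if "x\<in>L" for x using \<phi> that unfolding iso_def hom_def by auto
 have \<phi>m: "\<phi> (x \<otimes>\<^bsub>G\<^esub> y) = \<phi> x \<otimes>\<^bsub>PSL2R\<^esub> \<phi> y" if "x\<in>L" "y\<in>L" for x y
  using \<phi> that unfolding iso_def hom_def by auto
 have \<phi>i: "inj_on \<phi> L" using \<phi> unfolding iso_def bij_betw_def by auto
 have DP: "D\<subseteq>carrier PSL2R" using D(1) subgroup.subset by blast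
 have "\<forall>x\<in>L. \<exists>M. det M = 1\<and>\<phi> x = {M, - M}" using PSL2R_carrier_elt \<phi>D DP by blast
 then obtain m where m: "\<And>x. x\<in>L ==> det (m x) = 1\<and>\<phi> x = {m x, - m x}" by metis
 have mult: "m (x \<otimes>\<^bsub>G\<^esub> y) = m x ** m y \<or> m (x \<otimes>\<^bsub>G\<^esub> y) = - (m x ** m y)" if "x\<in>L" "y\<in>L" for x y
 proof -
  have "x \<otimes>\<^bsub>G\<^esub> y\<in>L" using that L(1) subgroup.m_closed by fast
  hence "{m (x \<otimes>\<^bsub>G\<^esub> y), - m (x \<otimes>\<^bsub>G\<^esub> y)} = {m x ** m y, - (m x ** m y)}"
   using \<phi>m[OF that] m that PSL2R_mult by metis
  thus ?thesis by (auto simp: doubleton_eq_iff)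
 qed
 have inj: "x = y" if "x\<in>L" "y\<in>L" "m x = m y \<or> m x = - m y" for x y
 proof -
  have "\<phi> x = \<phi> y" using m that by auto
  thus ?thesis using \<phi>i that by (auto dest: inj_onD)
 qed
 have oneL: "\<one>\<^bsub>G\<^esub>\<in>L" using L(1) subgroup.one_closed by blast
 have m1: "m \<one>\<^bsub>G\<^esub> = mat 1 \<or> m \<one>\<^bsub>G\<^esub> = - mat 1"
 proof -
  have "\<one>\<^bsub>G\<^esub> \<otimes>\<^bsub>G\<^esub> \<one>\<^bsub>G\<^esub> = \<one>\<^bsub>G\<^esub>" using G by (simp add: group.is_monoid monoid.one_closed)
  define M where "M = m \<one>\<^bsub>G\<^esub>"
  have d: "M$1$1 * M$2$2 - M$1$2 * M$2$1 = 1" using m[OF oneL] unfolding M_def by (simp add: det_2)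
  have inv: "invertible M" using m[OF oneL] unfolding M_def by (simp add: invertible_det_nz)
  from mult[OF oneL oneL] consider "M ** M = M ** mat 1" | "M ** M = M ** (- mat 1)" unfolding M_def
   \<open>\<one>\<^bsub>G\<^esub> \<otimes>\<^bsub>G\<^esub> \<one>\<^bsub>G\<^esub> = \<one>\<^bsub>G\<^esub>\<close> by (auto simp: mat2_eq_iff)
  thus ?thesis unfolding M_def[symmetric] using inv
   by (metis (no_types) invertible_def matrix_mul_assoc matrix_mul_lid)
 qed
 have IU: "mat 1\<in>\<Union>D" using m[OF oneL] \<phi>D[OF oneL] m1 by auto
 hence "mat 1 isolated_in \<Union>D" using D(2) unfolding discrete_def by blast
 then obtain e where e: "e > 0" "\<And>N. N\<in>\<Union>D ==> dist N (mat 1) < e ==> N = mat 1"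
  unfolding isolated_in_dist_Ex_iff by (auto simp: dist_commute)
 have far: "norm (m x - mat 1) \<ge> e\<and>norm (- m x - mat 1) \<ge> e" if x: "x\<in>E" "x\<noteq>\<one>\<^bsub>G\<^esub>" for x
 proof -
  have xL: "x\<in>L" using x E by blast
  have "m x\<in>\<Union>D" "- m x\<in>\<Union>D" using m[OF xL] \<phi>D[OF xL] by auto
  moreover have "m x\<noteq>mat 1" "- m x\<noteq>mat 1" using inj[OF xL oneL] m1 x(2) by (auto simp: minus_equation_iff)
  ultimately show ?thesis using e(2)[of "m x"] e(2)[of "- m x"] by (force simp: dist_norm)
 qed
 show ?thesis
  by (rule psl2_abelian_vcyc[OF G E(1), of m e]) (use E m mult inj far e(1) in \<open>auto simp: subset_iff\<close>)
qed

section \<open>Peripheral subgroups are almost malnormal\<close>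

lemma finite_relpow_Image:
 fixes R :: "('b\<times>'b) set"
 shows "(\<And>x. finite (R `` {x})) ==> finite ((R ^^ n) `` {x})"
proof (induction n)
 case (Suc n)
 have "(R ^^ Suc n) `` {x} = (\<Union>y\<in>(R ^^ n) `` {x}. R `` {y})" by auto
 thus ?case using Suc by simp
qed simp

lemma relpow_sym: "sym R ==> (x, y)\<in>R ^^ n ==> (y, x)\<in>R ^^ n"
proof (induction n arbitrary: y)
 case (Suc n)
 then obtain z where "(x, z)\<in>R ^^ n" "(y, z)\<in>R" by (auto dest: symD)
 thus ?case using Suc relpow_Suc_I2 by metis
qed simp

context
 fixes G :: "'a monoid" (structure)
 assumes grp: "group G"
begin

interpretation group G by (rule grp)

lemma cayley_generate_path:
 assumes "T\<subseteq>carrier G" "k\<in>generate G T" "a\<in>carrier G"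
 shows "(a, a\<otimes>k)\<in>(cayley G T)\<^sup>*"
 using assms(2,1,3)
proof (induction k arbitrary: a rule: generate.induct)
 case one thus ?case by simp
next
 case (incl h)
 hence "(a, a\<otimes>h)\<in>cayley G T" unfolding cayley_def by blast
 thus ?case by blast
next
 case (inv h)
 have "h\<in>carrier G" using inv by auto
 hence "(a, a\<otimes>inv h)\<in>cayley G T" using inv unfolding cayley_def
  by (auto simp: m_assoc intro!: bexI[of _ h])
 thus ?case by blast
next
 case (eng h1 h2)
 have h: "h1\<in>carrier G" "h2\<in>carrier G" using eng generate_in_carrier by auto
 have "(a, a\<otimes>h1)\<in>(cayley G T)\<^sup>*" "(a\<otimes>h1, a\<otimes>h1\<otimes>h2)\<in>(cayley G T)\<^sup>*"
  using eng h by auto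
 hence "(a, a\<otimes>h1\<otimes>h2)\<in>(cayley G T)\<^sup>*" by (rule rtrancl_trans)
 thus ?case using h eng by (simp add: m_assoc)
qed

lemma cayley_left_mult:
 assumes "T\<subseteq>carrier G" "g\<in>carrier G" "(x, y)\<in>cayley G T ^^ n"
 shows "(g\<otimes>x, g\<otimes>y)\<in>cayley G T ^^ n"
 using assms(3)
proof (induction n arbitrary: y)
 case (Suc n)
 then obtain z where z: "(x, z)\<in>cayley G T ^^ n" "(z, y)\<in>cayley G T" by auto
 then obtain s where s: "z\<in>carrier G" "y\<in>carrier G" "s\<in>T" "y = z\<otimes>s \<or> z = y\<otimes>s"
  unfolding cayley_def by blast
 have "s\<in>carrier G" using s assms by blast
 hence "g\<otimes>y = g\<otimes>z\<otimes>s \<or> g\<otimes>z = g\<otimes>y\<otimes>s" using s assms by (auto simp: m_assoc)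
 hence "(g\<otimes>z, g\<otimes>y)\<in>cayley G T" using s assms unfolding cayley_def by blast
 thus ?case using Suc.IH[OF z(1)] by auto
qed simp

lemma cayley_Image_one_finite:
 assumes "finite T" "T\<subseteq>carrier G" shows "finite (cayley G T `` {x})"
proof -
 have "cayley G T `` {x}\<subseteq>(\<lambda>s. x\<otimes>s) ` T\<union>(\<lambda>s. x\<otimes>inv s) ` T"
 proof
  fix y assume "y\<in>cayley G T `` {x}"
  then obtain s where s: "x\<in>carrier G" "y\<in>carrier G" "s\<in>T" "y = x\<otimes>s \<or> x = y\<otimes>s"
   unfolding cayley_def by blast
  have "s\<in>carrier G" using s assms by blast
  hence "y = x\<otimes>s \<or> y = x\<otimes>inv s" using s by (auto simp: m_assoc)
  thus "y\<in>(\<lambda>s. x\<otimes>s) ` T\<union>(\<lambda>s. x\<otimes>inv s) ` T" using s by blast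
 qed
 thus ?thesis using assms finite_subset by blast
qed

lemma cayley_path_carrier: "(a, b)\<in>cayley G T ^^ n ==> a\<in>carrier G ==> b\<in>carrier G"
 by (cases n) (auto simp: cayley_def)

lemma cayley_coset:
 assumes Q: "subgroup Q G" "g\<in>carrier G" "(a, b)\<in>cayley G (S\<inter>Q) ^^ n"
 shows "inv g\<otimes>a\<in>Q\<longleftrightarrow>inv g\<otimes>b\<in>Q"
 using assms(3)
proof (induction n arbitrary: b)
 case (Suc n)
 then obtain z where z: "(a, z)\<in>cayley G (S\<inter>Q) ^^ n" "(z, b)\<in>cayley G (S\<inter>Q)" by auto
 then obtain s where s: "z\<in>carrier G" "b\<in>carrier G" "s\<in>Q" "b = z\<otimes>s \<or> z = b\<otimes>s"
  unfolding cayley_def by blast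
 have sG: "s\<in>carrier G" using s Q subgroup.mem_carrier by fast
 have "inv g\<otimes>(c\<otimes>s)\<in>Q\<longleftrightarrow>inv g\<otimes>c\<in>Q" if c: "c\<in>carrier G" for c
 proof -
  have "inv g\<otimes>(c\<otimes>s) = (inv g\<otimes>c)\<otimes>s" using c sG Q(2) by (simp add: m_assoc)
  moreover have "inv g\<otimes>c = (inv g\<otimes>c\<otimes>s)\<otimes>inv s" using c sG Q(2) by (simp add: m_assoc)
  ultimately show ?thesis using Q(1) s(3) by (metis subgroup.m_closed subgroup.m_inv_closed)
 qed
 thus ?case using Suc.IH[OF z(1)] s by auto
qed simp

context
 fixes \<P> :: "'a set set" and S :: "'a set"
 assumes finP: "finite \<P>" and subP: "\<And>Q. Q\<in>\<P> ==> subgroup Q G"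
  and S: "finite S" "S\<subseteq>carrier G" "generate G S = carrier G"
  and SP: "\<And>Q. Q\<in>\<P> ==> generate G (S\<inter>Q) = Q"
begin

section \<open>Metric properties of the cusped graph\<close>

lemma cusped_base_path:
 "(a, b)\<in>cayley G S ^^ n ==> (Base a, Base b)\<in>cusped_edges G \<P> S ^^ n"
proof (induction n arbitrary: b)
 case (Suc n)
 then obtain z where "(a, z)\<in>cayley G S ^^ n" "(z, b)\<in>cayley G S" by auto
 thus ?case using Suc.IH[of z] cusped_edges.cayley by fastforce
qed simp

lemma cusped_down_path:
 assumes "Q\<in>\<P>" "g\<in>carrier G"
 shows "1 \<le> k ==> (Base g, Horo Q g k)\<in>cusped_edges G \<P> S ^^ k"
proof (induction k)
 case (Suc k)
 show ?case
 proof (cases "k = 0")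
  case True thus ?thesis using cusped_edges.down0[OF assms] by simp
 next
  case False
  hence "(Horo Q g k, Horo Q g (Suc k))\<in>cusped_edges G \<P> S"
   using cusped_edges.down[OF assms, of k] by simp
  moreover have "(Base g, Horo Q g k)\<in>cusped_edges G \<P> S ^^ k" using Suc False by simp
  ultimately show ?thesis by auto
 qed
qed simp

lemma cusped_sym: "(x, y)\<in>cusped_edges G \<P> S ==> (y, x)\<in>cusped_edges G \<P> S"
proof (induction rule: cusped_edges.induct)
 case (cayley g h) thus ?case by (intro cusped_edges.cayley) (auto simp: cayley_def)
next
 case (horizontal Q g k h n)
 have "sym (cayley G (S\<inter>Q))" by (auto simp: sym_def cayley_def)
 hence hg: "(h, g)\<in>cayley G (S\<inter>Q) ^^ n" using horizontal relpow_sym by metis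
 have "h\<in>carrier G" using cayley_path_carrier horizontal by metis
 thus ?case using horizontal hg by (intro cusped_edges.horizontal) auto
qed (auto intro: cusped_edges.intros simp del: One_nat_def)

lemma cusped_sym_path: "(x, y)\<in>cusped_edges G \<P> S ^^ n ==> (y, x)\<in>cusped_edges G \<P> S ^^ n"
 by (rule relpow_sym) (use cusped_sym in \<open>auto simp: sym_def\<close>)

text \<open>Ensures that \<open>graph_dist\<close> is realized by a path; without one,
  \<open>LEAST\<close> would return an unspecified number.\<close>

lemma cusped_connected:
 assumes "x\<in>cusped_verts G \<P>" "y\<in>cusped_verts G \<P>"
 shows "\<exists>n. (x, y)\<in>cusped_edges G \<P> S ^^ n"
proof -
 have base: "\<exists>g\<in>carrier G. (Base g, x)\<in>(cusped_edges G \<P> S)\<^sup>*" if "x\<in>cusped_verts G \<P>" for x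
 proof (cases x)
  case (Base g) thus ?thesis using that unfolding cusped_verts_def by auto
 next
  case (Horo Q g k)
  hence "Q\<in>\<P>" "g\<in>carrier G" "1 \<le> k" using that unfolding cusped_verts_def by auto
  thus ?thesis using Horo cusped_down_path relpow_imp_rtrancl by metis
 qed
 have bb: "(Base g, Base h)\<in>(cusped_edges G \<P> S)\<^sup>*" if "g\<in>carrier G" "h\<in>carrier G" for g h
 proof -
  have "inv g\<otimes>h\<in>generate G S" using that S by simp
  hence "(g, g\<otimes>(inv g\<otimes>h))\<in>(cayley G S)\<^sup>*" using cayley_generate_path[OF S(2)] that by blast
  hence "(g, h)\<in>(cayley G S)\<^sup>*" using that by (simp add: inv_cancel[OF grp])
  thus ?thesis using cusped_base_path by (meson rtrancl_power)
 qed
 obtain g h where gh: "g\<in>carrier G" "h\<in>carrier G" "(Base g, x)\<in>(cusped_edges G \<P> S)\<^sup>*"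
  "(Base h, y)\<in>(cusped_edges G \<P> S)\<^sup>*" using base assms by metis
 have "(x, Base g)\<in>(cusped_edges G \<P> S)\<^sup>*" using gh(3) cusped_sym_path by (meson rtrancl_power)
 thus ?thesis using gh bb[OF gh(1,2)] by (meson rtrancl_power rtrancl_trans)
qed

lemma graph_dist_le: "(x, y)\<in>E ^^ n ==> graph_dist E x y \<le> n"
 unfolding graph_dist_def by (simp add: Least_le)

lemma graph_dist_path:
 assumes "x\<in>cusped_verts G \<P>" "y\<in>cusped_verts G \<P>"
 shows "\<exists>n. (x, y)\<in>cusped_edges G \<P> S ^^ n\<and>graph_dist (cusped_edges G \<P> S) x y = n"
 using LeastI_ex[OF cusped_connected[OF assms]] unfolding graph_dist_def by blast

text \<open>A base vertex has finitely many neighbours as \<open>S\<close> and \<open>\<P>\<close>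
  are finite; at depth \<open>k\<close> the horizontal neighbours lie in a ball of radius
  \<open>2 ^ k\<close> of a locally finite Cayley graph.\<close>

lemma cusped_locally_finite: "finite (cusped_edges G \<P> S `` {x})"
proof (cases x)
 case (Base g)
 have "cusped_edges G \<P> S `` {x}\<subseteq>Base ` (cayley G S `` {g})\<union>(\<lambda>Q. Horo Q g 1) ` \<P>"
  unfolding Base by (auto elim: cusped_edges.cases)
 thus ?thesis using cayley_Image_one_finite[OF S(1,2)] finP finite_subset
  by (metis (no_types, lifting) finite_UnI finite_imageI)
next
 case (Horo Q g k)
 let ?F = "{Base g, Horo Q g (k + 1), Horo Q g (k - 1)} \<union>
  (\<lambda>h. Horo Q h k) ` (\<Union>n\<in>{..2 ^ k}. (cayley G (S\<inter>Q) ^^ n) `` {g})"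
 have "cusped_edges G \<P> S `` {x}\<subseteq>?F"
  unfolding Horo by (auto elim!: cusped_edges.cases)
 moreover have "finite (cayley G (S\<inter>Q) `` {a})" for a
  using S by (intro cayley_Image_one_finite) auto
 hence "finite ?F" by (intro finite_UnI finite_imageI finite_UN_I finite_relpow_Image) auto
 ultimately show ?thesis by (rule finite_subset)
qed

text \<open>A signed depth function, positive in one horoball and negative in another, is 1-Lipschitz.\<close>

lemma horoballs_far:
 assumes P: "P\<in>\<P>" and Q: "Q\<in>\<P>" and g: "g\<in>carrier G" and ne: "\<not> (P = Q\<and>g\<in>P)"
  and path: "(Horo P \<one> n, Horo Q g n')\<in>cusped_edges G \<P> S ^^ m"
 shows "n + n' \<le> m"
proof -
 define \<phi> :: "'a cusp_vertex => int" where "\<phi> v = (case v of Base _ => 0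
   | Horo R a k => if R = P\<and>a\<in>P then int k else if R = Q\<and>inv g\<otimes>a\<in>Q then - int k else 0)" for v
 have step: "\<phi> x - \<phi> y \<le> 1" if "(x, y)\<in>cusped_edges G \<P> S" for x y
  using that
 proof (cases rule: cusped_edges.cases)
  case (horizontal R a k b n)
  have "inv c\<otimes>a\<in>R\<longleftrightarrow>inv c\<otimes>b\<in>R" if "c\<in>carrier G" for c
   using cayley_coset[OF subP[OF horizontal(3)] that horizontal(7)] .
  moreover have "b\<in>carrier G" using cayley_path_carrier horizontal by metis
  ultimately have "a\<in>R\<longleftrightarrow>b\<in>R" "inv g\<otimes>a\<in>R\<longleftrightarrow>inv g\<otimes>b\<in>R" using g horizontal one_closed
   by (metis inv_one l_one, metis)
  thus ?thesis using horizontal unfolding \<phi>_def by auto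
 qed (auto simp: \<phi>_def)
 have "(x, y)\<in>cusped_edges G \<P> S ^^ m ==> \<phi> x - \<phi> y \<le> int m" for x y m
 proof (induction m arbitrary: y)
  case (Suc m)
  then obtain z where "(x, z)\<in>cusped_edges G \<P> S ^^ m" "(z, y)\<in>cusped_edges G \<P> S" by auto
  thus ?case using Suc.IH[of z] step[of z y] by simp
 qed simp
 from this[OF path] have "\<phi> (Horo P \<one> n) - \<phi> (Horo Q g n') \<le> int m" .
 moreover have "\<phi> (Horo P \<one> n) = int n" unfolding \<phi>_def using subP[OF P] subgroup.one_closed by auto
 moreover have "\<phi> (Horo Q g n') = - int n'" unfolding \<phi>_def using ne g subP[OF Q] subgroup.one_closed by auto
 ultimately show ?thesis by linarith
qed

text \<open>Points of one coset become adjacent deep in the horoball: their distance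
  \<open>n\<close> in the Cayley graph of \<open>Q\<close> is at most \<open>2 ^ (n + 1)\<close>.
  The case \<open>i = 0\<close> is that of equal points.\<close>

lemma cusped_horo_step:
 assumes "Q\<in>\<P>" "g\<in>carrier G" "q\<in>Q"
 shows "\<exists>k\<ge>1. \<exists>i\<le>1. (Horo Q g k, Horo Q (g\<otimes>q) k)\<in>cusped_edges G \<P> S ^^ i"
proof (cases "g\<otimes>q = g")
 case True thus ?thesis by (intro exI[of _ 1] conjI exI[of _ 0]) auto
next
 case False
 have "(g, g\<otimes>q)\<in>(cayley G (S\<inter>Q))\<^sup>*"
  using assms SP[OF assms(1)] S by (intro cayley_generate_path) auto
 then obtain n where n: "(g, g\<otimes>q)\<in>cayley G (S\<inter>Q) ^^ n" by (meson rtrancl_power)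
 have "n \<le> 2 ^ (n + 1)" by (rule order_trans[OF less_imp_le[OF less_exp]]) simp
 hence "(Horo Q g (n + 1), Horo Q (g\<otimes>q) (n + 1))\<in>cusped_edges G \<P> S"
  using assms n False by (intro cusped_edges.horizontal[where n = n]) auto
 thus ?thesis by (intro exI[of _ "n + 1"] conjI exI[of _ 1]) auto
qed

text \<open>For \<open>k\<close> in the intersection take deep vertices \<open>?x\<close> and
  \<open>?z\<close> in the horoballs on \<open>P\<close> and on \<open>gQ\<close>. As
  \<open>k\<close> lies in \<open>P\<close> and moves \<open>g\<close> within \<open>gQ\<close>, the
  elements \<open>\<one>\<close> and \<open>k\<close> have almost the same distances to
  \<open>?x\<close> and to \<open>?z\<close>, and both lie almost on a geodesic between them.
  Hyperbolicity bounds their distance independently of the depths, and a ball of the locally finite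
  cusped graph contains finitely many \<open>k\<close>.\<close>

lemma malnormal_aux:
 assumes hyp: "gromov_hyperbolic (cusped_verts G \<P>) (graph_dist (cusped_edges G \<P> S))"
  and P: "P\<in>\<P>" and Q: "Q\<in>\<P>" and g: "g\<in>carrier G"
  and inf: "infinite (P\<inter>conj_set G g Q)"
 shows "P = Q\<and>g\<in>P"
proof (rule ccontr)
 assume ne: "\<not> ?thesis"
 let ?E = "cusped_edges G \<P> S" let ?d = "graph_dist ?E"
 obtain \<delta> where \<delta>: "\<And>w x y z. w\<in>cusped_verts G \<P> ==> x\<in>cusped_verts G \<P> ==>
   y\<in>cusped_verts G \<P> ==> z\<in>cusped_verts G \<P> ==>
   gromov_product ?d w x z \<ge> min (gromov_product ?d w x y) (gromov_product ?d w y z) - \<delta>"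
  using hyp unfolding gromov_hyperbolic_def by blast
 have "(\<one>, \<one>\<otimes>g)\<in>(cayley G S)\<^sup>*" using S g by (intro cayley_generate_path) auto
 then obtain l where l: "(\<one>, g)\<in>cayley G S ^^ l" using g by (auto simp: rtrancl_power)
 \<comment> \<open>Here \<open>l\<close> is the length of a path from \<open>\<one>\<close> to
   \<open>g\<close>, the extra 1 pays for the horizontal step in a horoball, and
   \<open>2 * \<delta>\<close> is the loss in the four-point inequality.\<close>
 define M where "M = nat \<lceil>l + 1 + 2 * \<delta>\<rceil>"
 have "k\<in>(\<Union>n\<in>{..M}. {k. Base k\<in>(?E ^^ n) `` {Base \<one>}})" if k: "k\<in>P\<inter>conj_set G g Q" for k
 proof -
  obtain q where q: "q\<in>Q" "k = g\<otimes>q\<otimes>inv g" using k unfolding conj_set_def by blast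
  have qG: "q\<in>carrier G" by (rule subgroup.mem_carrier[OF subP[OF Q] q(1)])
  have kG: "k\<in>carrier G" using subgroup.mem_carrier[OF subP[OF P]] k by blast
  have kg: "k\<otimes>g = g\<otimes>q" using q qG g by (simp add: m_assoc)
  obtain n i where n: "1 \<le> n" "i \<le> 1" "(Horo P \<one> n, Horo P (\<one>\<otimes>k) n)\<in>?E ^^ i"
   using cusped_horo_step[OF P one_closed, of k] k by blast
  obtain n' i' where n': "1 \<le> n'" "i' \<le> 1" "(Horo Q g n', Horo Q (g\<otimes>q) n')\<in>?E ^^ i'"
   using cusped_horo_step[OF Q g q(1)] by blast
  let ?x = "Horo P \<one> n" and ?z = "Horo Q g n'" and ?p = "Base \<one>" and ?q = "Base k"
  have V: "?x\<in>cusped_verts G \<P>" "?z\<in>cusped_verts G \<P>" "?p\<in>cusped_verts G \<P>" "?q\<in>cusped_verts G \<P>"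
   unfolding cusped_verts_def using P Q g n n' kG by auto
  have xp: "?d ?x ?p \<le> n"
   by (rule graph_dist_le, rule cusped_sym_path, rule cusped_down_path[OF P one_closed n(1)])
  have "(?x, Base k)\<in>?E ^^ (i + n)"
   unfolding relpow_add using n(3)[unfolded l_one[OF kG]] cusped_sym_path[OF cusped_down_path[OF P kG n(1)]]
   by (rule relcompI)
  from graph_dist_le[OF this] have xq: "?d ?x ?q \<le> n + 1" using n(2) by linarith
  have "(Base \<one>, ?z)\<in>?E ^^ (l + n')"
   using cusped_base_path[OF l] cusped_down_path[OF Q g n'(1)] by (auto simp: relpow_add)
  from graph_dist_le[OF cusped_sym_path[OF this]] have zp: "?d ?z ?p \<le> l + n'" .
  have "(k\<otimes>\<one>, k\<otimes>g)\<in>cayley G S ^^ l" by (rule cayley_left_mult[OF S(2) kG l])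
  hence "(Base k, Base (g\<otimes>q))\<in>?E ^^ l" using cusped_base_path kG kg by simp
  moreover have "(Base (g\<otimes>q), Horo Q (g\<otimes>q) n')\<in>?E ^^ n'"
   by (rule cusped_down_path[OF Q _ n'(1)]) (use g qG in simp)
  moreover have "(Horo Q (g\<otimes>q) n', ?z)\<in>?E ^^ i'" using n'(3) by (rule cusped_sym_path)
  ultimately have "(Base k, ?z)\<in>?E ^^ (l + n' + i')" unfolding relpow_add by blast
  from graph_dist_le[OF this] have qz: "?d ?q ?z \<le> l + n' + 1" using n'(2) by linarith
  obtain m where m: "(?x, ?z)\<in>?E ^^ m" "?d ?x ?z = m" using graph_dist_path V by blast
  \<comment> \<open>The horoballs are distinct, so a path from one to the other climbs
    \<open>n\<close> levels and descends \<open>n'\<close>.\<close>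
  have xz: "?d ?x ?z \<ge> n + n'" using horoballs_far[OF P Q g ne m(1)] m(2) by simp
  have "?d ?q ?p \<le> l + 1 + 2 * \<delta>"
  proof -
   consider "gromov_product ?d ?p ?x ?z \<ge> gromov_product ?d ?p ?x ?q - \<delta>" |
     "gromov_product ?d ?p ?x ?z \<ge> gromov_product ?d ?p ?q ?z - \<delta>"
    using \<delta>[OF V(3) V(1) V(4) V(2)] by linarith
   thus ?thesis
   proof cases
    case 1 thus ?thesis using xp xq zp qz xz unfolding gromov_product_def of_nat_add of_nat_1 by argo
   next
    case 2 thus ?thesis using xp xq zp qz xz unfolding gromov_product_def of_nat_add of_nat_1 by argo
   qed
  qed
  moreover obtain m' where m': "(?q, ?p)\<in>?E ^^ m'" "?d ?q ?p = m'" using graph_dist_path V by blast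
  ultimately have "m' \<le> M" unfolding M_def by linarith
  thus ?thesis using cusped_sym_path[OF m'(1)] by blast
 qed
 hence "P\<inter>conj_set G g Q\<subseteq>(\<Union>n\<in>{..M}. {k. Base k\<in>(?E ^^ n) `` {Base \<one>}})" by blast
 moreover have "finite {k. Base k\<in>(?E ^^ n) `` {Base \<one>}}" for n
  using finite_vimageI[OF finite_relpow_Image[OF cusped_locally_finite, of n "Base \<one>"], of Base]
  by (simp add: vimage_def inj_def)
 hence "finite (\<Union>n\<in>{..M}. {k. Base k\<in>(?E ^^ n) `` {Base \<one>}})" by (intro finite_UN_I) auto
 ultimately show False using inf finite_subset by blast
qed

end

lemma peripheral_malnormal:
 assumes rel: "relatively_hyperbolic G \<P>" and "P\<in>\<P>" "Q\<in>\<P>" "g\<in>carrier G"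
  and "infinite (P\<inter>conj_set G g Q)"
 shows "P = Q\<and>g\<in>P"
proof -
 from rel obtain S where S: "finite S" "S\<subseteq>carrier G" "generate G S = carrier G"
  and gen: "\<forall>Q\<in>\<P>. generate G (S\<inter>Q) = Q"
  and hyp: "gromov_hyperbolic (cusped_verts G \<P>) (graph_dist (cusped_edges G \<P> S))"
  unfolding relatively_hyperbolic_def by (elim conjE exE)
 have fin: "finite \<P>" using rel unfolding relatively_hyperbolic_def by (elim conjE)
 have sub: "\<And>Q. Q\<in>\<P> ==> subgroup Q G" using rel unfolding relatively_hyperbolic_def by (elim conjE) blast
 show ?thesis by (rule malnormal_aux[OF fin sub S bspec[OF gen] hyp assms(2-)])
qed

end

section \<open>Spaces with walls\<close>

text \<open>\<open>R0\<close> joins points that represent the same vertex of a tree, \<open>R1\<close> joins the end points of an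
 edge, and the walls are the half-trees, one for each oriented edge.\<close>

locale wall_space = group G for G :: "'a monoid" (structure) +
 fixes H :: "'a set" and V :: "'x set" and act :: "'a => 'x => 'x"
  and R0 R1 :: "('x\<times>'x) set" and W :: "'x set set"
 assumes H: "subgroup H G"
  and act_closed: "h\<in>H ==> x\<in>V ==> act h x\<in>V"
  and act_one: "x\<in>V ==> act \<one> x = x"
  and act_mult: "g\<in>H ==> h\<in>H ==> x\<in>V ==> act (g\<otimes>h) x = act g (act h x)"
  and R0_V: "R0\<subseteq>V\<times>V" and R1_V: "R1\<subseteq>V\<times>V"
  and R0_sym: "sym R0" and R1_sym: "sym R1"
  and R1_act: "h\<in>H ==> (x, y)\<in>R1 ==> (act h x, act h y)\<in>R1"
  and conn: "x\<in>V ==> y\<in>V ==> (x, y)\<in>(R0\<union>R1)\<^sup>*"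
  and W_sub: "U\<in>W ==> U\<subseteq>V"
  and W_compl: "U\<in>W ==> V - U\<in>W"
  and W_act: "h\<in>H ==> U\<in>W ==> act h ` U\<in>W"
  and W_crossed: "U\<in>W ==> \<exists>x y. (x, y)\<in>R1\<and>x\<notin>U\<and>y\<in>U"
  and R1_crosses: "(x, y)\<in>R1 ==> \<exists>U\<in>W. x\<notin>U\<and>y\<in>U"
  and R0_uncrossed: "(x, y)\<in>R0 ==> U\<in>W ==> x\<in>U\<longleftrightarrow>y\<in>U"
  and R1_unique: "(x, y)\<in>R1 ==> U\<in>W ==> U'\<in>W ==> x\<notin>U ==> y\<in>U ==> x\<notin>U' ==> y\<in>U' ==> U = U'"
  and W_edge: "(x, y)\<in>R1 ==> (x', y')\<in>R1 ==> U\<in>W ==>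
   x\<notin>U ==> x'\<notin>U ==> y\<in>U ==> y'\<in>U ==> (x, x')\<in>R0\<^sup>*"
  and no_inversion: "h\<in>H ==> U\<in>W ==> act h ` U\<noteq>V - U"
begin

text \<open>For an invariant set \<open>I\<close> of walls, \<open>\<not> sep I\<close> is equality
  of vertices in the tree obtained by collapsing all edges outside \<open>I\<close>. Then
  \<open>stab I x\<close> is a vertex stabilizer of that tree, and \<open>wstab U\<close> an edge
  stabilizer.\<close>

definition sep :: "'x set set => 'x => 'x => bool" where
 "sep I x y\<longleftrightarrow>(\<exists>U\<in>I. (x\<in>U)\<noteq>(y\<in>U))"

definition invariant :: "'x set set => bool" where
 "invariant I\<longleftrightarrow>I\<subseteq>W\<and>(\<forall>U\<in>I. V - U\<in>I)\<and>(\<forall>h\<in>H. \<forall>U\<in>I. act h ` U\<in>I)"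

definition stab :: "'x set set => 'x => 'a set" where
 "stab I x = {h\<in>H. \<not> sep I x (act h x)}"

definition wstab :: "'x set => 'a set" where
 "wstab U = {h\<in>H. act h ` U = U}"

lemma H_closed [simp]: "g\<in>H ==> h\<in>H ==> g\<otimes>h\<in>H" "h\<in>H ==> inv h\<in>H" "\<one>\<in>H"
  "h\<in>H ==> h\<in>carrier G"
 using H by (auto simp: subgroup.m_closed subgroup.m_inv_closed subgroup.one_closed subgroup.mem_carrier)

lemma act_inv [simp]: "h\<in>H ==> x\<in>V ==> act (inv h) (act h x) = x" "h\<in>H ==> x\<in>V ==> act h (act (inv h) x) = x"
 by (simp_all add: act_mult[symmetric] act_one)

lemma act_mem:
 assumes h: "h\<in>H" and U: "U\<subseteq>V" and x: "x\<in>V"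
 shows "act h x\<in>act h ` U\<longleftrightarrow>x\<in>U" "x\<in>act h ` U\<longleftrightarrow>act (inv h) x\<in>U"
proof -
 have inj: "y = x" if "y\<in>U" "act h x = act h y" for y
  using that h U x act_inv(1)[of h x] act_inv(1)[of h y] by (metis subsetD)
 show "act h x\<in>act h ` U\<longleftrightarrow>x\<in>U" using inj by blast
 show "x\<in>act h ` U\<longleftrightarrow>act (inv h) x\<in>U"
 proof
  assume "x\<in>act h ` U"
  then obtain y where "y\<in>U" "x = act h y" by blast
  thus "act (inv h) x\<in>U" using h U by auto
 next
  assume "act (inv h) x\<in>U"
  moreover have "x = act h (act (inv h) x)" using h x by simp
  ultimately show "x\<in>act h ` U" by blast
 qed
qed

lemma act_image_mult: "g\<in>H ==> h\<in>H ==> U\<subseteq>V ==> act g ` act h ` U = act (g\<otimes>h) ` U"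
 unfolding image_image by (rule image_cong) (auto simp: act_mult)

lemma act_image_one: "U\<subseteq>V ==> act \<one> ` U = U"
 using act_one by force

lemma act_image_sub: "h\<in>H ==> U\<subseteq>V ==> act h ` U\<subseteq>V"
 using act_closed by blast

lemma act_image_compl: "h\<in>H ==> U\<subseteq>V ==> act h ` (V - U) = V - act h ` U"
proof -
 assume h: "h\<in>H" "U\<subseteq>V"
 have "x\<in>act h ` (V - U)\<longleftrightarrow>x\<in>V - act h ` U" if "x\<in>V" for x
  using act_mem(2)[OF h(1) _ that, of "V - U"] act_mem(2)[OF h that] act_closed[of "inv h" x] h that by auto
 thus ?thesis using act_image_sub[OF h(1), of "V - U"] by blast
qed

lemma act_image_inv: "h\<in>H ==> U\<subseteq>V ==> act (inv h) ` act h ` U = U" "h\<in>H ==> U\<subseteq>V ==> act h ` act (inv h) ` U = U"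
 by (simp_all add: act_image_mult act_image_one)

lemma R0_rtrancl_uncrossed: "(x, y)\<in>R0\<^sup>* ==> U\<in>W ==> x\<in>U\<longleftrightarrow>y\<in>U"
 by (induction rule: rtrancl_induct) (use R0_uncrossed in auto)

lemma R1_rev: "(x, y)\<in>R1 ==> (y, x)\<in>R1"
 using R1_sym by (auto dest: symD)

lemma R_V: "(x, y)\<in>R0\<union>R1 ==> x\<in>V\<and>y\<in>V"
 using R0_V R1_V by blast

lemma W_edge': "(x, y)\<in>R1 ==> (x', y')\<in>R1 ==> U\<in>W ==>
   x\<notin>U ==> x'\<notin>U ==> y\<in>U ==> y'\<in>U ==> (y, y')\<in>R0\<^sup>*"
 using W_edge[OF R1_rev R1_rev W_compl] R1_V by blast

lemma R1_unique': "(x, y)\<in>R1 ==> U\<in>W ==> U'\<in>W ==> x\<notin>U ==> y\<in>U ==> x\<in>U' ==> y\<notin>U' ==> U' = V - U"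
 using R1_unique[of x y U "V - U'"] W_compl[of U'] R1_V W_sub[of U'] by blast

text \<open>Follow a path from \<open>x\<close> to the far side of \<open>U\<close> up to the first
  edge that crosses \<open>U\<close>.\<close>

lemma side_connected:
 assumes U: "U\<in>W" and x: "x\<in>V" "x\<notin>U"
 shows "\<exists>p q. (p, q)\<in>R1\<and>p\<notin>U\<and>q\<in>U\<and>(x, p)\<in>((R0\<union>R1)\<inter>(- U)\<times>(- U))\<^sup>*"
proof -
 obtain p0 q0 where "(p0, q0)\<in>R1" "q0\<in>U" using W_crossed[OF U] by blast
 hence "(x, q0)\<in>(R0\<union>R1)\<^sup>*" using conn x R1_V by blast
 thus ?thesis using x(2)
 proof (induction rule: converse_rtrancl_induct)
  case base thus ?case using \<open>q0\<in>U\<close> by blast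
 next
  case (step y z)
  show ?case
  proof (cases "z\<in>U")
   case True
   hence "(y, z)\<in>R1" using step R0_uncrossed U by blast
   thus ?thesis using True step by blast
  next
   case False
   then obtain p q where pq: "(p, q)\<in>R1" "p\<notin>U" "q\<in>U" "(z, p)\<in>((R0\<union>R1)\<inter>(- U)\<times>(- U))\<^sup>*"
    using step by blast
   moreover have "(y, z)\<in>(R0\<union>R1)\<inter>(- U)\<times>(- U)" using step False by blast
   ultimately show ?thesis by (meson converse_rtrancl_into_rtrancl)
  qed
 qed
qed

text \<open>A point outside both half-trees is joined outside \<open>U\<close> to an edge crossing
  \<open>U\<close>, whose outer end is identified with \<open>p\<close> and lies in
  \<open>U'\<close>. So the path enters \<open>U'\<close>, but edges entering \<open>U'\<close> have
  their outer end inside \<open>U\<close>, where the path never goes.\<close>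

lemma cover_if_facing:
 assumes U: "U\<in>W" and U': "U'\<in>W" and pq: "(p, q)\<in>R1" "p\<notin>U" "q\<in>U" "p\<in>U'"
  and pq': "(p', q')\<in>R1" "p'\<notin>U'" "q'\<in>U'" "p'\<in>U"
 shows "U\<union>U' = V"
proof -
 have "x\<in>U\<union>U'" if x: "x\<in>V" for x
 proof (rule ccontr)
  assume no: "x\<notin>U\<union>U'"
  then obtain p1 q1 where p1: "(p1, q1)\<in>R1" "p1\<notin>U" "q1\<in>U"
   "(x, p1)\<in>((R0\<union>R1)\<inter>(- U)\<times>(- U))\<^sup>*" using side_connected[OF U x] by blast
  have "(p1, p)\<in>R0\<^sup>*" using W_edge[OF p1(1) pq(1) U] p1 pq by blast
  hence "p1\<in>U'" using R0_rtrancl_uncrossed U' pq by blast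
  have "x\<notin>U'" using no by blast
  from p1(4) this have "p1\<notin>U'"
  proof (induction rule: rtrancl_induct)
   case (step y z)
   show ?case
   proof
    assume z: "z\<in>U'"
    hence "(y, z)\<in>R1" using step R0_uncrossed U' by blast
    hence "(y, p')\<in>R0\<^sup>*" using W_edge[OF _ pq'(1) U'] step z pq' by blast
    hence "y\<in>U" using R0_rtrancl_uncrossed U pq' by blast
    thus False using step by blast
   qed
  qed
  thus False using \<open>p1\<in>U'\<close> by blast
 qed
 thus ?thesis using W_sub U U' by blast
qed

text \<open>If an edge of one wall crosses the other as well, the walls agree up to complement.
  Otherwise each wall has an edge on one side of the other, and taking complements reduces the four
  positions to \<open>cover_if_facing\<close>.\<close>

lemma nested:
 assumes U: "U\<in>W" and U': "U'\<in>W"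
 shows "U\<subseteq>U' \<or> U'\<subseteq>U \<or> U\<inter>U' = {} \<or> U\<union>U' = V"
proof -
 have UV: "U\<subseteq>V" "U'\<subseteq>V" using W_sub U U' by auto
 obtain p q where pq: "(p, q)\<in>R1" "p\<notin>U" "q\<in>U" using W_crossed[OF U] by blast
 obtain p' q' where pq': "(p', q')\<in>R1" "p'\<notin>U'" "q'\<in>U'" using W_crossed[OF U'] by blast
 have V: "p\<in>V" "q\<in>V" "p'\<in>V" "q'\<in>V" using R1_V pq pq' by auto
 consider (a) "p\<in>U'" "q\<notin>U'" | (b) "p\<notin>U'" "q\<in>U'" | (c) "p'\<in>U" "q'\<notin>U" | (d) "p'\<notin>U" "q'\<in>U"
  | (e) "p\<in>U'\<longleftrightarrow>q\<in>U'" "p'\<in>U\<longleftrightarrow>q'\<in>U" by blast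
 thus ?thesis
 proof cases
  case a thus ?thesis using R1_unique'[OF pq(1) U U' pq(2,3)] by blast
 next
  case b thus ?thesis using R1_unique[OF pq(1) U U' pq(2,3)] by blast
 next
  case c thus ?thesis using R1_unique'[OF pq'(1) U' U pq'(2,3)] by blast
 next
  case d thus ?thesis using R1_unique[OF pq'(1) U' U pq'(2,3)] by blast
 next
  case e
  note co = W_compl[OF U] W_compl[OF U']
  consider "p\<in>U'" "p'\<in>U" | "p\<in>U'" "p'\<notin>U" | "p\<notin>U'" "p'\<in>U" | "p\<notin>U'" "p'\<notin>U" by blast
  thus ?thesis
  proof cases
   case 1 thus ?thesis using cover_if_facing[OF U U' pq _ pq'] by blast
  next
   case 2
   hence "(V - U)\<union>U' = V" using cover_if_facing[OF co(1) U' R1_rev[OF pq(1)] _ _ _ pq'] pq V e by blast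
   thus ?thesis using UV by blast
  next
   case 3
   hence "U\<union>(V - U') = V" using cover_if_facing[OF U co(2) pq _ R1_rev[OF pq'(1)]] pq' V e by blast
   thus ?thesis using UV by blast
  next
   case 4
   hence "(V - U)\<union>(V - U') = V"
    using cover_if_facing[OF co R1_rev[OF pq(1)] _ _ _ R1_rev[OF pq'(1)]] pq pq' V e by blast
   thus ?thesis using UV by blast
  qed
 qed
qed

text \<open>A single step of a path crosses at most one wall in a given direction.\<close>

lemma finite_between:
 assumes "x\<in>V" "y\<in>V"
 shows "finite {U\<in>W. x\<in>U\<and>y\<notin>U}"
proof -
 have "(x, y)\<in>(R0\<union>R1)\<^sup>*" using conn assms by blast
 thus ?thesis
 proof (induction rule: rtrancl_induct)
  case base thus ?case by simp
 next
  case (step y z)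
  have "{U\<in>W. x\<in>U\<and>z\<notin>U}\<subseteq>{U\<in>W. x\<in>U\<and>y\<notin>U}\<union>{U\<in>W. y\<in>U\<and>z\<notin>U}" by blast
  moreover have "finite {U\<in>W. y\<in>U\<and>z\<notin>U}"
  proof (cases "\<exists>U. U\<in>W\<and>y\<in>U\<and>z\<notin>U")
   case True
   then obtain U where U: "U\<in>W" "y\<in>U" "z\<notin>U" by blast
   hence "(z, y)\<in>R1" using step R0_uncrossed R1_rev by blast
   hence "{U\<in>W. y\<in>U\<and>z\<notin>U}\<subseteq>{U}" using R1_unique U by blast
   thus ?thesis using finite_subset by blast
  next
   case False
   hence "{U\<in>W. y\<in>U\<and>z\<notin>U} = {}" by blast
   thus ?thesis by (metis finite.emptyI)
  qed
  ultimately show ?case using step by (meson finite_UnI finite_subset)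
 qed
qed

text \<open>A path that crosses an edge into \<open>U\<close> must come back out of
  \<open>U\<close>, and both crossings use the same edge of the tree. Cutting out the excursion
  shortens the path until no edge is left.\<close>

lemma unseparated_R0:
 assumes "x\<in>V" "y\<in>V" "\<not> sep W x y"
 shows "(x, y)\<in>R0\<^sup>*"
proof -
 have "\<lbrakk>(x, y)\<in>(R0\<union>R1) ^^ n; \<not> sep W x y\<rbrakk> \<Longrightarrow> (x, y)\<in>R0\<^sup>*" for n x
 proof (induction n arbitrary: x rule: less_induct)
  case (less n)
  show ?case
  proof (cases n)
   case 0 thus ?thesis using less by simp
  next
   case (Suc m)
   then obtain z where z: "(x, z)\<in>R0\<union>R1" "(z, y)\<in>(R0\<union>R1) ^^ m"
    using less.prems(1) by (meson relpow_Suc_D2)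
   show ?thesis
   proof (cases "(x, z)\<in>R0")
    case True
    have "x\<in>U'\<longleftrightarrow>z\<in>U'" if "U'\<in>W" for U' by (rule R0_uncrossed[OF True that])
    hence "\<not> sep W z y" using less.prems(2) unfolding sep_def by simp
    hence "(z, y)\<in>R0\<^sup>*" using less.IH[of m] Suc z by simp
    thus ?thesis using True by (rule converse_rtrancl_into_rtrancl[rotated])
   next
    case False
    hence xz: "(x, z)\<in>R1" using z by blast
    then obtain U where U: "U\<in>W" "x\<notin>U" "z\<in>U" using R1_crosses by blast
    have yU: "y\<notin>U" using less.prems(2) U unfolding sep_def by blast
    have "\<lbrakk>(z, y)\<in>(R0\<union>R1) ^^ k; z\<in>U\<rbrakk> \<Longrightarrow>
      \<exists>a b j. j < k\<and>(a, b)\<in>R1\<and>a\<in>U\<and>b\<notin>U\<and>(b, y)\<in>(R0\<union>R1) ^^ j" for k z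
    proof (induction k arbitrary: z)
     case 0 thus ?case using yU by simp
    next
     case (Suc k)
     then obtain w where w: "(z, w)\<in>R0\<union>R1" "(w, y)\<in>(R0\<union>R1) ^^ k" by (meson relpow_Suc_D2)
     show ?case
     proof (cases "w\<in>U")
      case True thus ?thesis using Suc.IH[OF w(2)] by (meson less_SucI)
     next
      case False
      hence "(z, w)\<in>R1" using w Suc.prems R0_uncrossed U by blast
      thus ?thesis using False Suc.prems w by blast
     qed
    qed
    from this[OF z(2) U(3)] obtain a b j where ab: "j < m" "(a, b)\<in>R1" "a\<in>U" "b\<notin>U"
     "(b, y)\<in>(R0\<union>R1) ^^ j" by blast
    have xb: "(x, b)\<in>R0\<^sup>*" by (rule W_edge[OF xz R1_rev[OF ab(2)] U(1) U(2) ab(4) U(3) ab(3)])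
    have "x\<in>U'\<longleftrightarrow>b\<in>U'" if "U'\<in>W" for U' by (rule R0_rtrancl_uncrossed[OF xb that])
    hence "\<not> sep W b y" using less.prems(2) unfolding sep_def by simp
    hence "(b, y)\<in>R0\<^sup>*" using less.IH[of j b] ab Suc by simp
    thus ?thesis using xb by simp
   qed
  qed
 qed
 moreover obtain n where "(x, y)\<in>(R0\<union>R1) ^^ n" using conn[OF assms(1,2)] by (meson rtrancl_power)
 ultimately show ?thesis using assms(3) by blast
qed

lemma sep_sym: "sep I x y\<longleftrightarrow>sep I y x"
 unfolding sep_def by blast

lemma not_sep_trans: "\<not> sep I x y ==> \<not> sep I y z ==> \<not> sep I x z"
 unfolding sep_def by blast

lemma not_sep_refl [simp]: "\<not> sep I x x"
 unfolding sep_def by blast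

lemma sep_act:
 assumes I: "invariant I" and h: "h\<in>H" and xy: "x\<in>V" "y\<in>V"
 shows "sep I (act h x) (act h y)\<longleftrightarrow>sep I x y"
proof -
 have le: "sep I (act h x) (act h y)" if a: "sep I x y" "h\<in>H" "x\<in>V" "y\<in>V" for h x y
 proof -
  obtain U where U: "U\<in>I" "(x\<in>U)\<noteq>(y\<in>U)" using a(1) unfolding sep_def by blast
  have UV: "U\<subseteq>V" "act h ` U\<in>I" using I U a(2) W_sub unfolding invariant_def by auto
  have "(act h x\<in>act h ` U)\<noteq>(act h y\<in>act h ` U)"
   using U(2) act_mem(1)[OF a(2) UV(1) a(3)] act_mem(1)[OF a(2) UV(1) a(4)] by simp
  thus ?thesis unfolding sep_def using UV(2) by blast
 qed
 show ?thesis using le[OF _ h xy] le[of "act h x" "act h y" "inv h"] h xy act_closed by auto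
qed

lemma stab_subgroup:
 assumes I: "invariant I" and x: "x\<in>V"
 shows "subgroup (stab I x) G"
proof (rule subgroupI)
 show "stab I x\<subseteq>carrier G" unfolding stab_def by auto
 have "\<one>\<in>stab I x" unfolding stab_def using x by (simp add: act_one)
 thus "stab I x\<noteq>{}" by blast
 show "inv h\<in>stab I x" if "h\<in>stab I x" for h
 proof -
  have "\<not> sep I (act (inv h) x) (act (inv h) (act h x))"
   using that sep_act[OF I, of "inv h" x "act h x"] x act_closed unfolding stab_def by simp
  thus ?thesis using that x sep_sym unfolding stab_def by simp
 qed
 show "g\<otimes>h\<in>stab I x" if "g\<in>stab I x" "h\<in>stab I x" for g h
 proof -
  have "\<not> sep I (act g x) (act g (act h x))"
   using that sep_act[OF I, of g x "act h x"] x act_closed unfolding stab_def by simp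
  thus ?thesis using that x not_sep_trans unfolding stab_def by (auto simp: act_mult)
 qed
qed

lemma wstab_subgroup: "U\<subseteq>V ==> subgroup (wstab U) G"
proof (rule subgroupI)
 assume U: "U\<subseteq>V"
 show "wstab U\<subseteq>carrier G" unfolding wstab_def by auto
 have "\<one>\<in>wstab U" unfolding wstab_def using U by (simp add: act_image_one)
 thus "wstab U\<noteq>{}" by blast
 show "inv h\<in>wstab U" if "h\<in>wstab U" for h
  using that act_image_inv(1)[of h U] U unfolding wstab_def by simp
 show "g\<otimes>h\<in>wstab U" if "g\<in>wstab U" "h\<in>wstab U" for g h
  using that act_image_mult[of g h U] U unfolding wstab_def by simp
qed

lemma invariant_W: "invariant W"
 unfolding invariant_def using W_compl W_act by blast

text \<open>The first edge of a shortest path from the \<open>I\<close>-class of \<open>x\<close> to a point that is fixed modulo \<open>J\<close>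
 is itself fixed by \<open>S\<close>.\<close>

lemma common_fixed_point:
 assumes I: "invariant I" and J: "invariant J" and x: "x\<in>V" and S: "subgroup S G" "S\<subseteq>stab I x"
  and w0: "w0\<in>V" "\<And>s. s\<in>S ==> \<not> sep J w0 (act s w0)"
 shows "\<exists>z\<in>V. \<not> sep I x z\<and>(\<forall>s\<in>S. \<not> sep (I\<union>J) z (act s z))"
proof -
 have SH: "s\<in>H" if "s\<in>S" for s using that S unfolding stab_def by blast
 define Z where "Z = {z\<in>V. \<not> sep I x z}"
 define F where "F = {w\<in>V. \<forall>s\<in>S. \<not> sep J w (act s w)}"
 define P where "P n\<longleftrightarrow>(\<exists>z\<in>Z. \<exists>w\<in>F. (z, w)\<in>(R0\<union>R1) ^^ n)" for n
 have "x\<in>Z" "w0\<in>F" using x w0 unfolding Z_def F_def by auto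
 moreover obtain n0 where "(x, w0)\<in>(R0\<union>R1) ^^ n0" using conn[OF x w0(1)] by (meson rtrancl_power)
 ultimately have "\<exists>n. P n" unfolding P_def by blast
 then obtain n where n: "P n" "\<And>m. m < n ==> \<not> P m" using exists_least_iff[of P] by blast
 then obtain z w where zw: "z\<in>Z" "w\<in>F" "(z, w)\<in>(R0\<union>R1) ^^ n" unfolding P_def by blast
 have zV: "z\<in>V" and wV: "w\<in>V" using zw unfolding Z_def F_def by auto
 have sz: "\<not> sep I z (act s z)" if s: "s\<in>S" for s
 proof -
  have "\<not> sep I x (act s x)" using s S unfolding stab_def by blast
  moreover have "\<not> sep I (act s x) (act s z)" using sep_act[OF I SH[OF s] x zV] zw unfolding Z_def by blast
  moreover have "\<not> sep I z x" using zw sep_sym unfolding Z_def by blast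
  ultimately show ?thesis using not_sep_trans by blast
 qed
 show ?thesis
 proof (cases n)
  case 0
  hence "z\<in>F" using zw by simp
  hence "\<forall>s\<in>S. \<not> sep (I\<union>J) z (act s z)" using sz unfolding F_def sep_def by blast
  thus ?thesis using zw zV unfolding Z_def by blast
 next
  case (Suc m)
  then obtain b where b: "(z, b)\<in>R0\<union>R1" "(b, w)\<in>(R0\<union>R1) ^^ m" using zw(3) by (meson relpow_Suc_D2)
  obtain c where c: "(z, c)\<in>(R0\<union>R1) ^^ m" "(c, w)\<in>R0\<union>R1" using zw(3) Suc by auto
  have bV: "b\<in>V" and cV: "c\<in>V" using R_V b c by auto
  have "b\<notin>Z" using n(2)[of m] Suc b zw unfolding P_def by blast
  hence "sep I z b" using bV zw not_sep_trans unfolding Z_def by blast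
  then obtain U where U: "U\<in>I" "z\<notin>U" "b\<in>U"
   using I zV bV unfolding sep_def invariant_def by (metis DiffD2 DiffI)
  have UW: "U\<in>W" using U I unfolding invariant_def by blast
  have zb: "(z, b)\<in>R1" using b U UW R0_uncrossed by blast
  \<comment> \<open>The rest of the path never leaves \<open>U\<close>: it would pass through the
    class of \<open>z\<close> again, and a shorter path would start there.\<close>
  have noret: "q\<in>U" if "(b, q)\<in>(R0\<union>R1) ^^ i" "(q, w)\<in>(R0\<union>R1) ^^ j" "i + j = m" for q i j
   using that
  proof (induction i arbitrary: q j)
   case 0 thus ?case using U by simp
  next
   case (Suc i)
   then obtain p where p: "(b, p)\<in>(R0\<union>R1) ^^ i" "(p, q)\<in>R0\<union>R1" by auto
   have "(p, w)\<in>(R0\<union>R1) ^^ Suc j" using p Suc by (meson relpow_Suc_I2)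
   hence pU: "p\<in>U" using Suc.IH[of p "Suc j"] p Suc.prems by simp
   show ?case
   proof (rule ccontr)
    assume q: "q\<notin>U"
    hence "(p, q)\<in>R1" using p pU R0_uncrossed UW by blast
    hence "(z, q)\<in>R0\<^sup>*" using W_edge[OF zb R1_rev UW] U pU q by blast
    moreover from this have "\<not> sep I z q"
     using R0_rtrancl_uncrossed I unfolding sep_def invariant_def by blast
    moreover have "q\<in>V" using p R_V by blast
    ultimately have "q\<in>Z" using zw not_sep_trans unfolding Z_def by blast
    hence "P j" unfolding P_def using zw Suc.prems by blast
    thus False using n(2)[of j] Suc.prems \<open>n = Suc m\<close> by simp
   qed
  qed
  have wU: "w\<in>U" using noret[of w m 0] b by simp
  have "c\<notin>F" using n(2)[of m] Suc c zw unfolding P_def by blast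
  then obtain s0 where s0: "s0\<in>S" "sep J c (act s0 c)" using cV unfolding F_def by blast
  have "sep J c w"
  proof (rule ccontr)
   assume "\<not> sep J c w"
   moreover have "\<not> sep J (act s0 c) (act s0 w)" using calculation sep_act[OF J SH[OF s0(1)] cV wV] by blast
   moreover have "\<not> sep J w (act s0 w)" using zw s0 unfolding F_def by blast
   ultimately show False using s0(2) not_sep_trans sep_sym by metis
  qed
  then obtain U' where U': "U'\<in>J" "c\<notin>U'" "w\<in>U'"
   using J cV wV unfolding sep_def invariant_def by (metis DiffD2 DiffI)
  have U'W: "U'\<in>W" using U' J unfolding invariant_def by blast
  have cw: "(c, w)\<in>R1" using c U' U'W R0_uncrossed by blast
  \<comment> \<open>The same minimality at the other end: before \<open>w\<close> the path does not
    enter \<open>U'\<close>, as it would reach a fixed point earlier.\<close>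
  have noret': "q\<notin>U'" if "(z, q)\<in>(R0\<union>R1) ^^ i" "(q, c)\<in>(R0\<union>R1) ^^ j" "i + j = m" for q i j
   using that
  proof (induction j arbitrary: q i)
   case 0 thus ?case using U' by simp
  next
   case (Suc j)
   then obtain p where p: "(q, p)\<in>R0\<union>R1" "(p, c)\<in>(R0\<union>R1) ^^ j" by (meson relpow_Suc_D2)
   have "(z, p)\<in>(R0\<union>R1) ^^ Suc i" using p Suc by auto
   hence pU: "p\<notin>U'" using Suc.IH[of p "Suc i"] p Suc.prems by simp
   show ?case
   proof (rule ccontr)
    assume "\<not> q\<notin>U'"
    hence q: "q\<in>U'" by blast
    hence "(q, p)\<in>R1" using p pU R0_uncrossed U'W by blast
    hence wq: "(w, q)\<in>R0\<^sup>*" using W_edge'[OF cw R1_rev U'W] U' pU q by blast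
    have qV: "q\<in>V" using p R_V by blast
    have nsep: "\<not> sep J w q" using R0_rtrancl_uncrossed[OF wq] J unfolding sep_def invariant_def by blast
    have "\<not> sep J q (act s q)" if s: "s\<in>S" for s
    proof -
     have "\<not> sep J (act s w) (act s q)" using nsep sep_act[OF J SH[OF s] wV qV] by blast
     moreover have "\<not> sep J w (act s w)" using zw s unfolding F_def by blast
     ultimately show ?thesis using nsep not_sep_trans sep_sym by metis
    qed
    hence "q\<in>F" using qV unfolding F_def by blast
    hence "P i" unfolding P_def using zw Suc.prems by blast
    thus False using n(2)[of i] Suc.prems \<open>n = Suc m\<close> by simp
   qed
  qed
  have zU': "z\<notin>U'" using noret'[of z 0 m] c by simp
  \<comment> \<open>Otherwise \<open>U\<close> and its translate are distinct half-trees that start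
    at the vertex of \<open>z\<close>, hence disjoint. Then \<open>act s w\<close> lies outside
    \<open>U\<close> and so outside the smaller \<open>U'\<close>, while \<open>J\<close> does not
    separate it from \<open>w\<close>.\<close>
  have fixU: "act s ` U = U" if s: "s\<in>S" for s
  proof (rule ccontr)
   assume neq: "act s ` U\<noteq>U"
   note sH = SH[OF s]
   have UV: "U\<subseteq>V" using W_sub UW by blast
   have sUI: "act s ` U\<in>I" using I U sH unfolding invariant_def by blast
   hence sUW: "act s ` U\<in>W" using I unfolding invariant_def by blast
   have szb: "(act s z, act s b)\<in>R1" by (rule R1_act[OF sH zb])
   have szU: "act s z\<notin>U" using sz[OF s] U unfolding sep_def by blast
   have zsU': "act s z\<notin>act s ` U" using act_mem(1)[OF sH UV zV] U by blast
   hence zsU: "z\<notin>act s ` U" using sz[OF s] sUI unfolding sep_def by blast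
   have sbsU: "act s b\<in>act s ` U" using U by blast
   from nested[OF UW sUW] consider "U\<subseteq>act s ` U" | "act s ` U\<subseteq>U" | "U\<inter>act s ` U = {}" | "U\<union>act s ` U = V"
    by blast
   thus False
   proof cases
    case 1 thus False using R1_unique[OF zb UW sUW] U zsU neq by blast
   next
    case 2 thus False using R1_unique[OF szb UW sUW szU _ zsU' sbsU] sbsU neq by blast
   next
    case 3
    have "act s w\<in>act s ` U" using wU by blast
    hence swU: "act s w\<notin>U" using 3 by blast
    from nested[OF UW U'W] consider "U\<subseteq>U'" | "U'\<subseteq>U" | "U\<inter>U' = {}" | "U\<union>U' = V" by blast
    hence "U'\<subseteq>U"
    proof cases
     case 1 thus ?thesis using R1_unique[OF zb UW U'W] U zU' by blast
    qed (use wU U' zU' U zV in blast)+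
    hence "act s w\<notin>U'" using swU by blast
    moreover have "\<not> sep J w (act s w)" using zw s unfolding F_def by blast
    ultimately show False using U' unfolding sep_def by blast
   next
    case 4 thus False using zV U zsU by blast
   qed
  qed
  have "\<not> sep (I\<union>J) z (act s z)" if s: "s\<in>S" for s
  proof -
   have UV: "U\<subseteq>V" using W_sub UW by blast
   have "act s z\<notin>U" "act s b\<in>U"
    using act_mem(1)[OF SH[OF s] UV zV] act_mem(1)[OF SH[OF s] UV bV] fixU[OF s] U by auto
   hence "(z, act s z)\<in>R0\<^sup>*" using W_edge[OF zb R1_act[OF SH[OF s] zb] UW] U by blast
   thus ?thesis using R0_rtrancl_uncrossed I J unfolding sep_def invariant_def by blast
  qed
  thus ?thesis using zw zV unfolding Z_def by blast
 qed
qed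

end

section \<open>The wall space of a splitting\<close>

lemma pi1_class_eq: "pi1_eq \<Gamma> T u w ==> pi1_class \<Gamma> T u = pi1_class \<Gamma> T w"
 unfolding pi1_class_def using pi1_eq.sym pi1_eq.trans by blast

lemma pi1_class_mult:
 assumes u: "u\<in>lists (gog_letters \<Gamma>)" and w: "w\<in>lists (gog_letters \<Gamma>)"
 shows "pi1_class \<Gamma> T u \<otimes>\<^bsub>pi1 \<Gamma> T\<^esub> pi1_class \<Gamma> T w = pi1_class \<Gamma> T (u @ w)"
proof -
 have "pi1_class \<Gamma> T (a @ b) = pi1_class \<Gamma> T (u @ w)" if "a\<in>pi1_class \<Gamma> T u" "b\<in>pi1_class \<Gamma> T w" for a b
 proof -
  have "pi1_eq \<Gamma> T u a" "pi1_eq \<Gamma> T w b" using that unfolding pi1_class_def by auto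
  thus ?thesis using pi1_eq.append pi1_class_eq by metis
 qed
 moreover have "u\<in>pi1_class \<Gamma> T u" "w\<in>pi1_class \<Gamma> T w" unfolding pi1_class_def using pi1_eq.refl u w by auto
 ultimately have "(\<Union>a\<in>pi1_class \<Gamma> T u. \<Union>b\<in>pi1_class \<Gamma> T w. pi1_class \<Gamma> T (a @ b)) = pi1_class \<Gamma> T (u @ w)" by blast
 thus ?thesis unfolding pi1_def by simp
qed

locale splitting_group = group G for G :: "'a monoid" (structure) +
 fixes H :: "'a set" and \<Delta> :: "'a splitting"
 assumes H: "subgroup H G" and splitting: "splitting_of G H \<Delta>"
begin

abbreviation "ver \<equiv> verts (base (gr \<Delta>))"
abbreviation "ars \<equiv> arcs (base (gr \<Delta>))"
abbreviation "tl_of \<equiv> tail (base (gr \<Delta>))"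
abbreviation "hd_of \<equiv> head (base (gr \<Delta>))"
abbreviation "rev_of \<equiv> bar (gr \<Delta>)"
abbreviation "wds \<equiv> lists (gog_letters (gr \<Delta>))"
abbreviation "eqw \<equiv> pi1_eq (gr \<Delta>) (mtree \<Delta>)"
abbreviation "cls \<equiv> pi1_class (gr \<Delta>) (mtree \<Delta>)"
abbreviation "wrd \<equiv> word_in \<Delta>"
abbreviation "stb e \<equiv> word_in \<Delta> [EL e]"
abbreviation "vsub \<equiv> vertex_subgroup \<Delta>"
abbreviation "esub \<equiv> edge_subgroup \<Delta>"

sublocale gg: graph_of_groups "gr \<Delta>"
 using splitting unfolding splitting_of_def by blast

lemma Hsub [simp]: "g\<in>H ==> h\<in>H ==> g\<otimes>h\<in>H" "h\<in>H ==> inv h\<in>H" "\<one>\<in>H"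
  "h\<in>H ==> h\<in>carrier G"
 using H by (auto simp: subgroup.m_closed subgroup.m_inv_closed subgroup.one_closed subgroup.mem_carrier)

lemma letters [simp]: "VL v g\<in>gog_letters (gr \<Delta>)\<longleftrightarrow>v\<in>ver\<and>g\<in>carrier (vgroup (gr \<Delta>) v)"
  "EL e\<in>gog_letters (gr \<Delta>)\<longleftrightarrow>e\<in>ars"
 unfolding gog_letters_def by auto

lemma rev_arc [simp]: "e\<in>ars ==> rev_of e\<in>ars" "e\<in>ars ==> tl_of (rev_of e) = hd_of e"
  "e\<in>ars ==> hd_of (rev_of e) = tl_of e" "rev_of (rev_of e) = e" "e\<in>ars ==> rev_of e\<noteq>e"
  "e\<in>ars ==> tl_of e\<in>ver" "e\<in>ars ==> hd_of e\<in>ver"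
 using gg.arev_neq by auto

lemma eqw_of_cls: "w\<in>wds ==> cls u = cls w ==> eqw u w"
 using pi1_eq.refl[of w "gr \<Delta>" "mtree \<Delta>"] unfolding pi1_class_def by blast

lemma realization: "realization \<Delta>\<in>iso (pi1 (gr \<Delta>) (mtree \<Delta>)) (G\<lparr>carrier := H\<rparr>)"
 using splitting unfolding splitting_of_def by blast

lemma pi1_carrier: "carrier (pi1 (gr \<Delta>) (mtree \<Delta>)) = cls ` wds"
 unfolding pi1_def by simp

lemma wrd_H [simp]: "w\<in>wds ==> wrd w\<in>H"
proof -
 assume "w\<in>wds"
 hence "cls w\<in>carrier (pi1 (gr \<Delta>) (mtree \<Delta>))" unfolding pi1_carrier by blast
 thus ?thesis using realization unfolding iso_def hom_def word_in_def by auto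
qed

lemma wrd_append: "u\<in>wds ==> w\<in>wds ==> wrd (u @ w) = wrd u\<otimes>wrd w"
proof -
 assume uw: "u\<in>wds" "w\<in>wds"
 hence "cls u\<in>carrier (pi1 (gr \<Delta>) (mtree \<Delta>))" "cls w\<in>carrier (pi1 (gr \<Delta>) (mtree \<Delta>))"
  unfolding pi1_carrier by blast+
 hence "realization \<Delta> (cls u \<otimes>\<^bsub>pi1 (gr \<Delta>) (mtree \<Delta>)\<^esub> cls w) = wrd u\<otimes>wrd w"
  using realization unfolding iso_def hom_def word_in_def by auto
 thus ?thesis unfolding pi1_class_mult[OF uw] word_in_def .
qed

lemma wrd_Nil [simp]: "wrd [] = \<one>"
proof -
 have w: "[]\<in>wds" by simp
 have "wrd []\<otimes>wrd [] = wrd []" using wrd_append[OF w w] by simp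
 moreover have "wrd []\<in>carrier G" using wrd_H[OF w] by simp
 ultimately show ?thesis using l_cancel_one by blast
qed

lemma wrd_Cons: "l\<in>gog_letters (gr \<Delta>) ==> w\<in>wds ==> wrd (l # w) = wrd [l]\<otimes>wrd w"
 using wrd_append[of "[l]" w] by simp

lemma eqw_wrd: "eqw u w ==> wrd u = wrd w"
 unfolding word_in_def using pi1_class_eq[of "gr \<Delta>" "mtree \<Delta>" u w] by simp

lemma wrd_eqw: "u\<in>wds ==> w\<in>wds ==> wrd u = wrd w ==> eqw u w"
proof -
 assume uw: "u\<in>wds" "w\<in>wds" "wrd u = wrd w"
 have "inj_on (realization \<Delta>) (cls ` wds)"
  using realization unfolding iso_def bij_betw_def pi1_carrier by blast
 hence "cls u = cls w" using uw unfolding word_in_def inj_on_def by blast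
 thus ?thesis using eqw_of_cls uw by blast
qed

lemma wrd_onto: "h\<in>H ==> \<exists>w\<in>wds. wrd w = h"
proof -
 assume h: "h\<in>H"
 have "realization \<Delta> ` cls ` wds = H"
  using realization unfolding iso_def bij_betw_def pi1_carrier by auto
 hence "h\<in>(\<lambda>w. wrd w) ` wds" using h unfolding word_in_def image_image by blast
 thus ?thesis by blast
qed

lemma wrd_vertex_mult: "v\<in>ver ==> g\<in>carrier (vgroup (gr \<Delta>) v) ==> h\<in>carrier (vgroup (gr \<Delta>) v) ==>
  wrd [VL v (g \<otimes>\<^bsub>vgroup (gr \<Delta>) v\<^esub> h)] = wrd [VL v g]\<otimes>wrd [VL v h]"
 using eqw_wrd[OF pi1_eq.vertex_mult[of v "gr \<Delta>" g h "mtree \<Delta>"]] wrd_Cons[of "VL v g" "[VL v h]"] by simp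

lemma vsub_hom: "v\<in>ver ==> group_hom (vgroup (gr \<Delta>) v) G (\<lambda>g. wrd [VL v g])"
 unfolding group_hom_def group_hom_axioms_def hom_def
 using gg.group_vgroup is_group wrd_vertex_mult wrd_H by auto

lemma vsub_subgroup: "v\<in>ver ==> subgroup (vsub v) G"
 using group_hom.subgroup_img_is_subgroup[OF vsub_hom] group.subgroup_self[OF gg.group_vgroup]
 unfolding vertex_subgroup_def by blast

lemma vsub_H: "v\<in>ver ==> vsub v\<subseteq>H"
 unfolding vertex_subgroup_def by auto

lemma emb_hom: "e\<in>ars ==> group_hom (egroup (gr \<Delta>) e) (vgroup (gr \<Delta>) (hd_of e)) (emb (gr \<Delta>) e)"
 unfolding group_hom_def group_hom_axioms_def
 using gg.group_vgroup gg.group_egroup gg.emb_mon[of e] unfolding mon_def by auto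

lemma emb_rev_hom: "e\<in>ars ==> group_hom (egroup (gr \<Delta>) e) (vgroup (gr \<Delta>) (tl_of e)) (emb (gr \<Delta>) (rev_of e))"
 using emb_hom[of "rev_of e"] gg.egroup_bar by simp

lemma emb_closed [simp]: "e\<in>ars ==> a\<in>carrier (egroup (gr \<Delta>) e) ==> emb (gr \<Delta>) e a\<in>carrier (vgroup (gr \<Delta>) (hd_of e))"
 "e\<in>ars ==> a\<in>carrier (egroup (gr \<Delta>) e) ==> emb (gr \<Delta>) (rev_of e) a\<in>carrier (vgroup (gr \<Delta>) (tl_of e))"
 using group_hom.hom_closed[OF emb_hom] group_hom.hom_closed[OF emb_rev_hom] by blast+

lemma esub_subgroup: "e\<in>ars ==> subgroup (esub e) G"
proof -
 assume e: "e\<in>ars"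
 have "subgroup (emb (gr \<Delta>) (rev_of e) ` carrier (egroup (gr \<Delta>) e)) (vgroup (gr \<Delta>) (tl_of e))"
  using group_hom.subgroup_img_is_subgroup[OF emb_rev_hom[OF e]] group.subgroup_self[OF gg.group_egroup[OF e]] by blast
 hence "subgroup ((\<lambda>g. wrd [VL (tl_of e) g]) ` emb (gr \<Delta>) (rev_of e) ` carrier (egroup (gr \<Delta>) e)) G"
  using group_hom.subgroup_img_is_subgroup[OF vsub_hom] e by simp
 thus ?thesis unfolding edge_subgroup_def image_image .
qed

lemma esub_vsub: "e\<in>ars ==> esub e\<subseteq>vsub (tl_of e)"
 unfolding edge_subgroup_def vertex_subgroup_def by auto

lemma esub_H: "e\<in>ars ==> esub e\<subseteq>H"
 using esub_vsub vsub_H by force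

lemma stb_rev: "e\<in>ars ==> stb e\<otimes>stb (rev_of e) = \<one>"
 using eqw_wrd[OF pi1_eq.arc_inv[of e "gr \<Delta>" "mtree \<Delta>"]] wrd_Cons[of "EL e" "[EL (rev_of e)]"] by simp

lemma stb_H [simp]: "e\<in>ars ==> stb e\<in>H"
 by simp

lemma stb_rev_inv: "e\<in>ars ==> stb (rev_of e) = inv (stb e)"
 using stb_rev[of "rev_of e"] inv_equality[of "stb (rev_of e)" "stb e"] by simp

lemma stb_tree: "e\<in>mtree \<Delta> ==> e\<in>ars ==> stb e = \<one>"
 using eqw_wrd[OF pi1_eq.tree_arc[of e "mtree \<Delta>" "gr \<Delta>"]] by simp

lemma arc_conj_wrd: "e\<in>ars ==> a\<in>carrier (egroup (gr \<Delta>) e) ==>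
  stb e\<otimes>wrd [VL (hd_of e) (emb (gr \<Delta>) e a)]\<otimes>inv (stb e) = wrd [VL (tl_of e) (emb (gr \<Delta>) (rev_of e) a)]"
 using eqw_wrd[OF pi1_eq.arc_conj[of e "gr \<Delta>" a "mtree \<Delta>"]]
  wrd_Cons[of "EL e" "[VL (hd_of e) (emb (gr \<Delta>) e a), EL (rev_of e)]"]
  wrd_Cons[of "VL (hd_of e) (emb (gr \<Delta>) e a)" "[EL (rev_of e)]"]
 by (simp add: stb_rev_inv m_assoc)

lemma esub_rev: "e\<in>ars ==> esub e = (\<lambda>c. stb e\<otimes>c\<otimes>inv (stb e)) ` esub (rev_of e)"
proof -
 assume e: "e\<in>ars"
 have "(\<lambda>c. stb e\<otimes>c\<otimes>inv (stb e)) ` esub (rev_of e) =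
   (\<lambda>a. stb e\<otimes>wrd [VL (hd_of e) (emb (gr \<Delta>) e a)]\<otimes>inv (stb e)) ` carrier (egroup (gr \<Delta>) e)"
  unfolding edge_subgroup_def image_image using e gg.egroup_bar by simp
 also have "\<dots> = esub e" unfolding edge_subgroup_def
  by (rule image_cong[OF HOL.refl]) (rule arc_conj_wrd[OF e])
 finally show ?thesis ..
qed

lemma esub_rev_mem: "e\<in>ars ==> c\<in>H ==> c\<in>esub (rev_of e)\<longleftrightarrow>stb e\<otimes>c\<otimes>inv (stb e)\<in>esub e"
proof
 assume e: "e\<in>ars" and c: "c\<in>H"
 show "stb e\<otimes>c\<otimes>inv (stb e)\<in>esub e" if "c\<in>esub (rev_of e)"
  unfolding esub_rev[OF e] using that by (rule imageI)
 show "c\<in>esub (rev_of e)" if "stb e\<otimes>c\<otimes>inv (stb e)\<in>esub e"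
 proof -
  obtain d where d: "d\<in>esub (rev_of e)" "stb e\<otimes>c\<otimes>inv (stb e) = stb e\<otimes>d\<otimes>inv (stb e)"
   using \<open>stb e\<otimes>c\<otimes>inv (stb e)\<in>esub e\<close> unfolding esub_rev[OF e] by (rule imageE)
  have "d\<in>H" using d(1) esub_H[of "rev_of e"] e by auto
  hence "c = d" using d(2) c stb_H[OF e] by simp
  thus ?thesis using d by simp
 qed
qed

text \<open>The point \<open>(v, h)\<close> stands for the vertex of the Bass-Serre tree given by
  the left coset of \<open>vsub v\<close> that contains \<open>h\<close>; \<open>same\<close>
  identifies points of one coset, and \<open>adj\<close> joins the ends of translated arcs.\<close>

definition pts :: "(nat\<times>'a) set" where "pts = ver\<times>H"

definition trans_pt :: "'a => nat\<times>'a => nat\<times>'a" where "trans_pt g = (\<lambda>(v, h). (v, g\<otimes>h))"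

definition same :: "((nat\<times>'a)\<times>(nat\<times>'a)) set" where
 "same = {((v, h), (v, h\<otimes>g)) | v h g. v\<in>ver\<and>h\<in>H\<and>g\<in>vsub v}"

definition adj :: "((nat\<times>'a)\<times>(nat\<times>'a)) set" where
 "adj = {((tl_of f, h), (hd_of f, h\<otimes>stb f)) | f h. f\<in>ars\<and>h\<in>H}"

lemma sameI: "v\<in>ver ==> h\<in>H ==> k\<in>H ==> inv h\<otimes>k\<in>vsub v ==> ((v, h), (v, k))\<in>same"
proof -
 assume a: "v\<in>ver" "h\<in>H" "k\<in>H" "inv h\<otimes>k\<in>vsub v"
 have "k = h\<otimes>(inv h\<otimes>k)" using a(2,3) by (simp add: inv_cancel[OF is_group])
 thus ?thesis unfolding same_def using a by blast
qed

lemma same_pts: "(x, y)\<in>same ==> x\<in>pts\<and>y\<in>pts"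
proof -
 assume "(x, y)\<in>same"
 then obtain v h g where p: "x = (v, h)" "y = (v, h\<otimes>g)" "v\<in>ver" "h\<in>H" "g\<in>vsub v" unfolding same_def by blast
 have "g\<in>H" using p vsub_H by blast
 thus ?thesis unfolding p(1,2) pts_def using p(3,4) by simp
qed

lemma adjI: "f\<in>ars ==> h\<in>H ==> ((tl_of f, h), (hd_of f, h\<otimes>stb f))\<in>adj"
 unfolding adj_def by blast

lemma same_sym: "sym same"
proof (rule symI)
 fix x y assume "(x, y)\<in>same"
 then obtain v h g where p: "x = (v, h)" "y = (v, h\<otimes>g)" "v\<in>ver" "h\<in>H" "g\<in>vsub v" unfolding same_def by blast
 have g: "g\<in>H" using p vsub_H by blast
 have "inv (h\<otimes>g)\<otimes>h = inv g" using p g by (simp add: inv_mult_group m_assoc)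
 hence "inv (h\<otimes>g)\<otimes>h\<in>vsub v" using subgroup.m_inv_closed[OF vsub_subgroup[OF p(3)] p(5)] by simp
 thus "(y, x)\<in>same" unfolding p(1,2) by (intro sameI) (use p g in auto)
qed

lemma adj_sym: "sym adj"
proof (rule symI)
 fix x y assume "(x, y)\<in>adj"
 then obtain f h where p: "x = (tl_of f, h)" "y = (hd_of f, h\<otimes>stb f)" "f\<in>ars" "h\<in>H" unfolding adj_def by blast
 have "((tl_of (rev_of f), h\<otimes>stb f), (hd_of (rev_of f), h\<otimes>stb f\<otimes>stb (rev_of f)))\<in>adj"
  by (rule adjI) (use p in auto)
 moreover have "h\<otimes>stb f\<otimes>stb (rev_of f) = h" using p stb_rev by (simp add: m_assoc)
 ultimately show "(y, x)\<in>adj" unfolding p(1,2) using p(3) by simp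
qed

lemma tree_path:
 assumes "u\<in>ver" "v\<in>ver"
 shows "\<exists>!p. gg.awalk u p v\<and>set p\<subseteq>mtree \<Delta>\<and>successively (\<lambda>e f. f\<noteq>rev_of e) p"
 using splitting assms unfolding splitting_of_def maximal_tree_def by blast

lemma tree_arcs: "f\<in>mtree \<Delta> ==> f\<in>ars" "f\<in>mtree \<Delta> ==> rev_of f\<in>mtree \<Delta>"
 using splitting unfolding splitting_of_def maximal_tree_def by blast+

lemma tree_walk_adj:
 assumes "gg.awalk u p v" "set p\<subseteq>mtree \<Delta>" "h\<in>H"
 shows "((u, h), (v, h))\<in>(same\<union>adj)\<^sup>*"
 using assms
proof (induction p arbitrary: u)
 case Nil thus ?case by (simp add: gg.awalk_Nil_iff)
next
 case (Cons e p)
 have e: "e\<in>ars" "u = tl_of e" "gg.awalk (hd_of e) p v" "stb e = \<one>"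
  using Cons.prems stb_tree[of e] by (simp_all add: gg.awalk_Cons_iff)
 have "((tl_of e, h), (hd_of e, h\<otimes>stb e))\<in>adj" using adjI e Cons.prems by blast
 hence "((u, h), (hd_of e, h))\<in>same\<union>adj" using e Cons.prems by simp
 thus ?case using Cons.IH[OF e(3)] Cons.prems by (auto intro: converse_rtrancl_into_rtrancl)
qed

lemma connected_level: "u\<in>ver ==> v\<in>ver ==> h\<in>H ==> ((u, h), (v, h))\<in>(same\<union>adj)\<^sup>*"
 using ex1_implies_ex[OF tree_path[of u v]] tree_walk_adj by blast

text \<open>Every word spells a path: a vertex letter moves within a coset, an arc letter crosses an
  edge, and between letters the path runs along a translate of the maximal tree.\<close>

lemma connected_word:
 assumes "w\<in>wds" "h\<in>H" "u\<in>ver" "v\<in>ver"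
 shows "((u, h), (v, h\<otimes>wrd w))\<in>(same\<union>adj)\<^sup>*"
 using assms
proof (induction w arbitrary: h u)
 case Nil thus ?case using connected_level by simp
next
 case (Cons l w)
 have l: "l\<in>gog_letters (gr \<Delta>)" "w\<in>wds" "wrd [l]\<in>H" using Cons.hyps by simp_all
 have "\<exists>a b. a\<in>ver\<and>b\<in>ver\<and>((a, h), (b, h\<otimes>wrd [l]))\<in>same\<union>adj"
 proof (cases l)
  case (VL v g)
  hence "v\<in>ver" "wrd [l]\<in>vsub v" using l unfolding vertex_subgroup_def by auto
  thus ?thesis using Cons.prems unfolding same_def by blast
 next
  case (EL f)
  hence "f\<in>ars" using l by simp
  hence "tl_of f\<in>ver\<and>hd_of f\<in>ver\<and>((tl_of f, h), (hd_of f, h\<otimes>wrd [l]))\<in>same\<union>adj"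
   using adjI[of f h] Cons.prems EL by simp
  thus ?thesis by blast
 qed
 then obtain a b where ab: "a\<in>ver" "b\<in>ver" "((a, h), (b, h\<otimes>wrd [l]))\<in>same\<union>adj" by blast
 have "((u, h), (a, h))\<in>(same\<union>adj)\<^sup>*" using connected_level Cons.prems ab by blast
 moreover have "((b, h\<otimes>wrd [l]), (v, h\<otimes>wrd [l]\<otimes>wrd w))\<in>(same\<union>adj)\<^sup>*"
  by (rule Cons.IH) (use Cons.prems l ab in auto)
 moreover have "h\<otimes>wrd [l]\<otimes>wrd w = h\<otimes>wrd (l # w)"
  using wrd_Cons[OF l(1,2)] l Cons.prems by (simp add: m_assoc)
 ultimately show ?case using ab(3) by (metis rtrancl.rtrancl_into_rtrancl rtrancl_trans)
qed

lemma connected: "x\<in>pts ==> y\<in>pts ==> (x, y)\<in>(same\<union>adj)\<^sup>*"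
proof -
 assume "x\<in>pts" "y\<in>pts"
 then obtain u h v k where p: "x = (u, h)" "y = (v, k)" "u\<in>ver" "v\<in>ver" "h\<in>H" "k\<in>H" unfolding pts_def by auto
 obtain w where w: "w\<in>wds" "wrd w = inv h\<otimes>k" using wrd_onto[of "inv h\<otimes>k"] p by auto
 have "h\<otimes>wrd w = k" using w p by (simp add: inv_cancel[OF is_group])
 thus ?thesis using connected_word[OF w(1) p(5,3,4)] p by simp
qed

text \<open>Sum \<open>\<sigma>\<close> along the unique reduced tree path from a base vertex.
  Appending \<open>f\<close> to the path to its tail either gives a reduced path or cancels a final
  \<open>rev_of f\<close>; antisymmetry makes the increment the same.\<close>

lemma tree_potential:
 assumes sigma: "\<And>f. f\<in>ars ==> \<sigma> (rev_of f) = - \<sigma> f"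
 shows "\<exists>c :: nat => int. \<forall>f\<in>mtree \<Delta>. c (hd_of f) = c (tl_of f) + \<sigma> f"
proof -
 obtain b where b: "b\<in>ver" using gg.nonempty by blast
 define good where "good v p\<longleftrightarrow>gg.awalk b p v\<and>set p\<subseteq>mtree \<Delta>\<and>successively (\<lambda>e f. f\<noteq>rev_of e) p" for v p
 define path where "path v = (THE p. good v p)" for v
 have path: "good v (path v)" if "v\<in>ver" for v
  unfolding path_def using theI'[OF tree_path[OF b that]] unfolding good_def .
 have uniq: "path v = p" if "good v p" for v p
 proof -
  have "v\<in>ver" using that gg.awalk_last_in_verts unfolding good_def by blast
  thus ?thesis using tree_path[OF b] path that unfolding good_def by blast
 qed
 have "sum_list (map \<sigma> (path (hd_of f))) = sum_list (map \<sigma> (path (tl_of f))) + \<sigma> f" if f: "f\<in>mtree \<Delta>" for f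
 proof -
  have fa: "f\<in>ars" "rev_of f\<in>ars" using f tree_arcs by auto
  define p where "p = path (tl_of f)"
  have p: "good (tl_of f) p" unfolding p_def using path fa by simp
  show ?thesis
  proof (cases "p\<noteq>[]\<and>last p = rev_of f")
   case True
   then obtain q where q: "p = q @ [rev_of f]" by (metis append_butlast_last_id)
   have "gg.awalk b q (gg.awlast b q)" "gg.awalk (gg.awlast b q) [rev_of f] (tl_of f)"
    using p unfolding good_def q by (simp_all only: gg.awalk_append_iff)
   hence "gg.awalk b q (hd_of f)" using fa by (simp add: gg.awalk_Cons_iff)
   hence "good (hd_of f) q" using p unfolding good_def q by (simp add: successively_append_iff)
   thus ?thesis using uniq sigma[OF fa(1)] q unfolding p_def[symmetric] by simp
  next
   case False
   have "gg.awalk b (p @ [f]) (hd_of f)"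
    using p gg.arc_implies_awalk[OF fa(1)] unfolding good_def by (intro gg.awalk_appendI) auto
   moreover have "f\<noteq>rev_of (last p)" if "p\<noteq>[]" using False that by auto
   ultimately have "good (hd_of f) (p @ [f])" using p f unfolding good_def by (auto simp: successively_append_iff)
   thus ?thesis using uniq unfolding p_def[symmetric] by fastforce
  qed
 qed
 thus ?thesis by (intro exI[of _ "\<lambda>v. sum_list (map \<sigma> (path v))"]) blast
qed

text \<open>The half-tree behind the edge of the Bass-Serre tree that is given by \<open>e\<close>
  and the coset of \<open>esub e\<close> containing \<open>k\<close>.\<close>

definition is_wall :: "nat => 'a => (nat\<times>'a) set => bool" where
 "is_wall e k U\<longleftrightarrow>U\<subseteq>pts\<and>(\<forall>(x, y)\<in>same. x\<in>U\<longleftrightarrow>y\<in>U) \<and>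
  (\<forall>f\<in>ars. \<forall>h\<in>H. (tl_of f, h)\<notin>U\<and>(hd_of f, h\<otimes>stb f)\<in>U\<longleftrightarrow>f = e\<and>inv k\<otimes>h\<in>esub e)"

section \<open>The half-tree behind one edge, by counting crossings\<close>

context
 fixes e c
 assumes e: "e\<in>ars"
  and c: "\<And>f. f\<in>mtree \<Delta> ==> (c (hd_of f) :: int) = c (tl_of f) + (of_bool (f = e) - of_bool (f = rev_of e))"
begin

text \<open>A letter is counted as a detour: at level \<open>h\<close> go along the tree from a
  fictitious vertex of potential 0 to the vertex of the letter, apply the letter, and return at the
  new level. Crossings count only at levels in \<open>esub e\<close>, hence the factors
  \<open>of_bool\<close>.\<close>

fun letter_weight :: "'a => (nat, nat, 'a) gog_letter => int" where
 "letter_weight h (VL v g) = of_bool (h\<in>esub e) * c v - of_bool (h\<otimes>wrd [VL v g]\<in>esub e) * c v"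
| "letter_weight h (EL f) = of_bool (h\<in>esub e) * c (tl_of f) + of_bool (f = e\<and>h\<in>esub e)
  - of_bool (f = rev_of e\<and>h\<otimes>stb f\<in>esub e) - of_bool (h\<otimes>stb f\<in>esub e) * c (hd_of f)"

primrec word_weight :: "'a => (nat, nat, 'a) gog_letter list => int" where
 "word_weight h [] = 0"
| "word_weight h (l # w) = letter_weight h l + word_weight (h\<otimes>wrd [l]) w"

lemma word_weight_append: "u\<in>wds ==> h\<in>H ==>
  word_weight h (u @ w) = word_weight h u + word_weight (h\<otimes>wrd u) w"
proof (induction u arbitrary: h)
 case (Cons l u)
 have l: "l\<in>gog_letters (gr \<Delta>)" "u\<in>wds" "wrd [l]\<in>H" "wrd u\<in>H" using Cons.prems by auto
 have "h\<otimes>wrd [l]\<otimes>wrd u = h\<otimes>wrd (l # u)"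
  using wrd_Cons[OF l(1,2)] l Cons.prems by (simp add: m_assoc)
 thus ?case using Cons.IH[of "h\<otimes>wrd [l]"] Cons.prems l by simp
qed simp

lemma esub_coset: "h\<in>H ==> d\<in>esub e ==> h\<otimes>d\<in>esub e\<longleftrightarrow>h\<in>esub e"
 using subgroup.m_closed[OF esub_subgroup[OF e]] subgroup.m_inv_closed[OF esub_subgroup[OF e]]
  subgroup.mem_carrier[OF esub_subgroup[OF e]]
 by (metis Hsub(4) inv_solve_right')

text \<open>If the arc is \<open>e\<close> or its reverse, the vertex letter in the middle moves the
  level within a coset of \<open>esub e\<close>, so the crossings on the way out and back
  cancel.\<close>

lemma weight_conj:
 assumes f: "f\<in>ars" and a: "a\<in>carrier (egroup (gr \<Delta>) f)" and h: "h\<in>H"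
 shows "word_weight h [EL f, VL (hd_of f) (emb (gr \<Delta>) f a), EL (rev_of f)] =
  word_weight h [VL (tl_of f) (emb (gr \<Delta>) (rev_of f) a)]"
proof -
 define p where "p = wrd [VL (hd_of f) (emb (gr \<Delta>) f a)]"
 define q where "q = wrd [VL (tl_of f) (emb (gr \<Delta>) (rev_of f) a)]"
 have pq: "p\<in>H" "q\<in>H" unfolding p_def q_def using f a by simp_all
 have "stb f\<otimes>p\<otimes>inv (stb f) = q" unfolding p_def q_def by (rule arc_conj_wrd[OF f a])
 hence "h\<otimes>q = h\<otimes>(stb f\<otimes>p\<otimes>inv (stb f))" by simp
 also have "\<dots> = h\<otimes>stb f\<otimes>p\<otimes>stb (rev_of f)"
  unfolding stb_rev_inv[OF f] using pq h stb_H[OF f] by (simp add: m_assoc)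
 finally have hq: "h\<otimes>stb f\<otimes>p\<otimes>stb (rev_of f) = h\<otimes>q" ..
 have 1: "h\<otimes>q\<in>esub e\<longleftrightarrow>h\<in>esub e" if "f = e"
 proof -
  have "q\<in>esub e" unfolding q_def edge_subgroup_def using a that by blast
  thus ?thesis by (rule esub_coset[OF h])
 qed
 have 2: "h\<otimes>stb f\<otimes>p\<in>esub e\<longleftrightarrow>h\<otimes>stb f\<in>esub e" if "rev_of f = e"
 proof -
  have r: "rev_of e = f" using that by auto
  have "p\<in>esub e" unfolding p_def edge_subgroup_def r
   using a that f gg.egroup_bar[OF f] by (intro image_eqI[of _ _ a]) auto
  thus ?thesis using esub_coset h f by simp
 qed
 have r: "f = rev_of e\<longleftrightarrow>rev_of f = e" and r2: "rev_of f = rev_of e\<longleftrightarrow>f = e" by (metis rev_arc(4))+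
 have LR: "word_weight h [EL f, VL (hd_of f) (emb (gr \<Delta>) f a), EL (rev_of f)] =
   of_bool (h\<in>esub e) * c (tl_of f) + of_bool (f = e\<and>h\<in>esub e)
   - of_bool (rev_of f = e\<and>h\<otimes>stb f\<in>esub e) + of_bool (rev_of f = e\<and>h\<otimes>stb f\<otimes>p\<in>esub e)
   - of_bool (f = e\<and>h\<otimes>q\<in>esub e) - of_bool (h\<otimes>q\<in>esub e) * c (tl_of f)"
  "word_weight h [VL (tl_of f) (emb (gr \<Delta>) (rev_of f) a)] =
   of_bool (h\<in>esub e) * c (tl_of f) - of_bool (h\<otimes>q\<in>esub e) * c (tl_of f)"
  using f r hq r2 by (simp_all add: p_def[symmetric] q_def[symmetric])
 have "(f = e\<and>h\<otimes>q\<in>esub e) = (f = e\<and>h\<in>esub e)"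
  "(rev_of f = e\<and>h\<otimes>stb f\<otimes>p\<in>esub e) = (rev_of f = e\<and>h\<otimes>stb f\<in>esub e)" using 1 2 by blast+
 thus ?thesis unfolding LR by simp
qed

text \<open>Hence the weight depends on the group element only. The relation for tree arcs is the
  one that forces \<open>c\<close> to be a potential on the maximal tree.\<close>

lemma weight_eqw: "eqw u w ==> u\<in>wds\<and>w\<in>wds\<and>(\<forall>h\<in>H. word_weight h u = word_weight h w)"
proof (induction rule: pi1_eq.induct)
 case (append u u' w w')
 have "wrd u = wrd u'" using append.hyps(1) by (rule eqw_wrd)
 thus ?case using append by (auto simp: word_weight_append)
next
 case (vertex_mult v g h)
 have "g \<otimes>\<^bsub>vgroup (gr \<Delta>) v\<^esub> h\<in>carrier (vgroup (gr \<Delta>) v)"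
  using vertex_mult gg.group_vgroup by (simp add: monoid.m_closed group.is_monoid)
 moreover have "x\<otimes>wrd [VL v g]\<otimes>wrd [VL v h] = x\<otimes>wrd [VL v (g \<otimes>\<^bsub>vgroup (gr \<Delta>) v\<^esub> h)]" if "x\<in>H" for x
  using that vertex_mult wrd_vertex_mult by (simp add: m_assoc)
 ultimately show ?case using vertex_mult by simp
next
 case (vertex_one v)
 have "[VL v \<one>\<^bsub>vgroup (gr \<Delta>) v\<^esub>]\<in>wds"
  using vertex_one gg.group_vgroup by (simp add: monoid.one_closed group.is_monoid)
 moreover have "wrd [VL v \<one>\<^bsub>vgroup (gr \<Delta>) v\<^esub>] = \<one>"
  using eqw_wrd[OF pi1_eq.vertex_one[OF vertex_one, of "mtree \<Delta>"]] by simp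
 ultimately show ?case by simp
next
 case (arc_inv f)
 have "x\<otimes>stb f\<otimes>stb (rev_of f) = x" if "x\<in>H" for x using arc_inv that stb_rev by (simp add: m_assoc)
 moreover have "f = rev_of e\<longleftrightarrow>rev_of f = e" "rev_of f = rev_of e\<longleftrightarrow>f = e" by (metis rev_arc(4))+
 ultimately show ?case using arc_inv by simp
next
 case (arc_conj f a)
 show ?case
 proof (intro conjI ballI)
  show "[EL f, VL (hd_of f) (emb (gr \<Delta>) f a), EL (rev_of f)]\<in>wds" using arc_conj by simp
  show "[VL (tl_of f) (emb (gr \<Delta>) (rev_of f) a)]\<in>wds" using arc_conj by simp
 qed (rule weight_conj[OF arc_conj])
next
 case (tree_arc f)
 show ?case using tree_arc stb_tree[of f] c[of f] by (auto simp: of_bool_def)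
qed auto

text \<open>The signed number of crossings of the wall along a path from the base point; \<open>c\<close> accounts for
 the arcs of the maximal tree, which are invisible in the group.\<close>

definition potential :: "nat\<times>'a => int" where
 "potential = (\<lambda>(v, h). word_weight \<one> (SOME w. w\<in>wds\<and>wrd w = h) + of_bool (h\<in>esub e) * c v)"

lemma potential_word: "w\<in>wds ==> potential (v, wrd w) = word_weight \<one> w + of_bool (wrd w\<in>esub e) * c v"
proof -
 assume w: "w\<in>wds"
 define u where "u = (SOME u. u\<in>wds\<and>wrd u = wrd w)"
 have "u\<in>wds\<and>wrd u = wrd w" unfolding u_def by (rule someI[of _ w]) (use w in simp)
 hence "word_weight \<one> u = word_weight \<one> w" using weight_eqw[OF wrd_eqw[of u w]] w by simp
 thus ?thesis unfolding potential_def u_def by simp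
qed

lemma potential_letter: "h\<in>H ==> l\<in>gog_letters (gr \<Delta>) ==> potential (v, h\<otimes>wrd [l]) =
  potential (u, h) - of_bool (h\<in>esub e) * c u + letter_weight h l + of_bool (h\<otimes>wrd [l]\<in>esub e) * c v"
proof -
 assume h: "h\<in>H" and l: "l\<in>gog_letters (gr \<Delta>)"
 obtain w where w: "w\<in>wds" "wrd w = h" using wrd_onto[OF h] by blast
 have "h\<otimes>wrd [l] = wrd (w @ [l])" using wrd_append[OF w(1), of "[l]"] l w by simp
 thus ?thesis using potential_word[of "w @ [l]" v] potential_word[OF w(1), of u] w l
  by (simp add: word_weight_append h)
qed

lemma potential_same: "(x, y)\<in>same ==> potential x = potential y"
proof -
 assume "(x, y)\<in>same"
 then obtain v h g where p: "x = (v, h)" "y = (v, h\<otimes>g)" "v\<in>ver" "h\<in>H" "g\<in>vsub v" unfolding same_def by blast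
 obtain a where a: "a\<in>carrier (vgroup (gr \<Delta>) v)" "g = wrd [VL v a]" using p(5) unfolding vertex_subgroup_def by blast
 show ?thesis using potential_letter[OF p(4), of "VL v a" v v] a p by simp
qed

lemma potential_arc: "f\<in>ars ==> h\<in>H ==> potential (hd_of f, h\<otimes>stb f) =
  potential (tl_of f, h) + of_bool (f = e\<and>h\<in>esub e) - of_bool (f = rev_of e\<and>h\<otimes>stb f\<in>esub e)"
 using potential_letter[of h "EL f" "hd_of f" "tl_of f"] by simp

lemma potential_esub: "h\<in>esub e ==> potential (tl_of e, h) = potential (tl_of e, \<one>)"
proof -
 assume "h\<in>esub e"
 hence h: "h\<in>vsub (tl_of e)" "h\<in>H" using esub_vsub[OF e] esub_H[OF e] by blast+
 have "((tl_of e, \<one>), (tl_of e, h))\<in>same" using h e by (intro sameI) simp_all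
 thus ?thesis using potential_same by simp
qed

text \<open>All counted edges start in the class of \<open>(tl_of e, \<one>)\<close>, so an upward
  crossing begins at the base value and a downward crossing ends there.\<close>

lemma potential_cases:
 assumes "x\<in>pts"
 shows "potential x = potential (tl_of e, \<one>) \<or> potential x = potential (tl_of e, \<one>) + 1"
proof -
 have "((tl_of e, \<one>), x)\<in>(same\<union>adj)\<^sup>*" using connected assms e unfolding pts_def by auto
 thus ?thesis
 proof (induction rule: rtrancl_induct)
  case (step y z)
  show ?case
  proof (cases "(y, z)\<in>same")
   case True thus ?thesis using potential_same step.IH by auto
  next
   case False
   then obtain f h where p: "y = (tl_of f, h)" "z = (hd_of f, h\<otimes>stb f)" "f\<in>ars" "h\<in>H"
    using step.hyps unfolding adj_def by blast
   note ars = potential_arc[OF p(3,4)]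
   show ?thesis
   proof (cases "f = rev_of e\<and>h\<otimes>stb f\<in>esub e")
    case True
    hence "hd_of f = tl_of e" using e by auto
    hence "potential z = potential (tl_of e, \<one>)" using True potential_esub p(2) by metis
    thus ?thesis by simp
   next
    case nd: False
    show ?thesis
    proof (cases "f = e\<and>h\<in>esub e")
     case True
     hence "potential y = potential (tl_of e, \<one>)" using potential_esub p(1) by simp
     thus ?thesis using ars True nd p by simp
    next
     case False
     hence "of_bool (f = e\<and>h\<in>esub e) = (0 :: int)" by auto
     moreover have "of_bool (f = rev_of e\<and>h\<otimes>stb f\<in>esub e) = (0 :: int)" using nd by auto
     ultimately have "potential z = potential y" using ars unfolding p by linarith
     thus ?thesis using step.IH by simp
    qed
   qed
  qed
 qed simp
qed

lemma potential_wall: "is_wall e \<one> {x\<in>pts. potential x\<noteq>potential (tl_of e, \<one>)}"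
proof -
 let ?m = "potential (tl_of e, \<one>)"
 have "(tl_of f, h)\<notin>{x\<in>pts. potential x\<noteq>?m}\<and>(hd_of f, h\<otimes>stb f)\<in>{x\<in>pts. potential x\<noteq>?m}
   \<longleftrightarrow>f = e\<and>inv \<one>\<otimes>h\<in>esub e" if f: "f\<in>ars" and h: "h\<in>H" for f h
 proof -
  have V: "(tl_of f, h)\<in>pts" "(hd_of f, h\<otimes>stb f)\<in>pts" using f h unfolding pts_def by auto
  note ars = potential_arc[OF f h]
  have "potential (tl_of f, h) = ?m\<and>potential (hd_of f, h\<otimes>stb f)\<noteq>?m\<longleftrightarrow>f = e\<and>h\<in>esub e"
  proof
   assume a: "f = e\<and>h\<in>esub e"
   hence "f\<noteq>rev_of e" using rev_arc(5)[OF e] by metis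
   moreover have "potential (tl_of f, h) = ?m" using a potential_esub by simp
   ultimately show "potential (tl_of f, h) = ?m\<and>potential (hd_of f, h\<otimes>stb f)\<noteq>?m" using ars a by simp
  next
   assume a: "potential (tl_of f, h) = ?m\<and>potential (hd_of f, h\<otimes>stb f)\<noteq>?m"
   have "potential (hd_of f, h\<otimes>stb f) = ?m + 1" using potential_cases[OF V(2)] a by simp
   thus "f = e\<and>h\<in>esub e" using ars a by (auto split: if_splits simp: of_bool_def)
  qed
  thus ?thesis using V h by simp
 qed
 moreover have "\<forall>(x, y)\<in>same. x\<in>{x\<in>pts. potential x\<noteq>?m}\<longleftrightarrow>y\<in>{x\<in>pts. potential x\<noteq>?m}"
  using same_pts potential_same by fastforce
 ultimately show ?thesis unfolding is_wall_def by blast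
qed

end

lemma base_wall:
 assumes e: "e\<in>ars"
 shows "\<exists>U. is_wall e \<one> U"
proof -
 define \<sigma> :: "nat => int" where "\<sigma> f = of_bool (f = e) - of_bool (f = rev_of e)" for f
 have "rev_of f = e\<longleftrightarrow>f = rev_of e" "rev_of f = rev_of e\<longleftrightarrow>f = e" for f by (metis rev_arc(4))+
 hence "\<sigma> (rev_of f) = - \<sigma> f" for f unfolding \<sigma>_def by simp
 hence "\<exists>c :: nat => int. \<forall>f\<in>mtree \<Delta>. c (hd_of f) = c (tl_of f) + \<sigma> f" by (rule tree_potential)
 then obtain c where c: "\<And>f. f\<in>mtree \<Delta> ==> c (hd_of f) = c (tl_of f) + \<sigma> f" by blast
 show ?thesis by (rule exI) (rule potential_wall[OF e c[unfolded \<sigma>_def]])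
qed


lemma act_pts: "g\<in>H ==> x\<in>pts ==> trans_pt g x\<in>pts"
 unfolding pts_def trans_pt_def by auto

lemma act_image: "g\<in>H ==> U\<subseteq>pts ==> h\<in>H ==> (v, h)\<in>trans_pt g ` U\<longleftrightarrow>(v, inv g\<otimes>h)\<in>U"
proof
 assume a: "g\<in>H" "U\<subseteq>pts" "h\<in>H"
 show "(v, inv g\<otimes>h)\<in>U" if "(v, h)\<in>trans_pt g ` U"
 proof -
  obtain x where x: "x\<in>U" "(v, h) = trans_pt g x" using \<open>(v, h)\<in>trans_pt g ` U\<close> by (rule imageE)
  obtain k where k: "x = (v, k)" "h = g\<otimes>k" using x(2) unfolding trans_pt_def by (cases x) auto
  have "k\<in>H" using x(1) k(1) a(2) unfolding pts_def by auto
  thus ?thesis using x(1) k a(1) by (simp add: inv_cancel[OF is_group])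
 qed
 show "(v, h)\<in>trans_pt g ` U" if "(v, inv g\<otimes>h)\<in>U"
  using a that by (intro image_eqI[of _ _ "(v, inv g\<otimes>h)"]) (simp_all add: trans_pt_def inv_cancel[OF is_group])
qed

lemma wall_crossing: "is_wall e k U ==> f\<in>ars ==> h\<in>H ==>
  (tl_of f, h)\<notin>U\<and>(hd_of f, h\<otimes>stb f)\<in>U\<longleftrightarrow>f = e\<and>inv k\<otimes>h\<in>esub e"
 unfolding is_wall_def by blast

lemma wall_downward: "is_wall e k U ==> f\<in>ars ==> h\<in>H ==>
  (tl_of f, h)\<in>U\<and>(hd_of f, h\<otimes>stb f)\<notin>U\<longleftrightarrow>rev_of f = e\<and>inv k\<otimes>(h\<otimes>stb f)\<in>esub e"
proof -
 assume a: "is_wall e k U" "f\<in>ars" "h\<in>H"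
 have "h\<otimes>stb f\<otimes>stb (rev_of f) = h" using a stb_rev by (simp add: m_assoc)
 thus ?thesis using wall_crossing[OF a(1), of "rev_of f" "h\<otimes>stb f"] a by (auto simp del: stb_rev_inv)
qed

lemma wall_same: "is_wall e k U ==> (x, y)\<in>same ==> x\<in>U\<longleftrightarrow>y\<in>U"
 unfolding is_wall_def by blast

lemma wall_edge:
 assumes "is_wall e k U" "e\<in>ars" "k\<in>H"
 shows "(tl_of e, k)\<notin>U\<and>(hd_of e, k\<otimes>stb e)\<in>U"
 using wall_crossing[OF assms(1,2), of k] assms subgroup.one_closed[OF esub_subgroup[OF assms(2)]] by simp

text \<open>A wall is determined by the edges that cross it, as the space is connected.\<close>

lemma wall_unique:
 assumes U: "is_wall e k U" and U': "is_wall e k' U'" and e: "e\<in>ars" and k: "k\<in>H" "k'\<in>H"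
  and kk: "inv k\<otimes>k'\<in>esub e"
 shows "U = U'"
proof -
 note sg = esub_subgroup[OF e]
 have coset: "inv k\<otimes>h\<in>esub e\<longleftrightarrow>inv k'\<otimes>h\<in>esub e" if h: "h\<in>H" for h
 proof -
  have 1: "inv k\<otimes>h = (inv k\<otimes>k')\<otimes>(inv k'\<otimes>h)" using k h by (simp add: m_assoc inv_cancel[OF is_group])
  have "inv (inv k\<otimes>k')\<otimes>(inv k\<otimes>h) = inv k'\<otimes>h" using k h by (simp add: inv_mult_group m_assoc inv_cancel[OF is_group])
  thus ?thesis using 1 kk subgroup.m_closed[OF sg] subgroup.m_inv_closed[OF sg kk] by metis
 qed
 have ends: "(tl_of e, k)\<in>U\<longleftrightarrow>(tl_of e, k)\<in>U'"
  using wall_edge[OF U e k(1)] wall_crossing[OF U' e k(1)] coset[of k] k subgroup.one_closed[OF sg] by simp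
 have "y\<in>U\<longleftrightarrow>y\<in>U'" if "y\<in>pts" for y
 proof -
  have "((tl_of e, k), y)\<in>(same\<union>adj)\<^sup>*" using connected that e k unfolding pts_def by auto
  thus ?thesis
  proof (induction rule: rtrancl_induct)
   case base show ?case by (rule ends)
  next
   case (step y z)
   show ?case
   proof (cases "(y, z)\<in>same")
    case True thus ?thesis using wall_same[OF U] wall_same[OF U'] step.IH by blast
   next
    case False
    then obtain f h where p: "y = (tl_of f, h)" "z = (hd_of f, h\<otimes>stb f)" "f\<in>ars" "h\<in>H"
     using step.hyps unfolding adj_def by blast
    have "h\<otimes>stb f\<in>H" using p by simp
    thus ?thesis using step.IH wall_crossing[OF U p(3,4)] wall_crossing[OF U' p(3,4)]
      wall_downward[OF U p(3,4)] wall_downward[OF U' p(3,4)] coset[of h] coset[of "h\<otimes>stb f"] p(4)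
     unfolding p(1,2) by blast
   qed
  qed
 qed
 thus ?thesis using U U' unfolding is_wall_def by blast
qed

lemma wall_act:
 assumes U: "is_wall e k U" and e: "e\<in>ars" and k: "k\<in>H" and g: "g\<in>H"
 shows "is_wall e (g\<otimes>k) (trans_pt g ` U)"
proof -
 have sub: "U\<subseteq>pts" using U unfolding is_wall_def by blast
 note mem = act_image[OF g sub]
 have "x\<in>trans_pt g ` U\<longleftrightarrow>y\<in>trans_pt g ` U" if xy: "(x, y)\<in>same" for x y
 proof -
  obtain v h d where p: "x = (v, h)" "y = (v, h\<otimes>d)" "v\<in>ver" "h\<in>H" "d\<in>vsub v" using xy unfolding same_def by blast
  have d: "d\<in>H" using p vsub_H by blast
  have "((v, inv g\<otimes>h), (v, inv g\<otimes>h\<otimes>d))\<in>same" unfolding same_def using p g by auto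
  moreover have "inv g\<otimes>(h\<otimes>d) = inv g\<otimes>h\<otimes>d" using p d g by (simp add: m_assoc)
  ultimately show ?thesis unfolding p(1,2) using mem p d wall_same[OF U] by simp
 qed
 moreover have "(tl_of f, h)\<notin>trans_pt g ` U\<and>(hd_of f, h\<otimes>stb f)\<in>trans_pt g ` U \<longleftrightarrow>
   f = e\<and>inv (g\<otimes>k)\<otimes>h\<in>esub e" if f: "f\<in>ars" and h: "h\<in>H" for f h
 proof -
  have "inv g\<otimes>(h\<otimes>stb f) = inv g\<otimes>h\<otimes>stb f" "inv (g\<otimes>k)\<otimes>h = inv k\<otimes>(inv g\<otimes>h)"
   using f g h k stb_H[OF f] by (simp_all add: m_assoc inv_mult_group)
  thus ?thesis using mem[OF h] mem[of "h\<otimes>stb f"] wall_crossing[OF U f, of "inv g\<otimes>h"] f g h by simp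
 qed
 moreover have "trans_pt g ` U\<subseteq>pts" using act_pts[OF g] sub by blast
 ultimately show ?thesis unfolding is_wall_def by blast
qed

text \<open>The complement is the half-tree of the reversed edge, which starts at the other end,
  hence the factor \<open>stb e\<close>.\<close>

lemma wall_compl:
 assumes U: "is_wall e k U" and e: "e\<in>ars" and k: "k\<in>H"
 shows "is_wall (rev_of e) (k\<otimes>stb e) (pts - U)"
proof -
 have "x\<in>pts - U\<longleftrightarrow>y\<in>pts - U" if "(x, y)\<in>same" for x y
  using wall_same[OF U that] same_pts[OF that] by blast
 moreover have "(tl_of f, h)\<notin>pts - U\<and>(hd_of f, h\<otimes>stb f)\<in>pts - U \<longleftrightarrow>
   f = rev_of e\<and>inv (k\<otimes>stb e)\<otimes>h\<in>esub (rev_of e)" if f: "f\<in>ars" and h: "h\<in>H" for f h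
 proof -
  have "(tl_of f, h)\<in>pts" "(hd_of f, h\<otimes>stb f)\<in>pts" using f h unfolding pts_def by auto
  hence "(tl_of f, h)\<notin>pts - U\<and>(hd_of f, h\<otimes>stb f)\<in>pts - U\<longleftrightarrow>rev_of f = e\<and>inv k\<otimes>(h\<otimes>stb f)\<in>esub e"
   using wall_downward[OF U f h] by blast
  moreover have "inv k\<otimes>(h\<otimes>stb f)\<in>esub e\<longleftrightarrow>inv (k\<otimes>stb e)\<otimes>h\<in>esub (rev_of e)" if rf: "rev_of f = e"
  proof -
   have fe: "stb f = inv (stb e)" using rf f stb_rev_inv[OF e] rev_arc(4)[of f] by simp
   have "stb e\<otimes>(inv (k\<otimes>stb e)\<otimes>h)\<otimes>inv (stb e) = inv k\<otimes>(h\<otimes>stb f)"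
    unfolding fe using stb_H[OF e] k h by (simp add: m_assoc inv_mult_group inv_cancel[OF is_group])
   thus ?thesis using esub_rev_mem[OF e, of "inv (k\<otimes>stb e)\<otimes>h"] k h stb_H[OF e] by simp
  qed
  moreover have "rev_of f = e\<longleftrightarrow>f = rev_of e" by (metis rev_arc(4))
  ultimately show ?thesis by blast
 qed
 ultimately show ?thesis unfolding is_wall_def by blast
qed

definition walls :: "(nat\<times>'a) set set" where
 "walls = {U. \<exists>e\<in>ars. \<exists>k\<in>H. is_wall e k U}"

sublocale wall_space G H pts trans_pt same adj walls
proof
 show "H\<subseteq>carrier G" "\<one>\<in>H" by auto
 show "x\<otimes>y\<in>H" if "x\<in>H" "y\<in>H" for x y using that by simp
 show "inv x\<in>H" if "x\<in>H" for x using that by simp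
 show "trans_pt h x\<in>pts" if "h\<in>H" "x\<in>pts" for h x by (rule act_pts[OF that])
 show "trans_pt \<one> x = x" if "x\<in>pts" for x using that unfolding trans_pt_def pts_def by auto
 show "trans_pt (g\<otimes>h) x = trans_pt g (trans_pt h x)" if "g\<in>H" "h\<in>H" "x\<in>pts" for g h x
  using that unfolding trans_pt_def pts_def by (auto simp: m_assoc)
 show "same\<subseteq>pts\<times>pts" using same_pts by auto
 show "adj\<subseteq>pts\<times>pts" unfolding adj_def pts_def by auto
 show "sym same" by (rule same_sym)
 show "sym adj" by (rule adj_sym)
 show "(trans_pt h x, trans_pt h y)\<in>adj" if "h\<in>H" "(x, y)\<in>adj" for h x y
 proof -
  obtain f k where p: "x = (tl_of f, k)" "y = (hd_of f, k\<otimes>stb f)" "f\<in>ars" "k\<in>H"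
   using \<open>(x, y)\<in>adj\<close> unfolding adj_def by blast
  have "h\<otimes>(k\<otimes>stb f) = h\<otimes>k\<otimes>stb f" using p that(1) stb_H[OF p(3)] by (simp add: m_assoc)
  thus ?thesis unfolding p(1,2) trans_pt_def using adjI[OF p(3), of "h\<otimes>k"] p that(1) by simp
 qed
 show "(x, y)\<in>(same\<union>adj)\<^sup>*" if "x\<in>pts" "y\<in>pts" for x y by (rule connected[OF that])
 show "U\<subseteq>pts" if "U\<in>walls" for U using that unfolding walls_def is_wall_def by blast
 show "pts - U\<in>walls" if "U\<in>walls" for U
 proof -
  obtain e k where "e\<in>ars" "k\<in>H" "is_wall e k U" using \<open>U\<in>walls\<close> unfolding walls_def by blast
  hence "rev_of e\<in>ars" "k\<otimes>stb e\<in>H" "is_wall (rev_of e) (k\<otimes>stb e) (pts - U)" using wall_compl by simp_all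
  thus ?thesis unfolding walls_def by blast
 qed
 show "trans_pt h ` U\<in>walls" if "h\<in>H" "U\<in>walls" for h U
 proof -
  obtain e k where "e\<in>ars" "k\<in>H" "is_wall e k U" using \<open>U\<in>walls\<close> unfolding walls_def by blast
  hence "e\<in>ars" "h\<otimes>k\<in>H" "is_wall e (h\<otimes>k) (trans_pt h ` U)" using wall_act that(1) by simp_all
  thus ?thesis unfolding walls_def by blast
 qed
 show "\<exists>x y. (x, y)\<in>adj\<and>x\<notin>U\<and>y\<in>U" if "U\<in>walls" for U
 proof -
  obtain e k where "e\<in>ars" "k\<in>H" "is_wall e k U" using \<open>U\<in>walls\<close> unfolding walls_def by blast
  thus ?thesis using wall_edge[of e k U] adjI[of e k] by blast
 qed
 show "\<exists>U\<in>walls. x\<notin>U\<and>y\<in>U" if "(x, y)\<in>adj" for x y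
 proof -
  obtain f k where p: "x = (tl_of f, k)" "y = (hd_of f, k\<otimes>stb f)" "f\<in>ars" "k\<in>H"
   using \<open>(x, y)\<in>adj\<close> unfolding adj_def by blast
  obtain U where "is_wall f \<one> U" using base_wall[OF p(3)] by blast
  hence w: "is_wall f k (trans_pt k ` U)" using wall_act[of f \<one> U k] p by simp
  hence "trans_pt k ` U\<in>walls" unfolding walls_def using p by blast
  thus ?thesis using wall_edge[OF w p(3,4)] unfolding p(1,2) by blast
 qed
 show "x\<in>U\<longleftrightarrow>y\<in>U" if "(x, y)\<in>same" "U\<in>walls" for x y U
  using that wall_same unfolding walls_def by blast
 show "U = U'" if xy: "(x, y)\<in>adj" and U: "U\<in>walls" and U': "U'\<in>walls"
  and cr: "x\<notin>U" "y\<in>U" "x\<notin>U'" "y\<in>U'" for x y U U'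
 proof -
  obtain f h where p: "x = (tl_of f, h)" "y = (hd_of f, h\<otimes>stb f)" "f\<in>ars" "h\<in>H"
   using xy unfolding adj_def by blast
  obtain e k where e: "e\<in>ars" "k\<in>H" "is_wall e k U" using U unfolding walls_def by blast
  obtain e' k' where e': "e'\<in>ars" "k'\<in>H" "is_wall e' k' U'" using U' unfolding walls_def by blast
  have 1: "f = e" "inv k\<otimes>h\<in>esub e" using wall_crossing[OF e(3) p(3,4)] cr unfolding p(1,2) by blast+
  have 2: "f = e'" "inv k'\<otimes>h\<in>esub e'" using wall_crossing[OF e'(3) p(3,4)] cr unfolding p(1,2) by blast+
  have ee: "e' = e" using 1 2 by simp
  have "inv k\<otimes>k' = (inv k\<otimes>h)\<otimes>inv (inv k'\<otimes>h)"
   using e(2) e'(2) p(4) by (simp add: inv_mult_group m_assoc inv_cancel[OF is_group])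
  hence "inv k\<otimes>k'\<in>esub e" using 1 2 subgroup.m_closed[OF esub_subgroup[OF e(1)]]
    subgroup.m_inv_closed[OF esub_subgroup[OF e(1)]] unfolding ee by metis
  thus ?thesis using wall_unique[OF e(3) _ e(1,2) e'(2)] e'(3) unfolding ee by blast
 qed
 show "(x, x')\<in>same\<^sup>*" if xy: "(x, y)\<in>adj" "(x', y')\<in>adj" and U: "U\<in>walls"
  and cr: "x\<notin>U" "x'\<notin>U" "y\<in>U" "y'\<in>U" for x y x' y' U
 proof -
  obtain f h where p: "x = (tl_of f, h)" "y = (hd_of f, h\<otimes>stb f)" "f\<in>ars" "h\<in>H"
   using xy(1) unfolding adj_def by blast
  obtain f' h' where p': "x' = (tl_of f', h')" "y' = (hd_of f', h'\<otimes>stb f')" "f'\<in>ars" "h'\<in>H"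
   using xy(2) unfolding adj_def by blast
  obtain e k where e: "e\<in>ars" "k\<in>H" "is_wall e k U" using U unfolding walls_def by blast
  have 1: "f = e" "inv k\<otimes>h\<in>esub e" using wall_crossing[OF e(3) p(3,4)] cr unfolding p(1,2) by blast+
  have 2: "f' = e" "inv k\<otimes>h'\<in>esub e" using wall_crossing[OF e(3) p'(3,4)] cr unfolding p'(1,2) by blast+
  have "inv h\<otimes>h' = inv (inv k\<otimes>h)\<otimes>(inv k\<otimes>h')"
   using e(2) p(4) p'(4) by (simp add: inv_mult_group m_assoc inv_cancel[OF is_group])
  hence "inv h\<otimes>h'\<in>esub e" using 1(2) 2(2) subgroup.m_closed[OF esub_subgroup[OF e(1)]]
    subgroup.m_inv_closed[OF esub_subgroup[OF e(1)]] by metis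
  hence "(x, x')\<in>same" unfolding p(1) p'(1) 1(1) 2(1) using esub_vsub[OF e(1)] e(1) p(4) p'(4) by (intro sameI) auto
  thus ?thesis by blast
 qed
 \<comment> \<open>A translate of a wall of \<open>e\<close> is again a wall of \<open>e\<close>,
   whereas the complement belongs to the different arc \<open>rev_of e\<close>.\<close>
 show "trans_pt h ` U\<noteq>pts - U" if h: "h\<in>H" and U: "U\<in>walls" for h U
 proof
  assume eq: "trans_pt h ` U = pts - U"
  obtain e k where e: "e\<in>ars" "k\<in>H" "is_wall e k U" using U unfolding walls_def by blast
  have w: "is_wall e (h\<otimes>k) (pts - U)" using wall_act[OF e(3,1,2) h] unfolding eq .
  have "k\<otimes>stb e\<in>H" using e by simp
  hence "e = rev_of e" using wall_edge[OF w e(1)] wall_crossing[OF wall_compl[OF e(3,1,2)] e(1)] e h by simp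
  thus False using rev_arc(5)[OF e(1)] by simp
 qed
qed

section \<open>Stabilizers in the wall space of a splitting\<close>

lemma same_class: "(x, y)\<in>same\<^sup>* ==> x = (v, h) ==> v\<in>ver ==> h\<in>H ==> \<exists>k\<in>H. y = (v, k)\<and>inv h\<otimes>k\<in>vsub v"
proof (induction rule: rtrancl_induct)
 case base thus ?case using subgroup.one_closed[OF vsub_subgroup] by simp
next
 case (step y z)
 then obtain k where k: "k\<in>H" "y = (v, k)" "inv h\<otimes>k\<in>vsub v" by blast
 obtain g where g: "g\<in>vsub v" "z = (v, k\<otimes>g)" using step.hyps(2) k(2) unfolding same_def by blast
 have gH: "g\<in>H" using g vsub_H[OF step.prems(2)] by blast
 have "inv h\<otimes>(k\<otimes>g) = inv h\<otimes>k\<otimes>g" using k gH step.prems by (simp add: m_assoc)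
 hence "inv h\<otimes>(k\<otimes>g)\<in>vsub v" using subgroup.m_closed[OF vsub_subgroup[OF step.prems(2)] k(3) g(1)] by simp
 thus ?case using k gH g by auto
qed

lemma not_sep_same: "(x, y)\<in>same ==> \<not> sep walls x y"
 unfolding sep_def using R0_uncrossed by blast

lemma stab_walls:
 assumes v: "v\<in>ver" and h: "h\<in>H" and k: "k\<in>H"
 shows "k\<in>stab walls (v, h)\<longleftrightarrow>inv h\<otimes>k\<otimes>h\<in>vsub v"
proof -
 have p: "(v, h)\<in>pts" "(v, k\<otimes>h)\<in>pts" using v h k unfolding pts_def by auto
 have "k\<in>stab walls (v, h)\<longleftrightarrow>\<not> sep walls (v, h) (v, k\<otimes>h)" unfolding stab_def trans_pt_def using k by simp
 also have "\<dots>\<longleftrightarrow>inv h\<otimes>(k\<otimes>h)\<in>vsub v"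
 proof
  assume "\<not> sep walls (v, h) (v, k\<otimes>h)"
  hence "((v, h), (v, k\<otimes>h))\<in>same\<^sup>*" by (rule unseparated_R0[OF p])
  thus "inv h\<otimes>(k\<otimes>h)\<in>vsub v" using same_class v h by blast
 next
  assume "inv h\<otimes>(k\<otimes>h)\<in>vsub v"
  thus "\<not> sep walls (v, h) (v, k\<otimes>h)" using sameI[OF v h] k h by (intro not_sep_same) simp
 qed
 finally show ?thesis using h k by (simp add: m_assoc)
qed

lemma stab_base: "v\<in>ver ==> stab walls (v, \<one>) = vsub v"
proof (rule Set.set_eqI)
 fix k assume v: "v\<in>ver"
 have "k\<in>H" if "k\<in>stab walls (v, \<one>) \<or> k\<in>vsub v" using that vsub_H[OF v] unfolding stab_def by blast
 thus "k\<in>stab walls (v, \<one>)\<longleftrightarrow>k\<in>vsub v" using stab_walls[OF v, of \<one> k] by auto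
qed

text \<open>Stabilizers of points are conjugates in \<open>H\<close> of vertex groups; if one of
  them is all of \<open>H\<close>, so is the vertex group.\<close>

lemma stab_proper:
 assumes nontriv: "\<not> trivial_splitting H \<Delta>" and x: "x\<in>pts"
 shows "stab walls x\<noteq>H"
proof
 assume eq: "stab walls x = H"
 obtain v h where p: "x = (v, h)" "v\<in>ver" "h\<in>H" using x unfolding pts_def by auto
 have "k\<in>vsub v" if k: "k\<in>H" for k
 proof -
  have "h\<otimes>k\<otimes>inv h\<in>stab walls (v, h)" using eq k p by simp
  hence "inv h\<otimes>(h\<otimes>k\<otimes>inv h)\<otimes>h\<in>vsub v" using stab_walls[OF p(2,3)] k p by simp
  thus ?thesis using k p(3) by (simp add: m_assoc inv_cancel[OF is_group])
 qed
 hence "vsub v = H" using vsub_H[OF p(2)] by blast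
 thus False using nontriv p(2) unfolding trivial_splitting_def by blast
qed

lemma wstab_wall:
 assumes U: "is_wall e k U" and e: "e\<in>ars" and k: "k\<in>H"
 shows "wstab U = conj_set G k (esub e)"
proof (rule Set.set_eqI)
 fix g
 have "g\<in>wstab U\<longleftrightarrow>inv k\<otimes>g\<otimes>k\<in>esub e" if g: "g\<in>H"
 proof
  assume "g\<in>wstab U"
  hence "is_wall e (g\<otimes>k) U" using wall_act[OF U e k g] unfolding wstab_def by simp
  hence "inv k\<otimes>(g\<otimes>k)\<in>esub e"
   using wall_edge[of e "g\<otimes>k" U] wall_crossing[OF U e, of "g\<otimes>k"] e g k by simp
  thus "inv k\<otimes>g\<otimes>k\<in>esub e" using g k by (simp add: m_assoc)
 next
  assume "inv k\<otimes>g\<otimes>k\<in>esub e"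
  hence "inv k\<otimes>(g\<otimes>k)\<in>esub e" using g k by (simp add: m_assoc)
  hence "U = trans_pt g ` U" using wall_unique[OF U wall_act[OF U e k g] e k] g k by simp
  thus "g\<in>wstab U" unfolding wstab_def using g by simp
 qed
 moreover have "g\<in>conj_set G k (esub e)\<longleftrightarrow>inv k\<otimes>g\<otimes>k\<in>esub e" if g: "g\<in>H"
 proof
  assume "g\<in>conj_set G k (esub e)"
  then obtain d where d: "d\<in>esub e" "g = k\<otimes>d\<otimes>inv k" unfolding conj_set_def by (rule imageE)
  have "d\<in>H" using d esub_H[OF e] by blast
  thus "inv k\<otimes>g\<otimes>k\<in>esub e" using d k by (simp add: m_assoc inv_cancel[OF is_group])
 next
  assume "inv k\<otimes>g\<otimes>k\<in>esub e"
  moreover have "g = k\<otimes>(inv k\<otimes>g\<otimes>k)\<otimes>inv k" using g k by (simp add: m_assoc inv_cancel[OF is_group])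
  ultimately show "g\<in>conj_set G k (esub e)" unfolding conj_set_def by (rule image_eqI[rotated])
 qed
 moreover have "g\<in>H" if "g\<in>wstab U \<or> g\<in>conj_set G k (esub e)"
  using that k esub_H[OF e] unfolding wstab_def conj_set_def by auto
 ultimately show "g\<in>wstab U\<longleftrightarrow>g\<in>conj_set G k (esub e)" by blast
qed

text \<open>There is one orbit for each of the finitely many arcs.\<close>

lemma walls_finite_orbits: "\<exists>F. finite F\<and>F\<subseteq>walls\<and>(\<forall>U\<in>walls. \<exists>h\<in>H. \<exists>U'\<in>F. U = trans_pt h ` U')"
proof -
 define rep where "rep e = (SOME U. is_wall e \<one> U)" for e
 have rep: "is_wall e \<one> (rep e)" if "e\<in>ars" for e unfolding rep_def using someI_ex[OF base_wall[OF that]] .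
 have "finite ars" using splitting unfolding splitting_of_def fin_digraph_def fin_digraph_axioms_def by blast
 moreover have "rep ` ars\<subseteq>walls" unfolding walls_def using rep Hsub(3) by blast
 moreover have "\<exists>h\<in>H. \<exists>U'\<in>rep ` ars. U = trans_pt h ` U'" if "U\<in>walls" for U
 proof -
  obtain e k where e: "e\<in>ars" "k\<in>H" "is_wall e k U" using \<open>U\<in>walls\<close> unfolding walls_def by blast
  have "is_wall e k (trans_pt k ` rep e)" using wall_act[OF rep[OF e(1)] e(1) _ e(2)] e(2) by simp
  hence "U = trans_pt k ` rep e"
   using wall_unique[OF e(3) _ e(1,2,2)] e subgroup.one_closed[OF esub_subgroup[OF e(1)]] by simp
  thus ?thesis using e by blast
 qed
 ultimately show ?thesis by (intro exI[of _ "rep ` ars"]) simp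
qed

text \<open>Whatever fixes an edge fixes its initial vertex, so a set \<open>S\<close> inside a
  vertex group handles fixed vertices and fixed edges together.\<close>

lemma fixes_point_unseparated:
 assumes K: "K\<subseteq>H" and fp: "fixes_point G H \<Delta> K"
 shows "\<exists>x\<in>pts. \<forall>k\<in>K. \<not> sep walls x (trans_pt k x)"
proof -
 have "\<exists>v g S. v\<in>ver\<and>g\<in>H\<and>S\<subseteq>vsub v\<and>\<one>\<in>S\<and>(\<forall>k\<in>K. k <# (g <# S) = g <# S)"
  using fp unfolding fixes_point_def bass_serre_tree_def
 proof (elim disjE bexE, goal_cases)
  case (1 x)
  then obtain v g where "v\<in>ver" "g\<in>H" "\<forall>k\<in>K. k <# (g <# vsub v) = g <# vsub v" by auto
  thus ?case using subgroup.one_closed[OF vsub_subgroup]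
   by (intro exI[of _ v] exI[of _ g] exI[of _ "vsub v"]) simp
 next
  case (2 x)
  then obtain e g where "e\<in>ars" "g\<in>H" "\<forall>k\<in>K. k <# (g <# esub e) = g <# esub e" by auto
  thus ?case using subgroup.one_closed[OF esub_subgroup] esub_vsub
   by (intro exI[of _ "tl_of e"] exI[of _ g] exI[of _ "esub e"]) simp
 qed
 then obtain v g S where p: "v\<in>ver" "g\<in>H" "S\<subseteq>vsub v" "\<one>\<in>S" "\<And>k. k\<in>K ==> k <# (g <# S) = g <# S" by blast
 have "\<not> sep walls (v, g) (trans_pt k (v, g))" if k: "k\<in>K" for k
 proof -
  have kH: "k\<in>H" using k K by blast
  have "g\<in>g <# S" unfolding l_coset_def using p(2,4) by force
  hence "k\<otimes>g\<in>k <# (g <# S)" unfolding l_coset_def by blast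
  then obtain s where s: "s\<in>S" "k\<otimes>g = g\<otimes>s" unfolding p(5)[OF k] by (auto simp: l_coset_def)
  have "((v, g), (v, g\<otimes>s))\<in>same" unfolding same_def using p s by blast
  thus ?thesis unfolding trans_pt_def using not_sep_same s by simp
 qed
 moreover have "(v, g)\<in>pts" unfolding pts_def using p by simp
 ultimately show ?thesis by blast
qed

end

section \<open>Cuts\<close>

text \<open>A cut of \<open>H\<close> encodes a half-tree of an \<open>H\<close>-tree with a single orbit of edges. The two layers
 of \<open>H\<times>UNIV\<close> record on which side the two end points of the translates of an edge lie; a single
 layer would not suffice if one of the end points has valence two. Vertices of the tree are
 encoded by the set of those translates of the cut which contain them.\<close>

definition cshift :: "'a monoid => 'a => ('a\<times>bool) set => ('a\<times>bool) set" where
 "cshift G g A = (\<lambda>(h, b). (g \<otimes>\<^bsub>G\<^esub> h, b)) ` A"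

definition is_cut :: "'a monoid => 'a set => ('a\<times>bool) set => bool" where
 "is_cut G H A\<longleftrightarrow>A\<subseteq>H\<times>UNIV\<and>A\<noteq>{}\<and>A\<noteq>H\<times>UNIV \<and>
  (\<forall>g\<in>H. cshift G g A\<subseteq>A \<or> A\<subseteq>cshift G g A \<or> cshift G g A\<inter>A = {} \<or> cshift G g A\<union>A = H\<times>UNIV) \<and>
  (\<forall>g\<in>H. cshift G g A\<noteq>H\<times>UNIV - A) \<and>
  (\<forall>p\<in>H\<times>UNIV. \<forall>q\<in>H\<times>UNIV. finite {cshift G g A | g. g\<in>H\<and>p\<in>cshift G g A\<and>q\<notin>cshift G g A})"

definition cside :: "'a monoid => 'a set => ('a\<times>bool) set => 'a set => 'a => ('a\<times>bool) set" where
 "cside G H A \<tau> g = (if g\<in>\<tau> then cshift G g A else H\<times>UNIV - cshift G g A)"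

text \<open>Sides that meet pairwise make \<open>\<tau>\<close> a consistent orientation of the
  edges. Ends of the tree give such orientations too; they are excluded by requiring agreement with
  each point up to finitely many translates.\<close>

definition cut_vertex :: "'a monoid => 'a set => ('a\<times>bool) set => 'a set => bool" where
 "cut_vertex G H A \<tau>\<longleftrightarrow>\<tau>\<subseteq>H \<and>
  (\<forall>g\<in>H. \<forall>h\<in>H. cside G H A \<tau> g\<inter>cside G H A \<tau> h\<noteq>{}) \<and>
  (\<forall>p\<in>H\<times>UNIV. finite {cshift G g A | g. g\<in>H\<and>(g\<in>\<tau>\<longleftrightarrow>p\<notin>cshift G g A)})"

definition elliptic :: "'a monoid => 'a set => ('a\<times>bool) set => 'a set => bool" where
 "elliptic G H A K\<longleftrightarrow>(\<exists>\<tau>. cut_vertex G H A \<tau>\<and>(\<forall>k\<in>K. \<forall>g\<in>H. k \<otimes>\<^bsub>G\<^esub> g\<in>\<tau>\<longleftrightarrow>g\<in>\<tau>))"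

text \<open>Compares families indexed by the same group elements, such as walls and translates of a
  cut.\<close>

lemma finite_image_determined:
 assumes "finite (f ` D)" "\<And>x y. x\<in>D ==> y\<in>D ==> f x = f y ==> g x = g y"
 shows "finite (g ` D)"
proof -
 have "g ` D\<subseteq>(\<lambda>b. g (SOME x. x\<in>D\<and>f x = b)) ` f ` D"
 proof
  fix c assume "c\<in>g ` D"
  then obtain x where x: "x\<in>D" "c = g x" by blast
  have "(SOME y. y\<in>D\<and>f y = f x)\<in>D\<and>f (SOME y. y\<in>D\<and>f y = f x) = f x"
   by (rule someI[of "\<lambda>y. y\<in>D\<and>f y = f x" x]) (use x in simp)
  hence "c = g (SOME y. y\<in>D\<and>f y = f x)" using x assms(2) by metis
  thus "c\<in>(\<lambda>b. g (SOME x. x\<in>D\<and>f x = b)) ` f ` D" using x by blast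
 qed
 thus ?thesis using assms(1) finite_subset by blast
qed

lemma elliptic_mono: "elliptic G H A K ==> L\<subseteq>K ==> elliptic G H A L"
 unfolding elliptic_def by blast

context
 fixes G :: "'a monoid" (structure) and H :: "'a set"
 assumes grp: "group G" and H: "subgroup H G"
begin

interpretation group G by (rule grp)

lemma sg [simp]: "g\<in>H ==> h\<in>H ==> g\<otimes>h\<in>H" "h\<in>H ==> inv h\<in>H" "\<one>\<in>H" "h\<in>H ==> h\<in>carrier G"
 using H by (auto simp: subgroup.m_closed subgroup.m_inv_closed subgroup.one_closed subgroup.mem_carrier)

lemma cshift_mem:
 assumes A: "A\<subseteq>H\<times>UNIV" and g: "g\<in>H"
 shows "(h, b)\<in>cshift G g A\<longleftrightarrow>h\<in>H\<and>(inv g\<otimes>h, b)\<in>A"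
proof
 assume "(h, b)\<in>cshift G g A"
 then obtain k where k: "(k, b)\<in>A" "h = g\<otimes>k" unfolding cshift_def by auto
 hence "k\<in>H" using A by blast
 thus "h\<in>H\<and>(inv g\<otimes>h, b)\<in>A" using k g by (simp add: inv_cancel[OF grp])
next
 assume a: "h\<in>H\<and>(inv g\<otimes>h, b)\<in>A"
 hence "(h, b) = (g\<otimes>(inv g\<otimes>h), b)" using g by (simp add: inv_cancel[OF grp])
 thus "(h, b)\<in>cshift G g A" unfolding cshift_def using a by force
qed

lemma cshift_sub: "A\<subseteq>H\<times>UNIV ==> g\<in>H ==> cshift G g A\<subseteq>H\<times>UNIV"
 unfolding cshift_def by auto

lemma cshift_cshift: "A\<subseteq>H\<times>UNIV ==> g\<in>H ==> h\<in>H ==> cshift G g (cshift G h A) = cshift G (g\<otimes>h) A"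
 unfolding cshift_def image_image by (rule image_cong) (auto simp: m_assoc)

lemma cshift_one: "A\<subseteq>H\<times>UNIV ==> cshift G \<one> A = A"
 unfolding cshift_def by (force simp: subset_iff image_iff)

lemma cshift_compl: "A\<subseteq>H\<times>UNIV ==> g\<in>H ==> cshift G g (H\<times>UNIV - A) = H\<times>UNIV - cshift G g A"
 by (auto simp: cshift_mem)

text \<open>The two sides of one translate are disjoint and cannot both be chosen.\<close>

lemma cut_vertex_wd:
 assumes "cut_vertex G H A \<tau>" "g\<in>H" "h\<in>H" "cshift G g A = cshift G h A"
 shows "g\<in>\<tau>\<longleftrightarrow>h\<in>\<tau>"
proof -
 have "cside G H A \<tau> g\<inter>cside G H A \<tau> h\<noteq>{}" using assms unfolding cut_vertex_def by blast
 thus ?thesis using assms(4) unfolding cside_def by (auto split: if_splits)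
qed

end

context wall_space
begin

section \<open>The cut given by an orbit of walls\<close>

context
 fixes U0 x0 y0
 assumes U0: "U0\<in>W" and e0: "(x0, y0)\<in>R1" "x0\<notin>U0" "y0\<in>U0"
begin

text \<open>The two layers are the two ends of the translates of the chosen edge.\<close>

definition wpt :: "'a\<times>bool => 'x" where
 "wpt p = act (fst p) (if snd p then y0 else x0)"

definition wcut :: "('a\<times>bool) set" where
 "wcut = {p\<in>H\<times>UNIV. wpt p\<in>U0}"

abbreviation tr :: "'a => 'x set" where "tr g \<equiv> act g ` U0"

definition orbit_walls :: "'x set set" where
 "orbit_walls = tr ` H\<union>(\<lambda>g. V - tr g) ` H"

lemma e0_V: "x0\<in>V" "y0\<in>V" "U0\<subseteq>V"
 using e0 R1_V U0 W_sub by auto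

lemma wpt_V: "p\<in>H\<times>UNIV ==> wpt p\<in>V"
 unfolding wpt_def using e0_V act_closed by auto

lemma wcut_sub: "wcut\<subseteq>H\<times>UNIV"
 unfolding wcut_def by blast

lemma wcut_shift:
 assumes "g\<in>H" "p\<in>H\<times>UNIV"
 shows "p\<in>cshift G g wcut\<longleftrightarrow>wpt p\<in>tr g"
proof -
 obtain h b where p: "p = (h, b)" "h\<in>H" using assms by (cases p) auto
 have e: "(if b then y0 else x0)\<in>V" using e0_V by simp
 have "p\<in>cshift G g wcut\<longleftrightarrow>act (inv g\<otimes>h) (if b then y0 else x0)\<in>U0"
  unfolding p cshift_mem[OF is_group H wcut_sub assms(1)] using p assms unfolding wcut_def wpt_def by auto
 also have "\<dots>\<longleftrightarrow>act (inv g) (wpt p)\<in>U0" unfolding p wpt_def using assms p e by (simp add: act_mult)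
 also have "\<dots>\<longleftrightarrow>wpt p\<in>tr g" using act_mem(2)[OF assms(1) e0_V(3) wpt_V[OF assms(2)]] by simp
 finally show ?thesis .
qed

lemma tr_W: "g\<in>H ==> tr g\<in>W"
 using W_act U0 by blast

lemma tr_edge: "g\<in>H ==> (wpt (g, False), wpt (g, True))\<in>R1\<and>wpt (g, False)\<notin>tr g\<and>wpt (g, True)\<in>tr g"
 unfolding wpt_def using R1_act e0 act_mem(1)[of g U0] e0_V by simp

text \<open>This is what the two layers are for: both ends of the edge of \<open>tr g\<close> are
  recorded, so an equal translate crosses that edge in the same direction and comes from the same
  wall.\<close>

lemma wcut_shift_eq:
 assumes "g\<in>H" "h\<in>H"
 shows "cshift G g wcut = cshift G h wcut\<longleftrightarrow>tr g = tr h"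
proof
 assume eq: "cshift G g wcut = cshift G h wcut"
 have "wpt (g, False)\<notin>tr h\<and>wpt (g, True)\<in>tr h"
  using wcut_shift[of g "(g, False)"] wcut_shift[of g "(g, True)"] wcut_shift[of h "(g, False)"]
   wcut_shift[of h "(g, True)"] eq tr_edge[OF assms(1)] assms by auto
 thus "tr g = tr h" using R1_unique tr_edge[OF assms(1)] tr_W assms by blast
next
 assume "tr g = tr h"
 hence "p\<in>cshift G g wcut\<longleftrightarrow>p\<in>cshift G h wcut" if "p\<in>H\<times>UNIV" for p
  using wcut_shift assms that by simp
 thus "cshift G g wcut = cshift G h wcut" using cshift_sub[OF is_group H wcut_sub] assms by blast
qed

lemma wcut_compl_eq:
 assumes "g\<in>H" "cshift G g wcut = H\<times>UNIV - wcut"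
 shows "tr g = V - U0"
proof -
 have "wpt (\<one>, False) = x0" "wpt (\<one>, True) = y0" unfolding wpt_def using e0_V by (simp_all add: act_one)
 hence "(\<one>, False)\<notin>wcut" "(\<one>, True)\<in>wcut" unfolding wcut_def using e0 by auto
 hence "x0\<in>tr g" "y0\<notin>tr g"
  using wcut_shift[OF assms(1), of "(\<one>, False)"] wcut_shift[OF assms(1), of "(\<one>, True)"] assms(2)
   \<open>wpt (\<one>, False) = x0\<close> \<open>wpt (\<one>, True) = y0\<close> by auto
 thus ?thesis using R1_unique'[OF e0(1) U0 tr_W[OF assms(1)] e0(2,3)] by blast
qed

lemma tr_one: "tr \<one> = U0"
 using act_image_one e0_V by blast

lemma orbit_walls_invariant: "invariant orbit_walls"
proof -
 have sub: "tr g\<subseteq>V" if "g\<in>H" for g using act_image_sub e0_V that by blast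
 have "act h ` tr g = tr (h\<otimes>g)" "act h ` (V - tr g) = V - tr (h\<otimes>g)" if "h\<in>H" "g\<in>H" for h g
  using act_image_mult[OF that e0_V(3)] act_image_compl[OF that(1) sub[OF that(2)]] by simp_all
 moreover have "V - (V - tr g) = tr g" if "g\<in>H" for g using sub[OF that] by blast
 ultimately show ?thesis unfolding invariant_def orbit_walls_def using tr_W W_compl by auto
qed

lemma wcut_is_cut: "is_cut G H wcut"
proof -
 have one: "cshift G \<one> wcut = wcut" by (rule cshift_one[OF is_group H wcut_sub])
 have mem1: "p\<in>wcut\<longleftrightarrow>wpt p\<in>U0" if "p\<in>H\<times>UNIV" for p using that unfolding wcut_def by blast
 have "(\<one>, True)\<in>wcut" "(\<one>, False)\<notin>wcut"
  using tr_edge[of \<one>] mem1[of "(\<one>, True)"] mem1[of "(\<one>, False)"] tr_one by auto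
 hence ne: "wcut\<noteq>{}" "wcut\<noteq>H\<times>UNIV" by (blast, force)
 have nest: "cshift G g wcut\<subseteq>wcut \<or> wcut\<subseteq>cshift G g wcut \<or> cshift G g wcut\<inter>wcut = {} \<or>
   cshift G g wcut\<union>wcut = H\<times>UNIV" if g: "g\<in>H" for g
 proof -
  note sub = cshift_sub[OF is_group H wcut_sub g] wcut_sub
  from nested[OF tr_W[OF g] U0] consider "tr g\<subseteq>U0" | "U0\<subseteq>tr g" | "tr g\<inter>U0 = {}" | "tr g\<union>U0 = V" by blast
  thus ?thesis
  proof cases
   case 1
   hence "cshift G g wcut\<subseteq>wcut" using wcut_shift[OF g] mem1 sub by blast
   thus ?thesis by blast
  next
   case 2
   hence "wcut\<subseteq>cshift G g wcut" using wcut_shift[OF g] mem1 sub by blast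
   thus ?thesis by blast
  next
   case 3
   hence "cshift G g wcut\<inter>wcut = {}" using wcut_shift[OF g] mem1 sub by blast
   thus ?thesis by blast
  next
   case 4
   hence "cshift G g wcut\<union>wcut = H\<times>UNIV" using wcut_shift[OF g] mem1 sub wpt_V by blast
   thus ?thesis by blast
  qed
 qed
 have ninv: "cshift G g wcut\<noteq>H\<times>UNIV - wcut" if g: "g\<in>H" for g
  using wcut_compl_eq[OF g] no_inversion[OF g U0] by blast
 have fin: "finite {cshift G g wcut | g. g\<in>H\<and>p\<in>cshift G g wcut\<and>q\<notin>cshift G g wcut}"
  if pq: "p\<in>H\<times>UNIV" "q\<in>H\<times>UNIV" for p q
 proof -
  let ?D = "{g\<in>H. p\<in>cshift G g wcut\<and>q\<notin>cshift G g wcut}"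
  have "tr ` ?D\<subseteq>{U\<in>W. wpt p\<in>U\<and>wpt q\<notin>U}"
  proof (rule image_subsetI)
   fix g assume "g\<in>?D"
   hence g: "g\<in>H" "p\<in>cshift G g wcut" "q\<notin>cshift G g wcut" by blast+
   show "tr g\<in>{U\<in>W. wpt p\<in>U\<and>wpt q\<notin>U}"
    using g wcut_shift[OF g(1) pq(1)] wcut_shift[OF g(1) pq(2)] tr_W[OF g(1)] by blast
  qed
  hence "finite (tr ` ?D)" by (rule finite_subset) (rule finite_between[OF wpt_V[OF pq(1)] wpt_V[OF pq(2)]])
  hence "finite ((\<lambda>g. cshift G g wcut) ` ?D)"
   by (rule finite_image_determined) (use wcut_shift_eq in blast)
  moreover have "{cshift G g wcut | g. g\<in>H\<and>p\<in>cshift G g wcut\<and>q\<notin>cshift G g wcut} =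
    (\<lambda>g. cshift G g wcut) ` ?D" by blast
  ultimately show ?thesis by simp
 qed
 show ?thesis unfolding is_cut_def by (intro conjI ballI wcut_sub ne nest ninv fin)
qed

lemma wcut_stabilizer: "{h\<in>H. cshift G h wcut = wcut} = wstab U0"
 unfolding wstab_def using wcut_shift_eq[of _ \<one>] cshift_one[OF is_group H wcut_sub] tr_one by auto

text \<open>The point \<open>z\<close> orients every wall of the orbit towards itself, and
  \<open>fix_z\<close> makes this orientation invariant under \<open>K\<close>.\<close>

lemma wcut_elliptic:
 assumes z: "z\<in>V" and K: "K\<subseteq>H" and fix_z: "\<And>k. k\<in>K ==> \<not> sep orbit_walls z (act k z)"
 shows "elliptic G H wcut K"
proof -
 define \<tau> where "\<tau> = {h\<in>H. z\<in>tr h}"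
 define D where "D g = (if z\<in>tr g then tr g else V - tr g)" for g
 have XW: "D g\<in>W" if "g\<in>H" for g unfolding D_def using tr_W W_compl that by simp
 have zX: "z\<in>D g" for g unfolding D_def using z by simp
 have cs: "p\<in>cside G H wcut \<tau> g\<longleftrightarrow>wpt p\<in>D g" if "g\<in>H" "p\<in>H\<times>UNIV" for g p
  unfolding cside_def D_def \<tau>_def using wcut_shift[OF that] that wpt_V[OF that(2)] by auto
 have end_pt: "\<exists>b. wpt (g, b)\<in>D g\<and>wpt (g, \<not> b)\<notin>D g" if g: "g\<in>H" for g
 proof (cases "z\<in>tr g")
  case True thus ?thesis unfolding D_def using tr_edge[OF g] by (intro exI[of _ True]) simp
 next
  case False thus ?thesis unfolding D_def using tr_edge[OF g] wpt_V g by (intro exI[of _ False]) simp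
 qed
 \<comment> \<open>Both sides contain \<open>z\<close>, but \<open>z\<close> need not be of the form
   \<open>wpt p\<close>. A common point of that form is found among the ends of the two edges, by
   nestedness.\<close>
 have meet: "cside G H wcut \<tau> g\<inter>cside G H wcut \<tau> h\<noteq>{}" if gh: "g\<in>H" "h\<in>H" for g h
 proof (rule ccontr)
  assume no: "\<not> ?thesis"
  obtain b where b: "wpt (g, b)\<in>D g" "wpt (g, \<not> b)\<notin>D g" using end_pt gh by blast
  obtain c where c: "wpt (h, c)\<in>D h" "wpt (h, \<not> c)\<notin>D h" using end_pt gh by blast
  have disj: "p\<notin>H\<times>UNIV" if "wpt p\<in>D g" "wpt p\<in>D h" for p using that cs gh no by blast
  have nb: "wpt (g, b)\<notin>D h" "wpt (h, c)\<notin>D g" using disj[of "(g, b)"] disj[of "(h, c)"] b c gh by auto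
  have edge: "(wpt (g, \<not> b), wpt (g, b))\<in>R1" using tr_edge[OF gh(1)] R1_rev by (cases b) auto
  have nb2: "wpt (g, \<not> b)\<notin>D h"
  proof
   assume "wpt (g, \<not> b)\<in>D h"
   hence "D h = V - D g" using R1_unique'[OF edge XW[OF gh(1)] XW[OF gh(2)] b(2,1)] nb by blast
   thus False using zX by blast
  qed
  have V: "wpt (g, \<not> b)\<in>V" using wpt_V gh by simp
  from nested[OF XW[OF gh(1)] XW[OF gh(2)]] show False using b c nb nb2 zX V by blast
 qed
 have fin: "finite {cshift G g wcut | g. g\<in>H\<and>(g\<in>\<tau>\<longleftrightarrow>p\<notin>cshift G g wcut)}" if p: "p\<in>H\<times>UNIV" for p
 proof -
  let ?D = "{g\<in>H. g\<in>\<tau>\<longleftrightarrow>p\<notin>cshift G g wcut}"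
  have "tr ` ?D\<subseteq>{U\<in>W. wpt p\<in>U\<and>z\<notin>U}\<union>{U\<in>W. z\<in>U\<and>wpt p\<notin>U}"
  proof (rule image_subsetI)
   fix g assume "g\<in>?D"
   hence g: "g\<in>H" "g\<in>\<tau>\<longleftrightarrow>p\<notin>cshift G g wcut" by blast+
   show "tr g\<in>{U\<in>W. wpt p\<in>U\<and>z\<notin>U}\<union>{U\<in>W. z\<in>U\<and>wpt p\<notin>U}"
    using g wcut_shift[OF g(1) p] tr_W[OF g(1)] unfolding \<tau>_def by blast
  qed
  hence "finite (tr ` ?D)"
   by (rule finite_subset) (rule finite_UnI[OF finite_between[OF wpt_V[OF p] z] finite_between[OF z wpt_V[OF p]]])
  hence "finite ((\<lambda>g. cshift G g wcut) ` ?D)"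
   by (rule finite_image_determined) (use wcut_shift_eq in blast)
  moreover have "{cshift G g wcut | g. g\<in>H\<and>(g\<in>\<tau>\<longleftrightarrow>p\<notin>cshift G g wcut)} =
    (\<lambda>g. cshift G g wcut) ` ?D" by blast
  ultimately show ?thesis by simp
 qed
 have "k\<otimes>g\<in>\<tau>\<longleftrightarrow>g\<in>\<tau>" if k: "k\<in>K" and g: "g\<in>H" for k g
 proof -
  have kH: "k\<in>H" using k K by blast
  have "tr (k\<otimes>g) \<in> orbit_walls" unfolding orbit_walls_def using g kH by (intro UnI1 imageI) simp
  hence "z\<in>tr (k\<otimes>g)\<longleftrightarrow>act k z\<in>tr (k\<otimes>g)" using fix_z[OF k] unfolding sep_def by blast
  also have "\<dots>\<longleftrightarrow>z\<in>tr g"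
   using act_image_mult[OF kH g e0_V(3)] act_mem(1)[OF kH _ z, of "tr g"] act_image_sub[OF g e0_V(3)] by simp
  finally show ?thesis unfolding \<tau>_def using kH g by simp
 qed
 moreover have "cut_vertex G H wcut \<tau>" unfolding cut_vertex_def using meet fin unfolding \<tau>_def by blast
 ultimately show ?thesis unfolding elliptic_def by blast
qed

text \<open>A vertex of the cut orients all walls of the orbit. Take a point with the fewest
  disagreements, a finite number. If a wall were wrong, moving to the far end of an edge crossing it
  would correct this wall and spoil no other. So the point lies on the chosen side of every
  wall.\<close>

lemma wcut_elliptic_fixes:
 assumes K: "K\<subseteq>H" and ell: "elliptic G H wcut K"
 shows "\<exists>z\<in>V. \<forall>k\<in>K. \<not> sep orbit_walls z (act k z)"
proof -
 obtain \<tau> where \<tau>: "cut_vertex G H wcut \<tau>" and inv\<tau>: "\<And>k g. k\<in>K ==> g\<in>H ==> k\<otimes>g\<in>\<tau>\<longleftrightarrow>g\<in>\<tau>"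
  using ell unfolding elliptic_def by blast
 define D where "D g = (if g\<in>\<tau> then tr g else V - tr g)" for g
 have XW: "D g\<in>W" if "g\<in>H" for g unfolding D_def using tr_W W_compl that by simp
 have trV: "tr g\<subseteq>V" if "g\<in>H" for g using tr_W W_sub that by blast
 have meet: "D g\<inter>D h\<noteq>{}" if gh: "g\<in>H" "h\<in>H" for g h
 proof -
  have "cside G H wcut \<tau> g\<inter>cside G H wcut \<tau> h\<noteq>{}" using \<tau> gh unfolding cut_vertex_def by blast
  then obtain p where p: "p\<in>cside G H wcut \<tau> g" "p\<in>cside G H wcut \<tau> h" by blast
  have pH: "p\<in>H\<times>UNIV" using p(1) cshift_sub[OF is_group H wcut_sub gh(1)]
   unfolding cside_def by (auto split: if_splits)
  have "wpt p\<in>D g" "wpt p\<in>D h"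
   using p wcut_shift[OF gh(1) pH] wcut_shift[OF gh(2) pH] wpt_V[OF pH]
   unfolding cside_def D_def by (auto split: if_splits)
  thus ?thesis by blast
 qed
 define bad where "bad z = tr ` {g\<in>H. z\<notin>D g}" for z
 have x0p: "(\<one>, False)\<in>H\<times>UNIV" "wpt (\<one>, False) = x0" unfolding wpt_def using e0_V act_one by auto
 have "finite (bad x0)"
 proof -
  let ?Y = "{g\<in>H. g\<in>\<tau>\<longleftrightarrow>(\<one>, False)\<notin>cshift G g wcut}"
  have "finite {cshift G g wcut | g. g\<in>H\<and>(g\<in>\<tau>\<longleftrightarrow>(\<one>, False)\<notin>cshift G g wcut)}"
   using \<tau> x0p unfolding cut_vertex_def by blast
  moreover have "{cshift G g wcut | g. g\<in>H\<and>(g\<in>\<tau>\<longleftrightarrow>(\<one>, False)\<notin>cshift G g wcut)} =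
    (\<lambda>g. cshift G g wcut) ` ?Y" by blast
  ultimately have "finite ((\<lambda>g. cshift G g wcut) ` ?Y)" by simp
  hence "finite (tr ` ?Y)" by (rule finite_image_determined) (use wcut_shift_eq in blast)
  moreover have "bad x0\<subseteq>tr ` ?Y" unfolding bad_def D_def using wcut_shift[OF _ x0p(1)] x0p e0_V
   by (auto split: if_splits)
  ultimately show ?thesis using finite_subset by blast
 qed
 then obtain z where z: "z\<in>V" "finite (bad z)" and
  min: "\<And>y. y\<in>V ==> finite (bad y) ==> card (bad z) \<le> card (bad y)"
  using ex_has_least_nat[of "\<lambda>y. y\<in>V\<and>finite (bad y)" x0 "\<lambda>y. card (bad y)"] e0_V by blast
 have good: "z\<in>D h" if h: "h\<in>H" for h
 proof (rule ccontr)
  assume zX: "z\<notin>D h"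
  obtain a b where ab: "(a, b)\<in>R1" "a\<notin>D h" "b\<in>D h"
   using W_crossed[OF XW[OF h]] by blast
  have bV: "b\<in>V" "a\<in>V" using ab R1_V by auto
  \<comment> \<open>A chosen side that misses \<open>b\<close> is contained in \<open>D h\<close> by
    nestedness, hence misses \<open>z\<close> too.\<close>
  have "bad b\<subseteq>bad z"
  proof
   fix U assume "U\<in>bad b"
   then obtain g where g: "g\<in>H" "U = tr g" "b\<notin>D g" unfolding bad_def by blast
   from nested[OF XW[OF h] XW[OF g(1)]]
   consider "D h\<subseteq>D g" | "D g\<subseteq>D h" | "D h\<inter>D g = {}" | "D h\<union>D g = V" by blast
   hence "D g\<subseteq>D h"
   proof cases
    case 4
    hence "a\<in>D g" using ab bV by blast
    hence "D g = V - D h" using R1_unique'[OF ab(1) XW[OF h] XW[OF g(1)] ab(2,3)] g by blast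
    thus ?thesis using meet[OF h g(1)] by blast
   qed (use ab g meet[OF h g(1)] in blast)+
   thus "U\<in>bad z" unfolding bad_def using g zX by blast
  qed
  moreover have "tr h\<in>bad z" unfolding bad_def using h zX by blast
  moreover have "tr h\<notin>bad b"
  proof
   assume "tr h\<in>bad b"
   then obtain g where g: "g\<in>H" "tr h = tr g" "b\<notin>D g" unfolding bad_def by blast
   hence "g\<in>\<tau>\<longleftrightarrow>h\<in>\<tau>" using cut_vertex_wd[OF is_group H \<tau> g(1) h] wcut_shift_eq[OF g(1) h] by simp
   hence "D g = D h" unfolding D_def using g by simp
   thus False using g ab by simp
  qed
  ultimately have "bad b\<subset>bad z" by blast
  hence "card (bad b) < card (bad z)" "finite (bad b)" using z(2) by (auto intro: psubset_card_mono finite_subset)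
  thus False using min[OF bV(1)] by simp
 qed
 have zin: "z\<in>tr h\<longleftrightarrow>h\<in>\<tau>" if "h\<in>H" for h
  using good[OF that] trV[OF that] unfolding D_def by (auto split: if_splits)
 have "\<not> sep orbit_walls z (act k z)" if k: "k\<in>K" for k
 proof -
  have kH: "k\<in>H" using k K by blast
  have "act k z\<in>tr h\<longleftrightarrow>z\<in>tr h" if h: "h\<in>H" for h
  proof -
   have h': "inv k\<otimes>h\<in>H" and eq: "k\<otimes>(inv k\<otimes>h) = h" using kH h by (auto simp: inv_cancel[OF is_group])
   have "act k z\<in>tr h\<longleftrightarrow>z\<in>tr (inv k\<otimes>h)"
    using act_mem(1)[OF kH trV[OF h'] z(1)] act_image_mult[OF kH h' e0_V(3)] eq by simp
   also have "\<dots>\<longleftrightarrow>z\<in>tr h" using zin[OF h'] zin[OF h] inv\<tau>[OF k h'] eq by simp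
   finally show ?thesis .
  qed
  thus ?thesis unfolding sep_def orbit_walls_def using act_closed[OF kH z(1)] z(1) by blast
 qed
 thus ?thesis using z by blast
qed

end

end

section \<open>Cuts induced from vertex groups\<close>

context
 fixes G :: "'a monoid" (structure) and H :: "'a set"
 assumes grp: "group G" and H: "subgroup H G"
begin

interpretation group G by (rule grp)

declare sg [OF grp H, simp]

lemma cut_vertex_principal:
 assumes A: "is_cut G H A" and p: "p\<in>H\<times>UNIV"
 shows "cut_vertex G H A {g\<in>H. p\<in>cshift G g A}"
proof -
 let ?\<tau> = "{g\<in>H. p\<in>cshift G g A}"
 have "p\<in>cside G H A ?\<tau> g" if "g\<in>H" for g unfolding cside_def using p that by simp
 moreover have "finite {cshift G g A | g. g\<in>H\<and>(g\<in>?\<tau>\<longleftrightarrow>q\<notin>cshift G g A)}" if q: "q\<in>H\<times>UNIV" for q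
 proof (rule finite_subset)
  show "{cshift G g A | g. g\<in>H\<and>(g\<in>?\<tau>\<longleftrightarrow>q\<notin>cshift G g A)} \<subseteq>
   {cshift G g A | g. g\<in>H\<and>p\<in>cshift G g A\<and>q\<notin>cshift G g A} \<union>
   {cshift G g A | g. g\<in>H\<and>q\<in>cshift G g A\<and>p\<notin>cshift G g A}" by blast
  show "finite ({cshift G g A | g. g\<in>H\<and>p\<in>cshift G g A\<and>q\<notin>cshift G g A} \<union>
   {cshift G g A | g. g\<in>H\<and>q\<in>cshift G g A\<and>p\<notin>cshift G g A})"
   using A p q unfolding is_cut_def by (intro finite_UnI) meson+
 qed
 ultimately show ?thesis unfolding cut_vertex_def by blast
qed

lemma cut_vertex_translate:
 assumes A: "A\<subseteq>H\<times>UNIV" and \<tau>: "cut_vertex G H A \<tau>" and m: "m\<in>H"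
 shows "cut_vertex G H A {g\<in>H. inv m\<otimes>g\<in>\<tau>}"
proof -
 let ?\<tau> = "{g\<in>H. inv m\<otimes>g\<in>\<tau>}"
 have sh: "(h, b)\<in>cshift G g A\<longleftrightarrow>(inv m\<otimes>h, b)\<in>cshift G (inv m\<otimes>g) A" if "g\<in>H" "h\<in>H" for g h b
  using that m by (simp add: cshift_mem[OF grp H A] inv_mult_group m_assoc inv_cancel[OF grp])
 have cs: "(h, b)\<in>cside G H A \<tau> (inv m\<otimes>g)\<longleftrightarrow>(m\<otimes>h, b)\<in>cside G H A ?\<tau> g" if "g\<in>H" "h\<in>H" for g h b
  unfolding cside_def using sh[OF that(1), of "m\<otimes>h" b] that m by (simp add: inv_cancel[OF grp])
 have "cside G H A ?\<tau> g\<inter>cside G H A ?\<tau> h\<noteq>{}" if gh: "g\<in>H" "h\<in>H" for g h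
 proof -
  have "cside G H A \<tau> (inv m\<otimes>g)\<inter>cside G H A \<tau> (inv m\<otimes>h)\<noteq>{}"
   using \<tau> gh m unfolding cut_vertex_def by simp
  then obtain k b where kb: "(k, b)\<in>cside G H A \<tau> (inv m\<otimes>g)" "(k, b)\<in>cside G H A \<tau> (inv m\<otimes>h)" by auto
  have "k\<in>H" using kb(1) cshift_sub[OF grp H A, of "inv m\<otimes>g"] gh m
   unfolding cside_def by (auto split: if_splits)
  hence "(m\<otimes>k, b)\<in>cside G H A ?\<tau> g" "(m\<otimes>k, b)\<in>cside G H A ?\<tau> h" using cs gh kb by blast+
  thus ?thesis by blast
 qed
 moreover have "finite {cshift G g A | g. g\<in>H\<and>(g\<in>?\<tau>\<longleftrightarrow>p\<notin>cshift G g A)}" if p: "p\<in>H\<times>UNIV" for p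
 proof -
  obtain h b where hb: "p = (h, b)" "h\<in>H" using p by (cases p) auto
  let ?q = "(inv m\<otimes>h, b)"
  have "finite {cshift G g A | g. g\<in>H\<and>(g\<in>\<tau>\<longleftrightarrow>?q\<notin>cshift G g A)}"
   using \<tau> hb m unfolding cut_vertex_def by simp
  hence "finite (cshift G m ` {cshift G g A | g. g\<in>H\<and>(g\<in>\<tau>\<longleftrightarrow>?q\<notin>cshift G g A)})" by (rule finite_imageI)
  moreover have "{cshift G g A | g. g\<in>H\<and>(g\<in>?\<tau>\<longleftrightarrow>p\<notin>cshift G g A)} \<subseteq>
    cshift G m ` {cshift G g A | g. g\<in>H\<and>(g\<in>\<tau>\<longleftrightarrow>?q\<notin>cshift G g A)}"
  proof
   fix B assume "B\<in>{cshift G g A | g. g\<in>H\<and>(g\<in>?\<tau>\<longleftrightarrow>p\<notin>cshift G g A)}"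
   then obtain g where g: "B = cshift G g A" "g\<in>H" "g\<in>?\<tau>\<longleftrightarrow>p\<notin>cshift G g A" by blast
   have "B = cshift G m (cshift G (inv m\<otimes>g) A)"
    using g m by (simp add: cshift_cshift[OF grp H A] inv_cancel[OF grp])
   moreover have "inv m\<otimes>g\<in>\<tau>\<longleftrightarrow>?q\<notin>cshift G (inv m\<otimes>g) A"
    using g sh[OF g(2) hb(2)] hb by simp
   moreover have "inv m\<otimes>g\<in>H" using g m by simp
   ultimately have "cshift G (inv m\<otimes>g) A\<in>{cshift G g A | g. g\<in>H\<and>(g\<in>\<tau>\<longleftrightarrow>?q\<notin>cshift G g A)}"
    by blast
   thus "B\<in>cshift G m ` {cshift G g A | g. g\<in>H\<and>(g\<in>\<tau>\<longleftrightarrow>?q\<notin>cshift G g A)}"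
    using \<open>B = cshift G m (cshift G (inv m\<otimes>g) A)\<close> by blast
  qed
  ultimately show ?thesis by (rule finite_subset[rotated])
 qed
 ultimately show ?thesis unfolding cut_vertex_def by blast
qed

end

context wall_space
begin

section \<open>Branches at a vertex of a tree\<close>

context
 fixes I :: "'x set set" and x :: 'x
 assumes I: "invariant I" and x: "x\<in>V"
begin

text \<open>The branch at the vertex of \<open>x\<close> that contains \<open>y\<close>. The walls
  in question form a finite chain under inclusion, so the union is the largest of them.\<close>

definition dir :: "'x => 'x set" where
 "dir y = \<Union>{U\<in>I. y\<in>U\<and>x\<notin>U}"

lemma I_W: "U\<in>I ==> U\<in>W" "U\<in>I ==> V - U\<in>I" "U\<in>I ==> U\<subseteq>V"
  "h\<in>H ==> U\<in>I ==> act h ` U\<in>I"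
 using I W_sub unfolding invariant_def by auto

lemma sep_away: "sep I y z ==> y\<in>V ==> z\<in>V ==> \<exists>U\<in>I. y\<in>U\<and>z\<notin>U"
 using I_W(2) unfolding sep_def by (metis DiffD2 DiffI)

lemma dir_props:
 assumes y: "y\<in>V" "sep I x y"
 shows "dir y\<in>I" "y\<in>dir y" "x\<notin>dir y"
proof -
 let ?C = "{U\<in>I. y\<in>U\<and>x\<notin>U}"
 have "?C\<subseteq>{U\<in>W. y\<in>U\<and>x\<notin>U}" using I_W by blast
 hence "finite ?C" using finite_between[OF y(1) x] finite_subset by blast
 moreover have "?C\<noteq>{}" using sep_away[of y x] y x sep_sym by blast
 ultimately obtain M where M: "M\<in>?C" "\<forall>U\<in>?C. M\<subseteq>U \<longrightarrow> U = M" using finite_has_maximal[of ?C] by blast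
 have "U\<subseteq>M" if U: "U\<in>?C" for U
 proof -
  have "U\<in>W" "M\<in>W" using U M I_W by auto
  from nested[OF this] show ?thesis using U M x y by blast
 qed
 hence "dir y = M" unfolding dir_def using M by blast
 thus "dir y\<in>I" "y\<in>dir y" "x\<notin>dir y" using M by auto
qed

lemma dir_max: "U\<in>I ==> y\<in>U ==> x\<notin>U ==> U\<subseteq>dir y"
 unfolding dir_def by blast

lemma dir_same:
 assumes y: "y\<in>V" "sep I x y" and z: "z\<in>dir y"
 shows "sep I x z" "dir z = dir y"
proof -
 note d = dir_props[OF y]
 have zV: "z\<in>V" using z d I_W by blast
 show s: "sep I x z" unfolding sep_def using z d by blast
 have "dir y\<subseteq>dir z" using dir_max[OF d(1) z d(3)] .
 hence "y\<in>dir z" using d by blast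
 hence "dir z\<subseteq>dir y" using dir_max dir_props[OF zV s] by blast
 thus "dir z = dir y" using \<open>dir y\<subseteq>dir z\<close> by blast
qed

lemma dir_unsep:
 assumes "\<not> sep I y z"
 shows "dir y = dir z" "sep I x y\<longleftrightarrow>sep I x z"
proof -
 have "y\<in>U\<longleftrightarrow>z\<in>U" if "U\<in>I" for U using assms that unfolding sep_def by blast
 thus "dir y = dir z" "sep I x y\<longleftrightarrow>sep I x z" unfolding dir_def sep_def by blast+
qed

abbreviation Ks where "Ks \<equiv> stab I x"

lemma Ks: "subgroup Ks G" "Ks\<subseteq>H" "k\<in>Ks ==> k\<in>H" "h\<in>H ==> h\<in>Ks\<longleftrightarrow>\<not> sep I x (act h x)"
 using stab_subgroup[OF I x] unfolding stab_def by auto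

lemma dir_act:
 assumes k: "k\<in>Ks" and y: "y\<in>V"
 shows "dir (act k y) = act k ` dir y" "sep I x (act k y)\<longleftrightarrow>sep I x y"
proof -
 have kH: "k\<in>H" and kx: "\<not> sep I x (act k x)" using k unfolding stab_def by auto
 have xU: "x\<in>act k ` U\<longleftrightarrow>x\<in>U" if "U\<in>I" for U
 proof -
  have "x\<in>act k ` U\<longleftrightarrow>act k x\<in>act k ` U" using kx I_W(4)[OF kH that] unfolding sep_def by blast
  thus ?thesis using act_mem(1)[OF kH I_W(3)[OF that] x] by simp
 qed
 have "{U\<in>I. act k y\<in>U\<and>x\<notin>U} = (\<lambda>U. act k ` U) ` {U\<in>I. y\<in>U\<and>x\<notin>U}"
 proof (intro equalityI subsetI)
  fix U assume U: "U\<in>{U\<in>I. act k y\<in>U\<and>x\<notin>U}"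
  define U' where "U' = act (inv k) ` U"
  have U': "U'\<in>I" "U = act k ` U'" unfolding U'_def
   using I_W(4)[of "inv k" U] act_image_inv(2)[OF kH, of U] U I_W(3) kH by auto
  hence "y\<in>U'" "x\<notin>U'" using U act_mem(1)[OF kH I_W(3) y, of U'] xU[OF U'(1)] by auto
  thus "U\<in>(\<lambda>U. act k ` U) ` {U\<in>I. y\<in>U\<and>x\<notin>U}" using U' by blast
 next
  fix U assume "U\<in>(\<lambda>U. act k ` U) ` {U\<in>I. y\<in>U\<and>x\<notin>U}"
  then obtain U' where "U'\<in>I" "y\<in>U'" "x\<notin>U'" "U = act k ` U'" by blast
  thus "U\<in>{U\<in>I. act k y\<in>U\<and>x\<notin>U}" using I_W(4)[OF kH] xU by blast
 qed
 thus "dir (act k y) = act k ` dir y" unfolding dir_def by (simp add: image_Union)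
 have "\<not> sep I (act k x) x" using kx sep_sym by blast
 hence "sep I x (act k y)\<longleftrightarrow>sep I (act k x) (act k y)" using not_sep_trans kx by blast
 thus "sep I x (act k y)\<longleftrightarrow>sep I x y" using sep_act[OF I kH x y] by simp
qed

text \<open>The edge of the branch starts at the vertex of \<open>x\<close>, since a wall in between
  would belong to a larger branch. Whatever fixes the edge fixes this end.\<close>

lemma wstab_dir:
 assumes y: "y\<in>V" "sep I x y"
 shows "wstab (dir y)\<subseteq>Ks"
proof
 note d = dir_props[OF y]
 fix s assume s: "s\<in>wstab (dir y)"
 hence sH: "s\<in>H" and sd: "act s ` dir y = dir y" unfolding wstab_def by auto
 obtain a b where ab: "(a, b)\<in>R1" "a\<notin>dir y" "b\<in>dir y" using W_crossed I_W d by blast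
 have V: "a\<in>V" "b\<in>V" using ab R1_V by auto
 have xa: "\<not> sep I x a"
 proof
  assume "sep I x a"
  then obtain U where U: "U\<in>I" "a\<in>U" "x\<notin>U" using sep_away[of a x] sep_sym V x by blast
  have bU: "b\<in>U"
  proof (rule ccontr)
   assume "b\<notin>U"
   hence "U = V - dir y" using R1_unique'[OF ab(1) I_W(1)[OF d(1)] I_W(1)[OF U(1)] ab(2,3)] U by blast
   thus False using U d x by blast
  qed
  from nested[OF I_W(1)[OF U(1)] I_W(1)[OF d(1)]]
  consider "U\<subseteq>dir y" | "dir y\<subseteq>U" | "U\<inter>dir y = {}" | "U\<union>dir y = V" by blast
  thus False
  proof cases
   case 2
   hence "U\<subseteq>dir y" using dir_max[OF U(1), of y] U d by blast
   thus False using U ab by blast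
  qed (use U ab bU x d in blast)+
 qed
 have "act s a\<notin>dir y" "act s b\<in>dir y"
  using act_mem(1)[OF sH I_W(3)[OF d(1)] V(1)] act_mem(1)[OF sH I_W(3)[OF d(1)] V(2)] sd ab by auto
 hence "(a, act s a)\<in>R0\<^sup>*" using W_edge[OF ab(1) R1_act[OF sH ab(1)] I_W(1)[OF d(1)]] ab by blast
 hence "\<not> sep I a (act s a)" using R0_rtrancl_uncrossed I_W unfolding sep_def by blast
 moreover have "\<not> sep I (act s a) (act s x)" using sep_act[OF I sH V(1) x] xa sep_sym by blast
 ultimately have "\<not> sep I x (act s x)" using xa not_sep_trans by blast
 thus "s\<in>Ks" using sH unfolding stab_def by blast
qed

text \<open>No point lies both outside the branch at \<open>x\<close> towards \<open>act g x\<close>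
  and outside the branch at \<open>act g x\<close> towards \<open>x\<close>. The second branch is
  moved by \<open>inv g\<close>, so that both are branches at \<open>x\<close>.\<close>

lemma facing_directions:
 assumes g: "g\<in>H" "g\<notin>Ks" and y: "y\<in>V"
 shows "sep I x y\<and>dir y = dir (act g x) \<or> sep I x (act (inv g) y)\<and>dir (act (inv g) y) = dir (act (inv g) x)"
proof -
 have gx: "act g x\<in>V" "sep I x (act g x)" using g x act_closed Ks(4) by auto
 note d = dir_props[OF gx]
 have ig: "inv g\<in>H" using g by simp
 show ?thesis
 proof (cases "y\<in>dir (act g x)")
  case True thus ?thesis using dir_same[OF gx] by blast
 next
  case False
  let ?U = "act (inv g) ` (V - dir (act g x))"
  have U: "?U\<in>I" using I_W(2,4) d(1) ig by blast
  have in1: "act (inv g) y\<in>?U" "act (inv g) x\<in>?U" using False y d x by auto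
  have "act g x\<notin>V - dir (act g x)" using d by blast
  hence nx: "x\<notin>?U" using act_mem(1)[OF ig, of "V - dir (act g x)" "act g x"] gx g x by auto
  have V: "act (inv g) x\<in>V" "act (inv g) y\<in>V" using act_closed ig x y by auto
  have s: "sep I x (act (inv g) x)" unfolding sep_def using U in1 nx by blast
  have "act (inv g) y\<in>dir (act (inv g) x)" using dir_max[OF U in1(2) nx] in1 by blast
  thus ?thesis using dir_same[OF V(1) s] by blast
 qed
qed

section \<open>Replacing the vertex of \<open>x\<close> and its translates by the tree of a
  cut\<close>

context
 fixes A
 assumes A: "is_cut G Ks A"
  and ell: "\<And>y. y\<in>V ==> sep I x y ==> elliptic G Ks A (wstab (dir y))"
begin

lemma A_sub: "A\<subseteq>Ks\<times>UNIV" "A\<noteq>{}" "A\<noteq>Ks\<times>UNIV"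
 using A unfolding is_cut_def by auto

lemma K_closed [simp]: "g\<in>Ks ==> h\<in>Ks ==> g\<otimes>h\<in>Ks" "h\<in>Ks ==> inv h\<in>Ks" "\<one>\<in>Ks"
 using Ks(1) by (auto simp: subgroup.m_closed subgroup.m_inv_closed subgroup.one_closed)

lemma K_carrier [simp]: "h\<in>Ks ==> h\<in>carrier G"
 using Ks(1) by (auto simp: subgroup.mem_carrier)

text \<open>Each edge at the vertex has to be attached to a vertex of the tree of \<open>A\<close>,
  equivariantly under \<open>Ks\<close>. This vertex is chosen for one branch in each orbit, fixed
  by the stabilizer of the branch thanks to \<open>ell\<close>, and translated from there.\<close>

lemma direction_choice:
 "\<exists>E. (\<forall>y. y\<in>V \<longrightarrow> sep I x y \<longrightarrow> cut_vertex G Ks A (E (dir y))) \<and>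
   (\<forall>k\<in>Ks. \<forall>g\<in>Ks. \<forall>y\<in>V. sep I x y \<longrightarrow> (g\<in>E (dir (act k y))\<longleftrightarrow>inv k\<otimes>g\<in>E (dir y)))"
proof -
 define orb where "orb c = (\<lambda>k. act k ` c) ` Ks" for c
 define rep where "rep c = (SOME d. d \<in> orb c)" for c
 define mv where "mv c = (SOME k. k\<in>Ks\<and>c = act k ` rep c)" for c
 define s where "s d = (SOME \<tau>. cut_vertex G Ks A \<tau>\<and>(\<forall>k\<in>wstab d. \<forall>g\<in>Ks. k\<otimes>g\<in>\<tau>\<longleftrightarrow>g\<in>\<tau>))" for d
 define E where "E c = {g\<in>Ks. inv (mv c)\<otimes>g\<in>s (rep c)}" for c
 have orb_eq: "orb (act k ` c) = orb c" if "k\<in>Ks" "c\<subseteq>V" for k c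
 proof -
  have "act l ` act k ` c \<in> orb c" if "l\<in>Ks" for l
   using that \<open>k\<in>Ks\<close> act_image_mult[of l k c] Ks(3) \<open>c\<subseteq>V\<close> unfolding orb_def by force
  moreover have "act l ` c \<in> orb (act k ` c)" if "l\<in>Ks" for l
  proof -
   have "act l ` c = act (l\<otimes>inv k) ` act k ` c"
    using that \<open>k\<in>Ks\<close> \<open>c\<subseteq>V\<close> act_image_mult[of "l\<otimes>inv k" k c] Ks(3) by (simp add: m_assoc)
   thus ?thesis unfolding orb_def using that \<open>k\<in>Ks\<close> by (metis K_closed(1,2) imageI)
  qed
  ultimately show ?thesis unfolding orb_def by blast
 qed
 have dV: "dir y\<subseteq>V" if "y\<in>V" "sep I x y" for y using dir_props[OF that] I_W(3) by blast
 have rep: "\<exists>k\<in>Ks. rep (dir y) = act k ` dir y" if "y\<in>V" "sep I x y" for y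
 proof -
  have "dir y \<in> orb (dir y)" unfolding orb_def using act_image_one[OF dV[OF that]] by (metis K_closed(3) imageI)
  hence "rep (dir y) \<in> orb (dir y)" unfolding rep_def by (rule someI)
  thus ?thesis unfolding orb_def by blast
 qed
 have mv: "mv (dir y)\<in>Ks\<and>dir y = act (mv (dir y)) ` rep (dir y)" if y: "y\<in>V" "sep I x y" for y
  unfolding mv_def
 proof (rule someI_ex)
  obtain k where k: "k\<in>Ks" "rep (dir y) = act k ` dir y" using rep[OF y] by blast
  have "dir y = act (inv k) ` rep (dir y)" unfolding k(2) using act_image_inv(1)[OF Ks(3)[OF k(1)] dV[OF y]] by simp
  thus "\<exists>k. k\<in>Ks\<and>dir y = act k ` rep (dir y)" using k(1) K_closed(2) by blast
 qed
 have s: "cut_vertex G Ks A (s (rep (dir y)))"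
   "\<And>k g. k\<in>wstab (rep (dir y)) ==> g\<in>Ks ==> k\<otimes>g\<in>s (rep (dir y))\<longleftrightarrow>g\<in>s (rep (dir y))"
  if y: "y\<in>V" "sep I x y" for y
 proof -
  obtain k where k: "k\<in>Ks" "rep (dir y) = act k ` dir y" using rep[OF y] by blast
  hence "rep (dir y) = dir (act k y)" "act k y\<in>V" "sep I x (act k y)"
   using dir_act[OF k(1) y(1)] act_closed Ks(3) y by auto
  hence "elliptic G Ks A (wstab (rep (dir y)))" using ell by metis
  hence "\<exists>\<tau>. cut_vertex G Ks A \<tau>\<and>(\<forall>k\<in>wstab (rep (dir y)). \<forall>g\<in>Ks. k\<otimes>g\<in>\<tau>\<longleftrightarrow>g\<in>\<tau>)"
   unfolding elliptic_def .
  from someI_ex[OF this] show "cut_vertex G Ks A (s (rep (dir y)))"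
   "\<And>k g. k\<in>wstab (rep (dir y)) ==> g\<in>Ks ==> k\<otimes>g\<in>s (rep (dir y))\<longleftrightarrow>g\<in>s (rep (dir y))"
   unfolding s_def by auto
 qed
 have E1: "cut_vertex G Ks A (E (dir y))" if y: "y\<in>V" "sep I x y" for y
  unfolding E_def using cut_vertex_translate[OF is_group Ks(1) A_sub(1) s(1)[OF y]] mv[OF y] by blast
 moreover have "g\<in>E (dir (act k y))\<longleftrightarrow>inv k\<otimes>g\<in>E (dir y)"
  if k: "k\<in>Ks" and g: "g\<in>Ks" and y: "y\<in>V" "sep I x y" for k g y
 proof -
  have y': "act k y\<in>V" "sep I x (act k y)" using dir_act[OF k y(1)] act_closed Ks(3)[OF k] y by auto
  have eq: "dir (act k y) = act k ` dir y" using dir_act[OF k y(1)] by simp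
  have r: "rep (dir (act k y)) = rep (dir y)" unfolding rep_def eq orb_eq[OF k dV[OF y]] ..
  define m m0 r where "m = mv (dir (act k y))" and "m0 = mv (dir y)" and "r = rep (dir y)"
  have m: "m\<in>Ks" "act k ` dir y = act m ` r" and m0: "m0\<in>Ks" "dir y = act m0 ` r"
   using mv[OF y] mv[OF y'] r eq unfolding m_def m0_def r_def by auto
  have rV: "r\<subseteq>V"
  proof -
   obtain l where "l\<in>Ks" "r = act l ` dir y" using rep[OF y] unfolding r_def by blast
   thus ?thesis using act_image_sub[OF Ks(3) dV[OF y]] by simp
  qed
  have H3: "k\<in>H" "m\<in>H" "m0\<in>H" using k m m0 Ks(3) by auto
  \<comment> \<open>Two ways of moving the representative to the same branch differ by an element of
    its stabilizer, which does not affect the chosen vertex.\<close>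
  have t: "inv m\<otimes>(k\<otimes>m0)\<in>wstab r"
  proof -
   have "act (inv m\<otimes>(k\<otimes>m0)) ` r = act (inv m) ` act k ` act m0 ` r"
    using H3 rV act_image_sub by (simp add: act_image_mult[symmetric])
   also have "\<dots> = act (inv m) ` act m ` r" using m m0 by simp
   also have "\<dots> = r" using act_image_inv(1)[OF H3(2) rV] .
   finally show ?thesis unfolding wstab_def using H3 by simp
  qed
  have "inv k\<otimes>g\<in>E (dir y)\<longleftrightarrow>inv m0\<otimes>(inv k\<otimes>g)\<in>s r"
   unfolding E_def m0_def[symmetric] r_def[symmetric] using k g by simp
  also have "\<dots>\<longleftrightarrow>(inv m\<otimes>(k\<otimes>m0))\<otimes>(inv m0\<otimes>(inv k\<otimes>g))\<in>s r"
   using s(2)[OF y, folded r_def, OF t, of "inv m0\<otimes>(inv k\<otimes>g)"] m0 k g by simp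
  also have "(inv m\<otimes>(k\<otimes>m0))\<otimes>(inv m0\<otimes>(inv k\<otimes>g)) = inv m\<otimes>g"
   using m m0 k g by (simp add: m_assoc inv_cancel[OF is_group])
  also have "inv m\<otimes>g\<in>s r\<longleftrightarrow>g\<in>E (dir (act k y))"
   unfolding E_def r m_def[symmetric] r_def[symmetric] using g by simp
  finally show ?thesis by simp
 qed
 ultimately show ?thesis by blast
qed

context
 fixes E
 assumes E1: "\<And>y. y\<in>V ==> sep I x y ==> cut_vertex G Ks A (E (dir y))"
  and E2: "\<And>k g y. k\<in>Ks ==> g\<in>Ks ==> y\<in>V ==> sep I x y ==>
   g\<in>E (dir (act k y))\<longleftrightarrow>inv k\<otimes>g\<in>E (dir y)"
begin

text \<open>A half-tree of the blown-up tree, in which each vertex in the orbit of \<open>x\<close>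
  is replaced by a copy of the tree of \<open>A\<close>. Elements outside \<open>Ks\<close> are
  sorted by the side of \<open>A\<close> on which their branch is attached.\<close>

definition icut :: "('a\<times>bool) set" where
 "icut = A\<union>{(h, b). h\<in>H\<and>h\<notin>Ks\<and>\<one>\<in>E (dir (act h x))}"

text \<open>The vertex of the cut \<open>A\<close>, placed at the translate by \<open>g\<close> of the vertex \<open>x\<close>, that is seen from
 the point \<open>y\<close>; \<open>S\<close> tells what is seen if \<open>y\<close> lies at that vertex.\<close>

definition view :: "'x => ('a => 'a set) => 'a => 'a set" where
 "view y S g = (if sep I x (act (inv g) y) then E (dir (act (inv g) y)) else S g)"

definition pview :: "'a\<times>bool => 'a => 'a set" where
 "pview p = view (act (fst p) x) (\<lambda>g. {k\<in>Ks. (inv g\<otimes>fst p, snd p)\<in>cshift G k A})"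

text \<open>\<open>S\<close> prescribes a vertex in the copy of the tree of \<open>A\<close> at
  which \<open>y\<close> itself is located. The second condition expresses that \<open>g\<close> and
  \<open>g \<otimes> k\<close> name the same copy.\<close>

definition coherent :: "'x => ('a => 'a set) => bool" where
 "coherent y S\<longleftrightarrow>(\<forall>g\<in>H. \<not> sep I x (act (inv g) y) \<longrightarrow> cut_vertex G Ks A (S g) \<and>
   (\<forall>k\<in>Ks. \<forall>l\<in>Ks. l\<in>S (g\<otimes>k)\<longleftrightarrow>k\<otimes>l\<in>S g))"

text \<open>The vertex of the blown-up tree that belongs to \<open>y\<close> and the choice
  \<open>S\<close>, encoded by the translates of \<open>icut\<close> that contain it.\<close>

definition seen :: "'x => ('a => 'a set) => 'a set" where
 "seen y S = {g\<in>H. \<one>\<in>view y S g}"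

lemma icut_sub: "icut\<subseteq>H\<times>UNIV"
 unfolding icut_def using A_sub Ks(3) by auto

lemma near_iff: "g\<in>H ==> h\<in>H ==> sep I x (act (inv g) (act h x))\<longleftrightarrow>inv g\<otimes>h\<notin>Ks"
 using Ks(4)[of "inv g\<otimes>h"] x by (simp add: act_mult)

lemma view_vertex: "y\<in>V ==> coherent y S ==> g\<in>H ==> cut_vertex G Ks A (view y S g)"
 unfolding view_def coherent_def using E1 act_closed by simp

lemma view_mult:
 assumes y: "y\<in>V" and S: "coherent y S" and g: "g\<in>H" and k: "k\<in>Ks" and l: "l\<in>Ks"
 shows "l\<in>view y S (g\<otimes>k)\<longleftrightarrow>k\<otimes>l\<in>view y S g"
proof -
 have kH: "k\<in>H" using k Ks(3) by blast
 have V: "act (inv g) y\<in>V" using act_closed g y by simp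
 have eq: "act (inv (g\<otimes>k)) y = act (inv k) (act (inv g) y)"
  using g kH y by (simp add: inv_mult_group act_mult)
 have s: "sep I x (act (inv (g\<otimes>k)) y)\<longleftrightarrow>sep I x (act (inv g) y)"
  unfolding eq using dir_act(2)[OF K_closed(2)[OF k] V] .
 show ?thesis
 proof (cases "sep I x (act (inv g) y)")
  case True
  have "l\<in>E (dir (act (inv k) (act (inv g) y)))\<longleftrightarrow>inv (inv k)\<otimes>l\<in>E (dir (act (inv g) y))"
   by (rule E2[OF K_closed(2)[OF k] l V True])
  thus ?thesis unfolding view_def s using True eq k by simp
 next
  case False
  thus ?thesis unfolding view_def s using S g k l unfolding coherent_def by simp
 qed
qed

lemma pview_coherent:
 assumes p: "p\<in>H\<times>UNIV"
 shows "coherent (act (fst p) x) (\<lambda>g. {k\<in>Ks. (inv g\<otimes>fst p, snd p)\<in>cshift G k A})"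
proof -
 obtain h b where hb: "p = (h, b)" "h\<in>H" using p by (cases p) auto
 show ?thesis unfolding coherent_def hb(1) fst_conv snd_conv
 proof (intro ballI impI conjI)
  fix g assume g: "g\<in>H" "\<not> sep I x (act (inv g) (act h x))"
  hence m: "inv g\<otimes>h\<in>Ks" using near_iff hb by blast
  show "cut_vertex G Ks A {k\<in>Ks. (inv g\<otimes>h, b)\<in>cshift G k A}"
   by (rule cut_vertex_principal[OF is_group Ks(1) A]) (use m in simp)
  fix k l assume kl: "k\<in>Ks" "l\<in>Ks"
  have kH: "k\<in>H" "l\<in>H" using kl Ks(3) by auto
  have e: "inv (g\<otimes>k)\<otimes>h = inv k\<otimes>(inv g\<otimes>h)" using g(1) kH hb by (simp add: inv_mult_group m_assoc)
  show "l\<in>{ka\<in>Ks. (inv (g\<otimes>k)\<otimes>h, b)\<in>cshift G ka A}\<longleftrightarrow>k\<otimes>l\<in>{k\<in>Ks. (inv g\<otimes>h, b)\<in>cshift G k A}"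
   unfolding e using kl m g kH hb
   by (simp add: cshift_mem[OF is_group Ks(1) A_sub(1)] inv_mult_group m_assoc)
 qed
qed

text \<open>Membership in a translate of \<open>icut\<close> becomes a question about
  \<open>A\<close>: on which side is the view of the point in the copy at \<open>g\<close>?
  Properties of \<open>icut\<close> are reduced to those of \<open>A\<close> in this way.\<close>

lemma icut_mem:
 assumes g: "g\<in>H" and k: "k\<in>Ks" and p: "p\<in>H\<times>UNIV"
 shows "p\<in>cshift G (g\<otimes>k) icut\<longleftrightarrow>k\<in>pview p g"
proof -
 obtain h b where hb: "p = (h, b)" "h\<in>H" using p by (cases p) auto
 have kH: "k\<in>H" using k Ks(3) by blast
 have gk: "g\<otimes>k\<in>H" using g kH by simp
 have "p\<in>cshift G (g\<otimes>k) icut\<longleftrightarrow>(inv (g\<otimes>k)\<otimes>h, b)\<in>icut"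
  unfolding hb cshift_mem[OF is_group H icut_sub gk] using hb by simp
 also have "\<dots>\<longleftrightarrow>\<one>\<in>pview p (g\<otimes>k)"
 proof (cases "inv (g\<otimes>k)\<otimes>h\<in>Ks")
  case True
  thus ?thesis unfolding pview_def view_def hb fst_conv snd_conv near_iff[OF gk hb(2)]
   using A_sub(1) by (auto simp: icut_def cshift_one[OF is_group Ks(1) A_sub(1)])
 next
  case False
  have "act (inv (g\<otimes>k)\<otimes>h) x = act (inv (g\<otimes>k)) (act h x)" by (rule act_mult) (use gk hb x in auto)
  thus ?thesis unfolding pview_def view_def hb fst_conv snd_conv near_iff[OF gk hb(2)]
   using False A_sub(1) gk hb by (auto simp: icut_def)
 qed
 also have "\<dots>\<longleftrightarrow>k\<in>pview p g"
  using view_mult[OF _ pview_coherent[OF p] g k, of \<one>] k x hb act_closed unfolding pview_def by simp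
 finally show ?thesis .
qed

lemma icut_mem_one: "k\<in>Ks ==> p\<in>H\<times>UNIV ==> p\<in>cshift G k icut\<longleftrightarrow>k\<in>pview p \<one>"
 using icut_mem[of \<one> k p] by simp

lemma pview_near:
 assumes "g\<in>H" "l\<in>Ks"
 shows "pview (g\<otimes>l, b) g = {k\<in>Ks. (l, b)\<in>cshift G k A}"
proof -
 have lH: "l\<in>H" using assms Ks(3) by blast
 have "inv g\<otimes>(g\<otimes>l) = l" using assms lH by (simp add: inv_cancel[OF is_group])
 thus ?thesis unfolding pview_def view_def using near_iff[OF assms(1), of "g\<otimes>l"] assms lH by simp
qed

lemma icut_K: "k\<in>Ks ==> cshift G k icut\<inter>Ks\<times>UNIV = cshift G k A"
proof -
 assume k: "k\<in>Ks"
 have "(l, b)\<in>cshift G k icut\<longleftrightarrow>(l, b)\<in>cshift G k A" if l: "l\<in>Ks" for l b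
  using icut_mem_one[OF k, of "(l, b)"] pview_near[of \<one> l b] l k Ks(3) by auto
 thus ?thesis using cshift_sub[OF is_group Ks(1) A_sub(1) k] by auto
qed

text \<open>From another copy all of \<open>Ks\<close> is seen in one direction.\<close>

lemma icut_off_K:
 assumes g: "g\<in>H" "g\<notin>Ks"
 shows "cshift G g icut\<inter>Ks\<times>UNIV = {} \<or> Ks\<times>UNIV\<subseteq>cshift G g icut"
proof -
 have ig: "inv g\<in>H" using g by simp
 have "(l, b)\<in>cshift G g icut\<longleftrightarrow>\<one>\<in>E (dir (act (inv g) x))" if l: "l\<in>Ks" for l b
 proof -
  have lH: "l\<in>H" using l Ks(3) by blast
  have "inv g\<otimes>l\<notin>Ks"
  proof
   assume "inv g\<otimes>l\<in>Ks"
   hence "inv (inv g\<otimes>l\<otimes>inv l)\<in>Ks" using l by simp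
   thus False using g lH by (simp add: m_assoc)
  qed
  moreover have "\<not> sep I (act (inv g) (act l x)) (act (inv g) x)"
   using sep_act[OF I ig, of "act l x" x] x lH act_closed Ks(4)[OF lH] l sep_sym by blast
  ultimately show ?thesis
   using icut_mem[OF g(1) K_closed(3), of "(l, b)"] lH g near_iff[OF g(1) lH] dir_unsep(1)
   unfolding pview_def view_def by simp
 qed
 thus ?thesis by auto
qed

text \<open>Translates from outside \<open>Ks\<close> are constant on
  \<open>Ks \<times> UNIV\<close>, where \<open>icut\<close> is the nontrivial set \<open>A\<close>.
  Inside \<open>Ks\<close>, every point is judged by a vertex of \<open>A\<close>, which does not
  distinguish equal translates of \<open>A\<close>.\<close>

lemma icut_fix_iff:
 assumes g: "g\<in>H"
 shows "cshift G g icut = icut\<longleftrightarrow>g\<in>Ks\<and>cshift G g A = A"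
proof
 have one: "cshift G \<one> icut = icut" "cshift G \<one> A = A"
  by (rule cshift_one[OF is_group H icut_sub], rule cshift_one[OF is_group Ks(1) A_sub(1)])
 have iK: "icut\<inter>Ks\<times>UNIV = A" using icut_K[OF K_closed(3)] one by simp
 assume eq: "cshift G g icut = icut"
 have "g\<in>Ks"
 proof (rule ccontr)
  assume "g\<notin>Ks"
  from icut_off_K[OF g this] eq have "icut\<inter>Ks\<times>UNIV = {} \<or> icut\<inter>Ks\<times>UNIV = Ks\<times>UNIV" by auto
  thus False using iK A_sub by simp
 qed
 thus "g\<in>Ks\<and>cshift G g A = A" using icut_K[of g] eq iK by simp
next
 assume a: "g\<in>Ks\<and>cshift G g A = A"
 have one: "cshift G \<one> icut = icut" "cshift G \<one> A = A"
  by (rule cshift_one[OF is_group H icut_sub], rule cshift_one[OF is_group Ks(1) A_sub(1)])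
 have "p\<in>cshift G g icut\<longleftrightarrow>p\<in>cshift G \<one> icut" if p: "p\<in>H\<times>UNIV" for p
 proof -
  have "cut_vertex G Ks A (pview p \<one>)"
   unfolding pview_def using view_vertex[OF _ pview_coherent[OF p]] p act_closed x by auto
  hence "g\<in>pview p \<one>\<longleftrightarrow>\<one>\<in>pview p \<one>" using cut_vertex_wd[OF is_group Ks(1), of A _ g \<one>] a one by simp
  thus ?thesis using icut_mem_one[OF _ p] a by simp
 qed
 thus "cshift G g icut = icut" using cshift_sub[OF is_group H icut_sub g] icut_sub one by blast
qed

lemma icut_eq_coset:
 assumes g: "g\<in>H" and k: "k\<in>Ks" "l\<in>Ks" and eq: "cshift G k A = cshift G l A"
 shows "cshift G (g\<otimes>k) icut = cshift G (g\<otimes>l) icut"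
proof -
 have kH: "k\<in>H" "l\<in>H" using k Ks(3) by auto
 have "p\<in>cshift G (g\<otimes>k) icut\<longleftrightarrow>p\<in>cshift G (g\<otimes>l) icut" if p: "p\<in>H\<times>UNIV" for p
 proof -
  have "cut_vertex G Ks A (pview p g)"
   unfolding pview_def using view_vertex[OF _ pview_coherent[OF p] g] p act_closed x by auto
  hence "k\<in>pview p g\<longleftrightarrow>l\<in>pview p g" using cut_vertex_wd[OF is_group Ks(1) _ k eq] by blast
  thus ?thesis using icut_mem[OF g _ p] k by simp
 qed
 moreover have "cshift G (g\<otimes>k) icut\<subseteq>H\<times>UNIV" "cshift G (g\<otimes>l) icut\<subseteq>H\<times>UNIV"
  using cshift_sub[OF is_group H icut_sub] g kH by simp_all
 ultimately show ?thesis by blast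
qed

text \<open>The views of \<open>y\<close> and \<open>z\<close> differ only at copies on the path
  between them. The key \<open>\<kappa>\<close> locates such a copy by its position relative to the
  finitely many walls between \<open>y\<close> and \<open>z\<close>.\<close>

lemma views_differ_finite:
 assumes y: "y\<in>V" "z\<in>V"
 shows "\<exists>\<Gamma>. finite \<Gamma>\<and>\<Gamma>\<subseteq>H\<and>(\<forall>g\<in>H. view y S g\<noteq>view z T g \<longrightarrow> (\<exists>\<gamma>\<in>\<Gamma>. inv \<gamma>\<otimes>g\<in>Ks))"
proof -
 define D where "D = {g\<in>H. view y S g\<noteq>view z T g}"
 define \<U> where "\<U> = {U\<in>I. (y\<in>U)\<noteq>(z\<in>U)}"
 define \<kappa> where "\<kappa> g = (sep I x (act (inv g) y), sep I x (act (inv g) z), {U\<in>\<U>. act g x\<in>U})" for g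
 have "\<U>\<subseteq>{U\<in>W. y\<in>U\<and>z\<notin>U}\<union>{U\<in>W. z\<in>U\<and>y\<notin>U}" unfolding \<U>_def using I_W by blast
 hence "finite \<U>" using finite_between[OF y] finite_between[OF y(2,1)] by (meson finite_UnI finite_subset)
 moreover have "\<kappa> ` D\<subseteq>UNIV\<times>UNIV\<times>Pow \<U>" unfolding \<kappa>_def by auto
 ultimately have "finite (\<kappa> ` D)" by (meson finite_Pow_iff finite_SigmaI finite_subset finite)
 then obtain \<Gamma> where \<Gamma>: "\<Gamma>\<subseteq>D" "finite \<Gamma>" "\<kappa> ` D = \<kappa> ` \<Gamma>" using finite_subset_image[of "\<kappa> ` D" \<kappa> D] by blast
 have near: "\<not> sep I w (act g x)" if "g\<in>H" "w\<in>V" "\<not> sep I x (act (inv g) w)" for g w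
  using sep_act[OF I that(1), of x "act (inv g) w"] that x act_closed sep_sym by simp
 have key: "inv \<gamma>\<otimes>g\<in>Ks" if g: "g\<in>D" and \<gamma>: "\<gamma>\<in>D" and eq: "\<kappa> g = \<kappa> \<gamma>" for g \<gamma>
 proof -
  have gH: "g\<in>H" "\<gamma>\<in>H" using g \<gamma> unfolding D_def by auto
  have "\<not> sep I (act \<gamma> x) (act g x)"
  proof (cases "sep I x (act (inv g) y)\<and>sep I x (act (inv g) z)")
   case False
   then obtain w where w: "w\<in>{y, z}" "\<not> sep I x (act (inv g) w)" by blast
   hence "\<not> sep I x (act (inv \<gamma>) w)" using eq unfolding \<kappa>_def by auto
   hence "\<not> sep I w (act \<gamma> x)" "\<not> sep I w (act g x)" using near[OF gH(2)] near[OF gH(1)] w y by auto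
   thus ?thesis using not_sep_trans sep_sym by metis
  next
   case True
   \<comment> \<open>If a wall has \<open>y\<close> and \<open>z\<close> on one side and the copy on
     the other, both are seen in the same branch.\<close>
   have off: False if a: "a\<in>D" "sep I x (act (inv a) y)" "sep I x (act (inv a) z)"
    and U: "U\<in>I" "y\<in>U" "z\<in>U" "act a x\<notin>U" for a U
   proof -
    have aH: "a\<in>H" "inv a\<in>H" using a unfolding D_def by auto
    let ?U = "act (inv a) ` U"
    have U': "?U\<in>I" using I_W(4) U aH by blast
    have in1: "act (inv a) y\<in>?U" "act (inv a) z\<in>?U" using U by auto
    have "act a x\<in>V" using aH x act_closed by simp
    hence nx: "x\<notin>?U" using act_mem(1)[OF aH(2) I_W(3)[OF U(1)], of "act a x"] U aH x by simp
    have "act (inv a) z\<in>dir (act (inv a) y)" using dir_max[OF U' in1(1) nx] in1 by blast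
    hence "dir (act (inv a) z) = dir (act (inv a) y)" using dir_same[OF _ a(2)] act_closed aH y by blast
    hence "view y S a = view z T a" unfolding view_def using a by simp
    thus False using a unfolding D_def by blast
   qed
   have True': "sep I x (act (inv \<gamma>) y)" "sep I x (act (inv \<gamma>) z)" using True eq unfolding \<kappa>_def by auto
   show ?thesis
   proof
    assume "sep I (act \<gamma> x) (act g x)"
    then obtain U where U: "U\<in>I" "act \<gamma> x\<in>U" "act g x\<notin>U"
     using sep_away act_closed gH x by metis
    have "U\<notin>\<U>" using eq U unfolding \<kappa>_def by auto
    then consider "y\<in>U" "z\<in>U" | "y\<notin>U" "z\<notin>U" using U unfolding \<U>_def by blast
    thus False
    proof cases
     case 1 thus False using off[OF g _ _ U(1)] True U by blast
    next
     case 2 thus False using off[OF \<gamma> True' I_W(2)[OF U(1)]] U y by blast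
    qed
   qed
  qed
  hence "\<not> sep I (act (inv \<gamma>) (act \<gamma> x)) (act (inv \<gamma>) (act g x))"
   using sep_act[OF I, of "inv \<gamma>" "act \<gamma> x" "act g x"] gH x act_closed by simp
  thus ?thesis using near_iff[OF gH(2,1)] gH x by simp
 qed
 have "\<exists>\<gamma>\<in>\<Gamma>. inv \<gamma>\<otimes>g\<in>Ks" if "g\<in>D" for g
 proof -
  have "\<kappa> g\<in>\<kappa> ` \<Gamma>" using that \<Gamma>(3) by blast
  then obtain \<gamma> where "\<gamma>\<in>\<Gamma>" "\<kappa> g = \<kappa> \<gamma>" by blast
  thus ?thesis using key[OF that] \<Gamma>(1) by blast
 qed
 thus ?thesis using \<Gamma> unfolding D_def by blast
qed

lemma seen_mult:
 assumes "y\<in>V" "coherent y S" "g\<in>H" "k\<in>Ks"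
 shows "g\<otimes>k\<in>seen y S\<longleftrightarrow>k\<in>view y S g"
 using view_mult[OF assms K_closed(3)] assms Ks(3)[OF assms(4)] unfolding seen_def by simp

text \<open>Disagreements occur in finitely many copies by \<open>views_differ_finite\<close>, and
  within one copy two vertices of the tree of \<open>A\<close> disagree on finitely many
  translates.\<close>

lemma seen_finite:
 assumes y: "y\<in>V" and S: "coherent y S" and p: "p\<in>H\<times>UNIV"
 shows "finite {cshift G g icut | g. g\<in>H\<and>(g\<in>seen y S\<longleftrightarrow>p\<notin>cshift G g icut)}"
proof -
 have pV: "act (fst p) x\<in>V" using p x act_closed by auto
 obtain \<Gamma> where \<Gamma>: "finite \<Gamma>" "\<Gamma>\<subseteq>H" "\<And>g. g\<in>H ==> view y S g\<noteq>pview p g ==> \<exists>\<gamma>\<in>\<Gamma>. inv \<gamma>\<otimes>g\<in>Ks"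
  using views_differ_finite[OF y pV] unfolding pview_def by meson
 define Q where "Q \<gamma> = {k\<in>Ks. k\<in>view y S \<gamma>\<longleftrightarrow>k\<notin>pview p \<gamma>}" for \<gamma>
 have finQ: "finite ((\<lambda>k. cshift G (\<gamma>\<otimes>k) icut) ` Q \<gamma>)" if \<gamma>: "\<gamma>\<in>H" for \<gamma>
 proof (rule finite_image_determined)
  show "cshift G (\<gamma>\<otimes>k) icut = cshift G (\<gamma>\<otimes>l) icut" if "k\<in>Q \<gamma>" "l\<in>Q \<gamma>" "cshift G k A = cshift G l A" for k l
   using icut_eq_coset[OF \<gamma>] that unfolding Q_def by blast
  have v: "cut_vertex G Ks A (view y S \<gamma>)" "cut_vertex G Ks A (pview p \<gamma>)"
   using view_vertex[OF y S \<gamma>] view_vertex[OF pV pview_coherent[OF p] \<gamma>] unfolding pview_def by auto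
  let ?e = "(\<one>, True)"
  have e: "?e\<in>Ks\<times>UNIV" by simp
  have "finite {cshift G k A | k. k\<in>Ks\<and>(k\<in>view y S \<gamma>\<longleftrightarrow>?e\<notin>cshift G k A)}"
   "finite {cshift G k A | k. k\<in>Ks\<and>(k\<in>pview p \<gamma>\<longleftrightarrow>?e\<notin>cshift G k A)}"
   using v e unfolding cut_vertex_def by meson+
  moreover have "(\<lambda>k. cshift G k A) ` Q \<gamma> \<subseteq>
   {cshift G k A | k. k\<in>Ks\<and>(k\<in>view y S \<gamma>\<longleftrightarrow>?e\<notin>cshift G k A)} \<union>
   {cshift G k A | k. k\<in>Ks\<and>(k\<in>pview p \<gamma>\<longleftrightarrow>?e\<notin>cshift G k A)}"
   unfolding Q_def by blast
  ultimately show "finite ((\<lambda>k. cshift G k A) ` Q \<gamma>)" by (meson finite_UnI finite_subset)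
 qed
 have "{cshift G g icut | g. g\<in>H\<and>(g\<in>seen y S\<longleftrightarrow>p\<notin>cshift G g icut)} \<subseteq>
   (\<Union>\<gamma>\<in>\<Gamma>. (\<lambda>k. cshift G (\<gamma>\<otimes>k) icut) ` Q \<gamma>)"
 proof
  fix B assume "B\<in>{cshift G g icut | g. g\<in>H\<and>(g\<in>seen y S\<longleftrightarrow>p\<notin>cshift G g icut)}"
  then obtain g where g: "B = cshift G g icut" "g\<in>H" "g\<in>seen y S\<longleftrightarrow>p\<notin>cshift G g icut" by blast
  have "p\<in>cshift G g icut\<longleftrightarrow>\<one>\<in>pview p g" using icut_mem[OF g(2) K_closed(3) p] g by simp
  hence "view y S g\<noteq>pview p g" using g unfolding seen_def by auto
  then obtain \<gamma> where \<gamma>: "\<gamma>\<in>\<Gamma>" "inv \<gamma>\<otimes>g\<in>Ks" using \<Gamma>(3)[OF g(2)] by blast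
  have \<gamma>H: "\<gamma>\<in>H" using \<gamma> \<Gamma> by blast
  have gk: "g = \<gamma>\<otimes>(inv \<gamma>\<otimes>g)" using g \<gamma>H by (simp add: inv_cancel[OF is_group])
  have "inv \<gamma>\<otimes>g\<in>Q \<gamma>"
   using g(3) seen_mult[OF y S \<gamma>H \<gamma>(2)] icut_mem[OF \<gamma>H \<gamma>(2) p] \<gamma>(2) gk[symmetric] unfolding Q_def by simp
  moreover have "B = cshift G (\<gamma>\<otimes>(inv \<gamma>\<otimes>g)) icut" using g(1) gk by simp
  ultimately show "B\<in>(\<Union>\<gamma>\<in>\<Gamma>. (\<lambda>k. cshift G (\<gamma>\<otimes>k) icut) ` Q \<gamma>)" using \<gamma> by blast
 qed
 moreover have "finite (\<Union>\<gamma>\<in>\<Gamma>. (\<lambda>k. cshift G (\<gamma>\<otimes>k) icut) ` Q \<gamma>)"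
  using \<Gamma>(1,2) finQ by (intro finite_UN_I) auto
 ultimately show ?thesis by (rule finite_subset)
qed

lemma cside_seen:
 assumes y: "y\<in>V" and S: "coherent y S" and g: "g\<in>H" and k: "k\<in>Ks"
  and l: "(l, b)\<in>cside G Ks A (view y S g) k"
 shows "(g\<otimes>l, b)\<in>cside G H icut (seen y S) (g\<otimes>k)"
proof -
 have lK: "l\<in>Ks" using l cshift_sub[OF is_group Ks(1) A_sub(1) k] unfolding cside_def by (auto split: if_splits)
 have p: "(g\<otimes>l, b)\<in>H\<times>UNIV" using lK Ks(3) g by simp
 have "(g\<otimes>l, b)\<in>cshift G (g\<otimes>k) icut\<longleftrightarrow>(l, b)\<in>cshift G k A"
  using icut_mem[OF g k p] pview_near[OF g lK] k by simp
 thus ?thesis using l p seen_mult[OF y S g k] unfolding cside_def by (auto split: if_splits)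
qed

text \<open>From the copy at \<open>g\<close>, the point \<open>y\<close> and the whole copy at
  \<open>g'\<close> are seen in the same branch, so they lie on the same side.\<close>

lemma cside_toward:
 assumes y: "y\<in>V" and S: "coherent y S" and g: "g\<in>H" "g'\<in>H" "inv g\<otimes>g'\<notin>Ks"
  and toward: "sep I x (act (inv g) y)" "dir (act (inv g) y) = dir (act (inv g\<otimes>g') x)" and l: "l\<in>Ks"
 shows "(g'\<otimes>l, b)\<in>cside G H icut (seen y S) g"
proof -
 have lH: "l\<in>H" using l Ks(3) by blast
 have p: "(g'\<otimes>l, b)\<in>H\<times>UNIV" using lH g by simp
 have "inv g\<otimes>(g'\<otimes>l)\<notin>Ks"
 proof
  assume "inv g\<otimes>(g'\<otimes>l)\<in>Ks"
  hence "inv g\<otimes>(g'\<otimes>l)\<otimes>inv l\<in>Ks" using l by simp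
  thus False using g lH by (simp add: m_assoc)
 qed
 moreover have "dir (act (inv g) (act (g'\<otimes>l) x)) = dir (act (inv g\<otimes>g') x)"
 proof -
  have "act (inv g) (act (g'\<otimes>l) x) = act (inv g\<otimes>g') (act l x)"
   using g lH x act_closed by (simp add: act_mult)
  moreover have "\<not> sep I (act (inv g\<otimes>g') (act l x)) (act (inv g\<otimes>g') x)"
   using sep_act[OF I, of "inv g\<otimes>g'" "act l x" x] g lH x act_closed l Ks(4)[OF lH] sep_sym by simp
  ultimately show ?thesis using dir_unsep(1) by simp
 qed
 ultimately have "pview (g'\<otimes>l, b) g = view y S g"
  unfolding pview_def view_def using near_iff[OF g(1), of "g'\<otimes>l"] g lH toward by simp
 hence "(g'\<otimes>l, b)\<in>cshift G g icut\<longleftrightarrow>g\<in>seen y S"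
  using icut_mem[OF g(1) K_closed(3) p] g unfolding seen_def by simp
 thus ?thesis using p unfolding cside_def by simp
qed

text \<open>Within one copy this is a property of the view as a vertex of \<open>A\<close>. For two
  copies, by \<open>facing_directions\<close> one of them sees \<open>y\<close> in the direction of
  the other, and the side chosen there contains the whole other copy.\<close>

lemma seen_meet:
 assumes y: "y\<in>V" and S: "coherent y S" and g: "g\<in>H" "g'\<in>H"
 shows "cside G H icut (seen y S) g\<inter>cside G H icut (seen y S) g'\<noteq>{}"
proof (cases "inv g\<otimes>g'\<in>Ks")
 case True
 have "cside G Ks A (view y S g) \<one>\<inter>cside G Ks A (view y S g) (inv g\<otimes>g')\<noteq>{}"
  using view_vertex[OF y S g(1)] True unfolding cut_vertex_def by simp
 then obtain l b where "(l, b)\<in>cside G Ks A (view y S g) \<one>" "(l, b)\<in>cside G Ks A (view y S g) (inv g\<otimes>g')" by auto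
 from cside_seen[OF y S g(1) K_closed(3) this(1)] cside_seen[OF y S g(1) True this(2)]
 show ?thesis using g by (auto simp: inv_cancel[OF is_group])
next
 case False
 have self: "\<exists>l b. (l, b)\<in>cside G Ks A (view y S h) \<one>" if "h\<in>H" for h
 proof -
  have "cside G Ks A (view y S h) \<one>\<inter>cside G Ks A (view y S h) \<one>\<noteq>{}"
   using view_vertex[OF y S that] K_closed(3) unfolding cut_vertex_def by blast
  thus ?thesis by auto
 qed
 have inK: "l\<in>Ks" if "(l, b)\<in>cside G Ks A \<tau> \<one>" for l b \<tau>
  using that cshift_sub[OF is_group Ks(1) A_sub(1) K_closed(3)] unfolding cside_def by (auto split: if_splits)
 have d: "inv g\<otimes>g'\<in>H" using g by simp
 have iv: "inv (inv g\<otimes>g') = inv g'\<otimes>g" using g by (simp add: inv_mult_group)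
 have eq: "act (inv (inv g\<otimes>g')) (act (inv g) y) = act (inv g') y"
  using g y unfolding iv by (simp add: act_mult[symmetric] m_assoc)
 have gy: "act (inv g) y\<in>V" using g y act_closed by simp
 have not': "inv g'\<otimes>g\<notin>Ks"
 proof
  assume "inv g'\<otimes>g\<in>Ks"
  hence "inv (inv g'\<otimes>g)\<in>Ks" by simp
  thus False using False g by (simp add: inv_mult_group)
 qed
 from facing_directions[OF d False gy] show ?thesis
 proof
  assume t: "sep I x (act (inv g) y)\<and>dir (act (inv g) y) = dir (act (inv g\<otimes>g') x)"
  obtain l b where lb: "(l, b)\<in>cside G Ks A (view y S g') \<one>" using self[OF g(2)] by blast
  have "(g'\<otimes>l, b)\<in>cside G H icut (seen y S) (g'\<otimes>\<one>)" by (rule cside_seen[OF y S g(2) K_closed(3) lb])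
  moreover have "(g'\<otimes>l, b)\<in>cside G H icut (seen y S) g"
   using cside_toward[OF y S g False] t inK[OF lb] by blast
  ultimately show ?thesis using g by auto
 next
  assume t: "sep I x (act (inv (inv g\<otimes>g')) (act (inv g) y)) \<and>
   dir (act (inv (inv g\<otimes>g')) (act (inv g) y)) = dir (act (inv (inv g\<otimes>g')) x)"
  obtain l b where lb: "(l, b)\<in>cside G Ks A (view y S g) \<one>" using self[OF g(1)] by blast
  have "(g\<otimes>l, b)\<in>cside G H icut (seen y S) (g\<otimes>\<one>)" by (rule cside_seen[OF y S g(1) K_closed(3) lb])
  moreover have "(g\<otimes>l, b)\<in>cside G H icut (seen y S) g'"
   using cside_toward[OF y S g(2,1) not' _ _ inK[OF lb]] t unfolding eq unfolding iv by blast
  ultimately show ?thesis using g by auto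
 qed
qed

lemma seen_vertex:
 assumes "y\<in>V" "coherent y S"
 shows "cut_vertex G H icut (seen y S)"
 unfolding cut_vertex_def using seen_meet[OF assms] seen_finite[OF assms] unfolding seen_def by blast

text \<open>Within one copy, each of the four relations between translates of \<open>A\<close> is
  carried over to all points, because every view is a vertex of \<open>A\<close>. For different
  copies, every point is seen from one of the two in the direction of the other.\<close>

lemma icut_is_cut: "is_cut G H icut"
proof -
 have one: "cshift G \<one> icut = icut" "cshift G \<one> A = A"
  by (rule cshift_one[OF is_group H icut_sub], rule cshift_one[OF is_group Ks(1) A_sub(1)])
 have iK: "icut\<inter>Ks\<times>UNIV = A" using icut_K[OF K_closed(3)] one by simp
 have KH: "Ks\<times>UNIV\<subseteq>H\<times>UNIV" using Ks(2) by blast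
 have ne: "icut\<noteq>{}" "icut\<noteq>H\<times>UNIV" using iK A_sub KH by auto
 have mem1: "p\<in>icut\<longleftrightarrow>\<one>\<in>pview p \<one>" if "p\<in>H\<times>UNIV" for p
  using icut_mem_one[OF K_closed(3) that] one by simp
 have nest: "cshift G g icut\<subseteq>icut \<or> icut\<subseteq>cshift G g icut \<or> cshift G g icut\<inter>icut = {} \<or>
   cshift G g icut\<union>icut = H\<times>UNIV" if g: "g\<in>H" for g
 proof -
  note sub = cshift_sub[OF is_group H icut_sub g] icut_sub
  show ?thesis
  proof (cases "g\<in>Ks")
   case True
   have v: "cut_vertex G Ks A (pview p \<one>)" if p: "p\<in>H\<times>UNIV" for p
    unfolding pview_def using view_vertex[OF _ pview_coherent[OF p]] p act_closed x by auto
   have meet: "cside G Ks A (pview p \<one>) g\<inter>cside G Ks A (pview p \<one>) \<one>\<noteq>{}" if p: "p\<in>H\<times>UNIV" for p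
    using v[OF p] True unfolding cut_vertex_def by simp
   have memg: "p\<in>cshift G g icut\<longleftrightarrow>g\<in>pview p \<one>" if "p\<in>H\<times>UNIV" for p
    by (rule icut_mem_one[OF True that])
   from A True consider "cshift G g A\<subseteq>A" | "A\<subseteq>cshift G g A" | "cshift G g A\<inter>A = {}" | "cshift G g A\<union>A = Ks\<times>UNIV"
    unfolding is_cut_def by blast
   thus ?thesis
   proof cases
    case 1
    have "p\<in>icut" if p: "p\<in>H\<times>UNIV" "p\<in>cshift G g icut" for p
     using meet[OF p(1)] 1 p memg[OF p(1)] mem1[OF p(1)] unfolding cside_def one by (auto split: if_splits)
    thus ?thesis using sub by blast
   next
    case 2
    have "p\<in>cshift G g icut" if p: "p\<in>H\<times>UNIV" "p\<in>icut" for p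
     using meet[OF p(1)] 2 p memg[OF p(1)] mem1[OF p(1)] unfolding cside_def one by (auto split: if_splits)
    thus ?thesis using sub by blast
   next
    case 3
    have "p\<notin>cshift G g icut" if p: "p\<in>H\<times>UNIV" "p\<in>icut" for p
     using meet[OF p(1)] 3 p memg[OF p(1)] mem1[OF p(1)] unfolding cside_def one by (auto split: if_splits)
    thus ?thesis using sub by blast
   next
    case 4
    have "p\<in>cshift G g icut \<or> p\<in>icut" if p: "p\<in>H\<times>UNIV" for p
     using meet[OF p(1)] 4 p memg[OF p(1)] mem1[OF p(1)] unfolding cside_def one by (auto split: if_splits)
    thus ?thesis using sub by blast
   qed
  next
   case False
   \<comment> \<open>The sides on which the two copies see each other; every point agrees with at
     least one of them, which empties one of the four quadrants.\<close>
   define \<alpha> \<beta> where "\<alpha>\<longleftrightarrow>\<one>\<in>E (dir (act g x))" and "\<beta>\<longleftrightarrow>\<one>\<in>E (dir (act (inv g) x))"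
   have "(p\<in>icut\<longleftrightarrow>\<alpha>) \<or> (p\<in>cshift G g icut\<longleftrightarrow>\<beta>)" if p: "p\<in>H\<times>UNIV" for p
   proof -
    have pV: "act (fst p) x\<in>V" using p x act_closed by auto
    have "p\<in>cshift G g icut\<longleftrightarrow>\<one>\<in>pview p g" using icut_mem[OF g K_closed(3) p] g by simp
    moreover have "act (inv \<one>) (act (fst p) x) = act (fst p) x" using pV act_one by simp
    ultimately show ?thesis using facing_directions[OF g False pV] mem1[OF p]
     unfolding \<alpha>_def \<beta>_def pview_def view_def by auto
   qed
   thus ?thesis using sub by (cases \<alpha>; cases \<beta>) blast+
  qed
 qed
 have ninv: "cshift G g icut\<noteq>H\<times>UNIV - icut" if g: "g\<in>H" for g
 proof
  assume eq: "cshift G g icut = H\<times>UNIV - icut"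
  hence r: "cshift G g icut\<inter>Ks\<times>UNIV = Ks\<times>UNIV - A" using iK KH by blast
  show False
  proof (cases "g\<in>Ks")
   case True
   hence "cshift G g A = Ks\<times>UNIV - A" using icut_K r by simp
   thus False using A True unfolding is_cut_def by blast
  next
   case False thus False using icut_off_K[OF g] r A_sub by blast
  qed
 qed
 have fin: "finite {cshift G g icut | g. g\<in>H\<and>p\<in>cshift G g icut\<and>q\<notin>cshift G g icut}"
  if pq: "p\<in>H\<times>UNIV" "q\<in>H\<times>UNIV" for p q
 proof -
  let ?S = "\<lambda>g. {k\<in>Ks. (inv g\<otimes>fst p, snd p)\<in>cshift G k A}"
  have pV: "act (fst p) x\<in>V" using pq x act_closed by auto
  have "g\<in>seen (act (fst p) x) ?S\<longleftrightarrow>p\<in>cshift G g icut" if "g\<in>H" for g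
   using icut_mem[OF that K_closed(3) pq(1)] that unfolding seen_def pview_def by simp
  hence "{cshift G g icut | g. g\<in>H\<and>p\<in>cshift G g icut\<and>q\<notin>cshift G g icut} \<subseteq>
    {cshift G g icut | g. g\<in>H\<and>(g\<in>seen (act (fst p) x) ?S\<longleftrightarrow>q\<notin>cshift G g icut)}" by blast
  thus ?thesis using seen_finite[OF pV pview_coherent[OF pq(1)] pq(2)] finite_subset by blast
 qed
 show ?thesis unfolding is_cut_def by (intro conjI ballI icut_sub ne nest ninv fin)
qed

text \<open>A fixed vertex of \<open>icut\<close> restricts to a fixed vertex of \<open>A\<close>.
  Two of its sides share a point, and the view of this point, being a vertex of \<open>A\<close>,
  supplies a common point inside \<open>Ks \<times> UNIV\<close>.\<close>

lemma icut_not_elliptic: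
 assumes "\<not> elliptic G Ks A Ks"
 shows "\<not> elliptic G H icut H"
proof
 assume "elliptic G H icut H"
 then obtain \<sigma> where \<sigma>: "cut_vertex G H icut \<sigma>" "\<And>h g. h\<in>H ==> g\<in>H ==> h\<otimes>g\<in>\<sigma>\<longleftrightarrow>g\<in>\<sigma>"
  unfolding elliptic_def by blast
 let ?\<tau> = "\<sigma>\<inter>Ks"
 have KH: "Ks\<times>UNIV\<subseteq>H\<times>UNIV" using Ks(2) by blast
 have kA: "p\<in>cshift G k icut\<longleftrightarrow>p\<in>cshift G k A" if "k\<in>Ks" "p\<in>Ks\<times>UNIV" for k p
  using icut_K[OF that(1)] that(2) by blast
 have meet: "cside G Ks A ?\<tau> k\<inter>cside G Ks A ?\<tau> l\<noteq>{}" if kl: "k\<in>Ks" "l\<in>Ks" for k l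
 proof -
  have klH: "k\<in>H" "l\<in>H" using kl Ks(3) by auto
  have "cside G H icut \<sigma> k\<inter>cside G H icut \<sigma> l\<noteq>{}" using \<sigma>(1) klH unfolding cut_vertex_def by blast
  then obtain p where p: "p\<in>cside G H icut \<sigma> k" "p\<in>cside G H icut \<sigma> l" by blast
  have pH: "p\<in>H\<times>UNIV" using p(1) cshift_sub[OF is_group H icut_sub klH(1)] unfolding cside_def by (auto split: if_splits)
  have e: "m\<in>?\<tau>\<longleftrightarrow>m\<in>pview p \<one>" if "m\<in>{k, l}" for m
   using that p icut_mem_one[OF _ pH, of m] kl pH unfolding cside_def by (auto split: if_splits)
  have "cut_vertex G Ks A (pview p \<one>)"
   unfolding pview_def using view_vertex[OF _ pview_coherent[OF pH]] pH act_closed x by auto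
  hence "cside G Ks A (pview p \<one>) k\<inter>cside G Ks A (pview p \<one>) l\<noteq>{}" using kl unfolding cut_vertex_def by blast
  thus ?thesis using e unfolding cside_def by simp
 qed
 have fin: "finite {cshift G k A | k. k\<in>Ks\<and>(k\<in>?\<tau>\<longleftrightarrow>p\<notin>cshift G k A)}" if p: "p\<in>Ks\<times>UNIV" for p
 proof -
  let ?D = "{k\<in>Ks. k\<in>\<sigma>\<longleftrightarrow>p\<notin>cshift G k icut}"
  have "(\<lambda>k. cshift G k icut) ` ?D\<subseteq>{cshift G g icut | g. g\<in>H\<and>(g\<in>\<sigma>\<longleftrightarrow>p\<notin>cshift G g icut)}"
   using Ks(3) by blast
  moreover have "finite {cshift G g icut | g. g\<in>H\<and>(g\<in>\<sigma>\<longleftrightarrow>p\<notin>cshift G g icut)}"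
   using \<sigma>(1) p KH unfolding cut_vertex_def by blast
  ultimately have "finite ((\<lambda>k. cshift G k icut) ` ?D)" by (rule finite_subset)
  hence "finite ((\<lambda>k. cshift G k A) ` ?D)"
   by (rule finite_image_determined) (use icut_K in \<open>metis (no_types, lifting) mem_Collect_eq\<close>)
  moreover have "{cshift G k A | k. k\<in>Ks\<and>(k\<in>?\<tau>\<longleftrightarrow>p\<notin>cshift G k A)}\<subseteq>(\<lambda>k. cshift G k A) ` ?D"
   using kA[OF _ p] by blast
  ultimately show ?thesis by (rule finite_subset[rotated])
 qed
 have "cut_vertex G Ks A ?\<tau>" unfolding cut_vertex_def using meet fin by blast
 moreover have "k\<otimes>g\<in>?\<tau>\<longleftrightarrow>g\<in>?\<tau>" if "k\<in>Ks" "g\<in>Ks" for k g using \<sigma>(2)[of k g] that Ks(3) by simp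
 ultimately have "elliptic G Ks A Ks" unfolding elliptic_def by blast
 thus False using assms by blast
qed

text \<open>Where \<open>y\<close> is seen from afar, the view is a branch, and \<open>L\<close>
  preserves it. The copies at which \<open>y\<close> is located are all the one named by a single
  \<open>g0\<close>; there a vertex fixed by the conjugate of \<open>L\<close> is provided by
  \<open>near\<close>.\<close>

lemma icut_elliptic:
 assumes L: "L\<subseteq>H" and y: "y\<in>V" and fix_y: "\<And>h. h\<in>L ==> \<not> sep I y (act h y)"
  and near: "\<And>g. g\<in>H ==> \<not> sep I y (act g x) ==> elliptic G Ks A ((\<lambda>h. inv g\<otimes>h\<otimes>g) ` L)"
 shows "elliptic G H icut L"
proof -
 have near_iff': "\<not> sep I x (act (inv g) y)\<longleftrightarrow>\<not> sep I y (act g x)" if "g\<in>H" for g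
  using sep_act[OF I that, of x "act (inv g) y"] that x y act_closed sep_sym by simp
 have "\<exists>S. coherent y S\<and>(\<forall>h\<in>L. \<forall>g\<in>H. \<not> sep I x (act (inv g) y) \<longrightarrow> (\<one>\<in>S (h\<otimes>g)\<longleftrightarrow>\<one>\<in>S g))"
 proof (cases "\<exists>g\<in>H. \<not> sep I y (act g x)")
  case False thus ?thesis unfolding coherent_def using near_iff' by blast
 next
  case True
  then obtain g0 where g0: "g0\<in>H" "\<not> sep I y (act g0 x)" by blast
  obtain \<tau> where \<tau>: "cut_vertex G Ks A \<tau>"
   "\<And>h g. h\<in>L ==> g\<in>Ks ==> (inv g0\<otimes>h\<otimes>g0)\<otimes>g\<in>\<tau>\<longleftrightarrow>g\<in>\<tau>"
   using near[OF g0] unfolding elliptic_def by blast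
  define S where "S g = {l\<in>Ks. (inv g0\<otimes>g)\<otimes>l\<in>\<tau>}" for g
  have inK: "inv g0\<otimes>g\<in>Ks" if g: "g\<in>H" "\<not> sep I x (act (inv g) y)" for g
  proof -
   have "\<not> sep I (act g0 x) (act g x)" using near_iff'[OF g(1)] g(2) g0 not_sep_trans sep_sym by metis
   hence "\<not> sep I (act (inv g0) (act g0 x)) (act (inv g0) (act g x))"
    using sep_act[OF I, of "inv g0" "act g0 x" "act g x"] g0 g x act_closed by simp
   thus ?thesis using near_iff[OF g0(1) g(1)] g0 x by simp
  qed
  have "coherent y S" unfolding coherent_def
  proof (intro ballI impI conjI)
   fix g assume g: "g\<in>H" "\<not> sep I x (act (inv g) y)"
   note k = inK[OF g]
   show "cut_vertex G Ks A (S g)"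
    using cut_vertex_translate[OF is_group Ks(1) A_sub(1) \<tau>(1) K_closed(2)[OF k]] k unfolding S_def by simp
   fix k' l assume kl: "k'\<in>Ks" "l\<in>Ks"
   have "k'\<in>H" "l\<in>H" using kl Ks(3) by auto
   hence "inv g0\<otimes>(g\<otimes>k')\<otimes>l = inv g0\<otimes>g\<otimes>(k'\<otimes>l)" using g g0 by (simp add: m_assoc)
   thus "l\<in>S (g\<otimes>k')\<longleftrightarrow>k'\<otimes>l\<in>S g" unfolding S_def using kl by simp
  qed
  moreover have "\<one>\<in>S (h\<otimes>g)\<longleftrightarrow>\<one>\<in>S g" if h: "h\<in>L" and g: "g\<in>H" "\<not> sep I x (act (inv g) y)" for h g
  proof -
   have hH: "h\<in>H" using h L by blast
   have "inv g0\<otimes>(h\<otimes>g) = (inv g0\<otimes>h\<otimes>g0)\<otimes>(inv g0\<otimes>g)"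
    using hH g g0 by (simp add: m_assoc inv_cancel[OF is_group])
   thus ?thesis unfolding S_def using \<tau>(2)[OF h inK[OF g]] g g0 hH by simp
  qed
  ultimately show ?thesis by blast
 qed
 then obtain S where S: "coherent y S"
  "\<And>h g. h\<in>L ==> g\<in>H ==> \<not> sep I x (act (inv g) y) ==> \<one>\<in>S (h\<otimes>g)\<longleftrightarrow>\<one>\<in>S g" by blast
 have "h\<otimes>g\<in>seen y S\<longleftrightarrow>g\<in>seen y S" if h: "h\<in>L" and g: "g\<in>H" for h g
 proof -
  have hH: "h\<in>H" using h L by blast
  have eq: "act (inv (h\<otimes>g)) y = act (inv g) (act (inv h) y)" using hH g y by (simp add: inv_mult_group act_mult)
  have "\<not> sep I (act (inv h) y) (act (inv h) (act h y))"
   using sep_act[OF I, of "inv h" y "act h y"] hH y act_closed fix_y[OF h] by simp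
  hence "\<not> sep I y (act (inv h) y)" using hH y sep_sym by simp
  hence "\<not> sep I (act (inv g) y) (act (inv (h\<otimes>g)) y)"
   unfolding eq using sep_act[OF I, of "inv g" y "act (inv h) y"] hH g y act_closed by simp
  note d = dir_unsep[OF this]
  show ?thesis unfolding seen_def view_def using d S(2)[OF h g] hH g by simp
 qed
 thus ?thesis unfolding elliptic_def using seen_vertex[OF y S(1)] by blast
qed

end

end

text \<open>Frees the construction from the choice \<open>E\<close>. The stabilizer of the cut stays
  the same, so virtually cyclic stabilizers remain so.\<close>

lemma induced_cut:
 assumes A: "is_cut G Ks A" "\<not> elliptic G Ks A Ks"
  and ell: "\<And>y. y\<in>V ==> sep I x y ==> elliptic G Ks A (wstab (dir y))"
 shows "\<exists>B. is_cut G H B\<and>{h\<in>H. cshift G h B = B} = {k\<in>Ks. cshift G k A = A}\<and>\<not> elliptic G H B H \<and>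
  (\<forall>L y. L\<subseteq>H \<longrightarrow> y\<in>V \<longrightarrow> (\<forall>h\<in>L. \<not> sep I y (act h y)) \<longrightarrow>
   (\<forall>g\<in>H. \<not> sep I y (act g x) \<longrightarrow> elliptic G Ks A ((\<lambda>h. inv g\<otimes>h\<otimes>g) ` L)) \<longrightarrow> elliptic G H B L)"
proof -
 obtain E where E: "\<And>y. y\<in>V ==> sep I x y ==> cut_vertex G Ks A (E (dir y))"
  "\<And>k g y. k\<in>Ks ==> g\<in>Ks ==> y\<in>V ==> sep I x y ==> g\<in>E (dir (act k y))\<longleftrightarrow>inv k\<otimes>g\<in>E (dir y)"
  using direction_choice[OF A(1) ell] by blast
 have "{h\<in>H. cshift G h (icut A E) = icut A E} = {k\<in>Ks. cshift G k A = A}"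
  using icut_fix_iff[OF A(1) ell E] Ks(3) by blast
 thus ?thesis
  using icut_is_cut[OF A(1) ell E] icut_not_elliptic[OF A(1) ell E A(2)] icut_elliptic[OF A(1) ell E]
  by (intro exI[of _ "icut A E"]) blast
qed

end

end

section \<open>A cut of a group determines a splitting\<close>

locale cut_group = group G for G :: "'a monoid" (structure) +
 fixes A :: "('a\<times>bool) set"
 assumes A: "is_cut G (carrier G) A"
  and not_elliptic: "\<not> elliptic G (carrier G) A (carrier G)"
begin

abbreviation pts :: "('a\<times>bool) set" where "pts \<equiv> carrier G\<times>UNIV"
abbreviation sh :: "'a => ('a\<times>bool) set => ('a\<times>bool) set" where "sh \<equiv> cshift G"

definition hs :: "('a\<times>bool) set set" where
 "hs = {sh g A | g. g\<in>carrier G}\<union>{pts - sh g A | g. g\<in>carrier G}"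

definition vx :: "('a\<times>bool) set => ('a\<times>bool) set set" where
 "vx B = {D\<in>hs. B\<subseteq>D \<or> pts - B\<subset>D}"

lemmas sh_simps = cshift_cshift[OF is_group subgroup_self] cshift_one[OF is_group subgroup_self]
 cshift_compl[OF is_group subgroup_self]

lemma A_sub: "A\<subseteq>pts" "A\<noteq>{}" "A\<noteq>pts"
 using A unfolding is_cut_def by auto

lemma sh_sub: "B\<subseteq>pts ==> g\<in>carrier G ==> sh g B\<subseteq>pts"
 by (rule cshift_sub[OF is_group subgroup_self])

lemma hs_sub: "B\<in>hs ==> B\<subseteq>pts"
 unfolding hs_def using sh_sub[OF A_sub(1)] by blast

lemma hs_compl: "B\<in>hs ==> pts - B\<in>hs"
proof -
 assume "B\<in>hs"
 then consider g where "g\<in>carrier G" "B = sh g A" | g where "g\<in>carrier G" "B = pts - sh g A"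
  unfolding hs_def by blast
 thus ?thesis
 proof cases
  case 1 thus ?thesis unfolding hs_def by blast
 next
  case (2 g)
  hence "pts - B = sh g A" using sh_sub[OF A_sub(1), of g] by blast
  thus ?thesis unfolding hs_def using 2 by blast
 qed
qed

lemma compl_compl: "B\<in>hs ==> pts - (pts - B) = B"
 using hs_sub by blast

lemma hs_A: "A\<in>hs" "pts - A\<in>hs"
proof -
 have "sh \<one> A = A" using sh_simps(2)[OF A_sub(1)] .
 thus "A\<in>hs" unfolding hs_def using one_closed by blast
 thus "pts - A\<in>hs" by (rule hs_compl)
qed

lemma sh_compl: "B\<subseteq>pts ==> g\<in>carrier G ==> sh g (pts - B) = pts - sh g B"
 by (rule sh_simps(3))

lemma sh_sh: "B\<subseteq>pts ==> g\<in>carrier G ==> h\<in>carrier G ==> sh g (sh h B) = sh (g\<otimes>h) B"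
 by (rule sh_simps(1))

lemma sh_one: "B\<subseteq>pts ==> sh \<one> B = B"
 by (rule sh_simps(2))

lemma sh_mem: "B\<subseteq>pts ==> g\<in>carrier G ==> (h, b)\<in>sh g B\<longleftrightarrow>h\<in>carrier G\<and>(inv g\<otimes>h, b)\<in>B"
 by (rule cshift_mem[OF is_group subgroup_self])

lemma sh_subset_iff:
 assumes "B\<subseteq>pts" "D\<subseteq>pts" "g\<in>carrier G"
 shows "sh g B\<subseteq>sh g D\<longleftrightarrow>B\<subseteq>D"
proof
 assume "sh g B\<subseteq>sh g D"
 hence "sh (inv g) (sh g B)\<subseteq>sh (inv g) (sh g D)" unfolding cshift_def by blast
 thus "B\<subseteq>D" using assms by (simp add: sh_sh sh_one)
qed (auto simp: cshift_def)

lemma sh_inj: "B\<subseteq>pts ==> D\<subseteq>pts ==> g\<in>carrier G ==> sh g B = sh g D\<longleftrightarrow>B = D"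
 using sh_subset_iff by (metis order_antisym order_refl)

lemma hs_sh: "B\<in>hs ==> g\<in>carrier G ==> sh g B\<in>hs"
proof -
 assume "B\<in>hs" and g: "g\<in>carrier G"
 then consider h where "h\<in>carrier G" "B = sh h A" | h where "h\<in>carrier G" "B = pts - sh h A"
  unfolding hs_def by blast
 thus ?thesis
 proof cases
  case (1 h)
  hence "sh g B = sh (g\<otimes>h) A" using g A_sub by (simp add: sh_sh)
  thus ?thesis unfolding hs_def using 1 g by blast
 next
  case (2 h)
  hence "sh g B = pts - sh (g\<otimes>h) A" using g A_sub by (simp add: sh_compl sh_sub sh_sh)
  thus ?thesis unfolding hs_def using 2 g by blast
 qed
qed

lemma nested_A:
 assumes g: "g\<in>carrier G" and h: "h\<in>carrier G"
 shows "sh g A\<subseteq>sh h A \<or> sh h A\<subseteq>sh g A \<or> sh g A\<inter>sh h A = {} \<or> sh g A\<union>sh h A = pts"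
proof -
 let ?B = "sh (inv h\<otimes>g) A"
 have eq: "sh g A = sh h ?B" using g h A_sub by (simp add: sh_sh inv_cancel[OF is_group])
 have B: "?B\<subseteq>pts" using sh_sub A_sub g h by simp
 have "inv h\<otimes>g\<in>carrier G" using g h by simp
 hence "?B\<subseteq>A \<or> A\<subseteq>?B \<or> ?B\<inter>A = {} \<or> ?B\<union>A = pts" using A unfolding is_cut_def by blast
 moreover have "?B\<subseteq>pts - A\<longleftrightarrow>sh h ?B\<subseteq>pts - sh h A"
  using sh_subset_iff[OF B, of "pts - A" h] h A_sub by (simp add: sh_compl)
 moreover have "pts - A\<subseteq>?B\<longleftrightarrow>pts - sh h A\<subseteq>sh h ?B"
  using sh_subset_iff[of "pts - A" ?B h] B h A_sub by (simp add: sh_compl)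
 moreover note sh_subset_iff[OF B A_sub(1) h] sh_subset_iff[OF A_sub(1) B h]
 moreover have "D\<inter>A = {}\<longleftrightarrow>D\<subseteq>pts - A" "D\<union>A = pts\<longleftrightarrow>pts - A\<subseteq>D"
  "D\<inter>sh h A = {}\<longleftrightarrow>D\<subseteq>pts - sh h A" "D\<union>sh h A = pts\<longleftrightarrow>pts - sh h A\<subseteq>D" if "D\<subseteq>pts" for D
  using that A_sub sh_sub[OF A_sub(1) h] by auto
 moreover note B sh_sub[OF B h]
 ultimately show ?thesis unfolding eq by metis
qed

lemma nested_hs:
 assumes "B\<in>hs" "D\<in>hs"
 shows "B\<subseteq>D \<or> D\<subseteq>B \<or> B\<inter>D = {} \<or> B\<union>D = pts"
proof -
 obtain g where g: "g\<in>carrier G" "B = sh g A \<or> B = pts - sh g A" using assms unfolding hs_def by blast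
 obtain h where h: "h\<in>carrier G" "D = sh h A \<or> D = pts - sh h A" using assms unfolding hs_def by blast
 have "sh g A\<subseteq>pts" "sh h A\<subseteq>pts" using sh_sub A_sub g h by auto
 thus ?thesis using nested_A[OF g(1) h(1)] g(2) h(2) by blast
qed

lemma hs_nonempty: "B\<in>hs ==> B\<noteq>{}" "B\<in>hs ==> B\<noteq>pts"
proof -
 have "sh g A\<noteq>{}" "sh g A\<noteq>pts" if "g\<in>carrier G" for g
 proof -
  show "sh g A\<noteq>{}" unfolding cshift_def using A_sub by blast
  have "sh g pts = pts" using that by (auto simp: sh_mem)
  thus "sh g A\<noteq>pts" using sh_inj[OF A_sub(1) _ that, of pts] A_sub by auto
 qed
 moreover have "pts - D\<noteq>{}" "pts - D\<noteq>pts" if "D\<subseteq>pts" "D\<noteq>{}" "D\<noteq>pts" for D :: "('a\<times>bool) set"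
  using that by auto
 ultimately have "B\<noteq>{}\<and>B\<noteq>pts" if "B\<in>hs"
 proof -
  obtain g where "g\<in>carrier G" "B = sh g A \<or> B = pts - sh g A" using \<open>B\<in>hs\<close> unfolding hs_def by blast
  thus ?thesis using sh_sub[OF A_sub(1)] \<open>\<And>g. g\<in>carrier G ==> sh g A\<noteq>{}\<close>
   \<open>\<And>g. g\<in>carrier G ==> sh g A\<noteq>pts\<close> \<open>\<And>D. D\<subseteq>pts ==> D\<noteq>{} ==> D\<noteq>pts ==> pts - D\<noteq>{}\<close>
   \<open>\<And>D. D\<subseteq>pts ==> D\<noteq>{} ==> D\<noteq>pts ==> pts - D\<noteq>pts\<close> by metis
 qed
 thus "B\<in>hs ==> B\<noteq>{}" "B\<in>hs ==> B\<noteq>pts" by auto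
qed

lemma no_inv: "g\<in>carrier G ==> B\<in>hs ==> sh g B\<noteq>pts - B"
proof
 assume g: "g\<in>carrier G" and B: "B\<in>hs" and eq: "sh g B = pts - B"
 obtain h where h: "h\<in>carrier G" "B = sh h A \<or> B = pts - sh h A" using B unfolding hs_def by blast
 have s: "sh h A\<subseteq>pts" "sh (g\<otimes>h) A\<subseteq>pts" using h g A_sub sh_sub by auto
 have "sh (g\<otimes>h) A = pts - sh h A"
  using h(2)
 proof
  assume "B = sh h A" thus ?thesis using eq g h A_sub by (simp add: sh_sh)
 next
  assume "B = pts - sh h A"
  hence "pts - sh (g\<otimes>h) A = pts - (pts - sh h A)" using eq g h A_sub s by (simp add: sh_compl sh_sh)
  thus ?thesis using s by blast
 qed
 hence "sh (inv h) (sh (g\<otimes>h) A) = sh (inv h) (pts - sh h A)" by simp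
 hence "sh (inv h\<otimes>(g\<otimes>h)) A = pts - A" using g h A_sub s by (simp add: sh_sh sh_compl sh_one)
 moreover have "inv h\<otimes>(g\<otimes>h)\<in>carrier G" using g h by simp
 ultimately show False using A unfolding is_cut_def by blast
qed

lemma finite_between_hs:
 assumes "p\<in>pts" "q\<in>pts"
 shows "finite {D\<in>hs. p\<in>D\<and>q\<notin>D}"
proof -
 let ?S = "\<lambda>p q. {sh g A | g. g\<in>carrier G\<and>p\<in>sh g A\<and>q\<notin>sh g A}"
 have "finite (?S p q)" "finite (?S q p)" using A assms unfolding is_cut_def by meson+
 hence "finite (?S p q\<union>(\<lambda>D. pts - D) ` ?S q p)" by simp
 moreover have "{D\<in>hs. p\<in>D\<and>q\<notin>D}\<subseteq>?S p q\<union>(\<lambda>D. pts - D) ` ?S q p"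
  using assms unfolding hs_def by blast
 ultimately show ?thesis by (rule finite_subset[rotated])
qed

lemma vx_sub: "vx B\<subseteq>hs" unfolding vx_def by blast

lemma vx_self: "B\<in>hs ==> B\<in>vx B" unfolding vx_def by blast

lemma vx_up: "D\<in>vx B ==> D\<subseteq>D' ==> D'\<in>hs ==> D'\<in>vx B" unfolding vx_def by blast

lemma vx_orient:
 assumes B: "B\<in>hs" and D: "D\<in>hs"
 shows "D\<in>vx B\<longleftrightarrow>pts - D\<notin>vx B"
proof -
 note s = hs_sub[OF B] hs_sub[OF D] hs_nonempty[OF B] hs_compl[OF D]
 have "D\<in>vx B \<or> pts - D\<in>vx B"
  using nested_hs[OF B D] s D unfolding vx_def by blast
 moreover have "\<not> (D\<in>vx B\<and>pts - D\<in>vx B)"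
  using s unfolding vx_def by blast
 ultimately show ?thesis by blast
qed

lemma vx_meet:
 assumes B: "B\<in>hs" and D: "D\<in>vx B" "D'\<in>vx B"
 shows "D\<inter>D'\<noteq>{}"
proof
 assume "D\<inter>D' = {}"
 hence "D\<subseteq>pts - D'" using D vx_sub hs_sub by blast
 hence "pts - D'\<in>vx B" using vx_up[OF D(1)] hs_compl D vx_sub by blast
 thus False using vx_orient[OF B] D vx_sub by blast
qed

text \<open>The two ends of an edge orient all other edges alike.\<close>

lemma vx_flip: "D\<noteq>B ==> D\<noteq>pts - B ==> D\<in>vx (pts - B)\<longleftrightarrow>D\<in>vx B" if "B\<in>hs"
 using hs_sub[OF that] hs_sub unfolding vx_def by blast

text \<open>A half-space on which the vertex and \<open>p\<close> disagree separates
  \<open>p\<close> from a fixed point \<open>q\<close> of \<open>B\<close> or from a fixed point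
  \<open>r\<close> outside \<open>B\<close>.\<close>

lemma vx_almost_principal:
 assumes B: "B\<in>hs" and p: "p\<in>pts"
 shows "finite {D\<in>hs. (D\<in>vx B)\<noteq>(p\<in>D)}"
proof -
 obtain q r where q: "q\<in>B" and r: "r\<in>pts" "r\<notin>B" using hs_nonempty[OF B] hs_sub[OF B] by blast
 have qp: "q\<in>pts" using q hs_sub[OF B] by blast
 let ?S = "\<lambda>a b. {D\<in>hs. a\<in>D\<and>b\<notin>D}"
 have "{D\<in>hs. (D\<in>vx B)\<noteq>(p\<in>D)}\<subseteq>?S q p\<union>?S p q\<union>?S r q\<union>?S q r\<union>?S r p\<union>?S p r"
 proof
  fix D assume D: "D\<in>{D\<in>hs. (D\<in>vx B)\<noteq>(p\<in>D)}"
  have "D\<in>vx B ==> q\<in>D \<or> r\<in>D" using q r unfolding vx_def by blast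
  moreover have "D\<notin>vx B ==> q\<notin>D \<or> r\<notin>D"
  proof -
   assume "D\<notin>vx B"
   hence "pts - D\<in>vx B" using vx_orient[OF B] D by blast
   thus ?thesis using q r unfolding vx_def by blast
  qed
  ultimately show "D\<in>?S q p\<union>?S p q\<union>?S r q\<union>?S q r\<union>?S r p\<union>?S p r" using D by blast
 qed
 moreover have "finite (?S q p\<union>?S p q\<union>?S r q\<union>?S q r\<union>?S r p\<union>?S p r)"
  using finite_between_hs qp p r by (intro finite_UnI) auto
 ultimately show ?thesis by (rule finite_subset)
qed

lemma vx_sh:
 assumes B: "B\<in>hs" and g: "g\<in>carrier G"
 shows "vx (sh g B) = sh g ` vx B"
proof -
 note Bs = hs_sub[OF B]
 have mem: "sh g D\<in>vx (sh g B)\<longleftrightarrow>D\<in>vx B" if D: "D\<in>hs" for D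
 proof -
  note Ds = hs_sub[OF D]
  have "sh g B\<subseteq>sh g D\<longleftrightarrow>B\<subseteq>D" by (rule sh_subset_iff[OF Bs Ds g])
  moreover have "pts - sh g B\<subset>sh g D\<longleftrightarrow>pts - B\<subset>D"
   using sh_subset_iff[of "pts - B" D g] sh_subset_iff[of D "pts - B" g] Ds Bs g by (simp add: sh_compl psubset_eq) blast
  ultimately show ?thesis unfolding vx_def using D hs_sh[OF D g] by simp
 qed
 have "D\<in>sh g ` vx B" if D: "D\<in>vx (sh g B)" for D
 proof -
  have Dh: "D\<in>hs" using D vx_sub by blast
  have eq: "D = sh g (sh (inv g) D)" using hs_sub[OF Dh] g by (simp add: sh_sh sh_one)
  have "sh (inv g) D\<in>vx B" using mem[OF hs_sh[OF Dh, of "inv g"]] D eq g by simp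
  thus ?thesis using eq by blast
 qed
 thus ?thesis using mem vx_sub by blast
qed

lemma vx_sh_eq: "B\<in>hs ==> D\<in>hs ==> g\<in>carrier G ==> vx B = vx D ==> vx (sh g B) = vx (sh g D)"
 by (simp add: vx_sh)

text \<open>The edge \<open>D\<close> starts where \<open>B\<close> ends: it either turns back or
  leads further into \<open>B\<close>.\<close>

lemma vx_consecutive:
 assumes B: "B\<in>hs" and D: "D\<in>hs" and eq: "vx B = vx (pts - D)"
 shows "D = pts - B \<or> D\<subset>B"
proof -
 have "B\<in>vx (pts - D)" "pts - D\<in>vx B" using vx_self[OF B] vx_self[OF hs_compl[OF D]] eq by auto
 thus ?thesis using hs_sub[OF B] hs_sub[OF D] unfolding vx_def by blast
qed

text \<open>A path leading deeper and deeper does not return to the initial vertex of its first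
  edge.\<close>

lemma vx_chain_end:
 assumes B: "B\<in>hs" and D: "D\<in>hs" "D\<subseteq>B"
 shows "vx (pts - B)\<noteq>vx D"
proof
 assume "vx (pts - B) = vx D"
 hence "pts - B\<in>vx D" using vx_self[OF hs_compl[OF B]] by simp
 thus False using D hs_nonempty[OF D(1)] hs_sub[OF B] unfolding vx_def by blast
qed

text \<open>The half-spaces at a globally fixed vertex would give a vertex of the cut
  \<open>A\<close> that is invariant under \<open>G\<close>.\<close>

lemma vx_not_fixed:
 assumes B: "B\<in>hs"
 shows "\<exists>g\<in>carrier G. vx (sh g B)\<noteq>vx B"
proof (rule ccontr)
 assume "\<not> ?thesis"
 hence fx: "\<And>g. g\<in>carrier G ==> sh g ` vx B = vx B" using vx_sh[OF B] by blast
 let ?\<tau> = "{g\<in>carrier G. sh g A\<in>vx B}"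
 have hA: "sh g A\<in>hs" if "g\<in>carrier G" for g using hs_sh hs_A that by blast
 have side: "cside G (carrier G) A ?\<tau> g\<in>vx B" if "g\<in>carrier G" for g
  unfolding cside_def using vx_orient[OF B hA[OF that]] that by auto
 have "finite {sh g A | g. g\<in>carrier G\<and>(g\<in>?\<tau>\<longleftrightarrow>p\<notin>sh g A)}" if p: "p\<in>pts" for p
  by (rule finite_subset[OF _ vx_almost_principal[OF B p]]) (use hA in blast)
 hence "cut_vertex G (carrier G) A ?\<tau>"
  unfolding cut_vertex_def using side vx_meet[OF B] by blast
 moreover have "k\<otimes>g\<in>?\<tau>\<longleftrightarrow>g\<in>?\<tau>" if kg: "k\<in>carrier G" "g\<in>carrier G" for k g
 proof -
  have "sh (k\<otimes>g) A = sh k (sh g A)" using kg A_sub by (simp add: sh_sh)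
  moreover have "sh k D\<in>vx B\<longleftrightarrow>D\<in>vx B" if D: "D\<in>hs" for D
  proof
   assume "sh k D\<in>vx B"
   then obtain D' where "D'\<in>vx B" "sh k D = sh k D'" using fx[OF kg(1)] by (metis imageE)
   thus "D\<in>vx B" using sh_inj[of D D' k] hs_sub[OF D] hs_sub vx_sub kg by blast
  qed (use fx[OF kg(1)] in blast)
  ultimately show ?thesis using hA kg by simp
 qed
 ultimately show False using not_elliptic unfolding elliptic_def by blast
qed

definition vstab :: "('a\<times>bool) set => 'a set" where
 "vstab B = {g\<in>carrier G. vx (sh g B) = vx B}"

lemma vstab_subgroup:
 assumes B: "B\<in>hs"
 shows "subgroup (vstab B) G"
proof (rule subgroupI)
 show "vstab B\<subseteq>carrier G" unfolding vstab_def by blast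
 have "\<one>\<in>vstab B" unfolding vstab_def using hs_sub[OF B] by (simp add: sh_one)
 thus "vstab B\<noteq>{}" by blast
 show "inv g\<in>vstab B" if "g\<in>vstab B" for g
 proof -
  have g: "g\<in>carrier G" "vx (sh g B) = vx B" using that unfolding vstab_def by auto
  have "vx (sh (inv g) (sh g B)) = vx (sh (inv g) B)" by (intro vx_sh_eq hs_sh B inv_closed g)
  thus ?thesis unfolding vstab_def using g hs_sub[OF B] by (simp add: sh_sh sh_one)
 qed
 show "g\<otimes>h\<in>vstab B" if "g\<in>vstab B" "h\<in>vstab B" for g h
 proof -
  have gh: "g\<in>carrier G" "vx (sh g B) = vx B" "h\<in>carrier G" "vx (sh h B) = vx B"
   using that unfolding vstab_def by auto
  have "vx (sh g (sh h B)) = vx (sh g B)" by (intro vx_sh_eq hs_sh B gh)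
  thus ?thesis unfolding vstab_def using gh hs_sub[OF B] by (simp add: sh_sh)
 qed
qed

definition C :: "'a set" where "C = {g\<in>carrier G. sh g A = A}"

lemma C_subgroup: "subgroup C G"
proof (rule subgroupI)
 show "C\<subseteq>carrier G" unfolding C_def by blast
 have "\<one>\<in>C" unfolding C_def using A_sub by (simp add: sh_one)
 thus "C\<noteq>{}" by blast
 show "inv g\<in>C" if "g\<in>C" for g
 proof -
  have g: "g\<in>carrier G" "sh g A = A" using that unfolding C_def by auto
  have "sh (inv g) (sh g A) = A" using g(1) A_sub by (simp add: sh_sh sh_one)
  thus ?thesis unfolding C_def using g by simp
 qed
 show "g\<otimes>h\<in>C" if "g\<in>C" "h\<in>C" for g h
  using that A_sub sh_sh[of A g h] unfolding C_def by simp
qed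

text \<open>If the end points of the edge \<open>A\<close> lie in one orbit, \<open>stable\<close> moves the initial one to the terminal
 one; the splitting is then an HNN extension with this stable letter, and an amalgam otherwise.\<close>

definition hnn :: bool where
 "hnn\<longleftrightarrow>(\<exists>t\<in>carrier G. vx (sh t (pts - A)) = vx A)"

definition stable :: 'a where
 "stable = (if hnn then SOME t. t\<in>carrier G\<and>vx (sh t (pts - A)) = vx A else \<one>)"

lemma stable: "stable\<in>carrier G" "hnn ==> vx (sh stable (pts - A)) = vx A"
proof -
 have "stable\<in>carrier G\<and>vx (sh stable (pts - A)) = vx A" if h: hnn
 proof -
  have "\<exists>t. t\<in>carrier G\<and>vx (sh t (pts - A)) = vx A" using h unfolding hnn_def by blast
  from someI_ex[OF this] show ?thesis unfolding stable_def using h by simp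
 qed
 moreover have "stable = \<one>" if "\<not> hnn" using that unfolding stable_def by simp
 ultimately show "stable\<in>carrier G" by (cases hnn) simp_all
 show "hnn ==> vx (sh stable (pts - A)) = vx A"
  using \<open>hnn ==> stable\<in>carrier G\<and>vx (sh stable (pts - A)) = vx A\<close> by blast
qed

section \<open>Edges and base vertices over the quotient graph\<close>

definition val_arc :: "nat => 'a" where "val_arc e = (if e = 0 then stable else inv stable)"
definition hed :: nat where "hed = (if hnn then 0 else 1)"
text \<open>The edge over the arc \<open>e\<close>, placed so that it starts at the base vertex of
  its tail, while \<open>base_half i\<close> is an edge that ends at the base vertex
  \<open>i\<close>. The reversed edge is moved back by the stable letter for this purpose.\<close>

definition half :: "nat => ('a\<times>bool) set" where
 "half e = (if e = 0 then A else sh (inv stable) (pts - A))"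
definition base_half :: "nat => ('a\<times>bool) set" where
 "base_half i = (if i = 0 then pts - A else sh (inv stable) A)"
definition tl_arc :: "nat => nat" where "tl_arc e = (if e = 0 then 0 else hed)"
definition hd_arc :: "nat => nat" where "hd_arc e = (if e = 0 then hed else 0)"
definition bar_arc :: "nat => nat" where "bar_arc e = (if e = 0 then 1 else if e = 1 then 0 else e)"
definition vg :: "nat => 'a set" where "vg i = vstab (base_half i)"

lemma arc_in: "val_arc e\<in>carrier G" "half e\<in>hs" "base_half i\<in>hs"
 unfolding val_arc_def half_def base_half_def using stable(1) hs_A hs_sh by auto

lemma half_compl: "e\<in>{0, 1} ==> pts - half e = sh (val_arc e) (half (bar_arc e))"
 unfolding half_def val_arc_def bar_arc_def using stable(1) A_sub
 by (auto simp: sh_sh sh_compl sh_one sh_sub double_diff)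

lemma half_init: "e\<in>{0, 1} ==> vx (pts - half e) = vx (base_half (tl_arc e))"
proof -
 have t: "inv stable\<in>carrier G" using stable by simp
 have "pts - sh (inv stable) (pts - A) = sh (inv stable) A"
  using A_sub t sh_sub[OF A_sub(1) t] by (simp add: sh_compl double_diff)
 moreover have "vx (sh (inv stable) A) = vx (pts - A)" if hnn
 proof -
  have "vx (sh (inv stable) (sh stable (pts - A))) = vx (sh (inv stable) A)"
   by (intro vx_sh_eq hs_sh hs_A t stable(1) stable(2)[OF that])
  thus ?thesis using stable(1) t by (simp add: sh_sh sh_one)
 qed
 ultimately show "e\<in>{0, 1} ==> vx (pts - half e) = vx (base_half (tl_arc e))"
  unfolding half_def base_half_def tl_arc_def hed_def by auto
qed

lemma half_term: "e\<in>{0, 1} ==> vx (half e) = vx (sh (val_arc e) (base_half (hd_arc e)))"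
proof -
 have t: "inv stable\<in>carrier G" using stable by simp
 have "vx (sh stable (sh (inv stable) A)) = vx A" using A_sub t stable(1) by (simp add: sh_sh sh_one)
 thus "e\<in>{0, 1} ==> vx (half e) = vx (sh (val_arc e) (base_half (hd_arc e)))"
  unfolding half_def base_half_def hd_arc_def hed_def val_arc_def using stable(2) by auto
qed

lemma vg_subgroup: "subgroup (vg i) G" unfolding vg_def by (rule vstab_subgroup[OF arc_in(3)])

lemma vgD: "g\<in>vg i ==> g\<in>carrier G\<and>vx (sh g (base_half i)) = vx (base_half i)"
 unfolding vg_def vstab_def by blast

definition emb_arc :: "nat => 'a => 'a" where
 "emb_arc e a = (if e = 0 then inv stable\<otimes>a\<otimes>stable else a)"

lemma emb_mem:
 assumes e: "e\<in>{0, 1}" and a: "a\<in>C"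
 shows "emb_arc e a\<in>vg (hd_arc e)" "sh (emb_arc e a) (half (bar_arc e)) = half (bar_arc e)"
proof -
 have aG: "a\<in>carrier G" "sh a A = A" using a unfolding C_def by auto
 have t: "stable\<in>carrier G" by (rule stable)
 have e0: "emb_arc e a\<in>carrier G" unfolding emb_arc_def using aG t by simp
 have "sh (inv stable\<otimes>a\<otimes>stable) (sh (inv stable) (pts - A)) = sh (inv stable) (sh a (pts - A))"
  using aG t by (simp add: sh_sh m_assoc)
 thus s: "sh (emb_arc e a) (half (bar_arc e)) = half (bar_arc e)"
  using e aG A_sub unfolding emb_arc_def half_def bar_arc_def by (auto simp: sh_compl)
 have be: "bar_arc e\<in>{0, 1}" "tl_arc (bar_arc e) = hd_arc e"
  using e unfolding bar_arc_def tl_arc_def hd_arc_def by auto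
 have "sh (emb_arc e a) (pts - half (bar_arc e)) = pts - half (bar_arc e)"
  using s e0 hs_sub[OF arc_in(2)] by (simp add: sh_compl)
 hence "vx (sh (emb_arc e a) (base_half (hd_arc e))) = vx (base_half (hd_arc e))"
  using half_init[OF be(1)] be(2) e0 arc_in hs_compl vx_sh_eq by metis
 thus "emb_arc e a\<in>vg (hd_arc e)" unfolding vg_def vstab_def using e0 by simp
qed

lemma half_fix:
 assumes e: "e\<in>{0, 1}" and g: "g\<in>carrier G" "sh g (half (bar_arc e)) = half (bar_arc e)"
 shows "\<exists>a\<in>C. g = emb_arc e a"
proof (cases "e = 0")
 case False
 hence "e = 1" using e by simp
 thus ?thesis using g unfolding half_def bar_arc_def C_def emb_arc_def by auto
next
 case True
 have t: "stable\<in>carrier G" by (rule stable)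
 have "sh stable (sh g (sh (inv stable) (pts - A))) = sh stable (sh (inv stable) (pts - A))"
  using g True unfolding half_def bar_arc_def by simp
 hence "sh (stable\<otimes>g\<otimes>inv stable) (pts - A) = pts - A" using g(1) t by (simp add: sh_sh sh_one m_assoc)
 hence "pts - sh (stable\<otimes>g\<otimes>inv stable) A = pts - A" using g(1) t A_sub by (simp add: sh_compl)
 moreover have "sh (stable\<otimes>g\<otimes>inv stable) A\<subseteq>pts" by (rule sh_sub[OF A_sub(1)]) (use g t in simp)
 from double_diff[OF this order_refl] double_diff[OF A_sub(1) order_refl]
 have "pts - (pts - sh (stable\<otimes>g\<otimes>inv stable) A) = sh (stable\<otimes>g\<otimes>inv stable) A" "pts - (pts - A) = A" .
 ultimately have "sh (stable\<otimes>g\<otimes>inv stable) A = A" by simp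
 hence "stable\<otimes>g\<otimes>inv stable\<in>C" unfolding C_def using g t by simp
 moreover have "g = emb_arc e (stable\<otimes>g\<otimes>inv stable)"
  unfolding emb_arc_def using True g t by (simp add: m_assoc inv_cancel[OF is_group])
 ultimately show ?thesis by blast
qed

text \<open>Otherwise \<open>val_arc e \<otimes> g\<close> would reverse the edge of
  \<open>e\<close>.\<close>

lemma half_turn:
 assumes e: "e\<in>{0, 1}" "e'\<in>{0, 1}" and g: "g\<in>carrier G" and eq: "sh g (half e') = half (bar_arc e)"
 shows "e' = bar_arc e"
proof (rule ccontr)
 assume "e'\<noteq>bar_arc e"
 hence "e' = e" using e unfolding bar_arc_def by auto
 have "sh (val_arc e) (sh g (half e)) = pts - half e" using eq half_compl[OF e(1)] \<open>e' = e\<close> by simp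
 hence "sh (val_arc e\<otimes>g) (half e) = pts - half e" using arc_in g hs_sub by (simp add: sh_sh)
 thus False using no_inv[of "val_arc e\<otimes>g" "half e"] arc_in g by simp
qed

text \<open>Any subset that contains the vertex groups and the stable letter and is closed under the group
 operations is everything, since vertices are joined by finite paths.\<close>

lemma generation:
 assumes G': "subgroup G' G" and v0: "vg 0\<subseteq>G'" and v1: "vg hed\<subseteq>G'" and st: "stable\<in>G'"
 shows "G' = carrier G"
proof -
 let ?m = "pts - A"
 note hA = hs_A
 have t: "stable\<in>carrier G" "inv stable\<in>carrier G" using stable by auto
 have mem: "a\<otimes>b\<in>G'" "inv a\<in>G'" if "a\<in>G'" "b\<in>G'" for a b
  using that G' by (auto simp: subgroup.m_closed subgroup.m_inv_closed)
 have G'G: "a\<in>carrier G" if "a\<in>G'" for a using that G' subgroup.mem_carrier by fast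
 \<comment> \<open>\<open>mm\<close>, \<open>mp\<close>, \<open>pm\<close> and \<open>pp\<close>
   concern elements that move one end of the edge \<open>A\<close> to an end of \<open>A\<close>;
   \<open>m\<close> stands for the initial and \<open>p\<close> for the terminal end.\<close>
 have mm: "a\<in>G'" if "a\<in>carrier G" "vx (sh a ?m) = vx ?m" for a
  using that v0 unfolding vg_def base_half_def vstab_def by auto
 have mp: "a\<in>G'" if a: "a\<in>carrier G" "vx (sh a ?m) = vx A" for a
 proof -
  have hnn unfolding hnn_def using a by blast
  hence "vx (sh a ?m) = vx (sh stable ?m)" using a stable(2) by simp
  hence "vx (sh (inv stable) (sh a ?m)) = vx (sh (inv stable) (sh stable ?m))"
   by (intro vx_sh_eq hs_sh hA t a)
  hence "vx (sh (inv stable\<otimes>a) ?m) = vx ?m" using a t by (simp add: sh_sh sh_one)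
  hence "inv stable\<otimes>a\<in>G'" using mm a t by simp
  hence "stable\<otimes>(inv stable\<otimes>a)\<in>G'" using mem st by blast
  thus ?thesis using a t by (simp add: inv_cancel[OF is_group])
 qed
 have pm: "a\<in>G'" if a: "a\<in>carrier G" "vx (sh a A) = vx ?m" for a
 proof -
  have "vx (sh (inv a) (sh a A)) = vx (sh (inv a) ?m)" by (intro vx_sh_eq hs_sh hA a inv_closed)
  hence "vx (sh (inv a) ?m) = vx A" using a A_sub by (simp add: sh_sh sh_one)
  hence "inv a\<in>G'" using mp a by simp
  thus ?thesis using mem(2) a by (metis inv_inv)
 qed
 have pp: "a\<in>G'" if a: "a\<in>carrier G" "vx (sh a A) = vx A" for a
 proof (cases hnn)
  case True
  note st' = stable(2)[OF True]
  have "vx (sh a (sh stable ?m)) = vx (sh a A)" by (intro vx_sh_eq hs_sh hA t a st')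
  hence "vx (sh (a\<otimes>stable) ?m) = vx A" using a t by (simp add: sh_sh)
  hence "a\<otimes>stable\<in>G'" using mp a t by simp
  hence "(a\<otimes>stable)\<otimes>inv stable\<in>G'" using mem st by blast
  thus ?thesis using a t by (simp add: m_assoc)
 next
  case False
  hence "vg hed = vstab A" unfolding vg_def hed_def base_half_def stable_def using A_sub by (simp add: sh_one)
  thus ?thesis using v1 a unfolding vstab_def by blast
 qed
 have key: "a\<in>G'" if "a\<in>carrier G" "B\<in>{A, ?m}" "D\<in>{A, ?m}" "vx (sh a B) = vx D" for a B D
  using that mm mp pm pp by auto
 have "g\<in>G'" if g: "g\<in>carrier G" for g
 proof -
  have fin: "finite (vx B - vx (sh g ?m))" if "B\<in>hs" for B
  proof -
   obtain p where p: "p\<in>pts" using A_sub by blast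
   have "vx B - vx (sh g ?m)\<subseteq>{D\<in>hs. (D\<in>vx B)\<noteq>(p\<in>D)}\<union>{D\<in>hs. (D\<in>vx (sh g ?m))\<noteq>(p\<in>D)}"
    using vx_sub by blast
   moreover have "finite ({D\<in>hs. (D\<in>vx B)\<noteq>(p\<in>D)}\<union>{D\<in>hs. (D\<in>vx (sh g ?m))\<noteq>(p\<in>D)})"
    using vx_almost_principal[OF that p] vx_almost_principal[OF _ p] hs_sh hA g by blast
   ultimately show ?thesis by (rule finite_subset)
  qed
  have gm: "sh g ?m\<in>hs" using hs_sh hA g by blast
  \<comment> \<open>Induction on the distance to the target, the number of half-spaces that contain
    the current vertex but not the target.\<close>
  have "\<lbrakk>y\<in>G'; B0\<in>{A, ?m}; card (vx (sh y B0) - vx (sh g ?m)) = n\<rbrakk> \<Longrightarrow> g\<in>G'" for n y B0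
  proof (induction n arbitrary: y B0 rule: less_induct)
   case (less n)
   let ?\<sigma> = "vx (sh y B0)"
   have yG: "y\<in>carrier G" using G'G less.prems by blast
   have yB: "sh y B0\<in>hs" using less.prems(2) hA hs_sh yG by blast
   have B0: "B0\<in>hs" using less.prems(2) hA by blast
   show ?case
   proof (cases "?\<sigma> - vx (sh g ?m) = {}")
    case True
    have "D\<in>?\<sigma>" if D: "D\<in>vx (sh g ?m)" for D
     using True vx_orient[OF yB] vx_orient[OF gm] D vx_sub hs_compl compl_compl by blast
    hence "vx (sh g ?m) = vx (sh y B0)" using True by blast
    hence "vx (sh (inv y) (sh g ?m)) = vx (sh (inv y) (sh y B0))" by (intro vx_sh_eq gm yB yG inv_closed)
    hence "vx (sh (inv y\<otimes>g) ?m) = vx B0" using yG g hs_sub[OF B0] by (simp add: sh_sh sh_one)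
    hence "inv y\<otimes>g\<in>G'" using key[of "inv y\<otimes>g" ?m B0] less.prems(2) yG g by simp
    hence "y\<otimes>(inv y\<otimes>g)\<in>G'" using mem less.prems(1) by blast
    thus ?thesis using yG g by (simp add: inv_cancel[OF is_group])
   next
    case False
    \<comment> \<open>A smallest such half-space belongs to the edge at the current vertex that
      comes from the target; reversing this edge is a step towards it.\<close>
    then obtain B where B: "B\<in>?\<sigma> - vx (sh g ?m)" "\<And>D. D\<in>?\<sigma> - vx (sh g ?m) ==> D\<subseteq>B ==> D = B"
     using finite_has_minimal[OF fin[OF yB]] by metis
    have Bh: "B\<in>hs" using B vx_sub by blast
    have min: "D = B" if D: "D\<in>?\<sigma>" "D\<subseteq>B" for D
    proof (cases "D\<in>vx (sh g ?m)")
     case True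
     hence "B\<in>vx (sh g ?m)" using vx_up D Bh by blast
     thus ?thesis using B by blast
    next
     case False thus ?thesis using B(2) D by blast
    qed
    have sub: "D\<in>vx B" if D: "D\<in>?\<sigma>" for D
    proof -
     have Dh: "D\<in>hs" using D vx_sub by blast
     consider "D\<subseteq>B" | "B\<subseteq>D" | "D\<inter>B = {}" | "D\<union>B = pts" using nested_hs[OF Dh Bh] by blast
     thus ?thesis
     proof cases
      case 1 thus ?thesis using min[OF D] vx_self[OF Bh] by simp
     next
      case 2 thus ?thesis unfolding vx_def using Dh by blast
     next
      case 3 thus ?thesis using vx_meet[OF yB D] B by blast
     next
      case 4
      have "D\<noteq>pts - B" using vx_orient[OF yB Bh] B D by blast
      thus ?thesis unfolding vx_def using Dh 4 hs_sub[OF Bh] by blast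
     qed
    qed
    have \<sigma>B: "?\<sigma> = vx B"
     using sub vx_orient[OF yB] vx_orient[OF Bh] vx_sub hs_compl compl_compl by blast
    obtain a where a: "a\<in>carrier G" "B = sh a A \<or> B = pts - sh a A" using Bh unfolding hs_def by blast
    have aA: "sh a A\<subseteq>pts" "pts - sh a A = sh a ?m" using sh_sub A_sub a by (auto simp: sh_compl)
    obtain B1 B2 where B12: "B1\<in>{A, ?m}" "B2\<in>{A, ?m}" "B = sh a B1" "pts - B = sh a B2"
     using a(2) aA by (metis double_diff insertCI order_refl)
    have "vx (sh (inv y) (sh a B1)) = vx (sh (inv y) (sh y B0))"
     using \<sigma>B B12(3) Bh yB yG by (intro vx_sh_eq inv_closed) simp_all
    hence "vx (sh (inv y\<otimes>a) B1) = vx B0"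
    proof -
     have "B1\<subseteq>pts" using B12(1) A_sub by blast
     thus ?thesis using \<open>vx (sh (inv y) (sh a B1)) = _\<close> yG a(1) hs_sub[OF B0] by (simp add: sh_sh sh_one)
    qed
    from key[OF _ B12(1) less.prems(2) this] have "inv y\<otimes>a\<in>G'" using yG a(1) by simp
    hence "y\<otimes>(inv y\<otimes>a)\<in>G'" using mem less.prems(1) by blast
    hence aG': "a\<in>G'" using yG a(1) by (simp add: inv_cancel[OF is_group])
    have Bc: "pts - B\<in>vx (sh g ?m)" using vx_orient[OF gm Bh] B by blast
    have "vx (pts - B) - vx (sh g ?m)\<subseteq>(?\<sigma> - vx (sh g ?m)) - {B}"
    proof
     fix D assume D: "D\<in>vx (pts - B) - vx (sh g ?m)"
     hence "D\<noteq>pts - B" using Bc by blast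
     moreover have "D\<noteq>B"
      using D vx_orient[OF hs_compl[OF Bh] Bh] vx_self[OF hs_compl[OF Bh]] by blast
     ultimately show "D\<in>(?\<sigma> - vx (sh g ?m)) - {B}" using D vx_flip[OF Bh] \<sigma>B by blast
    qed
    hence "vx (pts - B) - vx (sh g ?m)\<subset>?\<sigma> - vx (sh g ?m)" using B by blast
    hence "card (vx (sh a B2) - vx (sh g ?m)) < n"
     using less.prems(3) fin[OF yB] B12(4) psubset_card_mono by metis
    thus ?thesis using less.IH[OF _ aG' B12(2)] by blast
   qed
  qed
  moreover have "\<one>\<in>G'" using G' subgroup.one_closed by blast
  ultimately show ?thesis by blast
 qed
 thus ?thesis using G'G by blast
qed

end

context cut_group
begin

section \<open>The graph of groups and the evaluation of words\<close>

definition gG :: "(nat, nat, 'a, 'a) gog" where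
 "gG = \<lparr>base = \<lparr>verts = {0, hed}, arcs = {0, 1}, tail = tl_arc, head = hd_arc\<rparr>, bar = bar_arc,
   vgroup = (\<lambda>i. G\<lparr>carrier := vg i\<rparr>), egroup = (\<lambda>_. G\<lparr>carrier := C\<rparr>), emb = emb_arc\<rparr>"

definition gT :: "nat set" where "gT = (if hnn then {} else {0, 1})"

fun lval :: "(nat, nat, 'a) gog_letter => 'a" where
 "lval (VL i g) = g"
| "lval (EL e) = val_arc e"

definition wval :: "(nat, nat, 'a) gog_letter list => 'a" where
 "wval w = foldr (\<lambda>l y. lval l\<otimes>y) w \<one>"

text \<open>The realization evaluates some word of the class; by \<open>eqv_sound\<close> the choice
  does not matter.\<close>

definition gD :: "'a splitting" where
 "gD = \<lparr>gr = gG, mtree = gT, realization = (\<lambda>K. wval (SOME w. w\<in>K))\<rparr>"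

abbreviation eqv where "eqv \<equiv> pi1_eq gG gT"
abbreviation words where "words \<equiv> lists (gog_letters gG)"

lemma gG_simps [simp]: "verts (base gG) = {0, hed}" "arcs (base gG) = {0, 1}" "tail (base gG) = tl_arc"
  "head (base gG) = hd_arc" "bar gG = bar_arc" "vgroup gG i = G\<lparr>carrier := vg i\<rparr>"
  "egroup gG e = G\<lparr>carrier := C\<rparr>" "emb gG = emb_arc"
 unfolding gG_def by simp_all

lemma letters_iff [simp]: "VL i g\<in>gog_letters gG\<longleftrightarrow>i\<in>{0, hed}\<and>g\<in>vg i" "EL e\<in>gog_letters gG\<longleftrightarrow>e\<in>{0, 1}"
 unfolding gog_letters_def by auto

lemma arc_ends: "e\<in>{0, 1} ==> tl_arc e\<in>{0, hed}\<and>hd_arc e\<in>{0, hed}\<and>bar_arc e\<in>{0, 1} \<and>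
  tl_arc (bar_arc e) = hd_arc e\<and>hd_arc (bar_arc e) = tl_arc e\<and>bar_arc (bar_arc e) = e\<and>bar_arc e\<noteq>e"
 unfolding tl_arc_def hd_arc_def bar_arc_def by auto

lemma vg_carrier [simp]: "g\<in>vg i ==> g\<in>carrier G"
 using vgD by blast

lemma vg_closed [simp]: "g\<in>vg i ==> h\<in>vg i ==> g\<otimes>h\<in>vg i" "g\<in>vg i ==> inv g\<in>vg i" "\<one>\<in>vg i"
 using vg_subgroup[of i] by (auto simp: subgroup.m_closed subgroup.m_inv_closed subgroup.one_closed)

lemma wval_simps [simp]: "wval [] = \<one>" "wval (l # w) = lval l\<otimes>wval w"
 unfolding wval_def by simp_all

lemma lval_carrier: "l\<in>gog_letters gG ==> lval l\<in>carrier G"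
 by (cases l) (auto simp: arc_in)

lemma wval_carrier: "w\<in>words ==> wval w\<in>carrier G"
 by (induction w) (auto simp: lval_carrier)

lemma wval_append: "u\<in>words ==> w\<in>words ==> wval (u @ w) = wval u\<otimes>wval w"
 by (induction u) (auto simp: lval_carrier wval_carrier m_assoc)

lemma val_bar: "e\<in>{0, 1} ==> val_arc e\<otimes>val_arc (bar_arc e) = \<one>"
 unfolding val_arc_def bar_arc_def using stable(1) by auto

lemma val_conj: "e\<in>{0, 1} ==> a\<in>C ==>
  val_arc e\<otimes>(emb_arc e a\<otimes>val_arc (bar_arc e)) = emb_arc (bar_arc e) a"
 unfolding val_arc_def bar_arc_def emb_arc_def C_def using stable(1)
 by (auto simp: m_assoc inv_cancel[OF is_group])

lemma val_tree: "e\<in>gT ==> val_arc e = \<one>"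
 unfolding gT_def val_arc_def stable_def by (auto split: if_splits)

lemma emb_words: "e\<in>{0, 1} ==> a\<in>C ==> emb_arc e a\<in>vg (hd_arc e)\<and>emb_arc (bar_arc e) a\<in>vg (tl_arc e)"
 using emb_mem(1)[of e a] emb_mem(1)[of "bar_arc e" a] arc_ends[of e] by metis

lemma eqv_sound: "eqv u w ==> u\<in>words\<and>w\<in>words\<and>wval u = wval w"
proof (induction rule: pi1_eq.induct)
 case (append u u' w w') thus ?case by (simp add: wval_append)
next
 case (vertex_mult v g h) thus ?case by auto
next
 case (arc_inv e)
 hence "e\<in>{0, 1}" by simp
 thus ?case using val_bar[of e] arc_ends[of e] arc_in by simp
next
 case (arc_conj e a)
 hence e: "e\<in>{0, 1}" and a: "a\<in>C" by simp_all
 have "emb_arc (bar_arc e) a\<in>carrier G" using emb_words[OF e a] vg_carrier by blast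
 thus ?case using val_conj[OF e a] emb_words[OF e a] arc_ends[OF e] e arc_in by simp
next
 case (tree_arc e) thus ?case using val_tree[of e] by auto
qed auto

lemmas eqv_rules = pi1_eq.intros[of gG gT for gG gT]

lemma eqv_refl: "w\<in>words ==> eqv w w" by (rule pi1_eq.refl)
lemma eqv_trans: "eqv u w ==> eqv w x ==> eqv u x" by (rule pi1_eq.trans)
lemma eqv_sym: "eqv u w ==> eqv w u" by (rule pi1_eq.sym)

lemma eqv_context: "eqv u u' ==> p\<in>words ==> q\<in>words ==> eqv (p @ u @ q) (p @ u' @ q)"
 by (intro pi1_eq.append eqv_refl)

lemma eqv_merge: "i\<in>{0, hed} ==> g\<in>vg i ==> h\<in>vg i ==> eqv [VL i g, VL i h] [VL i (g\<otimes>h)]"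
 using pi1_eq.vertex_mult[of i gG g h gT] by simp

lemma eqv_one: "i\<in>{0, hed} ==> eqv [VL i \<one>] []"
 using pi1_eq.vertex_one[of i gG gT] by simp

lemma eqv_arc: "e\<in>{0, 1} ==> eqv [EL e, EL (bar_arc e)] []"
 using pi1_eq.arc_inv[of e gG gT] by simp

lemma eqv_conj: "e\<in>{0, 1} ==> a\<in>C ==>
  eqv [EL e, VL (hd_arc e) (emb_arc e a), EL (bar_arc e)] [VL (tl_arc e) (emb_arc (bar_arc e) a)]"
 using pi1_eq.arc_conj[of e gG a gT] by simp

lemma eqv_tree: "\<not> hnn ==> e\<in>{0, 1} ==> eqv [EL e] []"
 using pi1_eq.tree_arc[of e gT gG] unfolding gT_def by simp

lemma inverse_word: "w\<in>words ==> \<exists>w'\<in>words. eqv (w' @ w) []\<and>eqv (w @ w') []"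
proof (induction w)
 case Nil thus ?case using eqv_refl[of "[]"] by force
next
 case (Cons l w)
 then obtain w' where w': "w'\<in>words" "eqv (w' @ w) []" "eqv (w @ w') []" by auto
 have "\<exists>l'\<in>gog_letters gG. eqv [l', l] []\<and>eqv [l, l'] []"
 proof (cases l)
  case (VL i g)
  hence g: "i\<in>{0, hed}" "g\<in>vg i" using Cons.prems by auto
  have "eqv [VL i (inv g), VL i g] [VL i \<one>]" "eqv [VL i g, VL i (inv g)] [VL i \<one>]"
   using eqv_merge[OF g(1), of "inv g" g] eqv_merge[OF g(1), of g "inv g"] g by simp_all
  hence "eqv [VL i (inv g), VL i g] []" "eqv [VL i g, VL i (inv g)] []"
   using eqv_trans[OF _ eqv_one[OF g(1)]] by simp_all
  thus ?thesis using g VL by (intro bexI[of _ "VL i (inv g)"]) auto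
 next
  case (EL e)
  hence e: "e\<in>{0, 1}" using Cons.prems by auto
  have "eqv [EL (bar_arc e), EL e] []" using eqv_arc[of "bar_arc e"] arc_ends[OF e] by simp
  thus ?thesis using eqv_arc[OF e] arc_ends[OF e] EL by (intro bexI[of _ "EL (bar_arc e)"]) auto
 qed
 then obtain l' where l': "l'\<in>gog_letters gG" "eqv [l', l] []" "eqv [l, l'] []" by blast
 have ls: "w'\<in>words" "w\<in>words" "[l]\<in>words" "[l']\<in>words" using Cons.prems w' l' by auto
 have "eqv (w' @ [l', l] @ w) (w' @ [] @ w)" by (rule eqv_context[OF l'(2) ls(1,2)])
 from eqv_trans[OF this] have 1: "eqv ((w' @ [l']) @ (l # w)) []" using w'(2) by simp
 have "eqv ([l] @ (w @ w') @ [l']) ([l] @ [] @ [l'])" by (rule eqv_context[OF w'(3) ls(3,4)])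
 from eqv_trans[OF this] have 2: "eqv ((l # w) @ (w' @ [l'])) []" using l'(3) by simp
 show ?case using 1 2 ls by (intro bexI[of _ "w' @ [l']"]) auto
qed

text \<open>Words that spell a path of \<open>n\<close> arcs in the graph, with a vertex letter at
  each vertex on the way: the form in which backtracking becomes visible.\<close>

inductive epath :: "nat => (nat, nat, 'a) gog_letter list => nat => nat => bool" where
 enil: "i\<in>{0, hed} ==> g\<in>vg i ==> epath i [VL i g] 0 i"
| econs: "e\<in>{0, 1} ==> g\<in>vg (tl_arc e) ==> epath (hd_arc e) w n j ==>
  epath (tl_arc e) (VL (tl_arc e) g # EL e # w) (Suc n) j"

lemma epath_words: "epath i w n j ==> w\<in>words\<and>i\<in>{0, hed}\<and>j\<in>{0, hed}"
 by (induction rule: epath.induct) (use arc_ends in auto)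

lemma epath_left_mult:
 assumes "epath i w n j" "g\<in>vg i"
 shows "\<exists>w'. epath i w' n j\<and>eqv (VL i g # w) w'"
 using assms(1)
proof cases
 case (enil h)
 thus ?thesis using assms eqv_merge[of i g h] epath.enil[of i "g\<otimes>h"] by auto
next
 case (econs e h w' m)
 have ww: "EL e # w'\<in>words" using econs epath_words by auto
 have i: "i\<in>{0, hed}" using epath_words[OF assms(1)] by blast
 have "eqv ([VL i g, VL i h] @ (EL e # w')) ([VL i (g\<otimes>h)] @ (EL e # w'))"
  by (rule pi1_eq.append[OF eqv_merge[OF i] eqv_refl[OF ww]]) (use assms econs in auto)
 moreover have "epath i ([VL i (g\<otimes>h)] @ (EL e # w')) n j"
  using epath.econs[OF econs(4), of "g\<otimes>h" w' m j] assms econs by auto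
 ultimately show ?thesis using econs by auto
qed

lemma epath_append:
 assumes "epath i p n j" "epath j q m k"
 shows "\<exists>r. epath i r (n + m) k\<and>eqv (p @ q) r"
 using assms
proof (induction rule: epath.induct)
 case (enil i g)
 thus ?case using epath_left_mult by fastforce
next
 case (econs e g w n j)
 then obtain r where r: "epath (hd_arc e) r (n + m) k" "eqv (w @ q) r" by blast
 have "eqv ([VL (tl_arc e) g, EL e] @ (w @ q)) ([VL (tl_arc e) g, EL e] @ r)"
  by (rule pi1_eq.append[OF eqv_refl r(2)]) (use econs arc_ends in auto)
 thus ?case using epath.econs[OF econs(1,2) r(1)] by (intro exI conjI) (auto intro: epath.econs)
qed

text \<open>In an amalgam, a letter at the vertex \<open>hed\<close> is reached from vertex 0 and
  left again by arcs that are trivial as tree arcs.\<close>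

lemma epath_letter:
 assumes l: "l\<in>gog_letters gG"
 shows "\<exists>p n. epath 0 p n 0\<and>eqv [l] p"
proof -
 have one: "epath 0 [VL 0 \<one>] 0 0" by (rule epath.enil) auto
 have z: "0\<in>{0, hed}" by simp
 show ?thesis
 proof (cases l)
  case (VL i g)
  hence g: "i\<in>{0, hed}" "g\<in>vg i" using l by auto
  show ?thesis
  proof (cases "i = 0")
   case True
   thus ?thesis using VL g epath.enil[of 0 g] eqv_refl[of "[VL 0 g]"] by (intro exI conjI) auto
  next
   case False
   hence h: "i = hed" "\<not> hnn" "hed = 1" using g unfolding hed_def by (auto split: if_splits)
   have e01: "tl_arc 0 = 0" "hd_arc 0 = hed" "tl_arc 1 = hed" "hd_arc 1 = 0" unfolding tl_arc_def hd_arc_def by auto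
   have p1: "epath (tl_arc 1) (VL (tl_arc 1) g # EL 1 # [VL 0 \<one>]) (Suc 0) 0"
    using epath.econs[of 1 g "[VL 0 \<one>]" 0 0] one e01 g h by simp
   have p2: "epath (tl_arc 0) (VL (tl_arc 0) \<one> # EL 0 # (VL (tl_arc 1) g # EL 1 # [VL 0 \<one>])) (Suc (Suc 0)) 0"
    using epath.econs[of 0 \<one>, OF _ _ p1[unfolded e01(3), folded e01(2)]] e01 by simp
   let ?p = "VL 0 \<one> # EL 0 # VL hed g # EL 1 # [VL 0 \<one>]"
   have gw: "[VL hed g]\<in>words" using g h by simp
   have "eqv ([VL 0 \<one>] @ [EL 0] @ [VL hed g] @ [EL 1] @ [VL 0 \<one>]) ([] @ [] @ [VL hed g] @ [] @ [])"
    using eqv_one[OF z] eqv_tree[OF h(2), of 0] eqv_tree[OF h(2), of 1] eqv_refl[OF gw]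
    by (intro pi1_eq.append) auto
   hence "eqv [VL hed g] ?p" using eqv_sym by simp
   thus ?thesis using p2 e01 VL h by auto
  qed
 next
  case (EL e)
  hence e: "e\<in>{0, 1}" using l by auto
  show ?thesis
  proof (cases hnn)
   case True
   hence e0: "tl_arc e = 0" "hd_arc e = 0" unfolding tl_arc_def hd_arc_def hed_def by auto
   have p: "epath 0 (VL 0 \<one> # EL e # [VL 0 \<one>]) (Suc 0) 0"
    using epath.econs[OF e, of \<one> "[VL 0 \<one>]" 0 0] one e0 by simp
   have ew: "[EL e]\<in>words" using e by simp
   have "eqv ([VL 0 \<one>] @ [EL e] @ [VL 0 \<one>]) ([] @ [EL e] @ [])"
    using eqv_one[OF z] eqv_refl[OF ew] by (intro pi1_eq.append)
   thus ?thesis using p EL eqv_sym by auto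
  next
   case False
   have "eqv [EL e] [VL 0 \<one>]" using eqv_tree[OF False e] eqv_one[OF z] eqv_sym eqv_trans by blast
   thus ?thesis using one EL by blast
  qed
 qed
qed

lemma epath_normalize: "w\<in>words ==> \<exists>p n. epath 0 p n 0\<and>eqv w p"
proof (induction w)
 case Nil
 have "epath 0 [VL 0 \<one>] 0 0" by (rule epath.enil) auto
 thus ?case using eqv_one[of 0] eqv_sym by blast
next
 case (Cons l w)
 then obtain p n q m where p: "epath 0 p n 0" "eqv [l] p" and q: "epath 0 q m 0" "eqv w q"
  using epath_letter[of l] by auto
 obtain r where r: "epath 0 r (n + m) 0" "eqv (p @ q) r" using epath_append[OF p(1) q(1)] by blast
 have "eqv ([l] @ w) (p @ q)" using p q by (intro pi1_eq.append)
 from eqv_trans[OF this r(2)] show ?case using r(1) by (intro exI[of _ r] exI[of _ "n + m"]) simp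
qed

text \<open>Either the path that the word spells in the tree turns back somewhere, and the
  conjugation relation shortens the word, or its half-spaces descend strictly and the path ends in a
  half-space \<open>D\<close> inside the first one.\<close>

lemma epath_chain:
 "epath i p n j ==> n = 0 \<or> (\<exists>p' n'. n' < n\<and>epath i p' n' j\<and>eqv p p') \<or>
  (\<exists>g e w D. p = VL (tl_arc e) g # EL e # w\<and>i = tl_arc e\<and>e\<in>{0, 1}\<and>g\<in>vg (tl_arc e) \<and>
   D\<in>hs\<and>D\<subseteq>sh g (half e)\<and>vx D = vx (sh (wval p) (base_half j)))"
proof (induction rule: epath.induct)
 case (enil i g) thus ?case by simp
next
 case (econs e g w n j)
 note e = econs.hyps(1) and g = econs.hyps(2) and w = econs.hyps(3)
 let ?t = "val_arc e"
 let ?B = "sh g (half e)"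
 have gG: "g\<in>carrier G" and tG: "?t\<in>carrier G" using g arc_in by auto
 have gt: "g\<otimes>?t\<in>carrier G" using gG tG by simp
 have Bh: "?B\<in>hs" using hs_sh arc_in gG by blast
 have wG: "wval w\<in>carrier G" using epath_words[OF w] wval_carrier by blast
 have shB: "vx ?B = vx (sh (g\<otimes>?t) (base_half (hd_arc e)))"
 proof -
  have "vx ?B = vx (sh g (sh ?t (base_half (hd_arc e))))"
   by (rule vx_sh_eq[OF arc_in(2) hs_sh[OF arc_in(3) tG] gG half_term[OF e]])
  thus ?thesis using gG tG hs_sub[OF arc_in(3)] by (simp add: sh_sh)
 qed
 have wv: "wval (VL (tl_arc e) g # EL e # w) = g\<otimes>?t\<otimes>wval w" using gG tG wG by (simp add: m_assoc)
 from econs.IH consider (zero) "n = 0"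
  | (red) p' n' where "n' < n" "epath (hd_arc e) p' n' j" "eqv w p'"
  | (chain) g' e' w' D where "w = VL (tl_arc e') g' # EL e' # w'" "hd_arc e = tl_arc e'" "e'\<in>{0, 1}"
   "g'\<in>vg (tl_arc e')" "D\<in>hs" "D\<subseteq>sh g' (half e')" "vx D = vx (sh (wval w) (base_half j))" by blast
 thus ?case
 proof cases
  case zero
  from w zero obtain h where h: "w = [VL j h]" "j = hd_arc e" "h\<in>vg j" by (auto elim: epath.cases)
  have "vx (sh (g\<otimes>?t) (sh h (base_half j))) = vx (sh (g\<otimes>?t) (base_half j))"
   using vgD[OF h(3)] by (intro vx_sh_eq hs_sh arc_in gt) auto
  hence "vx ?B = vx (sh (wval (VL (tl_arc e) g # EL e # w)) (base_half j))"
   unfolding shB wv using h gt hs_sub[OF arc_in(3)] by (simp add: sh_sh)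
  thus ?thesis using e g Bh by blast
 next
  case red
  have "eqv ([VL (tl_arc e) g, EL e] @ w) ([VL (tl_arc e) g, EL e] @ p')"
   by (rule pi1_eq.append[OF eqv_refl red(3)]) (use e g arc_ends in auto)
  thus ?thesis using epath.econs[OF e g red(2)] red(1) by auto
 next
  case chain
  have g'G: "g'\<in>carrier G" using chain(4) by simp
  let ?B' = "sh (g\<otimes>?t) (sh g' (half e'))"
  have B'h: "?B'\<in>hs" "sh g' (half e')\<in>hs" using hs_sh arc_in gt g'G by auto
  have "pts - ?B' = sh (g\<otimes>?t) (sh g' (pts - half e'))"
   using gt g'G hs_sub[OF arc_in(2)] hs_sub[OF B'h(2)] by (simp add: sh_compl)
  moreover have "vx (sh g' (pts - half e')) = vx (base_half (tl_arc e'))"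
  proof -
   have "vx (sh g' (pts - half e')) = vx (sh g' (base_half (tl_arc e')))"
    by (rule vx_sh_eq[OF hs_compl[OF arc_in(2)] arc_in(3) g'G half_init[OF chain(3)]])
   thus ?thesis using vgD[OF chain(4)] by simp
  qed
  hence "vx (sh (g\<otimes>?t) (sh g' (pts - half e'))) = vx (sh (g\<otimes>?t) (base_half (tl_arc e')))"
   by (rule vx_sh_eq[OF hs_sh[OF hs_compl[OF arc_in(2)] g'G] arc_in(3) gt])
  ultimately have "vx ?B = vx (pts - ?B')" unfolding shB using chain(2) by simp
  from vx_consecutive[OF Bh B'h(1) this] show ?thesis
  proof
   \<comment> \<open>At a turn the vertex letter in between fixes the edge, so it comes from
     \<open>C\<close> by \<open>half_fix\<close> and can be moved across the arc, which then
     cancels.\<close>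
   assume turn: "?B' = pts - ?B"
   have "pts - ?B = sh g (pts - half e)" using gG hs_sub[OF arc_in(2)] by (simp add: sh_compl)
   also have "\<dots> = sh (g\<otimes>?t) (half (bar_arc e))"
    unfolding half_compl[OF e] using gG tG hs_sub[OF arc_in(2)] by (simp add: sh_sh)
   finally have "sh g' (half e') = half (bar_arc e)"
    using turn sh_inj[OF hs_sub[OF B'h(2)] hs_sub[OF arc_in(2)] gt] by simp
   moreover from this have e': "e' = bar_arc e" by (rule half_turn[OF e chain(3) g'G])
   ultimately obtain a where a: "a\<in>C" "g' = emb_arc e a" using half_fix[OF e g'G] by auto
   have w'p: "\<exists>m. n = Suc m\<and>epath (hd_arc e') w' m j"
    using w unfolding chain(1) by (auto elim: epath.cases)
   then obtain m where m: "n = Suc m" "epath (tl_arc e) w' m j" using e' arc_ends[OF e] by auto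
   have w'w: "w'\<in>words" using epath_words m by blast
   let ?b = "emb_arc (bar_arc e) a"
   have b: "?b\<in>vg (tl_arc e)" using emb_words[OF e a(1)] by blast
   have i: "tl_arc e\<in>{0, hed}" using arc_ends[OF e] by blast
   have "eqv ([VL (tl_arc e) g] @ [EL e, VL (hd_arc e) (emb_arc e a), EL (bar_arc e)] @ w')
     ([VL (tl_arc e) g] @ [VL (tl_arc e) ?b] @ w')"
    by (rule eqv_context[OF eqv_conj[OF e a(1)] _ w'w]) (use g i in simp)
   also have "[VL (tl_arc e) g] @ [EL e, VL (hd_arc e) (emb_arc e a), EL (bar_arc e)] @ w' = VL (tl_arc e) g # EL e # w"
    unfolding chain(1) using a e' arc_ends[OF e] by simp
   finally have r1: "eqv (VL (tl_arc e) g # EL e # w) ([VL (tl_arc e) g, VL (tl_arc e) ?b] @ w')" by simp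
   have "eqv ([VL (tl_arc e) g, VL (tl_arc e) ?b] @ w') ([VL (tl_arc e) (g\<otimes>?b)] @ w')"
    by (rule pi1_eq.append[OF eqv_merge[OF i g b] eqv_refl[OF w'w]])
   moreover obtain w'' where "epath (tl_arc e) w'' m j" "eqv (VL (tl_arc e) (g\<otimes>?b) # w') w''"
    using epath_left_mult[OF m(2), of "g\<otimes>?b"] g b by auto
   ultimately have "epath (tl_arc e) w'' m j\<and>eqv (VL (tl_arc e) g # EL e # w) w''"
    using eqv_trans[OF r1] eqv_trans by (metis append_Cons append_Nil)
   thus ?thesis using m by (metis lessI less_SucI)
  next
   assume strict: "?B'\<subset>?B"
   let ?D = "sh (g\<otimes>?t) D"
   have "?D\<in>hs" by (rule hs_sh[OF chain(5) gt])
   moreover have "?D\<subseteq>?B'" unfolding cshift_def[of G "g\<otimes>?t"] by (rule image_mono[OF chain(6)])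
   hence "?D\<subseteq>?B" using strict by blast
   moreover have "vx ?D = vx (sh (wval (VL (tl_arc e) g # EL e # w)) (base_half j))"
   proof -
    have "vx ?D = vx (sh (g\<otimes>?t) (sh (wval w) (base_half j)))"
     by (rule vx_sh_eq[OF chain(5) hs_sh[OF arc_in(3) wG] gt chain(7)])
    thus ?thesis unfolding wv using gt wG hs_sub[OF arc_in(3)] by (simp add: sh_sh)
   qed
   ultimately show ?thesis using e g by blast
  qed
 qed
qed

text \<open>A closed path in the tree is no descending chain, by \<open>vx_chain_end\<close>, so it
  can be shortened until no arc is left.\<close>

lemma epath_trivial: "epath 0 p n 0 ==> wval p = \<one> ==> eqv p []"
proof (induction n arbitrary: p rule: less_induct)
 case (less n)
 from epath_chain[OF less.prems(1)] consider (zero) "n = 0"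
  | (red) p' n' where "n' < n" "epath 0 p' n' 0" "eqv p p'"
  | (chain) g e w D where "p = VL (tl_arc e) g # EL e # w" "0 = tl_arc e" "e\<in>{0, 1}" "g\<in>vg (tl_arc e)"
   "D\<in>hs" "D\<subseteq>sh g (half e)" "vx D = vx (sh (wval p) (base_half 0))" by blast
 thus ?case
 proof cases
  case zero
  with less.prems(1) obtain g where "p = [VL 0 g]" "g\<in>vg 0" by (auto elim: epath.cases)
  thus ?thesis using less.prems(2) eqv_one[of 0] by simp
 next
  case red
  have "wval p' = \<one>" using eqv_sound[OF red(3)] less.prems by simp
  thus ?thesis using less.IH[OF red(1,2)] red(3) eqv_trans by blast
 next
  case chain
  have gG: "g\<in>carrier G" using chain by simp
  have B: "sh g (half e)\<in>hs" using hs_sh arc_in gG by blast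
  have "vx (sh g (pts - half e)) = vx (sh g (base_half 0))"
   using half_init[OF chain(3)] chain(2) by (intro vx_sh_eq hs_compl arc_in gG) simp
  also have "\<dots> = vx (base_half 0)" using vgD[OF chain(4)] chain(2) by simp
  also have "\<dots> = vx D" unfolding chain(7) less.prems(2) using sh_one[OF hs_sub[OF arc_in(3)]] by simp
  finally have "vx (pts - sh g (half e)) = vx D" using gG hs_sub[OF arc_in(2)] by (simp add: sh_compl)
  thus ?thesis using vx_chain_end[OF B chain(5,6)] by blast
 qed
qed

text \<open>Injectivity of the evaluation, by applying \<open>epath_trivial\<close> to the quotient
  of the two words.\<close>

lemma eqv_complete:
 assumes u: "u\<in>words" and w: "w\<in>words" and eq: "wval u = wval w"
 shows "eqv u w"
proof -
 obtain u' where u': "u'\<in>words" "eqv (u' @ u) []" "eqv (u @ u') []" using inverse_word[OF u] by blast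
 have uw: "u' @ w\<in>words" using u' w by simp
 have "wval u'\<otimes>wval u = \<one>" using eqv_sound[OF u'(2)] u' u by (simp add: wval_append)
 hence one: "wval (u' @ w) = \<one>" using u' w eq by (simp add: wval_append)
 obtain p n where p: "epath 0 p n 0" "eqv (u' @ w) p" using epath_normalize[OF uw] by blast
 have "eqv (u' @ w) []" using epath_trivial[OF p(1)] eqv_sound[OF p(2)] one p(2) eqv_trans by metis
 hence 1: "eqv (u @ (u' @ w)) (u @ [])" by (rule pi1_eq.append[OF eqv_refl[OF u]])
 have "eqv ((u @ u') @ w) ([] @ w)" by (rule pi1_eq.append[OF u'(3) eqv_refl[OF w]])
 hence "eqv w (u @ (u' @ w))" using eqv_sym by simp
 thus ?thesis using 1 eqv_trans eqv_sym by (metis append_Nil2)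
qed

lemma class_mem: "u\<in>pi1_class gG gT w\<longleftrightarrow>eqv w u"
 unfolding pi1_class_def by simp

lemma class_eq: "u\<in>words ==> w\<in>words ==> pi1_class gG gT u = pi1_class gG gT w\<longleftrightarrow>wval u = wval w"
proof
 assume uw: "u\<in>words" "w\<in>words"
 show "wval u = wval w" if "pi1_class gG gT u = pi1_class gG gT w"
  using that class_mem eqv_refl uw eqv_sound by blast
 show "pi1_class gG gT u = pi1_class gG gT w" if "wval u = wval w"
 proof -
  show ?thesis by (rule pi1_class_eq[OF eqv_complete[OF uw that]])
 qed
qed

lemma realization_class: "w\<in>words ==> realization gD (pi1_class gG gT w) = wval w"
proof -
 assume w: "w\<in>words"
 have "w\<in>pi1_class gG gT w" using class_mem eqv_refl w by blast
 hence "(SOME u. u\<in>pi1_class gG gT w)\<in>pi1_class gG gT w" by (rule someI)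
 hence "wval (SOME u. u\<in>pi1_class gG gT w) = wval w" using class_mem eqv_sound by metis
 thus ?thesis unfolding gD_def by simp
qed

lemma word_in_gD: "w\<in>words ==> word_in gD w = wval w"
 unfolding word_in_def using realization_class unfolding gD_def by simp

lemma wval_image: "wval ` words = carrier G"
proof (rule generation)
 show "subgroup (wval ` words) G"
 proof (rule subgroupI)
  show "wval ` words\<subseteq>carrier G" using wval_carrier by blast
  show "wval ` words\<noteq>{}" by blast
  show "inv a\<in>wval ` words" if "a\<in>wval ` words" for a
  proof -
   obtain w where w: "w\<in>words" "a = wval w" using \<open>a\<in>wval ` words\<close> by blast
   obtain w' where w': "w'\<in>words" "eqv (w' @ w) []" using inverse_word[OF w(1)] by blast
   have "wval w'\<otimes>wval w = \<one>" using eqv_sound[OF w'(2)] w' w by (simp add: wval_append)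
   hence "inv a = wval w'" using w w' wval_carrier by (metis inv_equality)
   thus ?thesis using w' by blast
  qed
  show "a\<otimes>b\<in>wval ` words" if "a\<in>wval ` words" "b\<in>wval ` words" for a b
  proof -
   obtain u where u: "u\<in>words" "a = wval u" using \<open>a\<in>wval ` words\<close> by blast
   obtain w where w: "w\<in>words" "b = wval w" using \<open>b\<in>wval ` words\<close> by blast
   from u w have "a\<otimes>b = wval (u @ w)" "u @ w\<in>words" by (simp_all add: wval_append)
   thus ?thesis by blast
  qed
 qed
 have "g\<in>wval ` words" if "g\<in>vg i" "i\<in>{0, hed}" for g i
 proof -
  have "[VL i g]\<in>words" "wval [VL i g] = g" using that by simp_all
  thus ?thesis by (metis imageI)
 qed
 thus "vg 0\<subseteq>wval ` words" "vg hed\<subseteq>wval ` words" by blast+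
 have "[EL 0]\<in>words" "wval [EL 0] = stable" using stable by (simp_all add: val_arc_def)
 thus "stable\<in>wval ` words" by (metis imageI)
qed

lemma realization_iso: "realization gD\<in>iso (pi1 gG gT) G"
proof -
 have car: "carrier (pi1 gG gT) = pi1_class gG gT ` words" unfolding pi1_def by simp
 have "realization gD\<in>hom (pi1 gG gT) G"
 proof (rule homI)
  show "realization gD K\<in>carrier G" if "K\<in>carrier (pi1 gG gT)" for K
  proof -
   obtain w where w: "w\<in>words" "K = pi1_class gG gT w"
    using \<open>K\<in>carrier (pi1 gG gT)\<close> unfolding car by (rule imageE)
   show ?thesis unfolding w(2) realization_class[OF w(1)] by (rule wval_carrier[OF w(1)])
  qed
  fix K L assume "K\<in>carrier (pi1 gG gT)" "L\<in>carrier (pi1 gG gT)"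
  then obtain u w where "u\<in>words" "w\<in>words" "K = pi1_class gG gT u" "L = pi1_class gG gT w" unfolding car by blast
  thus "realization gD (K \<otimes>\<^bsub>pi1 gG gT\<^esub> L) = realization gD K\<otimes>realization gD L"
   by (simp add: pi1_class_mult realization_class wval_append)
 qed
 moreover have "bij_betw (realization gD) (carrier (pi1 gG gT)) (carrier G)"
 proof (rule bij_betw_imageI)
  show "inj_on (realization gD) (carrier (pi1 gG gT))"
   unfolding car
  proof (rule inj_onI)
   fix K L assume KL: "K\<in>pi1_class gG gT ` words" "L\<in>pi1_class gG gT ` words" "realization gD K = realization gD L"
   obtain u where u: "u\<in>words" "K = pi1_class gG gT u" using KL(1) by (rule imageE)
   obtain w where w: "w\<in>words" "L = pi1_class gG gT w" using KL(2) by (rule imageE)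
   show "K = L" using KL(3) realization_class[OF u(1)] realization_class[OF w(1)] class_eq[OF u(1) w(1)]
    unfolding u(2) w(2) by argo
  qed
  have "realization gD ` pi1_class gG gT ` words = wval ` words"
   unfolding image_image by (rule image_cong[OF HOL.refl realization_class])
  thus "realization gD ` carrier (pi1 gG gT) = carrier G" unfolding car wval_image .
 qed
 ultimately show ?thesis unfolding iso_def by simp
qed

lemma gG_bidirected: "bidirected_digraph (base gG) (bar gG)"
 by unfold_locales (auto simp: tl_arc_def hd_arc_def bar_arc_def)

lemma gG_fin: "fin_digraph (base gG)"
 by unfold_locales (auto simp: tl_arc_def hd_arc_def)

lemma gG_awalk_Cons: "pre_digraph.awalk (base gG) u (e # p) v \<longleftrightarrow>
  e\<in>{0, 1}\<and>u = tl_arc e\<and>pre_digraph.awalk (base gG) (hd_arc e) p v"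
 unfolding pre_digraph.awalk_def using arc_ends[of e] by (auto simp: pre_digraph.cas.simps)

lemma gG_awalk_Nil: "pre_digraph.awalk (base gG) u [] v\<longleftrightarrow>u = v\<and>u\<in>{0, hed}"
 unfolding pre_digraph.awalk_def by (auto simp: pre_digraph.cas.simps)

lemma gG_graph: "graph_of_groups gG"
 unfolding graph_of_groups_def graph_of_groups_axioms_def
proof (intro conjI gG_bidirected allI impI)
 show "verts (base gG)\<noteq>{}" by simp
 show "\<exists>p. pre_digraph.awalk (base gG) u p v" if uv: "u\<in>verts (base gG)" "v\<in>verts (base gG)" for u v
 proof -
  have 1: "pre_digraph.awalk (base gG) 0 [0] hed" "pre_digraph.awalk (base gG) hed [1] 0"
   by (simp_all add: gG_awalk_Cons gG_awalk_Nil tl_arc_def hd_arc_def)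
  have 2: "pre_digraph.awalk (base gG) u [] u" using uv by (simp add: gG_awalk_Nil)
  have "u = v \<or> u = 0\<and>v = hed \<or> u = hed\<and>v = 0" using uv by auto
  thus ?thesis using 1 2 by blast
 qed
 show "group (vgroup gG v)" if "v\<in>verts (base gG)" for v
  using that subgroup_imp_group[OF vg_subgroup] by simp
 show "group (egroup gG e)" if "e\<in>arcs (base gG)" for e
  using subgroup_imp_group[OF C_subgroup] by simp
 show "egroup gG (bar gG e) = egroup gG e" if "e\<in>arcs (base gG)" for e by simp
 show "emb gG e\<in>mon (egroup gG e) (vgroup gG (head (base gG) e))" if "e\<in>arcs (base gG)" for e
 proof -
  have e: "e\<in>{0, 1}" using that by simp
  have CG: "a\<in>carrier G" if "a\<in>C" for a using that unfolding C_def by simp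
  have 1: "emb_arc e (a\<otimes>b) = emb_arc e a\<otimes>emb_arc e b" if "a\<in>C" "b\<in>C" for a b
   unfolding emb_arc_def using CG[OF that(1)] CG[OF that(2)] stable(1) by (simp add: m_assoc inv_cancel[OF is_group])
  have 2: "inj_on (emb_arc e) C"
   unfolding emb_arc_def inj_on_def using CG stable(1) by (auto simp: m_assoc)
  have 3: "emb_arc e a\<in>vg (hd_arc e)" if "a\<in>C" for a using emb_words[OF e that] by blast
  show ?thesis unfolding mon_def hom_def using 1 2 3 by simp
 qed
qed

text \<open>With a stable letter the only vertex is 0 and the tree is empty. Otherwise one pair of
  arcs joins two vertices, and a walk of two arcs backtracks.\<close>

lemma gG_tree: "maximal_tree gG gT"
proof -
 have "\<exists>!p. pre_digraph.awalk (base gG) u p v\<and>set p\<subseteq>gT\<and>successively (\<lambda>e f. f\<noteq>bar gG e) p"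
  if uv: "u\<in>{0, hed}" "v\<in>{0, hed}" for u v
 proof (cases hnn)
  case True
  hence "gT = {}" "u = 0" "v = 0" using uv unfolding gT_def hed_def by auto
  thus ?thesis using gG_awalk_Nil by (intro ex1I[of _ "[]"]) auto
 next
  case False
  hence h: "hed = 1" "gT = {0, 1}" unfolding hed_def gT_def by auto
  \<comment> \<open>The arc that starts at the vertex \<open>u\<close> also has the number
    \<open>u\<close>.\<close>
  define q where "q = (if u = v then [] else [u])"
  have arcs: "tl_arc 0 = 0" "hd_arc 0 = 1" "tl_arc 1 = 1" "hd_arc 1 = 0" unfolding tl_arc_def hd_arc_def h by auto
  have "pre_digraph.awalk (base gG) u q v"
  proof (cases "u = v")
   case True thus ?thesis unfolding q_def using uv by (simp add: gG_awalk_Nil)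
  next
   case False
   hence "u = 0\<and>v = 1 \<or> u = 1\<and>v = 0" using uv h(1) by auto
   thus ?thesis unfolding q_def using h(1) arcs by (elim disjE conjE) (simp_all add: gG_awalk_Cons gG_awalk_Nil)
  qed
  moreover have "set q\<subseteq>gT\<and>successively (\<lambda>e f. f\<noteq>bar gG e) q" unfolding q_def using uv h by auto
  moreover have uniq: "p = q" if p: "pre_digraph.awalk (base gG) u p v" "successively (\<lambda>e f. f\<noteq>bar gG e) p" for p
  proof (cases p)
   case Nil thus ?thesis using p gG_awalk_Nil unfolding q_def by simp
  next
   case (Cons e p')
   show ?thesis
   proof (cases p')
    case Nil
    have e: "e\<in>{0, 1}" "u = tl_arc e" "hd_arc e = v"
     using p(1) unfolding Cons Nil gG_awalk_Cons gG_awalk_Nil by blast+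
    hence "u = e" "u\<noteq>v" using arcs by (elim insertE; simp)+
    thus ?thesis unfolding q_def Cons Nil by simp
   next
    case (Cons f p'')
    have "e\<in>{0, 1}" "f\<in>{0, 1}" "hd_arc e = tl_arc f" "f\<noteq>bar_arc e"
     using p unfolding \<open>p = e # p'\<close> Cons gG_awalk_Cons gG_simps by (blast, blast, blast, simp)
    thus ?thesis using arcs unfolding bar_arc_def by auto
   qed
  qed
  ultimately show ?thesis by (intro ex1I[of _ q] conjI; elim conjE) (assumption | rule uniq)+
 qed
 moreover have "bar_arc ` gT\<subseteq>gT" "gT\<subseteq>{0, 1}" unfolding gT_def bar_arc_def by auto
 ultimately show ?thesis unfolding maximal_tree_def by simp
qed

text \<open>Nontriviality holds because a vertex group equal to \<open>G\<close> would fix a vertex,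
  against \<open>vx_not_fixed\<close>.\<close>

lemma splits: "splits_over G C"
proof -
 have grD: "gr gD = gG" "mtree gD = gT" unfolding gD_def by simp_all
 have "splitting_of G (carrier G) gD"
  unfolding splitting_of_def grD using gG_graph gG_fin gG_tree realization_iso by simp
 moreover have "\<not> trivial_splitting (carrier G) gD"
 proof
  assume "trivial_splitting (carrier G) gD"
  then obtain i where i: "i\<in>{0, hed}" "vertex_subgroup gD i = carrier G"
   unfolding trivial_splitting_def grD by auto
  have "vertex_subgroup gD i = (\<lambda>g. g) ` vg i"
   unfolding vertex_subgroup_def grD using i(1) by (intro image_cong) (auto simp: word_in_gD)
  hence "vg i = carrier G" using i by simp
  thus False using vx_not_fixed[OF arc_in(3)[of i]] unfolding vg_def vstab_def by blast
 qed
 moreover have "arcs (base (gr gD)) = {0, bar (gr gD) 0}" unfolding grD by (simp add: bar_arc_def)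
 moreover have "edge_subgroup gD 0 = C"
 proof -
  have "emb_arc 1 a = a" "tl_arc 0 = 0" "bar_arc 0 = 1" for a unfolding emb_arc_def tl_arc_def bar_arc_def by auto
  moreover have "C\<subseteq>vg 0" using emb_words[of 0] calculation by auto
  ultimately have "edge_subgroup gD 0 = (\<lambda>a. a) ` C"
   unfolding edge_subgroup_def grD by (intro image_cong) (auto simp: word_in_gD)
  thus ?thesis by simp
 qed
 ultimately show ?thesis unfolding splits_over_def by blast
qed

end

lemma cut_splits_over:
 assumes "group G" "is_cut G (carrier G) A" "\<not> elliptic G (carrier G) A (carrier G)"
 shows "splits_over G {g\<in>carrier G. cshift G g A = A}"
proof -
 interpret cut_group G A using assms by (simp add: cut_group_def cut_group_axioms_def)
 show ?thesis using splits unfolding C_def .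
qed

section \<open>Families of almost malnormal virtually abelian subgroups\<close>

locale malnormal_family = group G for G :: "'a monoid" (structure) +
 fixes Par :: "'a set set"
 assumes par_subgroup: "Q\<in>Par ==> subgroup Q G"
  and par_vab: "Q\<in>Par ==> vab G Q"
  and par_conj: "Q\<in>Par ==> g\<in>carrier G ==> conj_set G g Q\<in>Par"
  and par_eq: "Q\<in>Par ==> R\<in>Par ==> infinite (Q\<inter>R) ==> Q = R"
  and par_self: "Q\<in>Par ==> g\<in>carrier G ==> infinite (Q\<inter>conj_set G g Q) ==> g\<in>Q"
begin

text \<open>The alternative to a cut that can be passed up the hierarchy; groups without big
  subgroups in peripheral conjugates satisfy it vacuously.\<close>

definition absorbed :: "'a set => bool" where
 "absorbed K\<longleftrightarrow>(\<forall>Q\<in>Par. \<forall>E. subgroup E G \<longrightarrow> E\<subseteq>K \<longrightarrow> E\<subseteq>Q \<longrightarrow> \<not> vcyc G E \<longrightarrow> K\<subseteq>Q)"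

text \<open>The last condition allows a cut to be extended to the next group of the hierarchy, where
  the big edge groups lie in peripheral conjugates.\<close>

definition has_cut :: "'a set => bool" where
 "has_cut K\<longleftrightarrow>(\<exists>A. is_cut G K A\<and>vcyc G {k\<in>K. cshift G k A = A}\<and>\<not> elliptic G K A K \<and>
  (\<forall>Q\<in>Par. \<not> vcyc G (Q\<inter>K) \<longrightarrow> elliptic G K A (Q\<inter>K)))"

lemma absorbedD: "absorbed K ==> Q\<in>Par ==> subgroup E G ==> E\<subseteq>K ==> E\<subseteq>Q ==> \<not> vcyc G E ==> K\<subseteq>Q"
 unfolding absorbed_def by blast

lemma nonvcyc_infinite: "subgroup E G ==> \<not> vcyc G E ==> infinite E"
 using vcyc_finite[OF is_group] by blast

lemma absorbed_par:
 assumes "R\<in>Par" "K\<subseteq>R"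
 shows "absorbed K"
 unfolding absorbed_def
proof (intro ballI allI impI)
 fix Q E assume a: "Q\<in>Par" "subgroup E G" "E\<subseteq>K" "E\<subseteq>Q" "\<not> vcyc G E"
 have "E\<subseteq>Q\<inter>R" using a assms by blast
 hence "infinite (Q\<inter>R)" using nonvcyc_infinite[OF a(2,5)] infinite_super by blast
 thus "K\<subseteq>Q" using par_eq a(1) assms by blast
qed

text \<open>An abelian subgroup \<open>L\<close> of finite index centralizes the infinite group
  \<open>E \<inter> L\<close>. So every element of \<open>L\<close> conjugates \<open>Q\<close> to a
  group meeting \<open>Q\<close> in an infinite set, and \<open>L\<close> lies in \<open>Q\<close>.
  An element of \<open>K\<close> then moves \<open>L\<close> to a group that still meets
  \<open>L\<close> in an infinite set.\<close>

lemma absorbed_vab: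
 assumes K: "subgroup K G" and ab: "vab G K"
 shows "absorbed K"
 unfolding absorbed_def
proof (intro ballI allI impI)
 fix Q E assume a: "Q\<in>Par" "subgroup E G" "E\<subseteq>K" "E\<subseteq>Q" "\<not> vcyc G E"
 obtain L where L: "fin_index G L K" "\<And>x y. x\<in>L ==> y\<in>L ==> x\<otimes>y = y\<otimes>x"
  using ab unfolding vab_def by blast
 have LK: "subgroup L G" "L\<subseteq>K" using L(1) unfolding fin_index_def by auto
 have KG: "K\<subseteq>carrier G" "Q\<subseteq>carrier G" using K par_subgroup[OF a(1)] subgroup.subset by blast+
 have inf: "infinite (E\<inter>L)"
  using fin_index_infinite[OF is_group fin_index_Int[OF is_group L(1) a(2,3)]] nonvcyc_infinite[OF a(2,5)] .
 have LQ: "k\<in>Q" if k: "k\<in>L" for k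
 proof -
  have kG: "k\<in>carrier G" using k LK KG by blast
  have "x\<in>conj_set G k Q" if x: "x\<in>E\<inter>L" for x
  proof -
   have xG: "x\<in>carrier G" using x LK KG by blast
   have "k\<otimes>x\<otimes>inv k = x" using L(2)[OF k, of x] x xG kG by (simp add: m_assoc)
   thus ?thesis unfolding conj_set_def using x a(4) by (intro image_eqI[of _ _ x]) auto
  qed
  hence "E\<inter>L\<subseteq>Q\<inter>conj_set G k Q" using a(4) by blast
  hence "infinite (Q\<inter>conj_set G k Q)" using inf infinite_super by blast
  thus ?thesis using par_self[OF a(1) kG] by blast
 qed
 show "K\<subseteq>Q"
 proof
  fix k assume k: "k\<in>K"
  have kG: "k\<in>carrier G" using k KG by blast
  have "infinite K" using nonvcyc_infinite[OF a(2,5)] a(3) infinite_super by blast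
  hence "infinite L" by (rule fin_index_infinite[OF is_group L(1)])
  hence "infinite (conj_set G k L)" using finite_conj_set[OF is_group kG] LK KG by blast
  moreover have "subgroup (conj_set G k L) G" by (rule conj_set_subgroup[OF is_group kG LK(1)])
  moreover have "conj_set G k L\<subseteq>K"
   using conj_set_mono[OF is_group LK(2), of k] conj_set_self[OF is_group K k] by simp
  ultimately have "infinite (conj_set G k L\<inter>L)"
   using fin_index_infinite[OF is_group fin_index_Int[OF is_group L(1)]] by blast
  moreover have "conj_set G k L\<inter>L\<subseteq>Q\<inter>conj_set G k Q" using LQ conj_set_mono[OF is_group, of L Q k] by blast
  ultimately have "infinite (Q\<inter>conj_set G k Q)" using infinite_super by blast
  thus "k\<in>Q" using par_self[OF a(1) kG] by blast
 qed
qed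

lemma absorbed_small:
 assumes "\<And>E. subgroup E G ==> E\<subseteq>K ==> vab G E ==> vcyc G E"
 shows "absorbed K"
 unfolding absorbed_def using assms vab_subgroup[OF is_group] par_vab by blast

lemma absorbed_conj:
 assumes g: "g\<in>carrier G" and K: "K\<subseteq>carrier G" and ab: "absorbed (conj_set G g K)"
 shows "absorbed K"
 unfolding absorbed_def
proof (intro ballI allI impI)
 fix Q E assume a: "Q\<in>Par" "subgroup E G" "E\<subseteq>K" "E\<subseteq>Q" "\<not> vcyc G E"
 have EG: "E\<subseteq>carrier G" and QG: "Q\<subseteq>carrier G" using a par_subgroup subgroup.subset by blast+
 have s: "subgroup (conj_set G g E) G" by (rule conj_set_subgroup[OF is_group g a(2)])
 have "\<not> vcyc G (conj_set G g E)"
  using vcyc_conj[OF is_group inv_closed[OF g] s] conj_set_inv[OF is_group g EG] a(5) by metis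
 hence "conj_set G g K\<subseteq>conj_set G g Q"
  using absorbedD[OF ab par_conj[OF a(1) g] s] conj_set_mono[OF is_group] a(3,4) by blast
 hence "conj_set G (inv g) (conj_set G g K)\<subseteq>conj_set G (inv g) (conj_set G g Q)" by (rule conj_set_mono[OF is_group])
 thus "K\<subseteq>Q" using conj_set_inv[OF is_group g] K QG by simp
qed

end

section \<open>Cuts obtained from a splitting\<close>

context wall_space
begin

lemma wstab_compl: "U\<in>W ==> wstab (V - U) = wstab U"
proof -
 assume U: "U\<in>W"
 have "act h ` (V - U) = V - act h ` U" if "h\<in>H" for h
 proof (rule Set.set_eqI)
  fix x
  have 1: "x\<in>V" if "x\<in>act h ` (V - U) \<or> x\<in>V - act h ` U" using that act_closed \<open>h\<in>H\<close> by auto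
  have "x\<in>act h ` (V - U)\<longleftrightarrow>x\<in>V - act h ` U" if x: "x\<in>V"
   using act_mem(2)[OF \<open>h\<in>H\<close> _ x, of "V - U"] act_mem(2)[OF \<open>h\<in>H\<close> W_sub[OF U] x] x act_closed \<open>h\<in>H\<close> by simp
  thus "x\<in>act h ` (V - U)\<longleftrightarrow>x\<in>V - act h ` U" using 1 by blast
 qed
 moreover have "V - A = V - U\<longleftrightarrow>A = U" if "A\<subseteq>V" for A using W_sub[OF U] that by blast
 moreover have "act h ` U\<subseteq>V" if "h\<in>H" for h by (rule act_image_sub[OF that W_sub[OF U]])
 ultimately have "act h ` (V - U) = V - U\<longleftrightarrow>act h ` U = U" if "h\<in>H" for h using that by metis
 thus ?thesis unfolding wstab_def by blast
qed

lemma wstab_act: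
 assumes U: "U\<subseteq>V" and h: "h\<in>H"
 shows "wstab (act h ` U) = conj_set G h (wstab U)"
proof (rule Set.set_eqI)
 fix g
 have HG: "wstab U\<subseteq>carrier G" using subgroup.subset[OF wstab_subgroup[OF U]] .
 have "g\<in>wstab (act h ` U)\<longleftrightarrow>inv h\<otimes>g\<otimes>h\<in>wstab U" if g: "g\<in>H"
 proof
  assume "g\<in>wstab (act h ` U)"
  hence "act (g\<otimes>h) ` U = act h ` U" unfolding wstab_def using act_image_mult[OF g h U] by simp
  hence "act (inv h) ` act (g\<otimes>h) ` U = act (inv h) ` act h ` U" by simp
  hence "act (inv h\<otimes>(g\<otimes>h)) ` U = U" using act_image_mult U g h act_image_one by simp
  thus "inv h\<otimes>g\<otimes>h\<in>wstab U" unfolding wstab_def using g h by (simp add: m_assoc)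
 next
  assume "inv h\<otimes>g\<otimes>h\<in>wstab U"
  hence "act h ` act (inv h\<otimes>g\<otimes>h) ` U = act h ` U" unfolding wstab_def by simp
  moreover have "h\<otimes>(inv h\<otimes>g\<otimes>h) = g\<otimes>h" using g h by (simp add: m_assoc inv_cancel[OF is_group])
  ultimately have "act g ` act h ` U = act h ` U" using act_image_mult U g h by simp
  thus "g\<in>wstab (act h ` U)" unfolding wstab_def using g by simp
 qed
 moreover have "g\<in>H" if "g\<in>wstab (act h ` U)" using that unfolding wstab_def by blast
 moreover have "g\<in>H" if "g\<in>conj_set G h (wstab U)"
  using that h unfolding conj_set_def wstab_def by auto
 moreover have "g\<in>conj_set G h (wstab U)\<longleftrightarrow>g\<in>carrier G\<and>inv h\<otimes>g\<otimes>h\<in>wstab U"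
  using conj_set_eq[OF is_group _ HG, of h] h by simp
 ultimately show "g\<in>wstab (act h ` U)\<longleftrightarrow>g\<in>conj_set G h (wstab U)"
  using H_closed(4)[of g] by argo
qed

lemma stab_act:
 assumes I: "invariant I" and h: "h\<in>H" and x: "x\<in>V"
 shows "stab I (act h x) = conj_set G h (stab I x)"
proof (rule Set.set_eqI)
 fix g
 have HG: "stab I x\<subseteq>carrier G" using subgroup.subset[OF stab_subgroup[OF I x]] .
 have "g\<in>stab I (act h x)\<longleftrightarrow>inv h\<otimes>g\<otimes>h\<in>stab I x" if g: "g\<in>H"
 proof -
  have "h\<otimes>(inv h\<otimes>g\<otimes>h) = g\<otimes>h" using g h by (simp add: m_assoc inv_cancel[OF is_group])
  hence eq: "act h (act (inv h\<otimes>g\<otimes>h) x) = act g (act h x)" using act_mult x g h by (metis H_closed(1,2))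
  have "act (inv h\<otimes>g\<otimes>h) x\<in>V" using act_closed x g h by simp
  from sep_act[OF I h x this] have "sep I (act h x) (act g (act h x))\<longleftrightarrow>sep I x (act (inv h\<otimes>g\<otimes>h) x)"
   unfolding eq .
  thus ?thesis unfolding stab_def using g h by simp
 qed
 moreover have "g\<in>H" if "g\<in>stab I (act h x)" using that unfolding stab_def by blast
 moreover have "g\<in>H" if "g\<in>conj_set G h (stab I x)" using that h unfolding conj_set_def stab_def by auto
 moreover have "g\<in>conj_set G h (stab I x)\<longleftrightarrow>g\<in>carrier G\<and>inv h\<otimes>g\<otimes>h\<in>stab I x"
  using conj_set_eq[OF is_group _ HG, of h] h by simp
 ultimately show "g\<in>stab I (act h x)\<longleftrightarrow>g\<in>conj_set G h (stab I x)"
  using H_closed(4)[of g] by argo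
qed

lemma stab_cong:
 assumes I: "invariant I" and xy: "x\<in>V" "y\<in>V" "\<not> sep I x y"
 shows "stab I x = stab I y"
proof -
 have "g\<in>stab I z" if g: "g\<in>stab I w" and wz: "w\<in>V" "z\<in>V" "\<not> sep I w z" for g w z
 proof -
  have gH: "g\<in>H" "\<not> sep I w (act g w)" using g unfolding stab_def by auto
  have "\<not> sep I (act g w) (act g z)" using sep_act[OF I gH(1) wz(1,2)] wz(3) by simp
  hence "\<not> sep I z (act g z)" using gH(2) wz(3) unfolding sep_def by blast
  thus ?thesis unfolding stab_def using gH(1) by simp
 qed
 thus ?thesis using xy sep_sym by blast
qed

lemma R0_star_unseparated: "(x, y)\<in>R0\<^sup>* ==> \<not> sep W x y"
proof (induction rule: rtrancl_induct)
 case (step y z)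
 have "x\<in>U\<longleftrightarrow>y\<in>U" if "U\<in>W" for U using step.IH that unfolding sep_def by blast
 thus ?case unfolding sep_def using R0_uncrossed[OF step.hyps(2)] by simp
qed (simp add: sep_def)

text \<open>Fixing a half-tree fixes its edge together with the orientation, hence both
  ends.\<close>

lemma wstab_stab:
 assumes U: "U\<in>W" and xy: "(x, y)\<in>R1" "x\<notin>U" "y\<in>U"
 shows "wstab U\<subseteq>stab W x"
proof
 fix s assume s: "s\<in>wstab U"
 hence sH: "s\<in>H" "act s ` U = U" unfolding wstab_def by auto
 have V: "x\<in>V" "y\<in>V" using xy R1_V by auto
 have "act s x\<notin>U" "act s y\<in>U" using act_mem(1)[OF sH(1) W_sub[OF U]] V xy sH(2) by auto
 hence "(x, act s x)\<in>R0\<^sup>*" using W_edge[OF xy(1) R1_act[OF sH(1) xy(1)] U] xy by blast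
 thus "s\<in>stab W x" unfolding stab_def using R0_star_unseparated sH(1) by simp
qed

end

text \<open>The walls are those of a splitting of \<open>H\<close>, and \<open>Par\<close> are the conjugates of the peripheral subgroups.\<close>

locale relative_wall_space = wall_space G H V act R0 R1 W + malnormal_family G Par
 for G :: "'a monoid" (structure) and H V and act :: "'a => 'x => 'x" and R0 R1 W Par +
 assumes wall_stabilizer: "U\<in>W ==> vcyc G (wstab U) \<or> (\<exists>Q\<in>Par. wstab U\<subseteq>Q)"
  and finite_orbits: "\<exists>F. finite F\<and>F\<subseteq>W\<and>(\<forall>U\<in>W. \<exists>h\<in>H. \<exists>U'\<in>F. U = act h ` U')"
  and par_fixed: "Q\<in>Par ==> \<not> vcyc G (Q\<inter>H) ==> \<exists>y\<in>V. \<forall>h\<in>Q\<inter>H. \<not> sep W y (act h y)"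
  and vertices: "x\<in>V ==> \<exists>h\<in>H. has_cut (stab W (act h x)) \<or> absorbed (stab W (act h x))"
  and points: "V\<noteq>{}"
  and no_global_fixed: "x\<in>V ==> stab W x\<noteq>H"
begin

definition big :: "'x set set" where "big = {U\<in>W. \<not> vcyc G (wstab U)}"

lemma vcyc_conj_iff: "g\<in>carrier G ==> subgroup K G ==> vcyc G (conj_set G g K)\<longleftrightarrow>vcyc G K"
 using vcyc_conj[OF is_group] conj_set_inv[OF is_group] conj_set_subgroup[OF is_group] subgroup.subset
 by (metis inv_closed)

lemma big_invariant: "invariant big"
 unfolding invariant_def
proof (intro conjI ballI)
 show "big\<subseteq>W" unfolding big_def by blast
 show "V - U\<in>big" if "U\<in>big" for U using that W_compl wstab_compl unfolding big_def by auto
 show "act h ` U\<in>big" if "h\<in>H" "U\<in>big" for h U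
  using that W_act W_sub wstab_act vcyc_conj_iff[OF _ wstab_subgroup] unfolding big_def by simp
qed

lemma big_sub: "big\<subseteq>W"
 unfolding big_def by blast

lemma big_par: "U\<in>big ==> \<exists>Q\<in>Par. wstab U\<subseteq>Q"
 using wall_stabilizer unfolding big_def by blast

lemma sep_mono: "I\<subseteq>J ==> sep I x y ==> sep J x y"
 unfolding sep_def by blast

text \<open>The tree with this one orbit of edges has no global fixed point, and points fixed by
  peripheral intersections in the full tree stay fixed after collapsing.\<close>

lemma small_wall_cut:
 assumes U: "U\<in>W" "vcyc G (wstab U)" and nofix: "\<And>z. z\<in>V ==> \<exists>h\<in>H. sep (orbit_walls U) z (act h z)"
 shows "has_cut H"
proof -
 obtain x y where e: "(x, y)\<in>R1" "x\<notin>U" "y\<in>U" using W_crossed[OF U(1)] by blast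
 let ?A = "wcut U x y"
 have sub: "orbit_walls U\<subseteq>W" using orbit_walls_invariant[OF U(1) e] unfolding invariant_def by blast
 have "\<not> elliptic G H ?A H" using wcut_elliptic_fixes[OF U(1) e] nofix by blast
 moreover have "elliptic G H ?A (Q\<inter>H)" if Q: "Q\<in>Par" "\<not> vcyc G (Q\<inter>H)" for Q
 proof -
  obtain z where z: "z\<in>V" "\<forall>h\<in>Q\<inter>H. \<not> sep W z (act h z)" using par_fixed[OF Q] by blast
  show ?thesis by (rule wcut_elliptic[OF U(1) e z(1)]) (use z(2) sep_mono[OF sub] in blast)+
 qed
 ultimately show ?thesis unfolding has_cut_def
  using wcut_is_cut[OF U(1) e] wcut_stabilizer[OF U(1) e] U(2) by (intro exI[of _ ?A]) simp
qed

text \<open>The edge groups at the vertex are big and lie in peripheral conjugates, so they are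
  elliptic in the cut. A big peripheral intersection fixes a point \<open>y\<close>; where
  \<open>y\<close> is at a translate of \<open>x\<close>, its conjugate is a big subgroup of the
  vertex group and elliptic there.\<close>

lemma big_cut_extends:
 assumes x: "x\<in>V" and cut: "has_cut (stab big x)"
 shows "has_cut H"
proof -
 let ?K = "stab big x"
 note K = stab_subgroup[OF big_invariant x]
 obtain A where A: "is_cut G ?K A" "vcyc G {k\<in>?K. cshift G k A = A}" "\<not> elliptic G ?K A ?K"
  "\<And>Q. Q\<in>Par ==> \<not> vcyc G (Q\<inter>?K) ==> elliptic G ?K A (Q\<inter>?K)"
  using cut unfolding has_cut_def by blast
 \<comment> \<open>A big subgroup of a peripheral conjugate sits in the full intersection with
   \<open>?K\<close>, which is big as well.\<close>
 have ell: "elliptic G ?K A E" if E: "subgroup E G" "E\<subseteq>?K" "\<not> vcyc G E" "Q\<in>Par" "E\<subseteq>Q" for E Q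
 proof -
  have "subgroup (Q\<inter>?K) G" using subgroups_Inter_pair[OF par_subgroup[OF E(4)] K] .
  hence "\<not> vcyc G (Q\<inter>?K)" using vcyc_subgroup[OF is_group _ _ E(1), of "Q\<inter>?K"] E by blast
  thus ?thesis using A(4)[OF E(4)] elliptic_mono E by blast
 qed
 have "elliptic G ?K A (wstab (dir big x y))" if y: "y\<in>V" "sep big x y" for y
 proof -
  have d: "dir big x y\<in>big" "wstab (dir big x y)\<subseteq>?K"
   using dir_props[OF big_invariant x y] wstab_dir[OF big_invariant x y] by auto
  obtain Q where "Q\<in>Par" "wstab (dir big x y)\<subseteq>Q" using big_par[OF d(1)] by blast
  moreover have "subgroup (wstab (dir big x y)) G" "\<not> vcyc G (wstab (dir big x y))"
   using d(1) W_sub wstab_subgroup unfolding big_def by blast+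
  ultimately show ?thesis using ell d(2) by blast
 qed
 from induced_cut[OF big_invariant x A(1,3) this] obtain B where B: "is_cut G H B"
  "{h\<in>H. cshift G h B = B} = {k\<in>?K. cshift G k A = A}" "\<not> elliptic G H B H"
  and B_ell: "\<And>L y. L\<subseteq>H ==> y\<in>V ==> \<forall>h\<in>L. \<not> sep big y (act h y) ==>
   \<forall>g\<in>H. \<not> sep big y (act g x) \<longrightarrow> elliptic G ?K A ((\<lambda>h. inv g\<otimes>h\<otimes>g) ` L) ==> elliptic G H B L"
  by blast
 have "elliptic G H B (Q\<inter>H)" if Q: "Q\<in>Par" "\<not> vcyc G (Q\<inter>H)" for Q
 proof -
  obtain y where y: "y\<in>V" "\<And>h. h\<in>Q\<inter>H ==> \<not> sep W y (act h y)" using par_fixed[OF Q] by blast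
  have fixed: "\<not> sep big y (act h y)" if "h\<in>Q\<inter>H" for h using y(2)[OF that] sep_mono[OF big_sub] by blast
  have QH: "subgroup (Q\<inter>H) G" using subgroups_Inter_pair[OF par_subgroup[OF Q(1)] H] .
  have "elliptic G ?K A ((\<lambda>h. inv g\<otimes>h\<otimes>g) ` (Q\<inter>H))" if g: "g\<in>H" "\<not> sep big y (act g x)" for g
  proof -
   let ?E = "conj_set G (inv g) (Q\<inter>H)"
   have E: "(\<lambda>h. inv g\<otimes>h\<otimes>g) ` (Q\<inter>H) = ?E" unfolding conj_set_def using g by simp
   have gx: "act g x\<in>V" using act_closed g x by blast
   have "Q\<inter>H\<subseteq>stab big y" using fixed unfolding stab_def by blast
   also have "\<dots> = conj_set G g ?K" using stab_cong[OF big_invariant y(1) gx g(2)] stab_act[OF big_invariant g(1) x] by simp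
   finally have "?E\<subseteq>conj_set G (inv g) (conj_set G g ?K)" by (rule conj_set_mono[OF is_group])
   hence EK: "?E\<subseteq>?K" using conj_set_inv[OF is_group _ subgroup.subset[OF K]] g by simp
   have "?E\<subseteq>conj_set G (inv g) Q" by (rule conj_set_mono[OF is_group]) blast
   moreover have "conj_set G (inv g) Q\<in>Par" using par_conj[OF Q(1)] g by simp
   moreover have "subgroup ?E G" "\<not> vcyc G ?E"
    using conj_set_subgroup[OF is_group _ QH] vcyc_conj_iff[OF _ QH] g Q(2) by simp_all
   ultimately show ?thesis unfolding E using ell EK by blast
  qed
  thus ?thesis using B_ell[of "Q\<inter>H" y] y(1) fixed by blast
 qed
 thus ?thesis unfolding has_cut_def using B A(2) by (intro exI[of _ B]) simp
qed

text \<open>There are finitely many orbits of walls. Starting at the vertex of \<open>x\<close> in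
  the tree of big walls, the orbits of small walls are added one at a time;
  \<open>common_fixed_point\<close> provides a point fixed by \<open>stab big x\<close> without
  leaving that vertex.\<close>

lemma small_walls_fixed:
 assumes x: "x\<in>V"
  and small: "\<And>U. U\<in>W ==> vcyc G (wstab U) ==> \<exists>z\<in>V. \<forall>h\<in>H. \<not> sep (orbit_walls U) z (act h z)"
 shows "\<exists>z\<in>V. \<not> sep big x z\<and>stab big x = stab W z"
proof -
 let ?S = "stab big x"
 note S = stab_subgroup[OF big_invariant x]
 have inv1: "invariant (orbit_walls U)" if "U\<in>W" for U
  using W_crossed[OF that] orbit_walls_invariant[OF that] by blast
 have un: "invariant (big\<union>(\<Union>U\<in>F. orbit_walls U))" if "F\<subseteq>W" for F
  using inv1 that big_invariant unfolding invariant_def by blast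
 have step: "\<exists>z\<in>V. \<not> sep big x z\<and>(\<forall>s\<in>?S. \<not> sep (big\<union>(\<Union>U\<in>F. orbit_walls U)) z (act s z))"
  if "finite F" "F\<subseteq>{U\<in>W. vcyc G (wstab U)}" for F
  using that
 proof (induction F rule: finite_induct)
  case empty thus ?case using x unfolding stab_def sep_def by auto
 next
  case (insert U F)
  let ?I = "big\<union>(\<Union>U\<in>F. orbit_walls U)"
  obtain z where z: "z\<in>V" "\<not> sep big x z" "\<And>s. s\<in>?S ==> \<not> sep ?I z (act s z)" using insert by blast
  have UW: "U\<in>W" "vcyc G (wstab U)" "F\<subseteq>W" using insert.prems by auto
  obtain w where w: "w\<in>V" "\<forall>h\<in>H. \<not> sep (orbit_walls U) w (act h w)" using small[OF UW(1,2)] by blast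
  have sub: "?S\<subseteq>stab ?I z" using z(3) unfolding stab_def by auto
  have SH: "?S\<subseteq>H" unfolding stab_def by blast
  obtain z' where z': "z'\<in>V" "\<not> sep ?I z z'" "\<forall>s\<in>?S. \<not> sep (?I \<union> orbit_walls U) z' (act s z')"
   using common_fixed_point[OF un[OF UW(3)] inv1[OF UW(1)] z(1) S sub w(1)] w(2) SH by blast
  have "\<not> sep big x z'" using z(2) z'(2) unfolding sep_def by blast
  moreover have "?I \<union> orbit_walls U = big\<union>(\<Union>U\<in>insert U F. orbit_walls U)" by blast
  ultimately show ?case using z' by auto
 qed
 obtain F where F: "finite F" "F\<subseteq>W" "\<forall>U\<in>W. \<exists>h\<in>H. \<exists>U'\<in>F. U = act h ` U'"
  using finite_orbits by (elim exE conjE) (rule that)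
 let ?F = "{U\<in>F. vcyc G (wstab U)}"
 obtain z where z: "z\<in>V" "\<not> sep big x z" "\<And>s. s\<in>?S ==> \<not> sep (big\<union>(\<Union>U\<in>?F. orbit_walls U)) z (act s z)"
  using step[of ?F] F(1,2) by auto
 have "W\<subseteq>big\<union>(\<Union>U\<in>?F. orbit_walls U)"
 proof
  fix U assume "U\<in>W"
  then obtain h U' where U: "h\<in>H" "U'\<in>F" "U = act h ` U'" using F(3) by blast
  show "U\<in>big\<union>(\<Union>U\<in>?F. orbit_walls U)"
  proof (cases "vcyc G (wstab U')")
   case True
   have "U'\<in>W" using U(2) F(2) by blast
   then obtain a b where "(a, b)\<in>R1" "a\<notin>U'" "b\<in>U'" using W_crossed by blast
   note def = orbit_walls_def[OF \<open>U'\<in>W\<close> this]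
   have "U \<in> orbit_walls U'" unfolding def U(3) using U(1) by (intro UnI1 imageI)
   thus ?thesis using True U(2) by blast
  next
   case False
   hence "U'\<in>big" using U(2) F(2) unfolding big_def by blast
   thus ?thesis using big_invariant U unfolding invariant_def by blast
  qed
 qed
 hence "?S\<subseteq>stab W z" using z(3) sep_mono unfolding stab_def by blast
 moreover have "stab W z\<subseteq>stab big z" using sep_mono[OF big_sub] unfolding stab_def by blast
 moreover have "stab big z = ?S" using stab_cong[OF big_invariant x z(1,2)] by simp
 ultimately show ?thesis using z(1,2) by blast
qed

text \<open>A vertex group of the big tree contains the stabilizers of its edges, so it lies in
  their peripheral conjugates. At each edge the conjugates for both ends share the infinite
  stabilizer and agree; by connectedness one \<open>Q\<close> contains all vertex groups. An element
  of \<open>H\<close> permutes these, so it conjugates \<open>Q\<close> to a group meeting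
  \<open>Q\<close> in an infinite set.\<close>

lemma absorbed_everywhere:
 assumes ab: "\<And>x. x\<in>V ==> absorbed (stab big x)" and ne: "big\<noteq>{}"
 shows "\<exists>Q\<in>Par. H\<subseteq>Q"
proof -
 obtain U x0 y0 where U: "U\<in>big" "(x0, y0)\<in>R1" "x0\<notin>U" "y0\<in>U" using ne W_crossed big_sub by blast
 obtain Q where Q: "Q\<in>Par" "wstab U\<subseteq>Q" using big_par[OF U(1)] by blast
 have wst: "subgroup (wstab U') G" "\<not> vcyc G (wstab U')" "infinite (wstab U')" if "U'\<in>big" for U'
  using that W_sub wstab_subgroup nonvcyc_infinite unfolding big_def by blast+
 have mono: "stab W x\<subseteq>stab big x" for x using sep_mono[OF big_sub] unfolding stab_def by blast
 have absorb: "stab big x\<subseteq>R" if "U'\<in>big" "(x, y)\<in>R1" "x\<notin>U'" "y\<in>U'" "R\<in>Par" "wstab U'\<subseteq>R" for U' x y R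
 proof -
  have "wstab U'\<subseteq>stab big x" using wstab_stab[OF _ that(2-4)] that(1) big_sub mono by blast
  moreover have "x\<in>V" using that(2) R1_V by auto
  ultimately show ?thesis using absorbedD[OF ab that(5) wst(1)[OF that(1)] _ that(6) wst(2)[OF that(1)]] by blast
 qed
 have x0: "x0\<in>V" using U R1_V by auto
 have "stab big x\<subseteq>Q\<and>infinite (stab big x)" if "x\<in>V" for x
 proof -
  have "(x0, x)\<in>(R0\<union>R1)\<^sup>*" by (rule conn[OF x0 that])
  thus ?thesis
  proof (induction rule: rtrancl_induct)
   case base
   have "wstab U\<subseteq>stab big x0" using wstab_stab[OF _ U(2-4)] U(1) big_sub mono by blast
   thus ?case using absorb[OF U Q] wst(3)[OF U(1)] infinite_super by blast
  next
   case (step a b)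
   have ab_V: "a\<in>V" "b\<in>V" using step.hyps(2) R0_V R1_V by auto
   show ?case
   proof (cases "sep big a b")
    case False thus ?thesis using stab_cong[OF big_invariant ab_V False] step.IH by simp
   next
    case True
    hence r: "(a, b)\<in>R1" using step.hyps(2) R0_uncrossed big_sub unfolding sep_def by blast
    obtain U' where U': "U'\<in>big" "a\<notin>U'" "b\<in>U'"
    proof -
     obtain U' where "U'\<in>big" "(a\<in>U')\<noteq>(b\<in>U')" using True unfolding sep_def by blast
     moreover have "V - U'\<in>big" using calculation(1) big_invariant unfolding invariant_def by blast
     ultimately show ?thesis using that[of U'] that[of "V - U'"] ab_V by blast
    qed
    have c: "V - U'\<in>big" using U'(1) big_invariant unfolding invariant_def by blast
    have r': "(b, a)\<in>R1" using r R1_sym by (meson symD)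
    obtain R where R: "R\<in>Par" "wstab U'\<subseteq>R" using big_par[OF U'(1)] by blast
    have sa: "wstab U'\<subseteq>stab big a" using wstab_stab[OF _ r U'(2,3)] U'(1) big_sub mono by blast
    have w': "wstab (V - U') = wstab U'" using wstab_compl U'(1) big_sub by blast
    have sb: "wstab U'\<subseteq>stab big b"
     using wstab_stab[of "V - U'", OF _ r'] c U' ab_V big_sub mono w' by blast
    have "stab big b\<subseteq>R" using absorb[OF c r' _ _ R(1)] U' ab_V w' R(2) by blast
    moreover have "wstab U'\<subseteq>Q\<inter>R" using sa step.IH R(2) by blast
    hence "Q = R" using par_eq[OF Q(1) R(1)] wst(3)[OF U'(1)] infinite_super by blast
    ultimately show ?thesis using sb wst(3)[OF U'(1)] infinite_super by blast
   qed
  qed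
 qed
 note all = this
 have "g\<in>Q" if g: "g\<in>H" for g
 proof -
  have "stab big (act g x0) = conj_set G g (stab big x0)" by (rule stab_act[OF big_invariant g x0])
  moreover have "conj_set G g (stab big x0)\<subseteq>conj_set G g Q" using all[OF x0] conj_set_mono[OF is_group] by blast
  ultimately have "stab big (act g x0)\<subseteq>Q\<inter>conj_set G g Q" using all[OF act_closed[OF g x0]] by simp
  hence "infinite (Q\<inter>conj_set G g Q)" using all[OF act_closed[OF g x0]] infinite_super by blast
  thus ?thesis using par_self[OF Q(1)] g by simp
 qed
 thus ?thesis using Q(1) by blast
qed

text \<open>Were there no big walls, the fixed points for the small ones would combine into a global
  fixed point, which \<open>no_global_fixed\<close> excludes. So without a cut the big tree has an
  edge, and all its vertex groups are absorbed.\<close>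

theorem cut_or_parabolic: "has_cut H \<or> (\<exists>Q\<in>Par. H\<subseteq>Q)"
proof (rule disjCI[THEN disj_commute[THEN iffD1]])
 assume nocut: "\<not> has_cut H"
 have small: "\<exists>z\<in>V. \<forall>h\<in>H. \<not> sep (orbit_walls U) z (act h z)" if "U\<in>W" "vcyc G (wstab U)" for U
  using small_wall_cut[OF that] nocut by blast
 have fixed: "\<exists>z\<in>V. \<not> sep big x z\<and>stab big x = stab W z" if "x\<in>V" for x
  by (rule small_walls_fixed[OF that small])
 have "absorbed (stab big x)" if x: "x\<in>V" for x
 proof -
  obtain z where z: "z\<in>V" "stab big x = stab W z" using fixed[OF x] by blast
  obtain h where h: "h\<in>H" "has_cut (stab W (act h z)) \<or> absorbed (stab W (act h z))" using vertices[OF z(1)] by blast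
  have eq: "stab W (act h z) = conj_set G h (stab big x)" using stab_act[OF invariant_W h(1) z(1)] z(2) by simp
  have "\<not> has_cut (stab W (act h z))"
   using big_cut_extends[OF act_closed[OF h(1) x]] nocut stab_act[OF big_invariant h(1) x] eq by auto
  hence "absorbed (conj_set G h (stab big x))" using h(2) eq by simp
  thus ?thesis by (rule absorbed_conj[OF H_closed(4)[OF h(1)] subgroup.subset[OF stab_subgroup[OF big_invariant x]]])
 qed
 moreover have "big\<noteq>{}"
 proof
  assume "big = {}"
  hence "stab big x = H" for x unfolding stab_def sep_def by simp
  moreover obtain x where "x\<in>V" using points by blast
  ultimately show False using fixed no_global_fixed by blast
 qed
 ultimately show "\<exists>Q\<in>Par. H\<subseteq>Q" by (rule absorbed_everywhere)
qed

end

section \<open>Induction over the hierarchy\<close>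

definition peripheral_conjugates :: "'a monoid => 'a set set => 'a set set" where
 "peripheral_conjugates G \<P> = {conj_set G g P | g P. g\<in>carrier G\<and>P\<in>\<P>}"

lemma peripheral_malnormal_family:
 fixes G :: "'a monoid" (structure)
 assumes rel: "relatively_hyperbolic G \<P>"
  and ab: "\<forall>Q\<in>\<P>. virtually comm_group (G\<lparr>carrier := Q\<rparr>)"
 shows "malnormal_family G (peripheral_conjugates G \<P>)"
proof -
 interpret group G using rel unfolding relatively_hyperbolic_def by blast
 have sub: "subgroup P G" if "P\<in>\<P>" for P using rel that unfolding relatively_hyperbolic_def by blast
 have subG: "P\<subseteq>carrier G" if "P\<in>\<P>" for P using subgroup.subset[OF sub[OF that]] .
 have conj_Int: "conj_set G g (A\<inter>B) = conj_set G g A\<inter>conj_set G g B"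
  if "g\<in>carrier G" "A\<subseteq>carrier G" "B\<subseteq>carrier G" for g A B
  using conj_set_eq[OF is_group that(1), of A] conj_set_eq[OF is_group that(1), of B]
   conj_set_eq[OF is_group that(1), of "A\<inter>B"] that by blast
 \<comment> \<open>Conjugation by \<open>inv g\<close> turns the first group into \<open>P\<close>
   itself, so that \<open>peripheral_malnormal\<close> applies.\<close>
 have key: "P = P'\<and>inv g\<otimes>h\<in>P"
  if PP: "P\<in>\<P>" "P'\<in>\<P>" and gh: "g\<in>carrier G" "h\<in>carrier G"
   and inf: "infinite (conj_set G g P\<inter>conj_set G h P')" for P P' g h
 proof -
  have "conj_set G g (conj_set G (inv g\<otimes>h) P') = conj_set G h P'"
   using gh subG[OF PP(2)] by (simp add: conj_set_conj_set[OF is_group] inv_cancel[OF is_group])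
  hence "conj_set G g P\<inter>conj_set G h P' = conj_set G g (P\<inter>conj_set G (inv g\<otimes>h) P')"
   using conj_Int[OF gh(1) subG[OF PP(1)]] conj_set_subset[OF is_group _ subG[OF PP(2)]] gh by simp
  hence "infinite (P\<inter>conj_set G (inv g\<otimes>h) P')" using inf finite_imageI unfolding conj_set_def by metis
  moreover have "inv g\<otimes>h\<in>carrier G" using gh by simp
  ultimately show ?thesis by (intro peripheral_malnormal[OF is_group rel PP])
 qed
 show ?thesis
  unfolding malnormal_family_def malnormal_family_axioms_def
 proof (intro conjI allI impI is_group)
  fix Q assume "Q\<in>peripheral_conjugates G \<P>"
  then obtain g P where Q: "g\<in>carrier G" "P\<in>\<P>" "Q = conj_set G g P" unfolding peripheral_conjugates_def by blast
  show sQ: "subgroup Q G" unfolding Q(3) by (rule conj_set_subgroup[OF is_group Q(1) sub[OF Q(2)]])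
  show "vab G Q" unfolding Q(3) using vab_conj[OF is_group Q(1)] vab_iff[OF is_group sub[OF Q(2)]] ab Q(2) by blast
  show "conj_set G h Q\<in>peripheral_conjugates G \<P>" if h: "h\<in>carrier G" for h
  proof -
   have "conj_set G h Q = conj_set G (h\<otimes>g) P" unfolding Q(3)
    using conj_set_conj_set[OF is_group h Q(1) subG[OF Q(2)]] .
   moreover have "h\<otimes>g\<in>carrier G" using h Q(1) by simp
   ultimately show ?thesis unfolding peripheral_conjugates_def using Q(2) by blast
  qed
  show "h\<in>Q" if h: "h\<in>carrier G" and inf: "infinite (Q\<inter>conj_set G h Q)" for h
  proof -
   have "infinite (conj_set G g P\<inter>conj_set G (h\<otimes>g) P)"
    using inf conj_set_conj_set[OF is_group h Q(1) subG[OF Q(2)]] unfolding Q(3) by simp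
   hence "inv g\<otimes>(h\<otimes>g)\<in>P" using key[OF Q(2,2,1)] h Q(1) by simp
   hence "inv g\<otimes>h\<otimes>g\<in>P" using h Q(1) by (simp add: m_assoc)
   thus ?thesis unfolding Q(3) using conj_set_eq[OF is_group Q(1) subG[OF Q(2)]] h by simp
  qed
  show "Q = R" if R: "R\<in>peripheral_conjugates G \<P>" and inf: "infinite (Q\<inter>R)" for R
  proof -
   obtain h P' where R': "h\<in>carrier G" "P'\<in>\<P>" "R = conj_set G h P'"
    using R unfolding peripheral_conjugates_def by blast
   have k: "P = P'" "inv g\<otimes>h\<in>P" using key[OF Q(2) R'(2) Q(1) R'(1)] inf unfolding Q(3) R'(3) by blast+
   have "conj_set G g (conj_set G (inv g\<otimes>h) P) = conj_set G h P"
    using Q(1) R'(1) subG[OF Q(2)] by (simp add: conj_set_conj_set[OF is_group] inv_cancel[OF is_group])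
   thus ?thesis unfolding Q(3) R'(3) using conj_set_self[OF is_group sub[OF Q(2)] k(2)] k(1) by simp
  qed
 qed
qed

text \<open>An abelian subgroup of finite index in \<open>E\<close> meets the subgroup satisfying
  \<open>\<Phi>\<close> in finite index, and \<open>ab\<close> applies to the intersection.\<close>

lemma virtually_mono_small:
 assumes G: "group G" and K: "subgroup K G" and virt: "virtually \<Phi> (G\<lparr>carrier := K\<rparr>)"
  and ab: "\<And>L E. \<lbrakk>subgroup L G; \<Phi> (G\<lparr>carrier := L\<rparr>); subgroup E G; E\<subseteq>L;
   \<And>x y. x\<in>E ==> y\<in>E ==> x \<otimes>\<^bsub>G\<^esub> y = y \<otimes>\<^bsub>G\<^esub> x\<rbrakk> \<Longrightarrow> vcyc G E"
  and E: "subgroup E G" "E\<subseteq>K" "vab G E"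
 shows "vcyc G E"
proof -
 interpret group G by (rule G)
 obtain L where L: "fin_index G L K" "\<Phi> (G\<lparr>carrier := L\<rparr>)" using virt virtually_iff[OF G K] by blast
 obtain M where M: "fin_index G M E" "\<And>x y. x\<in>M ==> y\<in>M ==> x \<otimes>\<^bsub>G\<^esub> y = y \<otimes>\<^bsub>G\<^esub> x"
  using E(3) unfolding vab_def by blast
 have sub: "subgroup M G" "M\<subseteq>K" "subgroup L G" using M(1) L(1) E(2) unfolding fin_index_def by auto
 have "vcyc G (M\<inter>L)"
  by (rule ab[OF sub(3) L(2) subgroups_Inter_pair[OF sub(1,3)]]) (use M(2) in auto)
 hence "vcyc G M" using vcyc_of_fin_index[OF G fin_index_Int[OF G L(1) sub(1,2)]] by blast
 thus ?thesis using vcyc_of_fin_index[OF G M(1)] by blast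
qed

context malnormal_family
begin

lemma absorbed_terminal:
 assumes K: "subgroup K G" and "virtually free_group (G\<lparr>carrier := K\<rparr>) \<or> virtually comm_group (G\<lparr>carrier := K\<rparr>) \<or>
  virtually fuchsian_group (G\<lparr>carrier := K\<rparr>)"
 shows "absorbed K"
 using assms(2)
proof (elim disjE)
 assume "virtually free_group (G\<lparr>carrier := K\<rparr>)"
 from virtually_mono_small[OF is_group K this free_abelian_vcyc[OF is_group]] show ?thesis by (rule absorbed_small)
next
 assume "virtually comm_group (G\<lparr>carrier := K\<rparr>)"
 thus ?thesis using absorbed_vab[OF K] vab_iff[OF is_group K] by blast
next
 assume "virtually fuchsian_group (G\<lparr>carrier := K\<rparr>)"
 from virtually_mono_small[OF is_group K this fuchsian_abelian_vcyc[OF is_group]] show ?thesis by (rule absorbed_small)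
qed

end

context
 fixes G :: "'a monoid" (structure) and \<P> :: "'a set set" and \<H> :: "'a hierarchy"
 assumes rel: "relatively_hyperbolic G \<P>"
  and abel: "\<forall>Q\<in>\<P>. virtually comm_group (G\<lparr>carrier := Q\<rparr>)"
  and hier: "is_hierarchy G \<H>" and over: "hierarchy_over (elementary G \<P>) \<H>"
  and hrel: "hierarchy_relative G \<P> \<H>"
  and terminals: "\<forall>p. terminal \<H> p \<longrightarrow>
    virtually free_group (G\<lparr>carrier := grp \<H> p\<rparr>) \<or> virtually comm_group (G\<lparr>carrier := grp \<H> p\<rparr>) \<or>
    virtually fuchsian_group (G\<lparr>carrier := grp \<H> p\<rparr>)"
begin

interpretation malnormal_family G "peripheral_conjugates G \<P>"
 by (rule peripheral_malnormal_family[OF rel abel])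

lemma node: "p\<in>nodes \<H> ==> subgroup (grp \<H> p) G" "p\<in>nodes \<H> ==> splitting_of G (grp \<H> p) (spl \<H> p)"
 using hier unfolding is_hierarchy_def by blast+

lemma node_child: "v # p\<in>nodes \<H>\<longleftrightarrow>p\<in>nodes \<H>\<and>\<not> terminal \<H> p\<and>v\<in>verts (base (gr (spl \<H> p)))"
  "v # p\<in>nodes \<H> ==> grp \<H> (v # p) = vertex_subgroup (spl \<H> p) v"
 using hier unfolding is_hierarchy_def by blast+

lemma root_grp: "grp \<H> [] = carrier G"
 using hier unfolding is_hierarchy_def by blast

lemma peripheral_sub: "Q\<in>\<P> ==> Q\<subseteq>carrier G"
 by (rule subgroup.subset) (use rel in \<open>simp add: relatively_hyperbolic_def\<close>)

lemma induced_sub: "Q\<in>induced_peripherals G \<P> \<H> p ==> Q\<subseteq>grp \<H> p"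
 using peripheral_sub root_grp by (cases p) auto

lemma child_sub:
 assumes "v # p\<in>nodes \<H>"
 shows "grp \<H> (v # p)\<subseteq>grp \<H> p"
proof -
 have p: "p\<in>nodes \<H>" "v\<in>verts (base (gr (spl \<H> p)))" using node_child(1) assms by blast+
 interpret sp: splitting_group G "grp \<H> p" "spl \<H> p"
  using node[OF p(1)] is_group by (simp add: splitting_group_def splitting_group_axioms_def)
 show ?thesis unfolding node_child(2)[OF assms] by (rule sp.vsub_H[OF p(2)])
qed

text \<open>The induced structure drops only intersections that are finite or two-ended, hence
  virtually cyclic. A big intersection is big in all groups above it, so it survives from node to
  node. A conjugation is needed at the root only, where the structure consists of
  representatives.\<close>

lemma nonvcyc_induced:
 assumes Q: "Q\<in>peripheral_conjugates G \<P>"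
 shows "p\<in>nodes \<H> ==> \<not> vcyc G (Q\<inter>grp \<H> p) ==>
  \<exists>h\<in>grp \<H> p. \<exists>R\<in>induced_peripherals G \<P> \<H> p. Q\<inter>grp \<H> p = conj_set G h R"
proof (induction p)
 case Nil
 obtain g P where gP: "g\<in>carrier G" "P\<in>\<P>" "Q = conj_set G g P" using Q unfolding peripheral_conjugates_def by blast
 have "Q\<inter>carrier G = conj_set G g P" using conj_set_subset[OF is_group gP(1) peripheral_sub[OF gP(2)]] gP(3) by blast
 thus ?case using gP root_grp by auto
next
 case (Cons v p)
 have p: "p\<in>nodes \<H>" using Cons.prems node_child by blast
 let ?K = "Q\<inter>grp \<H> (v # p)"
 note sub = child_sub[OF Cons.prems(1)]
 have sg: "subgroup ?K G" "subgroup (Q\<inter>grp \<H> p) G"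
  using subgroups_Inter_pair[OF par_subgroup[OF Q]] node(1)[OF Cons.prems(1)] node(1)[OF p] by blast+
 have "\<not> vcyc G (Q\<inter>grp \<H> p)" using vcyc_subgroup[OF is_group sg(2) _ sg(1)] Cons.prems(2) sub by blast
 then obtain h R where h: "h\<in>grp \<H> p" "R\<in>induced_peripherals G \<P> \<H> p" "Q\<inter>grp \<H> p = conj_set G h R"
  using Cons.IH[OF p] by blast
 have "?K = conj_set G h R\<inter>grp \<H> (v # p)" using h(3) sub by blast
 moreover have "infinite ?K" by (rule nonvcyc_infinite[OF sg(1) Cons.prems(2)])
 moreover have "\<not> two_ended (G\<lparr>carrier := ?K\<rparr>)" using two_ended_vcyc[OF is_group sg(1)] Cons.prems(2) by blast
 ultimately have "?K\<in>induced_peripherals G \<P> \<H> (v # p)" using h by auto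
 moreover have "conj_set G \<one> ?K = ?K" using conj_set_one[OF is_group subgroup.subset[OF sg(1)]] .
 moreover have "\<one>\<in>grp \<H> (v # p)" using subgroup.one_closed[OF node(1)[OF Cons.prems(1)]] .
 ultimately show ?case by metis
qed

text \<open>Edge groups are elementary, peripheral intersections fix points as the hierarchy is
  relative, and each point can be moved to some \<open>(v, \<one>)\<close>, whose stabilizer is the
  group of a child.\<close>

lemma node_step:
 assumes p: "p\<in>nodes \<H>" "\<not> terminal \<H> p"
  and children: "\<And>v. v # p\<in>nodes \<H> ==> has_cut (grp \<H> (v # p)) \<or> absorbed (grp \<H> (v # p))"
 shows "has_cut (grp \<H> p) \<or> (\<exists>Q\<in>peripheral_conjugates G \<P>. grp \<H> p\<subseteq>Q)"
proof -
 let ?H = "grp \<H> p"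
 interpret sp: splitting_group G ?H "spl \<H> p"
  using node[OF p(1)] is_group by (simp add: splitting_group_def splitting_group_axioms_def)
 interpret rw: relative_wall_space G ?H sp.pts sp.trans_pt sp.same sp.adj sp.walls "peripheral_conjugates G \<P>"
 proof
  show "vcyc G (sp.wstab U) \<or> (\<exists>Q\<in>peripheral_conjugates G \<P>. sp.wstab U\<subseteq>Q)" if "U\<in>sp.walls" for U
  proof -
   obtain e k where e: "e\<in>sp.ars" "k\<in>?H" "sp.is_wall e k U"
    using \<open>U\<in>sp.walls\<close> unfolding sp.walls_def by blast
   have kG: "k\<in>carrier G" using e(2) by simp
   have w: "sp.wstab U = conj_set G k (sp.esub e)" by (rule sp.wstab_wall[OF e(3,1,2)])
   have "elementary G \<P> (sp.esub e)" using over p(1) e(1) unfolding hierarchy_over_def splitting_over_def by blast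
   hence el: "subgroup (sp.esub e) G" "finite (sp.esub e) \<or> two_ended (G\<lparr>carrier := sp.esub e\<rparr>) \<or>
     (\<exists>Q\<in>\<P>. \<exists>g\<in>carrier G. sp.esub e\<subseteq>conj_set G g Q)" unfolding elementary_def by blast+
   show ?thesis
   proof (cases "vcyc G (sp.esub e)")
    case True thus ?thesis unfolding w using vcyc_conj[OF is_group kG el(1)] by blast
   next
    case False
    then obtain Q g where Q: "Q\<in>\<P>" "g\<in>carrier G" "sp.esub e\<subseteq>conj_set G g Q"
     using el vcyc_finite[OF is_group] two_ended_vcyc[OF is_group] by blast
    have "conj_set G g Q\<in>peripheral_conjugates G \<P>" unfolding peripheral_conjugates_def using Q by blast
    hence "conj_set G k (conj_set G g Q)\<in>peripheral_conjugates G \<P>" using par_conj kG by blast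
    thus ?thesis unfolding w using conj_set_mono[OF is_group Q(3)] by blast
   qed
  qed
  show "\<exists>F. finite F\<and>F\<subseteq>sp.walls\<and>(\<forall>U\<in>sp.walls. \<exists>h\<in>?H. \<exists>U'\<in>F. U = sp.trans_pt h ` U')"
   by (rule sp.walls_finite_orbits)
  show "\<exists>y\<in>sp.pts. \<forall>h\<in>Q\<inter>?H. \<not> sp.sep sp.walls y (sp.trans_pt h y)"
   if Q: "Q\<in>peripheral_conjugates G \<P>" "\<not> vcyc G (Q\<inter>?H)" for Q
  proof -
   obtain h R where h: "h\<in>?H" "R\<in>induced_peripherals G \<P> \<H> p" "Q\<inter>?H = conj_set G h R"
    using nonvcyc_induced[OF Q(1) p(1) Q(2)] by blast
   have RH: "R\<subseteq>?H" by (rule induced_sub[OF h(2)])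
   have "fixes_point G ?H (spl \<H> p) R" using hrel p(1) h(2) unfolding hierarchy_relative_def by blast
   then obtain x where x: "x\<in>sp.pts" "\<And>k. k\<in>R ==> \<not> sp.sep sp.walls x (sp.trans_pt k x)"
    using sp.fixes_point_unseparated[OF RH] by blast
   have "R\<subseteq>sp.stab sp.walls x" using x(2) RH unfolding sp.stab_def by blast
   hence "Q\<inter>?H\<subseteq>sp.stab sp.walls (sp.trans_pt h x)"
    unfolding h(3) sp.stab_act[OF sp.invariant_W h(1) x(1)] by (rule conj_set_mono[OF is_group])
   thus ?thesis using sp.act_pts[OF h(1) x(1)] unfolding sp.stab_def by blast
  qed
  show "\<exists>h\<in>?H. has_cut (sp.stab sp.walls (sp.trans_pt h x)) \<or> absorbed (sp.stab sp.walls (sp.trans_pt h x))"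
   if "x\<in>sp.pts" for x
  proof -
   obtain v h where x: "x = (v, h)" "v\<in>sp.ver" "h\<in>?H" using \<open>x\<in>sp.pts\<close> unfolding sp.pts_def by auto
   have "sp.trans_pt (inv h) x = (v, \<one>)" unfolding x(1) sp.trans_pt_def using x(3) by simp
   moreover have vp: "v # p\<in>nodes \<H>" using node_child(1) p x(2) by blast
   ultimately have "sp.stab sp.walls (sp.trans_pt (inv h) x) = grp \<H> (v # p)"
    using sp.stab_base[OF x(2)] node_child(2)[OF vp] by simp
   thus ?thesis using children[OF vp] x(3) by (intro bexI[of _ "inv h"]) simp_all
  qed
  show "sp.pts\<noteq>{}" unfolding sp.pts_def using sp.gg.nonempty sp.Hsub(3) by blast
  show "sp.stab sp.walls x\<noteq>?H" if "x\<in>sp.pts" for x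
   using sp.stab_proper[OF _ that] p unfolding terminal_def by blast
 qed
 show ?thesis by (rule rw.cut_or_parabolic)
qed

text \<open>Induction from the greatest depth upwards; a node in the second alternative of
  \<open>node_step\<close> is absorbed, being contained in a peripheral conjugate.\<close>

lemma node_dichotomy:
 assumes "p\<in>nodes \<H>" "\<forall>p\<in>nodes \<H>. length p \<le> n"
 shows "has_cut (grp \<H> p) \<or> absorbed (grp \<H> p)"
 using assms(1)
proof (induction "n - length p" arbitrary: p rule: less_induct)
 case less
 show ?case
 proof (cases "terminal \<H> p")
  case True
  thus ?thesis using absorbed_terminal[OF node(1)[OF less.prems]] terminals by blast
 next
  case False
  have "has_cut (grp \<H> (v # p)) \<or> absorbed (grp \<H> (v # p))" if v: "v # p\<in>nodes \<H>" for v
   by (rule less.hyps[OF _ v]) (use v assms(2) in force)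
  from node_step[OF less.prems False this] show ?thesis using absorbed_par by blast
 qed
qed

text \<open>At the root \<open>node_step\<close> is applied itself: being absorbed would be no
  contradiction there, whereas lying in a peripheral conjugate makes the group virtually
  abelian.\<close>

lemma root_cut:
 assumes fin: "finite_hierarchy \<H>" and "\<not> virtually comm_group G" "\<not> virtually free_group G" "\<not> virtually fuchsian_group G"
 shows "has_cut (carrier G)"
proof -
 have root: "[]\<in>nodes \<H>" using hier unfolding is_hierarchy_def by blast
 have Gid: "G\<lparr>carrier := carrier G\<rparr> = G" by simp
 have nt: "\<not> terminal \<H> []" using terminals assms(2-4) unfolding root_grp[symmetric]
  by (metis Gid root_grp)
 obtain n where n: "\<forall>p\<in>nodes \<H>. length p \<le> n" using fin unfolding finite_hierarchy_def by blast
 have "\<not> carrier G\<subseteq>Q" if Q: "Q\<in>peripheral_conjugates G \<P>" for Q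
 proof
  assume "carrier G\<subseteq>Q"
  hence "vab G (carrier G)" using vab_subgroup[OF is_group par_vab[OF Q] subgroup_self] by blast
  thus False using vab_iff[OF is_group subgroup_self] assms(2) Gid by simp
 qed
 moreover have "has_cut (grp \<H> []) \<or> (\<exists>Q\<in>peripheral_conjugates G \<P>. grp \<H> []\<subseteq>Q)"
  by (rule node_step[OF root nt node_dichotomy[OF _ n]])
 ultimately show ?thesis unfolding root_grp by blast
qed

end

lemma cut_stabilizer_subgroup:
 assumes "group G" "is_cut G (carrier G) A" "\<not> elliptic G (carrier G) A (carrier G)"
 shows "subgroup {g\<in>carrier G. cshift G g A = A} G"
proof -
 interpret cut_group G A using assms by (simp add: cut_group_def cut_group_axioms_def)
 show ?thesis using C_subgroup unfolding C_def .
qed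

theorem lemma8p1:
  fixes G :: "'a monoid" and \<P> :: "'a set set"
  assumes "ATEH G \<P>"
    and "\<not> virtually comm_group G"
    and "\<not> virtually free_group G"
    and "\<not> virtually fuchsian_group G"
  shows "\<exists>C. subgroup C G \<and>
    (finite C \<or> virtually cyclic_group (G\<lparr>carrier := C\<rparr>)) \<and> splits_over G C"
proof -
 obtain \<H> where H: "relatively_hyperbolic G \<P>" "\<forall>Q\<in>\<P>. virtually comm_group (G\<lparr>carrier := Q\<rparr>)"
  "is_hierarchy G \<H>" "finite_hierarchy \<H>" "hierarchy_over (elementary G \<P>) \<H>" "hierarchy_relative G \<P> \<H>"
  "\<forall>p. terminal \<H> p \<longrightarrow> virtually free_group (G\<lparr>carrier := grp \<H> p\<rparr>) \<or>
   virtually comm_group (G\<lparr>carrier := grp \<H> p\<rparr>) \<or> virtually fuchsian_group (G\<lparr>carrier := grp \<H> p\<rparr>)"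
  using assms(1) unfolding ATEH_def by blast
 interpret malnormal_family G "peripheral_conjugates G \<P>" by (rule peripheral_malnormal_family[OF H(1,2)])
 obtain A where A: "is_cut G (carrier G) A" "vcyc G {g\<in>carrier G. cshift G g A = A}"
  "\<not> elliptic G (carrier G) A (carrier G)"
  using root_cut[OF H(1,2,3,5,6,7,4) assms(2-4)] unfolding has_cut_def by blast
 have "subgroup {g\<in>carrier G. cshift G g A = A} G" by (rule cut_stabilizer_subgroup[OF is_group A(1,3)])
 thus ?thesis using vcyc_iff[OF is_group] A(2) cut_splits_over[OF is_group A(1,3)] by blast
qed

end
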